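(* Let $\kappa>0$ and let $\bar f_0:=-\frac{1}{2\kappa}\sum_{i=1}^r\nabla_{f_i}f_i$, where $\nabla$ is the Levi-Civita connection of the metric $\langle\cdot,\cdot\rangle$ induced by $\mathcal F=\{f_1,\dots,f_r\}$ (see context). Consider the Stratonovich SDE on $\mathcal M$ $$\mathrm d\bar x_t=\Big(\bar f_0(\bar x_t)+\sum_{i=1}^r[F_1(\phi)f_i,\,F_2(\phi)f_i](\bar x_t)\Big)\mathrm dt+\frac{1}{\sqrt\kappa}\sum_{i=1}^r\sum_{j=1}^2F_j(\phi(\bar x_t))f_i(\bar x_t)\bullet\mathrm dW^{2i+j-2}_t,$$ with $F_1=\cos$, $F_2=-\sin$. Then: (a) The infinitesimal generator of this SDE is given by $$\mathcal L\psi=\frac{1}{2\kappa}\Delta\psi-\langle\operatorname{grad}\phi,\operatorname{grad}\psi\rangle\qquad\text{for all }\psi\in C^\infty(\mathcal M).$$ (b) The SDE admits a unique invariant probability measure, namely $$\mu_\kappa=c_\kappa^{-1}e^{-2\kappa\phi}\,\mathrm{vol},\qquad c_\kappa:=\int_{\mathcal M}e^{-2\kappa\phi}\,\mathrm{vol}.$$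
   Context: $\mathcal M$ is a smooth, connected, compact, orientable $n$-dimensional manifold without boundary, embedded in $\mathbb R^m$, and $\phi\in C^\infty(\mathcal M)$. $\mathcal F=\{f_1,\dots,f_r\}$ is a family of smooth vector fields on $\mathcal M$ with $\operatorname{span}_{\mathbb R}\{f_1(x),\dots,f_r(x)\}=T_x\mathcal M$ for all $x\in\mathcal M$. By this span condition there is a unique Riemannian metric $\langle\cdot,\cdot\rangle$ on $\mathcal M$ such that $\operatorname{grad}\psi=\sum_{i=1}^r f_i(\psi)f_i$ for all $\psi\in C^\infty(\mathcal M)$ (the metric whose co-metric is $\sum_i f_i\otimes f_i$); $f(\psi)$ denotes the derivative of $\psi$ along $f$. All geometric operators ($\operatorname{grad}$, Laplace–Beltrami operator $\Delta=\operatorname{div}\operatorname{grad}$, Levi-Civita connection $\nabla$, Riemannian density $\mathrm{vol}$) refer to this metric. $[\cdot,\cdot]$ is the Lie bracket of vector fields, $F_j(\phi)$ denotes $F_j\circ\phi$, $W=(W^1,\dots,W^{2r})$ is a standard $2r$-dimensional Wiener process, and $\bullet\,\mathrm dW$ denotes the Stratonovich differential. *)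

theory Defs
  imports "HOL-Probability.Probability"
begin

section \<open>Smooth maps and embedded submanifolds\<close>

primrec Ck_on :: "nat \<Rightarrow> 'a::euclidean_space set \<Rightarrow> ('a \<Rightarrow> 'b::real_normed_vector) \<Rightarrow> bool" where
  "Ck_on 0 S f \<longleftrightarrow> continuous_on S f"
| "Ck_on (Suc k) S f \<longleftrightarrow>
     (\<forall>x\<in>S. f differentiable (at x)) \<and> (\<forall>v. Ck_on k S (\<lambda>x. frechet_derivative f (at x) v))"

text \<open>Intended for open \<open>S\<close> only.\<close>

definition smooth_on :: "'a::euclidean_space set \<Rightarrow> ('a \<Rightarrow> 'b::real_normed_vector) \<Rightarrow> bool" where
  "smooth_on S f \<longleftrightarrow> (\<forall>k. Ck_on k S f)"

text \<open>A smooth local parametrization (inverse of a chart) of a subset \<open>M\<close> of Euclidean space: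
  a smooth immersion of an open set \<open>U\<close> that is a homeomorphism onto a relatively open subset
  of \<open>M\<close>.\<close>

definition local_param ::
  "'a::euclidean_space set \<Rightarrow> (real^'n) set \<Rightarrow> (real^'n \<Rightarrow> 'a) \<Rightarrow> bool" where
  "local_param M U h \<longleftrightarrow>
     open U \<and> smooth_on U h \<and> openin (top_of_set M) (h ` U) \<and>
     (\<exists>k. homeomorphism U (h ` U) h k) \<and>
     (\<forall>u\<in>U. inj (frechet_derivative h (at u)))"

text \<open>The dimension \<open>n\<close> of a submanifold is the cardinality of the index type \<open>'n\<close> of its model
  space \<open>real^'n\<close>, which is passed as a type argument.\<close>

definition embedded_submanifold :: "'n::finite itself \<Rightarrow> 'a::euclidean_space set \<Rightarrow> bool" where
  "embedded_submanifold T M \<longleftrightarrow>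
     (\<forall>p\<in>M. \<exists>(U::(real^'n) set) h. local_param M U h \<and> p \<in> h ` U)"

definition orientable :: "'n::finite itself \<Rightarrow> 'a::euclidean_space set \<Rightarrow> bool" where
  "orientable T M \<longleftrightarrow>
     (\<exists>A :: ((real^'n) set \<times> (real^'n \<Rightarrow> 'a)) set.
        (\<forall>(U, h)\<in>A. local_param M U h) \<and>
        (\<forall>p\<in>M. \<exists>(U, h)\<in>A. p \<in> h ` U) \<and>
        (\<forall>(U, h)\<in>A. \<forall>(U', h')\<in>A. \<forall>u\<in>U. h u \<in> h' ` U' \<longrightarrow>
           det (jacobian (\<lambda>w. inv_into U' h' (h w)) (at u)) > 0))"

definition tangent_space :: "'a::euclidean_space set \<Rightarrow> 'a \<Rightarrow> 'a set" where
  "tangent_space M p =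
     {v. \<exists>c::real \<Rightarrow> 'a. \<exists>\<epsilon>>0. smooth_on {-\<epsilon><..<\<epsilon>} c \<and> c ` {-\<epsilon><..<\<epsilon>} \<subseteq> M \<and> c 0 = p \<and>
         (c has_vector_derivative v) (at 0)}"

text \<open>Smooth maps on a submanifold \<open>M\<close>; values outside \<open>M\<close> are irrelevant.\<close>

definition smooth_map :: "'a::euclidean_space set \<Rightarrow> ('a \<Rightarrow> 'b::real_normed_vector) \<Rightarrow> bool" where
  "smooth_map M f \<longleftrightarrow>
     (\<forall>p\<in>M. \<exists>U f'. open U \<and> p \<in> U \<and> smooth_on U f' \<and> (\<forall>y\<in>U \<inter> M. f' y = f y))"

definition smooth_vector_field :: "'a::euclidean_space set \<Rightarrow> ('a \<Rightarrow> 'a) \<Rightarrow> bool" where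
  "smooth_vector_field M V \<longleftrightarrow> smooth_map M V \<and> (\<forall>p\<in>M. V p \<in> tangent_space M p)"

text \<open>The differential at \<open>p\<close> of a function on \<open>M\<close>. A Frechet derivative within \<open>M\<close> is not unique
  as a linear map on the ambient space, but all of them agree on the tangent space at \<open>p\<close>, and this
  is the only place where they are evaluated.\<close>

definition dir_deriv ::
  "'a::euclidean_space set \<Rightarrow> ('a \<Rightarrow> 'b::real_normed_vector) \<Rightarrow> 'a \<Rightarrow> 'a \<Rightarrow> 'b" where
  "dir_deriv M f p v = frechet_derivative f (at p within M) v"

definition lie_deriv ::
  "'a::euclidean_space set \<Rightarrow> ('a \<Rightarrow> 'a) \<Rightarrow> ('a \<Rightarrow> 'b::real_normed_vector) \<Rightarrow> 'a \<Rightarrow> 'b" where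
  "lie_deriv M V f p = dir_deriv M f p (V p)"

text \<open>The sign convention is that \<open>[V, W]\<close> acts on functions as \<open>V W - W V\<close>.\<close>

definition lie_bracket ::
  "'a::euclidean_space set \<Rightarrow> ('a \<Rightarrow> 'a) \<Rightarrow> ('a \<Rightarrow> 'a) \<Rightarrow> 'a \<Rightarrow> 'a" where
  "lie_bracket M V W p = lie_deriv M V W p - lie_deriv M W V p"


section \<open>Riemannian geometry\<close>

text \<open>A metric is a family \<open>g p v w\<close>; only tangent arguments at points of \<open>M\<close> matter.\<close>

definition riemannian_metric ::
  "'a::euclidean_space set \<Rightarrow> ('a \<Rightarrow> 'a \<Rightarrow> 'a \<Rightarrow> real) \<Rightarrow> bool" where
  "riemannian_metric M g \<longleftrightarrow>
     (\<forall>p\<in>M. \<forall>u\<in>tangent_space M p. \<forall>v\<in>tangent_space M p.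
        g p u v = g p v u \<and>
        (u \<noteq> 0 \<longrightarrow> g p u u > 0) \<and>
        (\<forall>a. g p (a *\<^sub>R u) v = a * g p u v) \<and>
        (\<forall>w\<in>tangent_space M p. g p (u + v) w = g p u w + g p v w)) \<and>
     (\<forall>V W. smooth_vector_field M V \<longrightarrow> smooth_vector_field M W \<longrightarrow>
        smooth_map M (\<lambda>p. g p (V p) (W p)))"

definition gradient ::
  "'a::euclidean_space set \<Rightarrow> ('a \<Rightarrow> 'a \<Rightarrow> 'a \<Rightarrow> real) \<Rightarrow> ('a \<Rightarrow> real) \<Rightarrow> 'a \<Rightarrow> 'a" where
  "gradient M g \<psi> p =
     (THE v. v \<in> tangent_space M p \<and> (\<forall>w\<in>tangent_space M p. g p v w = dir_deriv M \<psi> p w))"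

definition levi_civita ::
  "'a::euclidean_space set \<Rightarrow> ('a \<Rightarrow> 'a \<Rightarrow> 'a \<Rightarrow> real) \<Rightarrow>
   (('a \<Rightarrow> 'a) \<Rightarrow> ('a \<Rightarrow> 'a) \<Rightarrow> 'a \<Rightarrow> 'a) \<Rightarrow> bool" where
  "levi_civita M g nabla \<longleftrightarrow>
     (\<forall>X Y. smooth_vector_field M X \<longrightarrow> smooth_vector_field M Y \<longrightarrow>
        smooth_vector_field M (nabla X Y) \<and>
        (\<forall>p\<in>M. nabla X Y p - nabla Y X p = lie_bracket M X Y p) \<and>
        (\<forall>\<psi>. smooth_map M \<psi> \<longrightarrow> (\<forall>p\<in>M.
           nabla (\<lambda>q. \<psi> q *\<^sub>R X q) Y p = \<psi> p *\<^sub>R nabla X Y p \<and>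
           nabla X (\<lambda>q. \<psi> q *\<^sub>R Y q) p = lie_deriv M X \<psi> p *\<^sub>R Y p + \<psi> p *\<^sub>R nabla X Y p)) \<and>
        (\<forall>Z. smooth_vector_field M Z \<longrightarrow> (\<forall>p\<in>M.
           nabla (\<lambda>q. X q + Z q) Y p = nabla X Y p + nabla Z Y p \<and>
           nabla X (\<lambda>q. Y q + Z q) p = nabla X Y p + nabla X Z p \<and>
           lie_deriv M X (\<lambda>q. g q (Y q) (Z q)) p =
             g p (nabla X Y p) (Z p) + g p (Y p) (nabla X Z p))))"

text \<open>The function \<open>sqrt (det (g\<^sub>i\<^sub>j))\<close> in the coordinates given by \<open>h\<close>.\<close>

definition vol_coeff ::
  "('a::euclidean_space \<Rightarrow> 'a \<Rightarrow> 'a \<Rightarrow> real) \<Rightarrow> (real^'n \<Rightarrow> 'a) \<Rightarrow> real^'n \<Rightarrow> real" where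
  "vol_coeff g h u =
     sqrt (det (\<chi> i j. g (h u) (frechet_derivative h (at u) (axis i 1))
                              (frechet_derivative h (at u) (axis j 1)) :: real^'n^'n))"

text \<open>The divergence with respect to the Riemannian density: the number equal to
  \<open>\<Sum>\<^sub>i \<partial>\<^sub>i (sqrt (det g) V\<^sup>i) / sqrt (det g)\<close> in all local coordinates around \<open>p\<close>.
  Here \<open>inv (frechet_derivative h (at w)) (V (h w))\<close> is the vector of components \<open>V\<^sup>i\<close>.\<close>

definition divergence ::
  "'n::finite itself \<Rightarrow> 'a::euclidean_space set \<Rightarrow> ('a \<Rightarrow> 'a \<Rightarrow> 'a \<Rightarrow> real) \<Rightarrow>
   ('a \<Rightarrow> 'a) \<Rightarrow> 'a \<Rightarrow> real" where
  "divergence T M g V p =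
     (THE d. \<forall>(U::(real^'n) set) h u. local_param M U h \<and> u \<in> U \<and> h u = p \<longrightarrow>
        d = (\<Sum>i\<in>UNIV. frechet_derivative
               (\<lambda>w. vol_coeff g h w * (inv (frechet_derivative h (at w)) (V (h w)) $ i))
               (at u) (axis i 1)) / vol_coeff g h u)"

definition laplace_beltrami ::
  "'n::finite itself \<Rightarrow> 'a::euclidean_space set \<Rightarrow> ('a \<Rightarrow> 'a \<Rightarrow> 'a \<Rightarrow> real) \<Rightarrow>
   ('a \<Rightarrow> real) \<Rightarrow> 'a \<Rightarrow> real" where
  "laplace_beltrami T M g \<psi> = divergence T M g (gradient M g \<psi>)"

definition riemannian_density ::
  "'n::finite itself \<Rightarrow> 'a::euclidean_space set \<Rightarrow> ('a \<Rightarrow> 'a \<Rightarrow> 'a \<Rightarrow> real) \<Rightarrow> 'a measure \<Rightarrow> bool" where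
  "riemannian_density T M g vol \<longleftrightarrow>
     sets vol = sets (restrict_space borel M) \<and>
     (\<forall>(U::(real^'n) set) h. local_param M U h \<longrightarrow>
        (\<forall>A\<in>sets vol. A \<subseteq> h ` U \<longrightarrow>
           emeasure vol A = (\<integral>\<^sup>+u\<in>U \<inter> h -` A. ennreal (vol_coeff g h u) \<partial>lborel)))"


section \<open>Continuous semimartingales and the Stratonovich integral\<close>

text \<open>Time is \<open>[0, \<infinity>)\<close>; processes and filtrations are indexed by \<open>real\<close> and only nonnegative
  times are relevant.\<close>

definition filtered_prob_space :: "'w measure \<Rightarrow> (real \<Rightarrow> 'w measure) \<Rightarrow> bool" where
  "filtered_prob_space P F \<longleftrightarrow>
     prob_space P \<and> filtration (space P) F \<and> (\<forall>t. subalgebra P (F t))"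

definition cont_adapted ::
  "'w measure \<Rightarrow> (real \<Rightarrow> 'w measure) \<Rightarrow> (real \<Rightarrow> 'w \<Rightarrow> 'b::topological_space) \<Rightarrow> bool" where
  "cont_adapted P F Y \<longleftrightarrow>
     (\<forall>t\<ge>0. Y t \<in> borel_measurable (F t)) \<and>
     (\<forall>\<omega>\<in>space P. continuous_on {0..} (\<lambda>t. Y t \<omega>))"

definition cont_martingale ::
  "'w measure \<Rightarrow> (real \<Rightarrow> 'w measure) \<Rightarrow> (real \<Rightarrow> 'w \<Rightarrow> real) \<Rightarrow> bool" where
  "cont_martingale P F Y \<longleftrightarrow>
     cont_adapted P F Y \<and> (\<forall>t\<ge>0. integrable P (Y t)) \<and>
     (\<forall>s t. 0 \<le> s \<longrightarrow> s \<le> t \<longrightarrow> (AE \<omega> in P. real_cond_exp P (F s) (Y t) \<omega> = Y s \<omega>))"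

definition cont_local_martingale ::
  "'w measure \<Rightarrow> (real \<Rightarrow> 'w measure) \<Rightarrow> (real \<Rightarrow> 'w \<Rightarrow> real) \<Rightarrow> bool" where
  "cont_local_martingale P F Y \<longleftrightarrow>
     cont_adapted P F Y \<and>
     (\<exists>\<tau> :: nat \<Rightarrow> 'w \<Rightarrow> real.
        (\<forall>k. stopping_time F (\<tau> k)) \<and>
        (\<forall>\<omega>\<in>space P. \<forall>k. 0 \<le> \<tau> k \<omega> \<and> \<tau> k \<omega> \<le> \<tau> (Suc k) \<omega>) \<and>
        (AE \<omega> in P. filterlim (\<lambda>k. \<tau> k \<omega>) at_top sequentially) \<and>
        (\<forall>k. cont_martingale P F (\<lambda>t \<omega>. Y (min t (\<tau> k \<omega>)) \<omega> - Y 0 \<omega>)))"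

text \<open>A partition \<open>0 = \<pi> 0 \<le> \<dots> \<le> \<pi> N = t\<close> of \<open>[0, t]\<close> with mesh at most \<open>\<delta>\<close>.\<close>

definition is_partition :: "real \<Rightarrow> real \<Rightarrow> nat \<Rightarrow> (nat \<Rightarrow> real) \<Rightarrow> bool" where
  "is_partition t \<delta> N \<pi> \<longleftrightarrow>
     \<pi> 0 = 0 \<and> \<pi> N = t \<and> (\<forall>k<N. \<pi> k \<le> \<pi> (Suc k) \<and> \<pi> (Suc k) - \<pi> k \<le> \<delta>)"

definition locally_bounded_variation :: "(real \<Rightarrow> real) \<Rightarrow> bool" where
  "locally_bounded_variation a \<longleftrightarrow>
     (\<forall>t\<ge>0. \<exists>C. \<forall>N \<pi>. is_partition t t N \<pi> \<longrightarrow> (\<Sum>k<N. \<bar>a (\<pi> (Suc k)) - a (\<pi> k)\<bar>) \<le> C)"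

definition cont_semimartingale ::
  "'w measure \<Rightarrow> (real \<Rightarrow> 'w measure) \<Rightarrow> (real \<Rightarrow> 'w \<Rightarrow> real) \<Rightarrow> bool" where
  "cont_semimartingale P F Y \<longleftrightarrow>
     (\<exists>N A. cont_local_martingale P F N \<and> cont_adapted P F A \<and>
        (\<forall>\<omega>\<in>space P. locally_bounded_variation (\<lambda>t. A t \<omega>)) \<and>
        (\<forall>\<omega>\<in>space P. \<forall>t\<ge>0. Y t \<omega> = N t \<omega> + A t \<omega>))"

text \<open>\<open>J t\<close> is the Stratonovich integral of \<open>Y\<close> with respect to \<open>B\<close> over \<open>[0, t]\<close>, i.e. the limit
  in probability of the symmetric Riemann sums as the mesh tends to zero. For continuous
  semimartingales \<open>Y\<close> and \<open>B\<close> this is the Ito integral plus one half of the covariation.\<close>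

definition has_stratonovich_integral ::
  "'w measure \<Rightarrow> (real \<Rightarrow> 'w \<Rightarrow> real) \<Rightarrow> (real \<Rightarrow> 'w \<Rightarrow> real) \<Rightarrow> (real \<Rightarrow> 'w \<Rightarrow> real) \<Rightarrow> bool" where
  "has_stratonovich_integral P Y B J \<longleftrightarrow>
     (\<forall>t\<ge>0. J t \<in> borel_measurable P \<and>
        (\<forall>\<epsilon>>0. \<exists>\<delta>>0. \<forall>N \<pi>. is_partition t \<delta> N \<pi> \<longrightarrow>
           measure P {\<omega>\<in>space P.
             \<bar>(\<Sum>k<N. (Y (\<pi> k) \<omega> + Y (\<pi> (Suc k)) \<omega>) / 2 * (B (\<pi> (Suc k)) \<omega> - B (\<pi> k) \<omega>))
               - J t \<omega>\<bar> > \<epsilon>} < \<epsilon>))"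

definition wiener_process ::
  "'w measure \<Rightarrow> (real \<Rightarrow> 'w measure) \<Rightarrow> 'k set \<Rightarrow> ('k \<Rightarrow> real \<Rightarrow> 'w \<Rightarrow> real) \<Rightarrow> bool" where
  "wiener_process P F I W \<longleftrightarrow>
     (\<forall>k\<in>I. cont_adapted P F (W k) \<and> (AE \<omega> in P. W k 0 \<omega> = 0)) \<and>
     (\<forall>s t. 0 \<le> s \<longrightarrow> s < t \<longrightarrow>
        (\<forall>k\<in>I. distributed P lborel (\<lambda>\<omega>. W k t \<omega> - W k s \<omega>)
                  (\<lambda>x. ennreal (normal_density 0 (sqrt (t - s)) x))) \<and>
        prob_space.indep_vars P (\<lambda>_. borel) (\<lambda>k \<omega>. W k t \<omega> - W k s \<omega>) I \<and>
        prob_space.indep_set P (sets (F s))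
          (sets (vimage_algebra (space P) (\<lambda>\<omega>. \<lambda>k\<in>I. W k t \<omega> - W k s \<omega>) (\<Pi>\<^sub>M k\<in>I. borel))))"


section \<open>Stratonovich equations on a submanifold\<close>

text \<open>\<open>X\<close> is a solution of \<open>dX = b(X) dt + \<Sum>\<^sub>k \<sigma>\<^sub>k(X) \<bullet> dW\<^sup>k\<close> on \<open>M\<close> with \<open>X\<^sub>0 = x\<close>, in the usual
  intrinsic sense: \<open>X\<close> is an \<open>M\<close>-valued semimartingale and, for every smooth test function \<open>\<psi>\<close>,
  \<open>d\<psi>(X) = (b \<psi>)(X) dt + \<Sum>\<^sub>k (\<sigma>\<^sub>k \<psi>)(X) \<bullet> dW\<^sup>k\<close>.\<close>

definition stratonovich_solution ::
  "'a::euclidean_space set \<Rightarrow> 'w measure \<Rightarrow> (real \<Rightarrow> 'w measure) \<Rightarrow>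
   ('a \<Rightarrow> 'a) \<Rightarrow> 'k set \<Rightarrow> ('k \<Rightarrow> 'a \<Rightarrow> 'a) \<Rightarrow> ('k \<Rightarrow> real \<Rightarrow> 'w \<Rightarrow> real) \<Rightarrow>
   'a \<Rightarrow> (real \<Rightarrow> 'w \<Rightarrow> 'a) \<Rightarrow> bool" where
  "stratonovich_solution M P F b I \<sigma> W x X \<longleftrightarrow>
     cont_adapted P F X \<and> (\<forall>t\<ge>0. \<forall>\<omega>\<in>space P. X t \<omega> \<in> M) \<and>
     (AE \<omega> in P. X 0 \<omega> = x) \<and>
     (\<forall>\<psi> :: 'a \<Rightarrow> real. smooth_map M \<psi> \<longrightarrow>
        cont_semimartingale P F (\<lambda>t \<omega>. \<psi> (X t \<omega>)) \<and>
        (\<exists>J. (\<forall>k\<in>I. has_stratonovich_integral P (\<lambda>t \<omega>. lie_deriv M (\<sigma> k) \<psi> (X t \<omega>)) (W k) (J k)) \<and>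
             (\<forall>t\<ge>0. AE \<omega> in P.
                \<psi> (X t \<omega>) = \<psi> (X 0 \<omega>) + integral {0..t} (\<lambda>s. lie_deriv M b \<psi> (X s \<omega>))
                             + (\<Sum>k\<in>I. J k t \<omega>))))"

text \<open>In the following two definitions, \<open>X x\<close> is the solution started at \<open>x\<close>. The transition
  semigroup acts on functions as \<open>\<psi> \<mapsto> E \<psi>(X x t)\<close>; its generator maps \<open>\<psi>\<close> to \<open>\<eta>\<close> if the
  difference quotients at time \<open>0\<close> converge to \<open>\<eta>\<close> in the supremum norm.\<close>

definition generator_maps ::
  "'a::euclidean_space set \<Rightarrow> 'w measure \<Rightarrow> ('a \<Rightarrow> real \<Rightarrow> 'w \<Rightarrow> 'a) \<Rightarrow>
   ('a \<Rightarrow> real) \<Rightarrow> ('a \<Rightarrow> real) \<Rightarrow> bool" where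
  "generator_maps M P X \<psi> \<eta> \<longleftrightarrow>
     uniform_limit M (\<lambda>t x. ((\<integral>\<omega>. \<psi> (X x t \<omega>) \<partial>P) - \<psi> x) / t) \<eta> (at_right 0)"

definition invariant_prob ::
  "'a::euclidean_space set \<Rightarrow> 'w measure \<Rightarrow> ('a \<Rightarrow> real \<Rightarrow> 'w \<Rightarrow> 'a) \<Rightarrow> 'a measure \<Rightarrow> bool" where
  "invariant_prob M P X \<mu> \<longleftrightarrow>
     prob_space \<mu> \<and> sets \<mu> = sets (restrict_space borel M) \<and>
     (\<forall>t\<ge>0. \<forall>A\<in>sets \<mu>.
        emeasure \<mu> A = (\<integral>\<^sup>+x. emeasure P {\<omega>\<in>space P. X x t \<omega> \<in> A} \<partial>\<mu>))"

end

theory Submission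
  imports Defs "HOL-Complex_Analysis.Great_Picard"
begin

text \<open>In a chart the divergence of \<open>grad u = \<Sum>\<^sub>i f\<^sub>i(u) f\<^sub>i\<close> is a sum of squares plus a drift, and the brackets
  in the SDE contribute \<open>- grad \<phi>\<close>. Trapezoidal sums turn the Stratonovich integrals into left-point sums and
  covariations, so Dynkin's formula holds with the operator \<open>L\<close> of (a); \<open>L\<close> is symmetric with respect to \<open>\<mu>\<close>,
  which is therefore invariant.

  No regularity theory is used for the semigroup: it is the limit of the iterates of a symmetric
  random walk with steps \<open>\<plusminus>\<epsilon>\<close>, whose derivatives are bounded uniformly in \<open>\<epsilon>\<close>. By Bernstein's method
  \<open>\<Gamma>(u) + A u\<^sup>2\<close> is a subsolution, hence the iterates are equicontinuous uniformly in time, and the energy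
  identity bounds the time integral of their Dirichlet energies. By Arzela-Ascoli a subsequence
  converges uniformly to a limit of zero energy, which is constant since the manifold is connected; so the
  semigroup converges to the mean with respect to \<open>\<mu>\<close>, and every invariant probability equals \<open>\<mu>\<close>.\<close>

text \<open>Neither a Markov property nor smoothness of x |-> E u(X_t) is at hand; only the law of
  each solution at single times is controlled, through Dynkin's formula. The comparison is arranged
  so that this formula is applied to iterates of the walk, which are smooth by construction: in E
  v_{n-k}(X at time k eps^2) one walk step is exchanged for a time eps^2, at a cost of order eps^4,
  and t / eps^2 such exchanges cost order eps^2. The symmetric signs remove the odd orders of eps,
  which yields both the order eps^4 and the growth factor 1 + C eps^2 of the derivatives. The walk
  runs in the ambient space with compactly supported extensions of the fields, so it leaves M and
  obeys no maximum principle on M; positivity of the expectation over the process replaces it.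
  Derivative bounds for the iterates grow with the time horizon, the constant of Bernstein's method
  does not; hence the horizon is fixed first and eps afterwards. The martingale parts are merely
  integrable, so tightness of their quadratic variation cannot rest on second moments.\<close>

notation abs ("|_|") and scaleR (infixr "*R" 75) and iff (infixr "<->" 25)

lemmas bm = borel_measurable_sum borel_measurable_times borel_measurable_diff
lemmas square_simps = power2_eq_square algebra_simps
lemmas lint_cong = Bochner_Integration.integral_cong and lint_sum = Bochner_Integration.integral_sum

abbreviation (input) LIMSEQ' (infixr "---->" 60) where "X ----> L == X \<longlonglongrightarrow> L"

section \<open>Frechet derivatives and smooth maps on open sets\<close>

abbreviation fd :: "('a::real_normed_vector => 'b::real_normed_vector) => 'a => 'a => 'b" where
 "fd f x v \<equiv> frechet_derivative f (at x) v"

lemma fd_eqI: "(f has_derivative D) (at x) ==> fd f x v = D v" using frechet_derivative_at by metis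

lemma has_derivative_fd: "f differentiable (at x) ==> (f has_derivative (%v. fd f x v)) (at x)" by (simp add: frechet_derivative_works)

text \<open>The choices behind the two derivatives range over the same set of linear maps, so they
  agree, also at points where neither function is differentiable.\<close>

lemma fd_cong_open:
 assumes "open S" "x:S" "!!y. y:S ==> f y = g y"
 shows "fd f x v = fd g x v"
proof -
 have "(f has_derivative D) (at x) <-> (g has_derivative D) (at x)" for D
  using assms by (metis has_derivative_transform_within_open)
 thus ?thesis unfolding frechet_derivative_def by simp
qed

lemma differentiable_cong_open:
 assumes "open S" "x:S" "!!y. y:S ==> f y = g y" "f differentiable (at x)"
 shows "g differentiable (at x)" using assms by (metis differentiable_def has_derivative_transform_within_open)

lemma Ck_on_cong:
 assumes "open S" "!!x. x:S ==> f x = g x" "Ck_on k S f"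
 shows "Ck_on k S g" using assms(2,3)
proof (induction k arbitrary: f g)
 case 0
 thus ?case by (simp cong: continuous_on_cong)
next
 case (Suc k)
 have "Ck_on k S (%x. fd g x v)" for v
 proof (rule Suc.IH)
  show "fd f x v = fd g x v" if "x:S" for x by (rule fd_cong_open[OF assms(1) that]) (use Suc.prems in simp)
  show "Ck_on k S (%x. fd f x v)" using Suc.prems by simp
 qed
 moreover have "g differentiable (at x)" if "x:S" for x by (rule differentiable_cong_open[OF assms(1) that, of f]) (use Suc.prems that in simp_all)
 ultimately show ?case by simp
qed

lemma Ck_on_SucD: "Ck_on (Suc k) S f ==> Ck_on k S f"
proof (induction k arbitrary: f)
 case 0
 thus ?case by (auto intro!: continuous_at_imp_continuous_on differentiable_imp_continuous_within)
next
 case (Suc k)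
 from Suc.prems have "ALL x:S. f differentiable (at x)" "!!v. Ck_on (Suc k) S (%x. fd f x v)" by auto
 thus ?case using Suc.IH by simp
qed

lemma Ck_on_mono: "Ck_on k S f ==> j <= k ==> Ck_on j S f"
proof (induction k)
 case (Suc k)
 thus ?case using Ck_on_SucD le_Suc_eq by blast
qed simp

lemma Ck_on_subset: "Ck_on k S f ==> T <= S ==> Ck_on k T f" by (induction k arbitrary: f) (auto intro: continuous_on_subset)

text \<open>The closure properties are proved by induction on \<open>k\<close> through this rule: it
  suffices to exhibit a derivative whose directional values are of the kind treated by the induction
  hypothesis.\<close>

lemma Ck_on_SucI:
 assumes "open S" "!!x. x:S ==> (f has_derivative D x) (at x)" "!!v. Ck_on k S (%x. D x v)"
 shows "Ck_on (Suc k) S f"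
proof -
 have "Ck_on k S (%x. fd f x v)" for v using fd_eqI[OF assms(2)] by (intro Ck_on_cong[OF assms(1) _ assms(3)[of v]]) auto
 thus ?thesis using assms(2) by (auto simp: differentiable_def)
qed

lemma Ck_on_imp_continuous: "Ck_on k S f ==> continuous_on S f" using Ck_on_mono[of k S f 0] by simp

lemma Ck_on_Suc_differentiable: "Ck_on (Suc k) S f ==> x:S ==> f differentiable (at x)" by simp

lemma Ck_on_Suc_fd: "Ck_on (Suc k) S f ==> Ck_on k S (%x. fd f x v)" by simp

declare Ck_on.simps(2) [simp del]

lemma Ck_on_const: "open S ==> Ck_on k S (%x. c)"
proof (induction k arbitrary: c)
 case (Suc k)
 thus ?case by (intro Ck_on_SucI[where D="%x v. 0"]) auto
qed simp

lemma Ck_on_bounded_linear: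
 assumes "open S" "bounded_linear f" shows "Ck_on k S f"
proof (cases k)
 case 0
 thus ?thesis using assms by (simp add: linear_continuous_on)
next
 case (Suc j)
 thus ?thesis using assms by (auto intro!: Ck_on_SucI[where D="%x. f"] bounded_linear_imp_has_derivative Ck_on_const)
qed

lemma Ck_on_add:
 assumes "open S" "Ck_on k S f" "Ck_on k S g" shows "Ck_on k S (%x. f x + g x)" using assms(2,3)
proof (induction k arbitrary: f g)
 case 0
 thus ?case by (simp add: continuous_on_add)
next
 case (Suc k)
 thus ?case by (intro Ck_on_SucI[where D="%x v. fd f x v + fd g x v"] assms(1))
   (auto intro!: has_derivative_add has_derivative_fd Ck_on_Suc_differentiable Ck_on_Suc_fd)
qed

lemma Ck_on_sum:
 assumes "open S" "!!i. i:I ==> Ck_on k S (f i)" shows "Ck_on k S (%x. \<Sum>i\<in>I. f i x)" using assms(2)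
 by (induction I rule: infinite_finite_induct) (auto intro!: Ck_on_add Ck_on_const assms(1))

lemma Ck_on_linear_comp:
 assumes "open S" "bounded_linear L" "Ck_on k S f" shows "Ck_on k S (%x. L (f x))" using assms(3)
proof (induction k arbitrary: f)
 case 0
 thus ?case using assms(2) by (simp add: bounded_linear.continuous_on)
next
 case (Suc k)
 thus ?case by (intro Ck_on_SucI[where D="%x v. L (fd f x v)"] assms(1))
   (auto intro!: bounded_linear.has_derivative[OF assms(2)] has_derivative_fd Ck_on_Suc_differentiable Ck_on_Suc_fd)
qed

lemma Ck_on_bilinear:
 assumes "open S" "bounded_bilinear B" "Ck_on k S f" "Ck_on k S g"
 shows "Ck_on k S (%x. B (f x) (g x))" using assms(3,4)
proof (induction k arbitrary: f g)
 case 0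
 thus ?case using bounded_bilinear.continuous_on[OF assms(2)] by simp
next
 case (Suc k)
 have "Ck_on k S f" "Ck_on k S g" using Suc.prems Ck_on_SucD by blast+
 thus ?case using Suc by (intro Ck_on_SucI[where D="%x v. B (f x) (fd g x v) + B (fd f x v) (g x)"] assms(1))
   (auto intro!: bounded_bilinear.FDERIV[OF assms(2)] has_derivative_fd Ck_on_Suc_differentiable Ck_on_Suc_fd Ck_on_add assms(1) Suc.IH)
qed

lemma fd_linear_expand:
 fixes f :: "'a::euclidean_space => 'b::real_normed_vector"
 assumes "f differentiable (at x)"
 shows "fd f x v = (\<Sum>e\<in>Basis. (v \<bullet> e) *R fd f x e)"
proof -
 have "linear (%v. fd f x v)" using has_derivative_fd[OF assms] has_derivative_linear by blast
 hence "fd f x (\<Sum>e\<in>Basis. (v \<bullet> e) *R e) = (\<Sum>e\<in>Basis. (v \<bullet> e) *R fd f x e)"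
  by (simp add: linear_sum linear_scale)
 thus ?thesis by (simp add: euclidean_representation)
qed

lemma Ck_on_compose:
 fixes f :: "'b::euclidean_space => 'c::real_normed_vector" and g :: "'a::euclidean_space => 'b"
 assumes "open S" "open T" "Ck_on k T f" "Ck_on k S g" "g ` S <= T"
 shows "Ck_on k S (%x. f (g x))" using assms(3,4)
proof (induction k arbitrary: f)
 case 0
 thus ?case using assms(5) continuous_on_compose2[of T f S g] by simp
next
 case (Suc k)
 have gk: "Ck_on k S g" using Suc.prems Ck_on_SucD by blast
 have dg: "Ck_on k S (%x. fd g x v)" for v using Suc.prems Ck_on_Suc_fd by blast
 have fT: "f differentiable (at (g x))" if "x:S" for x using that Suc.prems(1) assms(5) by (auto intro: Ck_on_Suc_differentiable)
 \<comment> \<open>Expanding \<open>fd g x v\<close> in the basis freezes the direction in which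
   \<open>f\<close> is differentiated, so \<open>fd f (g x) e\<close> is again a composition and the
   induction hypothesis applies to it.\<close>
 define D where "D x v = (\<Sum>e\<in>Basis. (fd g x v \<bullet> e) *R fd f (g x) e)" for x v
 have D: "((%x. f (g x)) has_derivative D x) (at x)" if x: "x:S" for x
 proof -
  have 1: "(g has_derivative fd g x) (at x)" by (rule has_derivative_fd[OF Ck_on_Suc_differentiable[OF Suc.prems(2) x]])
  have 2: "(f has_derivative fd f (g x)) (at (g x))" by (rule has_derivative_fd[OF fT[OF x]])
  have "D x = (%v. fd f (g x) (fd g x v))" unfolding D_def using fd_linear_expand[OF fT[OF x]] by metis
  thus ?thesis using has_derivative_compose[OF 1 2] by simp
 qed
 have C: "Ck_on k S (%x. D x v)" for v
 proof -
  have "Ck_on k S (%x. (fd g x v \<bullet> e) *R fd f (g x) e)" for e by (intro Ck_on_bilinear[OF assms(1) bounded_bilinear_scaleR]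
     Ck_on_linear_comp[OF assms(1) bounded_linear_inner_left] Suc.IH[of "%y. fd f y e"] gk dg
     Ck_on_Suc_fd Suc.prems)
  thus ?thesis unfolding D_def by (intro Ck_on_sum assms(1))
 qed
 show ?case by (rule Ck_on_SucI[OF assms(1) D C])
qed


lemma smooth_on_cong: "open S ==> (!!x. x:S ==> f x = g x) ==> smooth_on S f ==> smooth_on S g"
 using Ck_on_cong[of S f g] by (simp add: smooth_on_def)
lemma smooth_on_subset: "smooth_on S f ==> T <= S ==> smooth_on T f" using Ck_on_subset[of _ S f T] by (simp add: smooth_on_def)
lemma smooth_on_imp_continuous: "smooth_on S f ==> continuous_on S f" unfolding smooth_on_def using Ck_on_imp_continuous by blast
lemma smooth_on_differentiable: "smooth_on S f ==> x:S ==> f differentiable (at x)" unfolding smooth_on_def using Ck_on_Suc_differentiable by blast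
lemma smooth_on_fd: "smooth_on S f ==> smooth_on S (%x. fd f x v)" unfolding smooth_on_def using Ck_on_Suc_fd by blast
lemma smooth_on_const: "open S ==> smooth_on S (%x. c)" by (simp add: smooth_on_def Ck_on_const)
lemma smooth_on_bounded_linear: "open S ==> bounded_linear f ==> smooth_on S f" by (simp add: smooth_on_def Ck_on_bounded_linear)
lemma smooth_on_ident: "open S ==> smooth_on S (%x. x)" using smooth_on_bounded_linear[OF _ bounded_linear_ident] .
lemma smooth_on_add: "open S ==> smooth_on S f ==> smooth_on S g ==> smooth_on S (%x. f x + g x)" by (simp add: smooth_on_def Ck_on_add)
lemma smooth_on_sum: "open S ==> (!!i. i:I ==> smooth_on S (f i)) ==> smooth_on S (%x. \<Sum>i\<in>I. f i x)" by (simp add: smooth_on_def Ck_on_sum)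
lemma smooth_on_linear_comp:
 "open S ==> bounded_linear L ==> smooth_on S f ==> smooth_on S (%x. L (f x))" by (simp add: smooth_on_def Ck_on_linear_comp)
lemma smooth_on_bilinear:
 "open S ==> bounded_bilinear B ==> smooth_on S f ==> smooth_on S g ==> smooth_on S (%x. B (f x) (g x))" by (simp add: smooth_on_def Ck_on_bilinear)
lemma smooth_on_compose:
 fixes f :: "'b::euclidean_space => 'c::real_normed_vector" and g :: "'a::euclidean_space => 'b"
 shows "open S ==> open T ==> smooth_on T f ==> smooth_on S g ==> g ` S <= T ==> smooth_on S (%x. f (g x))"
 using Ck_on_compose[of S T _ f g] by (simp add: smooth_on_def)

lemmas smooth_on_scaleR = smooth_on_bilinear[OF _ bounded_bilinear_scaleR]
lemmas smooth_on_inner = smooth_on_bilinear[OF _ bounded_bilinear_inner]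

lemma smooth_on_mult:
 fixes f g :: "'a::euclidean_space => real"
 shows "open S ==> smooth_on S f ==> smooth_on S g ==> smooth_on S (%x. f x*g x)" by (rule smooth_on_bilinear[OF _ bounded_bilinear_mult])
lemma smooth_on_uminus: "open S ==> smooth_on S f ==> smooth_on S (%x. - f x)"
 by (rule smooth_on_linear_comp[OF _ bounded_linear_minus[OF bounded_linear_ident]])
lemma smooth_on_diff: "open S ==> smooth_on S f ==> smooth_on S g ==> smooth_on S (%x. f x - g x)"
 unfolding diff_conv_add_uminus by (intro smooth_on_add smooth_on_uminus)
lemma smooth_on_prod:
 fixes f :: "'i => 'a::euclidean_space => real"
 assumes "open S" "!!i. i:I ==> smooth_on S (f i)" shows "smooth_on S (%x. \<Prod>i\<in>I. f i x)" using assms(2)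
 by (induction I rule: infinite_finite_induct) (auto intro!: smooth_on_mult smooth_on_const assms(1))
lemma smooth_on_power:
 fixes f :: "'a::euclidean_space => real"
 assumes "open S" "smooth_on S f" shows "smooth_on S (%x. f x^n)" by (induction n) (auto intro!: smooth_on_mult smooth_on_const assms)

lemma fd_zero: "f differentiable (at x) ==> fd f x 0 = 0" using has_derivative_fd has_derivative_linear linear_0 by blast

lemma fd_linear: "f differentiable (at x) ==> linear (%v. fd f x v)" using has_derivative_fd has_derivative_linear by blast

lemma smooth_on_fd_field:
 fixes f :: "'a::euclidean_space => 'b::real_normed_vector"
 assumes "open S" "smooth_on S f" "smooth_on S V"
 shows "smooth_on S (%x. fd f x (V x))"
proof (rule smooth_on_cong[OF assms(1)])
 show "smooth_on S (%x. \<Sum>e\<in>Basis. (V x \<bullet> e) *R fd f x e)"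
  by (intro smooth_on_sum smooth_on_scaleR smooth_on_inner smooth_on_fd smooth_on_const assms)
 fix x assume "x:S"
 thus "(\<Sum>e\<in>Basis. (V x \<bullet> e) *R fd f x e) = fd f x (V x)" using fd_linear_expand smooth_on_differentiable[OF assms(2)] by metis
qed

lemma smooth_on_SucI:
 fixes f :: "'a::euclidean_space => 'b::real_normed_vector"
 assumes "open S" "!!x. x:S ==> (f has_derivative D x) (at x)" "!!v. smooth_on S (%x. D x v)"
 shows "smooth_on S f" unfolding smooth_on_def
proof
 fix k show "Ck_on k S f" using Ck_on_SucI[OF assms(1,2), of k] assms(3) Ck_on_SucD by (auto simp: smooth_on_def)
qed

lemmas Ck_on_mult = Ck_on_bilinear[OF _ bounded_bilinear_mult]

lemma Ck_on_exp: "Ck_on k UNIV (exp :: real => real)"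
proof (induction k)
 case (Suc k)
 have "(exp has_derivative (%v. v * exp x)) (at x)" for x :: real by (auto intro!: derivative_eq_intros)
 moreover have "Ck_on k UNIV (%x. v * exp x)" for v :: real by (intro Ck_on_mult Ck_on_const Suc open_UNIV)
 ultimately show ?case by (intro Ck_on_SucI open_UNIV)
qed (auto intro: continuous_intros)

lemma Ck_on_sin_cos: "Ck_on k UNIV (sin :: real => real) & Ck_on k UNIV (cos :: real => real)"
proof (induction k)
 case (Suc k)
 have "(sin has_derivative (%v. v * cos x)) (at x)" "(cos has_derivative (%v. (- v) * sin x)) (at x)"
  for x :: real by (auto intro!: derivative_eq_intros)
 moreover have "Ck_on k UNIV (%x. v * cos x)" "Ck_on k UNIV (%x. v * sin x)" for v :: real
  by (intro Ck_on_mult Ck_on_const open_UNIV conjunct1[OF Suc] conjunct2[OF Suc])+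
 ultimately show ?case by (intro conjI Ck_on_SucI open_UNIV)
qed (auto intro: continuous_intros)

lemma Ck_on_inverse: "Ck_on k (- {0}) (inverse :: real => real)"
proof (induction k)
 case (Suc k)
 have o: "open (- {0::real})" by (simp add: open_Compl)
 have "(inverse has_derivative (%v. (- v)*(inverse x*inverse x))) (at x)" if "x:- {0}" for x :: real using that by (auto intro!: derivative_eq_intros)
 moreover have "Ck_on k (- {0}) (%x. (- v)*(inverse x*inverse x))" for v :: real by (intro Ck_on_mult Ck_on_const o Suc)
 ultimately show ?case by (intro Ck_on_SucI o)
qed (auto intro!: continuous_intros)

lemma smooth_on_exp: "open S ==> smooth_on S f ==> smooth_on S (%x. exp (f x :: real))"
 by (rule smooth_on_compose[where f=exp and T=UNIV]) (auto simp: smooth_on_def Ck_on_exp)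
lemma smooth_on_sin: "open S ==> smooth_on S f ==> smooth_on S (%x. sin (f x :: real))"
 by (rule smooth_on_compose[where f=sin and T=UNIV]) (auto simp: smooth_on_def Ck_on_sin_cos)
lemma smooth_on_cos: "open S ==> smooth_on S f ==> smooth_on S (%x. cos (f x :: real))"
 by (rule smooth_on_compose[where f=cos and T=UNIV]) (auto simp: smooth_on_def Ck_on_sin_cos)
lemma smooth_on_inverse:
 "open S ==> smooth_on S f ==> (!!x. x:S ==> f x ~= 0) ==> smooth_on S (%x. inverse (f x :: real))"
 by (rule smooth_on_compose[where f=inverse and T="- {0}"]) (auto simp: smooth_on_def Ck_on_inverse open_Compl)
lemma smooth_on_divide:
 "open S ==> smooth_on S f ==> smooth_on S g ==> (!!x. x:S ==> g x ~= 0) ==>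
  smooth_on S (%x. f x/(g x :: real))" unfolding divide_inverse by (intro smooth_on_mult smooth_on_inverse)

lemma Ck_on_sqrt: "Ck_on k {0<..} (sqrt :: real => real)"
proof (induction k)
 case (Suc k)
 have i: "Ck_on k {0<..} (%x. inverse (sqrt x) :: real)" by (rule Ck_on_compose[OF _ _ Ck_on_inverse Suc]) (auto simp: open_Compl)
 have "(sqrt has_derivative (%v. (v/2)*inverse (sqrt x))) (at x)" if "x:{0<..}" for x :: real
  using that by (auto intro!: derivative_eq_intros simp: field_simps)
 moreover have "Ck_on k {0<..} (%x. (v/2)*inverse (sqrt x))" for v :: real by (intro Ck_on_mult Ck_on_const i) auto
 ultimately show ?case by (intro Ck_on_SucI) auto
qed (auto intro!: continuous_intros)

lemma smooth_on_sqrt: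
 "open S ==> smooth_on S f ==> (!!x. x:S ==> 0 < f x) ==> smooth_on S (%x. sqrt (f x :: real))"
 by (rule smooth_on_compose[where f=sqrt and T="{0<..}"]) (auto simp: smooth_on_def Ck_on_sqrt)

lemma smooth_on_vec_lambda:
 fixes f :: "'i::finite => 'a::euclidean_space => real"
 assumes "open S" "!!i. smooth_on S (f i)"
 shows "smooth_on S (%x. \<chi> i. f i x)"
proof (rule smooth_on_cong[OF assms(1)])
 show "smooth_on S (%x. \<Sum>i\<in>UNIV. f i x *R axis i (1::real))" by (intro smooth_on_sum smooth_on_scaleR assms smooth_on_const)
 show "(\<Sum>i\<in>UNIV. f i x *R axis i (1::real)) = (\<chi> i. f i x)" for x
  by (simp add: vec_eq_iff axis_def if_distrib sum.delta cong: if_cong)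
qed

lemma smooth_on_vec_nth:
 "open S ==> smooth_on S f ==> smooth_on S (%x. f x $ i)" by (rule smooth_on_linear_comp[OF _ bounded_linear_vec_nth])

lemma smooth_on_det:
 fixes A :: "'a::euclidean_space => real^'n^'n"
 assumes "open S" "!!i j. smooth_on S (%x. A x $ i $ j)"
 shows "smooth_on S (%x. det (A x))" unfolding det_def by (intro smooth_on_sum smooth_on_mult smooth_on_prod smooth_on_const assms)

text \<open>The second difference over the parallelogram spanned by \<open>h v\<close> and
  \<open>h w\<close> is symmetric in \<open>v\<close> and \<open>w\<close>, and two applications of
  the mean value theorem make it \<open>h^2\<close> times a mixed derivative at a nearby point.
  Continuity of the mixed derivatives does the rest.\<close>

lemma fd_second_symmetric:
 fixes f :: "'a::euclidean_space => real"
 assumes S: "open S" "x:S" and f: "smooth_on S f"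
 shows "fd (%y. fd f y v) x w = fd (%y. fd f y w) x v"
proof (rule ccontr)
 define H where "H v w y = fd (%y. fd f y v) y w" for v w y
 have cont: "continuous_on S (H v w)" for v w unfolding H_def by (intro smooth_on_imp_continuous smooth_on_fd f)
 have mvt: "EX p. dist x p < dl & f (x + h *R v + h *R w) - f (x + h *R v) - f (x + h *R w) + f x = h^2*H v w p"
  if h: "0 < h" "h*norm v + h*norm w < dl" "ball x dl <= S" for h dl and v w :: 'a
 proof -
  have in_ball: "dist x (x + s *R v + t *R w) < dl" if "0 <= s" "s <= h" "0 <= t" "t <= h" for s t
  proof -
   have "dist x (x + s *R v + t *R w) = norm (s *R v + t *R w)"
    by (metis add.assoc add_diff_cancel_left' dist_norm norm_minus_commute)
   also have "... <= s*norm v + t*norm w" using that norm_triangle_ineq[of "s *R v" "t *R w"] by simp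
   also have "... <= h*norm v + h*norm w" using that by (intro add_mono mult_right_mono) auto
   finally show ?thesis using h by simp
  qed
  hence inS: "x + s *R v + t *R w:S" if "0 <= s" "s <= h" "0 <= t" "t <= h" for s t using that h(3) by (auto simp: subset_iff)
  have line: "((%s. g (a + s *R b)) has_real_derivative fd g (a + s *R b) b) (at s)"
   if "g differentiable (at (a + s *R b))" for g :: "'a => real" and a b s
  proof -
   have "((%s. a + s *R b) has_derivative (%s. s *R b)) (at s)" by (auto intro!: derivative_eq_intros)
   from has_derivative_compose[OF this has_derivative_fd[OF that]]
   have "((%s. g (a + s *R b)) has_derivative (%t. fd g (a + s *R b) (t *R b))) (at s)" .
   thus ?thesis by (simp add: has_field_derivative_def linear_scale[OF fd_linear[OF that]] mult_commute_abs)
  qed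
  define G where "G s = f (x + h *R w + s *R v) - f (x + s *R v)" for s
  have "(G has_real_derivative fd f (x + h *R w + s *R v) v - fd f (x + s *R v) v) (at s)"
   if "0 <= s" "s <= h" for s unfolding G_def using inS[of s h] inS[of s 0] that h
   by (intro DERIV_diff line smooth_on_differentiable[OF f]) (auto simp: algebra_simps)
  then obtain s where s: "0 < s" "s < h"
   "G h - G 0 = h*(fd f (x + h *R w + s *R v) v - fd f (x + s *R v) v)"
   using MVT2[of 0 h G "%s. fd f (x + h *R w + s *R v) v - fd f (x + s *R v) v"] h by auto
  have "((%t. fd f (x + s *R v + t *R w) v) has_real_derivative H v w (x + s *R v + t *R w)) (at t)"
   if "0 <= t" "t <= h" for t unfolding H_def using inS[of s t] that s by (intro line smooth_on_differentiable[OF smooth_on_fd[OF f]]) auto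
  then obtain t where t: "0 < t" "t < h"
   "fd f (x + s *R v + h *R w) v - fd f (x + s *R v) v = h*H v w (x + s *R v + t *R w)"
   using MVT2[of 0 h "%t. fd f (x + s *R v + t *R w) v" "%t. H v w (x + s *R v + t *R w)"] h by auto
  have "f (x + h *R v + h *R w) - f (x + h *R v) - f (x + h *R w) + f x = G h - G 0" by (simp add: G_def add_ac)
  also have "... = h^2*H v w (x + s *R v + t *R w)" using s t by (simp add: add_ac power2_eq_square)
  finally show ?thesis using in_ball[of s t] s t by (intro exI[of _ "x + s *R v + t *R w"]) auto
 qed
 assume ne: "\<not> ?thesis"
 define e where "e = |H v w x - H w v x|/2"
 have e: "e > 0" using ne by (auto simp: e_def H_def)
 obtain d0 where d0: "d0 > 0" "ball x d0 <= S" using S open_contains_ball by blast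
 obtain d1 where d1: "d1 > 0" "!!y. y:S ==> dist y x < d1 ==> dist (H v w y) (H v w x) < e"
  using cont[of v w] S e unfolding continuous_on_iff by blast
 obtain d2 where d2: "d2 > 0" "!!y. y:S ==> dist y x < d2 ==> dist (H w v y) (H w v x) < e"
  using cont[of w v] S e unfolding continuous_on_iff by blast
 define dl where "dl = min d0 (min d1 d2)"
 \<comment> \<open>Small enough for the parallelogram to stay in the ball of radius
   \<open>dl\<close>; the added 1 covers \<open>v = w = 0\<close>.\<close>
 define h where "h = dl/(2*(norm v + norm w + 1))"
 have dl: "dl > 0" "ball x dl <= S" using d0 d1 d2 by (auto simp: dl_def)
 have n: "norm v + norm w + 1 > 0" using norm_ge_zero[of v] norm_ge_zero[of w] by linarith
 have h0: "h > 0" using dl n by (simp add: h_def)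
 have "norm v + norm w < 2*(norm v + norm w + 1)" using n by argo
 hence "h*norm v + h*norm w < h*(2*(norm v + norm w + 1))" using h0 by (simp only: distrib_left[symmetric] mult_less_cancel_left_pos)
 also have "... = dl" using n by (simp add: h_def)
 finally have hd: "h*norm v + h*norm w < dl" .
 obtain p where p: "dist x p < dl"
  "f (x + h *R v + h *R w) - f (x + h *R v) - f (x + h *R w) + f x = h^2*H v w p" using mvt[OF h0 hd dl(2)] by blast
 obtain q where q: "dist x q < dl"
  "f (x + h *R w + h *R v) - f (x + h *R w) - f (x + h *R v) + f x = h^2*H w v q"
  using mvt[of h w v dl] h0 hd dl(2) by (auto simp: add_ac)
 have "x + h *R w + h *R v = x + h *R v + h *R w" by (simp add: add_ac)
 hence "f (x + h *R v + h *R w) - f (x + h *R w) - f (x + h *R v) + f x = h^2*H w v q" using q(2) by metis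
 hence "h^2*H v w p = h^2*H w v q" using p(2) by linarith
 hence "H v w p = H w v q" using h0 by simp
 moreover have "p:S" "q:S" using p q dl by auto
 ultimately have "dist (H v w x) (H w v x) < e + e" using d1(2)[of p] d2(2)[of q] p(1) q(1) by (auto simp: dl_def dist_commute dist_real_def)
 thus False by (simp add: e_def dist_real_def)
qed

section \<open>Bump functions, partitions of unity, extension of smooth maps\<close>

text \<open>The functions exp(-1/t) t^(-j), extended by zero, are closed under differentiation up to
  linear combinations. Smoothness of the classical bump \<open>flat 0\<close> thus follows by one
  induction over all \<open>j\<close> at once.\<close>

definition flat :: "nat => real => real" where
 "flat j t = (if t > 0 then exp (- (1/t))*(1/t)^j else 0)"

lemma flat_tendsto_0: "(flat j \<longlongrightarrow> 0) (at 0)"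
proof (rule filterlim_split_at)
 show "(flat j \<longlongrightarrow> 0) (at_left 0)" by (rule tendsto_eventually) (auto simp: eventually_at_filter flat_def)
 have lim: "((%x. x^j/exp x) \<longlongrightarrow> (0::real)) at_top" by (rule tendsto_power_div_exp_0)
 have "((%t. inverse t^j/exp (inverse t)) \<longlongrightarrow> (0::real)) (at_right 0)"
  by (rule filterlim_compose[OF lim filterlim_inverse_at_top_right])
 thus "(flat j \<longlongrightarrow> 0) (at_right 0)" by (rule Lim_transform_eventually)
   (auto simp: eventually_at_filter flat_def exp_minus field_simps)
qed

lemma flat_has_derivative:
 "(flat j has_real_derivative (flat (j + 2) t - j*flat (j + 1) t)) (at t)"
proof -
 consider "t > 0" | "t < 0" | "t = 0" by linarith
 thus ?thesis
 proof cases
  case 1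
  define g where "g t = 1/t" for t :: real
  have g: "(g has_real_derivative - (g t*g t)) (at t)" unfolding g_def using 1 by (auto intro!: derivative_eq_intros simp: field_simps)
  have "((%t. exp (- g t)*g t^j) has_real_derivative exp (- g t)*g t^(j + 2) - j*(exp (- g t)*g t^(j + 1))) (at t)"
  proof (cases j)
   case (Suc i)
   have "((%t. g t^Suc i) has_real_derivative (1 + real i)*(- (g t*g t)*g t^i)) (at t)" by (rule DERIV_power_Suc[OF g])
   from DERIV_mult[OF DERIV_fun_exp[OF DERIV_minus[OF g]] this]
   show ?thesis unfolding Suc by (rule DERIV_cong) (simp add: algebra_simps power2_eq_square)
  qed (auto intro!: derivative_eq_intros g simp: algebra_simps power2_eq_square)
  hence "((%t. exp (- (1/t))*(1/t)^j) has_real_derivative (flat (j + 2) t - j*flat (j + 1) t)) (at t)" using 1 by (simp add: g_def flat_def)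
  thus ?thesis by (rule DERIV_cong_ev[THEN iffD1, rotated -1])
    (use 1 in \<open>auto simp: flat_def intro!: eventually_mono[OF eventually_nhds_in_open[of "{0<..}" t]]\<close>)
 next
  case 2
  have "((%t. 0::real) has_real_derivative (flat (j + 2) t - j*flat (j + 1) t)) (at t)" using 2 by (auto simp: flat_def)
  thus ?thesis by (rule DERIV_cong_ev[THEN iffD1, rotated -1])
    (use 2 in \<open>auto simp: flat_def intro!: eventually_mono[OF eventually_nhds_in_open[of "{..<0}" t]]\<close>)
 next
  case 3
  have "((%h. (flat j (0 + h) - flat j 0)/h) \<longlongrightarrow> 0) (at 0)" by (rule Lim_transform_eventually[OF flat_tendsto_0[of "Suc j"]])
    (auto simp: eventually_at_filter flat_def field_simps)
  thus ?thesis using 3 by (simp add: DERIV_def flat_def)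
 qed
qed

lemma Ck_on_flat: "Ck_on k UNIV (flat j)"
proof (induction k arbitrary: j)
 case 0
 show ?case using DERIV_isCont[OF flat_has_derivative] by (simp add: continuous_on_eq_continuous_at)
next
 case (Suc k)
 have "(flat j has_derivative (%v. v * (flat (j + 2) x + (- real j)*flat (j + 1) x))) (at x)" for x
  using flat_has_derivative[of j x] by (simp add: has_field_derivative_def mult_commute_abs)
 moreover have "Ck_on k UNIV (%x. v * (flat (j + 2) x + (- real j)*flat (j + 1) x))" for v by (intro Ck_on_mult Ck_on_add Ck_on_const Suc open_UNIV)
 ultimately show ?case by (intro Ck_on_SucI open_UNIV)
qed

definition bump :: "real => real" where "bump = flat 0"

lemma bump_pos: "t > 0 ==> bump t > 0" and bump_zero: "t <= 0 ==> bump t = 0"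
 and bump_nonneg: "bump t >= 0" by (auto simp: bump_def flat_def)

lemma smooth_on_bump: "open S ==> smooth_on S f ==> smooth_on S (%x. bump (f x))" unfolding bump_def
 by (rule smooth_on_compose[where f="flat 0" and T=UNIV]) (auto simp: smooth_on_def Ck_on_flat)

lemma smooth_on_Un:
 assumes "open S" "open T" "smooth_on S f" "smooth_on T f" shows "smooth_on (S \<union> T) f"
proof -
 have "Ck_on k S f ==> Ck_on k T f ==> Ck_on k (S \<union> T) f" for k
 proof (induction k arbitrary: f)
  case (Suc k)
  thus ?case by (auto simp: Ck_on.simps(2))
 qed (auto intro: continuous_on_open_Un assms)
 thus ?thesis using assms by (simp add: smooth_on_def)
qed

lemma smooth_on_zero_extend:
 fixes f :: "'a::euclidean_space => 'b::real_normed_vector"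
 assumes "open S" "closed K" "K <= S" "smooth_on S f" "!!x. x \<notin> K ==> f x = 0"
 shows "smooth_on UNIV f"
proof -
 have o: "open (- K)" using assms by (simp add: open_Compl)
 have "smooth_on (- K) f" by (rule smooth_on_cong[OF o _ smooth_on_const[OF o, of 0]]) (use assms in auto)
 hence "smooth_on (S \<union> - K) f" by (intro smooth_on_Un assms o)
 moreover have "S \<union> - K = UNIV" using assms by auto
 ultimately show ?thesis by simp
qed

lemma smooth_partition:
 fixes M :: "'a::euclidean_space set"
 assumes M: "compact M" and r: "!!p. p:M ==> r p > 0"
 obtains I and xi :: "'a => 'a => real" where "finite I" "I <= M"
  "!!p. p:I ==> smooth_on UNIV (xi p)"
  "!!p x. p:I ==> x \<notin> ball p (r p) ==> xi p x = 0"
  "!!x. x:M ==> (\<Sum>p\<in>I. xi p x) = 1" "!!p x. p:I ==> 0 <= xi p x"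
proof -
 have "M <= (\<Union>p\<in>M. ball p (r p))" using r by auto
 then obtain I where I: "I <= M" "finite I" "M <= (\<Union>p\<in>I. ball p (r p))" using compactE_image[OF M, of M "%p. ball p (r p)"] by auto
 define bt where "bt p x = bump ((r p)^2 - (x - p) \<bullet> (x - p))" for p x :: 'a
 define S where "S x = (\<Sum>p\<in>I. bt p x)" for x
 have sq: "(r p)^2 - (x - p) \<bullet> (x - p) > 0 <-> x:ball p (r p)" if "p:I" for p x
 proof -
  have "(x - p) \<bullet> (x - p) = (dist p x)^2" by (simp add: power2_norm_eq_inner[symmetric] dist_norm norm_minus_commute)
  moreover have "r p > 0" using r I that by auto
  moreover have "(dist p x)^2 < (r p)^2 <-> dist p x < r p"
   using calculation(2) by (meson less_imp_le power2_less_imp_less power_strict_mono zero_le_dist pos2)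
  ultimately show ?thesis by simp
 qed
 have bts: "smooth_on UNIV (bt p)" for p unfolding bt_def
  by (intro smooth_on_bump smooth_on_diff smooth_on_const smooth_on_inner smooth_on_ident open_UNIV)
 have Ss: "smooth_on UNIV S" unfolding S_def by (intro smooth_on_sum bts open_UNIV)
 have S0: "S x >= 0" for x unfolding S_def bt_def by (intro sum_nonneg bump_nonneg)
 have Spos: "S x > 0" if xM: "x:M" for x
 proof -
  obtain p where p: "p:I" "x:ball p (r p)" using subsetD[OF I(3) xM] by blast
  have "0 < bt p x" using sq[OF p(1), of x] p(2) by (simp add: bt_def bump_pos)
  also have "bt p x <= S x" unfolding S_def by (rule member_le_sum[OF p(1)]) (auto simp: bt_def bump_nonneg I)
  finally show ?thesis .
 qed
 obtain m where m: "m > 0" "!!x. x:M ==> S x >= m"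
 proof (cases "M = {}")
  case False
  have "continuous_on M S" using smooth_on_imp_continuous[OF Ss] continuous_on_subset by blast
  then obtain x where "x:M" "!!y. y:M ==> S x <= S y" using continuous_attains_inf[OF M False] by blast
  thus ?thesis using that Spos by blast
 qed (auto intro: that[of 1])
 \<comment> \<open>The added bump vanishes where \<open>S >= m\<close>, hence on \<open>M\<close>,
   and is positive where \<open>S\<close> vanishes. Dividing by \<open>D\<close> therefore makes the
   sum 1 on \<open>M\<close> and is harmless everywhere else.\<close>
 define D where "D x = S x + bump (m - S x)" for x
 have Dpos: "D x > 0" for x using S0[of x] m(1) bump_pos[of "m - S x"] bump_nonneg[of "m - S x"] by (cases "S x = 0") (auto simp: D_def)
 have Ds: "smooth_on UNIV D" unfolding D_def by (intro smooth_on_add smooth_on_bump smooth_on_diff smooth_on_const Ss open_UNIV)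
 show ?thesis
 proof (rule that[OF I(2,1), of "%p x. bt p x/D x"])
  show "smooth_on UNIV (%x. bt p x/D x)" for p using Dpos by (intro smooth_on_divide bts Ds open_UNIV) (simp add: less_imp_neq[symmetric])
  show "bt p x/D x = 0" if "p:I" "x \<notin> ball p (r p)" for p x using sq[OF that(1), of x] that(2) by (auto simp: bt_def bump_zero)
  show "(\<Sum>p\<in>I. bt p x/D x) = 1" if "x:M" for x using Spos[OF that] m(2)[OF that]
   by (simp add: D_def bump_zero sum_divide_distrib[symmetric] S_def[symmetric])
  show "0 <= bt p x/D x" for p x using Dpos[of x] by (simp add: bt_def bump_nonneg)
 qed
qed

text \<open>Local extensions are glued by a partition of unity. Each product extends by zero because
  its cutoff vanishes outside a ball whose closure lies in the domain of the local extension;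
  finitely many balls give bounded support.\<close>

lemma smooth_map_extension:
 fixes f :: "'a::euclidean_space => 'b::real_normed_vector"
 assumes M: "compact M" and f: "smooth_map M f"
 obtains f' R where "smooth_on UNIV f'" "!!x. x:M ==> f' x = f x" "!!x. norm x > R ==> f' x = 0"
proof -
 have "ALL p:M. EX U g. open U & p:U & smooth_on U g & (ALL y:U \<inter> M. g y = f y)" using f unfolding smooth_map_def .
 then obtain U g where U: "!!p. p:M ==> open (U p) & p:U p & smooth_on (U p) (g p) & (ALL y:U p \<inter> M. g p y = f y)" by metis
 have "ALL p:M. EX e>0. cball p e <= U p" using U open_contains_cball by metis
 then obtain r where r: "!!p. p:M ==> r p > 0 & cball p (r p) <= U p" by metis
 obtain I xi where I: "finite I" "I <= M"
  "!!p. p:I ==> smooth_on UNIV (xi p)"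
  "!!p x. p:I ==> x \<notin> ball p (r p) ==> xi p x = (0::real)"
  "!!x. x:M ==> (\<Sum>p\<in>I. xi p x) = 1" by (rule smooth_partition[OF M, of r]) (use r in blast, blast)
 define f' where "f' x = (\<Sum>p\<in>I. xi p x *R g p x)" for x
 show ?thesis
 proof (rule that)
  show "smooth_on UNIV f'" unfolding f'_def
  proof (intro smooth_on_sum open_UNIV)
   fix p assume p: "p:I"
   hence pM: "p:M" using I by auto
   have o: "open (U p)" using U pM by blast
   have c: "cball p (r p) <= U p" using r pM by blast
   have sm: "smooth_on (U p) (%x. xi p x *R g p x)" using U[OF pM] smooth_on_subset[OF I(3)[OF p], of "U p"] by (intro smooth_on_scaleR o) auto
   show "smooth_on UNIV (%x. xi p x *R g p x)" by (rule smooth_on_zero_extend[OF o closed_cball c sm]) (use I(4)[OF p] in auto)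
  qed
  show "f' x = f x" if x: "x:M" for x
  proof -
   have "xi p x *R g p x = xi p x *R f x" if p: "p:I" for p
   proof (cases "x:ball p (r p)")
    case True
    hence "x:U p" using r[of p] p I by (auto simp: subset_iff)
    thus ?thesis using U[of p] p I x by auto
   qed (use I(4)[OF p] in auto)
   hence "f' x = (\<Sum>p\<in>I. xi p x *R f x)" unfolding f'_def by (intro sum.cong refl)
   thus ?thesis using I(5)[OF x] by (simp add: scaleR_sum_left[symmetric])
  qed
  show "f' x = 0" if big: "norm x > (\<Sum>p\<in>I. norm p + |r p| )" for x
  proof -
   have "x \<notin> ball p (r p)" if p: "p:I" for p
   proof -
    have "norm p + |r p| <= (\<Sum>p\<in>I. norm p + |r p| )" by (rule member_le_sum[OF p]) (use I in auto)
    moreover have "norm x <= norm p + dist p x" by (metis dist_norm norm_minus_commute norm_triangle_sub)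
    ultimately show ?thesis using big by auto
   qed
   thus ?thesis using I(4) by (simp add: f'_def)
  qed
 qed
qed

text \<open>A derivative within \<open>M\<close> is not unique as an ambient linear map. Composed
  with a curve through \<open>p\<close> of velocity \<open>v\<close>, it becomes a derivative on an
  open interval, and that one is unique.\<close>

lemma dir_deriv_eq_fd:
 assumes p: "p:M" and v: "v:tangent_space M p" and U: "open U" "p:U"
  and eq: "!!y. y:U \<inter> M ==> f' y = f y" and d: "f' differentiable (at p)"
 shows "dir_deriv M f p v = fd f' p v"
proof -
 have 1: "(f' has_derivative fd f' p) (at p within M)" using has_derivative_fd[OF d] has_derivative_at_withinI by blast
 obtain e where e: "e > 0" "ball p e <= U" using U open_contains_ball by blast
 have D': "(f has_derivative fd f' p) (at p within M)"
  by (rule has_derivative_transform_within[OF 1 e(1) p]) (use e eq in "auto simp: dist_commute subset_iff")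
 define D where "D = frechet_derivative f (at p within M)"
 have D: "(f has_derivative D) (at p within M)" using D' unfolding D_def by (metis differentiable_def frechet_derivative_works)
 obtain c eps where c: "eps > 0" "c ` {-eps<..<eps} <= M" "c 0 = p" "(c has_vector_derivative v) (at 0)" using v unfolding tangent_space_def by blast
 have at0: "at 0 within {-eps<..<eps} = at (0::real)" using c(1) by (intro at_within_open) auto
 have un: "((%t. f (c t)) has_derivative (%t. E (t *R v))) (at 0 within {-eps<..<eps})" if E: "(f has_derivative E) (at p within M)" for E
 proof -
  have "(c has_derivative (%t. t *R v)) (at 0 within {-eps<..<eps})"
   using c(4) unfolding has_vector_derivative_def by (rule has_derivative_at_withinI)
  moreover have "(f has_derivative E) (at (c 0) within c ` {-eps<..<eps})" using E c(2,3) has_derivative_subset by metis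
  ultimately show ?thesis using diff_chain_within[of c _ 0 "{-eps<..<eps}" f E] by (simp add: o_def)
 qed
 have "(%t. D (t *R v)) = (%t. fd f' p (t *R v))" using has_derivative_unique[OF un[OF D, unfolded at0] un[OF D', unfolded at0]] .
 hence "D (1 *R v) = fd f' p (1 *R v)" by metis
 thus ?thesis by (simp add: dir_deriv_def D_def)
qed

section \<open>Weighted bounds for iterated derivatives\<close>

primrec fds :: "'a::real_normed_vector list => ('a => real) => 'a => real" where
 "fds [] F = F"
| "fds (v # vs) F = fds vs (%x. fd F x v)"

text \<open>A derivative of order \<open>j <= k\<close> may have the size
  \<open>C N^(d + j)\<close>: every differentiation has weight one, and \<open>d\<close> is the
  weight of the function itself. With \<open>N = 1\<close> the weights disappear and plain bounds
  remain.\<close>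

primrec wb :: "nat => nat => real => ('a::euclidean_space => real) => 'a => real => bool" where
 "wb 0 d N F x C <-> |F x| <= C*N^d"
| "wb (Suc k) d N F x C <-> |F x| <= C*N^d & (ALL e:Basis. wb k (Suc d) N (%y. fd F y e) x C)"

lemma wb_abs_le: "wb k d N F x C ==> |F x| <= C*N^d" by (cases k) auto

lemma wb_iff_fds:
 "wb k d N F x C <-> (ALL bt. set bt <= Basis & length bt <= k --> |fds bt F x| <= C*N^(d + length bt))"
proof (induction k arbitrary: d F)
 case (Suc k)
 have "(ALL bt. set bt <= Basis & length bt <= Suc k --> |fds bt F x| <= C*N^(d + length bt)) <-> |F x| <= C*N^d &
  (ALL e:Basis. ALL bt. set bt <= Basis & length bt <= k --> |fds bt (%y. fd F y e) x| <= C*N^(Suc d + length bt))"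
  (is "?L <-> ?R")
 proof
  assume L: ?L
  have "|fds bt (%y. fd F y e) x| <= C*N^(Suc d + length bt)"
   if "e:Basis" "set bt <= Basis" "length bt <= k" for e bt using L[rule_format, of "e # bt"] that by simp
  thus ?R using L[rule_format, of "[]"] by simp
 next
  assume R: ?R
  show ?L
  proof (intro allI impI)
   fix bt :: "'a list" assume "set bt <= Basis & length bt <= Suc k"
   thus "|fds bt F x| <= C*N^(d + length bt)" using R by (cases bt) auto
  qed
 qed
 thus ?case by (simp only: wb.simps Suc.IH)
qed simp

lemma wb_mono:
 assumes "wb k d N F x C" "C <= C'" "0 <= N" shows "wb k d N F x C'"
proof -
 have "C*N^j <= C'*N^j" for j using assms by (intro mult_right_mono) auto
 thus ?thesis using assms(1) unfolding wb_iff_fds by (meson order_trans)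
qed

lemma wb_le: "wb k d N F x C ==> j <= k ==> wb j d N F x C" unfolding wb_iff_fds by auto

lemma wb_one: "wb k d 1 F x C <-> wb k d' 1 F x C" unfolding wb_iff_fds by simp

lemma wb_nonneg: "wb k d 1 F x C ==> 0 <= C" using order_trans[OF abs_ge_zero wb_abs_le] by fastforce

lemma fd_add: "f differentiable (at x) ==> g differentiable (at x) ==> fd (%y. f y + g y) x v = fd f x v + fd g x v"
 by (rule fd_eqI) (intro has_derivative_add has_derivative_fd)

lemma fd_diff: "f differentiable (at x) ==> g differentiable (at x) ==> fd (%y. f y - g y) x v = fd f x v - fd g x v"
 by (rule fd_eqI) (intro has_derivative_diff has_derivative_fd)

lemma fd_sum: "(!!i. i:I ==> f i differentiable (at x)) ==> fd (%y. \<Sum>i\<in>I. f i y) x v = (\<Sum>i\<in>I. fd (f i) x v)"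
 by (rule fd_eqI) (intro has_derivative_sum has_derivative_fd)

lemma fd_scaleR:
 "f differentiable (at x) ==> g differentiable (at x) ==>
  fd (%y. f y *R g y) x v = f x *R fd g x v + fd f x v *R g x" by (rule fd_eqI) (intro has_derivative_scaleR has_derivative_fd)

lemma fd_mult:
 fixes f g :: "'a::real_normed_vector => real"
 shows "f differentiable (at x) ==> g differentiable (at x) ==>
  fd (%y. f y*g y) x v = f x*fd g x v + fd f x v * g x" by (rule fd_eqI) (intro has_derivative_mult has_derivative_fd)

lemma fd_const: "fd (%y. c) x v = 0" by (rule fd_eqI) simp

lemma fd_linear_comp:
 assumes "bounded_linear L" "f differentiable (at x)"
 shows "fd (%y. L (f y)) x v = L (fd f x v)" using fd_eqI[OF bounded_linear.has_derivative[OF assms(1) has_derivative_fd[OF assms(2)]]] .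

lemma fd_bounded_linear: "bounded_linear L ==> fd L x v = L v" by (rule fd_eqI) (rule bounded_linear_imp_has_derivative)

lemma fd_compose:
 assumes "g differentiable (at x)" "f differentiable (at (g x))"
 shows "fd (%y. f (g y)) x v = fd f (g x) (fd g x v)"
 using fd_eqI[OF has_derivative_compose[OF has_derivative_fd[OF assms(1)] has_derivative_fd[OF assms(2)]]] .

abbreviation "smooth \<equiv> smooth_on UNIV"

lemma smooth_diff: "smooth f ==> f differentiable (at x)" by (rule smooth_on_differentiable) auto

lemma wb_const: "0 <= N ==> |c| <= C*N^d ==> 0 <= C ==> wb k d N (%x. c) x C"
proof (induction k arbitrary: c d)
 case (Suc k)
 thus ?case by (simp add: fd_const)
qed simp

lemma wb_add:
 assumes "smooth F" "smooth G" "wb k d N F x A" "wb k d N G x B"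
 shows "wb k d N (%x. F x + G x) x (A + B)" using assms
proof (induction k arbitrary: d F G)
 case 0
 thus ?case by (simp add: distrib_right)
next
 case (Suc k)
 have "wb k (Suc d) N (%y. fd F y e + fd G y e) x (A + B)" if "e:Basis" for e using Suc.prems that by (intro Suc.IH smooth_on_fd) auto
 moreover have "|F x + G x| <= (A + B)*N^d" using Suc.prems(3,4) abs_triangle_ineq[of "F x" "G x"] by (auto simp add: distrib_right)
 ultimately show ?case by (simp add: fd_add smooth_diff Suc.prems(1,2))
qed

lemma wb_sum:
 assumes "finite I" "!!i. i:I ==> smooth (F i)" "!!i. i:I ==> wb k d N (F i) x (A i)" "0 <= N"
 shows "wb k d N (%x. \<Sum>i\<in>I. F i x) x (\<Sum>i\<in>I. A i)" using assms(1-3)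
proof (induction I rule: finite_induct)
 case empty
 show ?case by (simp add: wb_const assms)
next
 case (insert i I)
 thus ?case by (simp add: wb_add smooth_on_sum)
qed

text \<open>Leibniz' rule: each differentiation doubles the number of terms, whence
  \<open>2^k\<close>, and the weights of the factors add.\<close>

lemma wb_mult:
 assumes "smooth F" "smooth G" "wb k d N F x A" "wb k d' N G x B"
 shows "wb k (d + d') N (%x. F x*G x) x (2^k*A*B)" using assms
proof (induction k arbitrary: d d' F G)
 case 0
 have "|F x|*|G x| <= (A*N^d)*(B*N^d')" using 0 by (intro mult_mono) (auto intro: order_trans[OF abs_ge_zero])
 thus ?case by (simp add: abs_mult power_add algebra_simps)
next
 case (Suc k)
 have wF: "wb k d N F x A" and wG: "wb k d' N G x B" using Suc.prems wb_le le_Suc_eq by blast+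
 have "wb k (Suc (d + d')) N (%y. F y*fd G y e + fd F y e*G y) x (2^Suc k*A*B)" if e: "e:Basis" for e
 proof -
  have "wb k (d + Suc d') N (%y. F y*fd G y e) x (2^k*A*B)" using Suc.prems e by (intro Suc.IH smooth_on_fd wF) auto
  moreover have "wb k (Suc d + d') N (%y. fd F y e*G y) x (2^k*A*B)" using Suc.prems e by (intro Suc.IH smooth_on_fd wG) auto
  ultimately have "wb k (Suc (d + d')) N (%y. F y*fd G y e + fd F y e*G y) x
    (2^k*A*B + 2^k*A*B)" using Suc.prems by (intro wb_add smooth_on_mult smooth_on_fd) auto
  thus ?thesis by (simp add: algebra_simps)
 qed
 moreover have "|F x*G x| <= (2^Suc k*A*B)*N^(d + d')"
 proof -
  have "|F x|*|G x| <= (A*N^d)*(B*N^d')" using Suc.prems by (intro mult_mono) (auto intro: order_trans[OF abs_ge_zero])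
  moreover from this have "0 <= (A*N^d)*(B*N^d')" by (rule order_trans[rotated]) simp
  hence "(A*N^d)*(B*N^d') <= 2^Suc k*((A*N^d)*(B*N^d'))" by (intro mult_le_cancel_right1[THEN iffD2]) (auto simp del: power_Suc intro: one_le_power)
  ultimately have "|F x|*|G x| <= 2^Suc k*((A*N^d)*(B*N^d'))" by linarith
  thus ?thesis by (simp add: abs_mult power_add algebra_simps)
 qed
 ultimately show ?case by (simp add: fd_mult smooth_diff Suc.prems(1,2))
qed

fun comp_const :: "real => nat => real" where
 "comp_const n 0 = 1"
| "comp_const n (Suc k) = max 1 (n*(2^k*comp_const n k))"

lemma comp_const_ge1: "comp_const n k >= 1" by (cases k) auto

abbreviation (input) even_part where "even_part a b d (e::real) n == ((a + e*b + e^2*d)^n + (a - e*b + e^2*d)^n)/2"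
abbreviation (input) odd_part where "odd_part a b d (e::real) n == ((a + e*b + e^2*d)^n - (a - e*b + e^2*d)^n)/2"

text \<open>The chain rule respects the grading: in a derivative of order \<open>j\<close> of the
  composition, the orders of the derivatives of \<open>xi\<close> in each product add up to
  \<open>j\<close>. The constant \<open>comp_const\<close> collects the sum over coordinates and the
  Leibniz factors of this recursion.\<close>

lemma wb_compose:
 fixes f :: "'a::euclidean_space => real" and xi :: "'b::euclidean_space => 'a"
 assumes "smooth f" "smooth xi" "!!y. wb k 0 1 f y K" "0 <= N"
  "!!j e e'. j < k ==> e:Basis ==> e':Basis ==> wb j 1 N (%y. fd xi y e' \<bullet> e) x 1"
 shows "wb k 0 N (%y. f (xi y)) x (comp_const DIM('a) k*K)" using assms(1,3,5)
proof (induction k arbitrary: f)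
 case 0
 thus ?case by simp
next
 case (Suc k)
 have K: "0 <= K" using Suc.prems(2) wb_nonneg by blast
 let ?c = "comp_const DIM('a)"
 have smc: "smooth (%y. fd xi y e' \<bullet> e)" for e e' by (intro smooth_on_inner smooth_on_fd smooth_on_const assms open_UNIV)
 have smf: "smooth (%y. fd f (xi y) e)" for e by (rule smooth_on_compose[where T=UNIV]) (auto intro: smooth_on_fd Suc.prems assms)
 have "wb k 1 N (%y. fd (%y. f (xi y)) y e') x (?c (Suc k)*K)" if e': "e':Basis" for e'
 proof -
  have "wb k (1 + 0) N (%y. (fd xi y e' \<bullet> e)*fd f (xi y) e) x (2^k*1*(?c k*K))" if e: "e:Basis" for e
  proof (rule wb_mult[OF smc smf])
   show "wb k 1 N (%y. fd xi y e' \<bullet> e) x 1" using Suc.prems(3) e e' by auto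
   show "wb k 0 N (%y. fd f (xi y) e) x (?c k*K)"
   proof (rule Suc.IH)
    show "smooth (%y. fd f y e)" using Suc.prems smooth_on_fd by auto
    show "wb k 0 1 (%y. fd f y e) y K" for y by (rule wb_one[THEN iffD1, of _ "Suc 0"]) (use Suc.prems(2)[of y] e in auto)
    show "wb j 1 N (%y. fd xi y e' \<bullet> e) x 1" if "j < k" "e:Basis" "e':Basis" for j e e' using Suc.prems(3) that by auto
   qed
  qed
  hence "wb k 1 N (%y. \<Sum>e\<in>Basis. (fd xi y e' \<bullet> e)*fd f (xi y) e) x
    (\<Sum>e\<in>(Basis::'a set). 2^k*1*(?c k*K))" using smc smf assms(4) by (intro wb_sum smooth_on_mult) auto
  moreover have "(%y. \<Sum>e\<in>Basis. (fd xi y e' \<bullet> e)*fd f (xi y) e) = (%y. fd (%y. f (xi y)) y e')"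
  proof
   fix y
   have "fd (%y. f (xi y)) y e' = fd f (xi y) (fd xi y e')" by (rule fd_compose) (intro smooth_diff Suc.prems(1) assms(2))+
   also have "... = (\<Sum>e\<in>Basis. (fd xi y e' \<bullet> e) *R fd f (xi y) e)" by (rule fd_linear_expand[OF smooth_diff[OF Suc.prems(1)]])
   finally show "(\<Sum>e\<in>Basis. (fd xi y e' \<bullet> e)*fd f (xi y) e) = fd (%y. f (xi y)) y e'" by simp
  qed
  ultimately have "wb k 1 N (%y. fd (%y. f (xi y)) y e') x (\<Sum>e\<in>(Basis::'a set). 2^k*1*(?c k*K))" by simp
  thus ?thesis by (rule wb_mono) (use K assms(4) in "auto simp: mult.assoc[symmetric] intro!: mult_right_mono")
 qed
 moreover have "|f (xi x)| <= ?c (Suc k)*K"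
 proof -
  have "|f (xi x)| <= 1*K" using Suc.prems(2)[of "xi x"] by simp
  also have "... <= ?c (Suc k)*K" using comp_const_ge1 K by (intro mult_right_mono) auto
  finally show ?thesis .
 qed
 ultimately show ?case by simp
qed

section \<open>Powers of symmetric perturbations\<close>

definition symmetric_power_bound :: "real => nat => real => real => bool" where
 "symmetric_power_bound C n A B <-> 0 <= A & 0 <= B &
  (ALL a b d M eps :: real. |a| <= M --> |b| <= C*M --> |d| <= C*M --> 0 <= eps --> eps <= 1 --> |even_part a b d eps n - a^n| <= A*eps^2*M^n &
   |odd_part a b d eps n| <= B*eps*M^n)"

lemma symmetric_power_boundD:
 assumes "symmetric_power_bound C n A B" "|a| <= M" "|b| <= C*M" "|d| <= C*M" "0 <= eps" "eps <= 1"
 shows "|even_part a b d eps n - a^n| <= A*eps^2*M^n"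
  and "|odd_part a b d eps n| <= B*eps*M^n" using assms unfolding symmetric_power_bound_def by metis+

text \<open>The terms of odd order in \<open>eps\<close> cancel in the even part. Even and odd part
  at exponent \<open>n + 1\<close> are combinations of both at \<open>n\<close>, where the odd part
  enters the even one with a factor \<open>eps\<close>; so both estimates go through one
  induction.\<close>

lemma symmetric_power_bound_exists:
 assumes "C >= 0"
 shows "EX A B. symmetric_power_bound C n A B"
proof (induction n)
 case 0
 show ?case by (intro exI[of _ "0::real"]) (simp add: symmetric_power_bound_def)
next
 case (Suc n)
 then obtain A B where P: "symmetric_power_bound C n A B" by blast
 hence AB: "A >= 0" "B >= 0" by (simp_all add: symmetric_power_bound_def)
 define A' B' where "A' = A + C*(1 + A) + C*B" and "B' = (1 + C)*B + C*(1 + A)"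
 have AB': "A' >= 0" "B' >= 0" using AB assms by (auto simp: A'_def B'_def)
 have "|even_part a b d eps (Suc n) - a^Suc n| <= A'*eps^2*M^Suc n & |odd_part a b d eps (Suc n)| <= B'*eps*M^Suc n"
  if h: "|a| <= M" "|b| <= C*M" "|d| <= C*M" "0 <= eps" "eps <= 1" for a b d M eps :: real
 proof
  define S where "S = even_part a b d eps n"
  define D where "D = odd_part a b d eps n"
  have M: "0 <= M" using h by linarith
  have e2: "0 <= eps^2" "eps^2 <= eps" "eps^2 <= 1" using h mult_left_le[of eps eps] by (auto simp: power2_eq_square intro: mult_le_one)
  have SD: "|S - a^n| <= A*eps^2*M^n" "|D| <= B*eps*M^n" using symmetric_power_boundD[OF P h] by (simp_all only: S_def D_def)
  have "|a|^n <= M^n" using h by (intro power_mono) auto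
  moreover have "A*eps^2*M^n <= A*1*M^n" using AB e2 M by (intro mult_right_mono mult_left_mono) auto
  ultimately have Sb: "|S| <= (1 + A)*M^n" using SD(1) by (simp add: distrib_right flip: power_abs)
  have Srec: "even_part a b d eps (Suc n) = (a + eps^2*d)*S + eps*b*D" by (simp add: S_def D_def field_simps)
  have Drec: "odd_part a b d eps (Suc n) = (a + eps^2*d)*D + eps*b*S" by (simp add: S_def D_def field_simps)
  have t1: "|a*(S - a^n)| <= M*(A*eps^2*M^n)" unfolding abs_mult using h SD M by (intro mult_mono) auto
  have t2: "|eps\<^sup>2*d*S| <= eps^2*(C*M)*((1 + A)*M^n)" unfolding abs_mult using h Sb M e2 assms by (intro mult_mono) auto
  have t3: "|eps*b*D| <= eps*(C*M)*(B*eps*M^n)" unfolding abs_mult using h SD M assms by (intro mult_mono) auto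
  have "|(a + eps^2*d)*S + eps*b*D - a^Suc n| = |a*(S - a^n) + eps^2*d*S + eps*b*D|" by (simp add: algebra_simps)
  also have "... <= M*(A*eps^2*M^n) + eps^2*(C*M)*((1 + A)*M^n) + eps*(C*M)*(B*eps*M^n)" using t1 t2 t3 by linarith
  also have "... = (A + C*(1 + A) + C*B)*eps^2*M^Suc n" by (simp add: algebra_simps power2_eq_square)
  finally show "|even_part a b d eps (Suc n) - a^Suc n| <= A'*eps^2*M^Suc n" unfolding Srec A'_def .
  have "eps^2*|d| <= 1*(C*M)" using e2 h by (intro mult_mono) auto
  hence "|a + eps^2*d| <= (1 + C)*M" using h abs_triangle_ineq[of a "eps^2*d"] by (simp add: abs_mult algebra_simps)
  hence u1: "|(a + eps^2*d)*D| <= ((1 + C)*M)*(B*eps*M^n)" unfolding abs_mult using SD M assms by (intro mult_mono) auto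
  have u2: "|eps*b*S| <= eps*(C*M)*((1 + A)*M^n)" unfolding abs_mult using h Sb M assms by (intro mult_mono) auto
  have "|(a + eps^2*d)*D + eps*b*S| <= ((1 + C)*M)*(B*eps*M^n) + eps*(C*M)*((1 + A)*M^n)" using u1 u2 by linarith
  also have "... = ((1 + C)*B + C*(1 + A))*eps*M^Suc n" by (simp add: algebra_simps)
  finally show "|odd_part a b d eps (Suc n)| <= B'*eps*M^Suc n" unfolding Drec B'_def .
 qed
 with AB' have "symmetric_power_bound C (Suc n) A' B'" unfolding symmetric_power_bound_def by blast
 thus ?case by blast
qed

lemma power_symmetric_upper:
 assumes "C >= 0"
 obtains A where "A >= 0" "!!a b d M eps :: real. |a| <= M ==> |b| <= C*M ==> |d| <= C*M ==> 0 <= eps ==> eps <= 1 ==>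
  (a + eps*b + eps^2*d)^n + (a - eps*b + eps^2*d)^n <= 2*a^n + 2*(A*eps^2*M^n)"
proof -
 obtain A B where P: "symmetric_power_bound C n A B" using symmetric_power_bound_exists[OF assms] by blast
 hence A: "A >= 0" by (simp add: symmetric_power_bound_def)
 show ?thesis
 proof (rule that[OF A])
  fix a b d M eps :: real
  assume h: "|a| <= M" "|b| <= C*M" "|d| <= C*M" "0 <= eps" "eps <= 1"
  have "X + Y <= 2*Z + 2* R" if "|(X + Y)/2 - Z| <= R" for X Y Z R :: real using that by (simp add: abs_le_iff field_simps)
  from this[OF symmetric_power_boundD(1)[OF P h]]
  show "(a + eps*b + eps^2*d)^n + (a - eps*b + eps^2*d)^n <= 2*a^n + 2*(A*eps^2*M^n)" .
 qed
qed

lemma smooth_fds: "smooth F ==> smooth (fds bt F)" by (induction bt arbitrary: F) (auto intro: smooth_on_fd)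

lemma fds_add: "smooth F ==> smooth G ==> fds bt (%x. F x + G x) x = fds bt F x + fds bt G x"
 by (induction bt arbitrary: F G) (simp_all add: fd_add smooth_diff smooth_on_fd)

lemma fd_cmult: "f differentiable (at x) ==> fd (%y. c*f y :: real) x v = c*fd f x v" using fd_mult[of "%y. c" x f v] by (simp add: fd_const)

lemma fds_cmult: "smooth F ==> fds bt (%x. c*F x) x = c*fds bt F x" by (induction bt arbitrary: F) (simp_all add: fd_cmult smooth_diff smooth_on_fd)

lemma fds_const: "bt ~= [] ==> fds bt (%x. c) x = 0"
proof (induction bt arbitrary: c)
 case (Cons v bt)
 show ?case by (cases "bt = []") (simp_all add: fd_const Cons.IH)
qed simp

lemma fds_zero: "fds bt (%x. 0) x = 0" by (induction bt) (simp_all add: fd_const)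

lemma smooth_cmult: "smooth F ==> smooth (%x. c*F x :: real)" by (intro smooth_on_mult smooth_on_const open_UNIV)

lemma smooth_add: "smooth F ==> smooth G ==> smooth (%x. F x + G x)" by (intro smooth_on_add open_UNIV)

lemma smooth_sum: "(!!i. i:I ==> smooth (F i)) ==> smooth (%x. \<Sum>i\<in>I. F i x)" by (intro smooth_on_sum open_UNIV)

lemma smooth_component: "smooth F ==> smooth (%x. F x \<bullet> e)" by (intro smooth_on_inner smooth_on_const open_UNIV)

lemma fds_sum:
 assumes "finite I" "!!i. i:I ==> smooth (F i)"
 shows "fds bt (%x. \<Sum>i\<in>I. F i x) x = (\<Sum>i\<in>I. fds bt (F i) x)" using assms
 by (induction I rule: finite_induct) (simp_all add: fds_zero fds_add smooth_sum)

lemma fd_component: "smooth xi ==> fd (%y. xi y \<bullet> e) x v = fd xi x v \<bullet> e"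
 by (rule fd_linear_comp[OF bounded_linear_inner_left]) (rule smooth_diff)

subsection \<open>A gauge for the derivatives of a map\<close>

definition gauge_idx :: "nat => 'a::euclidean_space list set" where
 "gauge_idx k = {bt. set bt <= Basis & 1 <= length bt & length bt <= k}"

text \<open>Orders from 1 to \<open>k\<close> divide \<open>fact k\<close>, so the division is exact
  on \<open>gauge_idx\<close>; the factor 2 makes the exponents even and every summand of the gauge
  non-negative.\<close>

definition gauge_exp :: "nat => 'a list => nat" where
 "gauge_exp k bt = 2*(fact k div length bt)"

text \<open>The exponents make the gauge homogeneous of degree \<open>2 k!\<close> when a derivative of order \<open>j\<close>
  is given weight \<open>j\<close>, which is the grading respected by the chain rule.\<close>

definition gauge_at :: "nat => ('b::euclidean_space => 'a::euclidean_space) => 'b => real" where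
 "gauge_at k xi x = (\<Sum>e\<in>Basis. \<Sum>bt\<in>gauge_idx k. (fds bt (%y. xi y \<bullet> e) x)^gauge_exp k bt)"

lemma finite_gauge_idx: "finite (gauge_idx k :: 'a::euclidean_space list set)"
 by (rule finite_subset[OF _ finite_lists_length_le[of "Basis :: 'a set" k]]) (auto simp: gauge_idx_def)

lemma gauge_exp:
 assumes "bt:gauge_idx k"
 shows "length bt*gauge_exp k bt = 2*fact k" "gauge_exp k bt > 0" "even (gauge_exp k bt)"
proof -
 have "length bt dvd fact k" using assms by (intro dvd_fact) (auto simp: gauge_idx_def)
 thus 1: "length bt*gauge_exp k bt = 2*fact k" by (simp add: gauge_exp_def)
 show "gauge_exp k bt > 0" using 1 by (metis fact_nonzero gr0I mult_is_0 zero_neq_numeral)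
qed (simp add: gauge_exp_def)

lemma gauge_at_nonneg: "gauge_at k xi x >= 0" unfolding gauge_at_def by (intro sum_nonneg) (auto simp: gauge_exp zero_le_even_power)

definition gauge_root :: "nat => ('b::euclidean_space => 'a::euclidean_space) => 'b => real" where
 "gauge_root k xi x = root (2*fact k) (gauge_at k xi x)"

lemma gauge_root_nonneg: "gauge_root k xi x >= 0" by (simp add: gauge_root_def gauge_at_nonneg)

lemma gauge_root_power: "gauge_root k xi x^(2*fact k) = gauge_at k xi x"
 unfolding gauge_root_def by (intro real_root_pow_pos2) (auto simp: gauge_at_nonneg)

lemma fds_le_gauge_root:
 assumes "bt:gauge_idx k" "e:Basis"
 shows "|fds bt (%y. xi y \<bullet> e) x| <= gauge_root k xi x^length bt"
proof -
 let ?a = "fds bt (%y. xi y \<bullet> e) x"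
 have nn: "0 <= (fds bt (%y. xi y \<bullet> e) x)^gauge_exp k bt" if "bt:gauge_idx k" for bt e
  using gauge_exp(3)[OF that] by (simp add: zero_le_even_power)
 have "|?a|^gauge_exp k bt = ?a^gauge_exp k bt" using gauge_exp(3)[OF assms(1)] by (rule power_even_abs)
 also have "... <= (\<Sum>bt\<in>gauge_idx k. (fds bt (%y. xi y \<bullet> e) x)^gauge_exp k bt)"
  by (rule member_le_sum[OF assms(1)]) (auto simp: finite_gauge_idx nn)
 also have "... <= gauge_at k xi x" unfolding gauge_at_def by (rule member_le_sum[OF assms(2)]) (auto intro!: sum_nonneg nn)
 also have "... = (gauge_root k xi x^length bt)^gauge_exp k bt" by (simp add: gauge_root_power gauge_exp(1)[OF assms(1)] flip: power_mult)
 finally show ?thesis using gauge_exp(2)[OF assms(1)] by (simp add: power_mono_iff gauge_root_nonneg)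
qed

lemma wb_gauge:
 assumes "smooth xi" "j < k" "e:Basis" "e':Basis"
 shows "wb j 1 (gauge_root k xi x) (%y. fd xi y e' \<bullet> e) x 1" unfolding wb_iff_fds
proof (intro allI impI)
 fix bt :: "'a list" assume bt: "set bt <= Basis & length bt <= j"
 have "|fds (e' # bt) (%y. xi y \<bullet> e) x| <= gauge_root k xi x^length (e' # bt)"
  using bt assms by (intro fds_le_gauge_root) (auto simp: gauge_idx_def)
 thus "|fds bt (%y. fd xi y e' \<bullet> e) x| <= 1*gauge_root k xi x^(1 + length bt)" using fd_component[OF assms(1), of e] by simp
qed

text \<open>The weighted chain rule with \<open>N\<close> the gauge root, for which derivatives of
  \<open>xi\<close> of order \<open>j\<close> are at most \<open>N^j\<close> by construction of the
  gauge.\<close>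

lemma fds_compose_gauge:
 fixes f :: "'a::euclidean_space => real" and xi :: "'b::euclidean_space => 'a"
 assumes "smooth f" "smooth xi" "!!y. wb k 0 1 f y K" "set bt <= Basis" "length bt <= k"
 shows "|fds bt (%y. f (xi y)) x| <= comp_const DIM('a) k*K*gauge_root k xi x^length bt"
proof -
 have "wb k 0 (gauge_root k xi x) (%y. f (xi y)) x (comp_const DIM('a) k*K)"
  by (rule wb_compose[OF assms(1-3) gauge_root_nonneg wb_gauge[OF assms(2)]])
 thus ?thesis using assms(4,5) unfolding wb_iff_fds by auto
qed

subsection \<open>Families with uniformly bounded derivatives\<close>

text \<open>The bound may depend on the order \<open>k\<close> but not on the index. The families of
  interest are the iterates of the walk, indexed by step size and number of steps.\<close>

definition bfam :: "'j set => ('j => 'a::euclidean_space => real) => bool" where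
 "bfam A u <-> (ALL j:A. smooth (u j)) & (ALL k. EX K. ALL j:A. ALL x. wb k 0 1 (u j) x K)"

definition bvec :: "'j set => ('j => 'a::euclidean_space => 'a) => bool" where
 "bvec A V <-> (ALL j:A. smooth (V j)) & (ALL k. EX K. ALL j:A. ALL e:Basis. ALL x. wb k 0 1 (%y. V j y \<bullet> e) x K)"

section \<open>The symmetric random walk and the derivatives of its iterates\<close>

locale scheme =
 fixes I :: "'i set" and s c :: "'i => 'a::euclidean_space => 'a"
 assumes I: "finite I" "I ~= {}" and s: "bvec I s" and c: "bvec I c"
begin

definition T :: "'i => real => 'a => 'a" where
 "T i eps x = x + eps *R s i x + eps^2 *R c i x"

text \<open>The transition operator of a walk that chooses an index and a sign uniformly. The first
  order displacement has mean zero, so \<open>n\<close> steps correspond to the time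
  \<open>n eps^2\<close>.\<close>

definition Q :: "real => ('a => real) => 'a => real" where
 "Q eps u x = (1/(2*card I))*(\<Sum>i\<in>I. u (T i eps x) + u (T i (- eps) x))"

abbreviation (input) gauge_pm where "gauge_pm k i eps xi x == gauge_at k (%y. T i eps (xi y)) x + gauge_at k (%y. T i (- eps) (xi y)) x"

lemma card_I: "real (card I) > 0" using I by (simp add: card_gt_0_iff)

lemma smooth_s: "i:I ==> smooth (s i)" and smooth_c: "i:I ==> smooth (c i)" using s c by (auto simp: bvec_def)

lemma smooth_comp: "smooth f ==> smooth xi ==> smooth (%y. f (xi y))"
 for f :: "'b::euclidean_space => 'c::real_normed_vector" and xi :: "'d::euclidean_space => 'b" by (rule smooth_on_compose[where T=UNIV]) auto

lemma smooth_T: "i:I ==> smooth (T i eps)" unfolding T_def[abs_def]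
 by (intro smooth_on_add smooth_on_scaleR smooth_on_const smooth_on_ident smooth_s smooth_c open_UNIV)

lemma smooth_Q:
 assumes "smooth u" shows "smooth (Q eps u)"
proof -
 have "smooth (%x. u (T i dl x))" if "i:I" for i dl by (rule smooth_comp[OF assms smooth_T[OF that]])
 thus ?thesis unfolding Q_def[abs_def] by (intro smooth_cmult smooth_sum smooth_add)
qed

lemma smooth_Q_pow: "smooth u ==> smooth ((Q eps ^^ n) u)" by (induction n) (auto intro: smooth_Q)

text \<open>A derivative of order \<open>j\<close> of a step after \<open>xi\<close> has the form
  \<open>a + eps b + eps^2 d\<close>, with \<open>a\<close> bounded by \<open>N^j\<close> and
  \<open>b\<close>, \<open>d\<close> by \<open>K N^j\<close>, where \<open>N\<close> is the gauge
  root. The two signs cancel the terms linear in \<open>eps\<close>, and after raising to the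
  exponent of the gauge each remainder is \<open>eps^2\<close> times a multiple of the gauge itself,
  with a factor that does not depend on \<open>xi\<close>.\<close>

lemma gauge_step:
 "EX C>=0. ALL i:I. ALL eps x. ALL xi :: 'b::euclidean_space => 'a. smooth xi --> 0 <= eps --> eps <= 1 -->
  gauge_pm k i eps xi x <= 2*(1 + C*eps^2)*gauge_at k xi x"
proof -
 obtain K1 where K1: "!!i e x. i:I ==> e:Basis ==> wb k 0 1 (%y. s i y \<bullet> e) x K1" using s unfolding bvec_def by meson
 obtain K2 where K2: "!!i e x. i:I ==> e:Basis ==> wb k 0 1 (%y. c i y \<bullet> e) x K2" using c unfolding bvec_def by meson
 define K where "K = comp_const DIM('a) k*max 0 (max K1 K2)"
 have K0: "K >= 0" using comp_const_ge1[of "DIM('a)" k] by (simp add: K_def)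
 have "EX A. A >= 0 & (ALL a b d M eps :: real. |a| <= M --> |b| <= K*M --> |d| <= K*M --> 0 <= eps --> eps <= 1 -->
  (a + eps*b + eps^2*d)^n + (a - eps*b + eps^2*d)^n <= 2*a^n + 2*(A*eps^2*M^n))" (is "EX A. ?P n A") for n
  by (rule power_symmetric_upper[OF K0, of n]) (rule exI, rule conjI, assumption, intro allI impI, assumption)
 hence "EX A. ALL n. ?P n (A n)" by (intro choice allI)
 then obtain A where A: "ALL n. ?P n (A n)" by (elim exE)
 have A0: "A n >= 0" for n using A[rule_format, of n] by (elim conjE)
 have A2: "(a + eps*b + eps^2*d)^n + (a - eps*b + eps^2*d)^n <= 2*a^n + 2*(A n*eps^2*M^n)"
  if "|a| <= M" "|b| <= K*M" "|d| <= K*M" "0 <= eps" "eps <= 1" for n and a b d M eps :: real using conjunct2[OF spec[OF A], rule_format, OF that] .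
 define C where "C = (\<Sum>e\<in>(Basis::'a set). \<Sum>bt\<in>(gauge_idx k :: 'b list set). A (gauge_exp k bt))"
 have C0: "C >= 0" unfolding C_def by (intro sum_nonneg A0)
 have "gauge_pm k i eps xi x <= 2*(1 + C*eps^2)*gauge_at k xi x"
  if i: "i:I" and xi: "smooth xi" and eps: "0 <= eps" "eps <= 1" for i eps x and xi :: "'b => 'a"
 proof -
  define N where "N = gauge_root k xi x"
  have N0: "N >= 0" by (simp add: N_def gauge_root_nonneg)
  have NP: "N^(2*fact k) = gauge_at k xi x" by (simp add: N_def gauge_root_power)
  define a where "a e bt = fds bt (%y. xi y \<bullet> e) x" for e bt
  define b where "b e bt = fds bt (%y. s i (xi y) \<bullet> e) x" for e bt
  define d where "d e bt = fds bt (%y. c i (xi y) \<bullet> e) x" for e bt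
  have expand: "fds bt (%y. T i dl (xi y) \<bullet> e) x = a e bt + dl*b e bt + dl^2*d e bt" for dl e bt
  proof -
   have 1: "smooth (%y. s i (xi y) \<bullet> e)" "smooth (%y. c i (xi y) \<bullet> e)" "smooth (%y. xi y \<bullet> e)"
    by (intro smooth_component smooth_comp[OF smooth_s[OF i] xi] smooth_comp[OF smooth_c[OF i] xi] xi)+
   have "(%y. T i dl (xi y) \<bullet> e) = (%y. (xi y \<bullet> e + dl*(s i (xi y) \<bullet> e)) + dl^2*(c i (xi y) \<bullet> e))"
    by (simp add: T_def inner_add_left)
   thus ?thesis using 1 by (simp add: fds_add fds_cmult smooth_add smooth_cmult a_def b_def d_def)
  qed
  have bd: "|a e bt| <= N^length bt" "|b e bt| <= K*N^length bt" "|d e bt| <= K*N^length bt" if e: "e:Basis" and bt: "bt:gauge_idx k" for e bt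
  proof -
   show "|a e bt| <= N^length bt" unfolding a_def N_def by (rule fds_le_gauge_root[OF bt e])
   have bt': "set bt <= Basis" "length bt <= k" using bt by (auto simp: gauge_idx_def)
   have "wb k 0 1 (%y. s i y \<bullet> e) y (max 0 (max K1 K2))" for y by (rule wb_mono[OF K1[OF i e]]) auto
   from fds_compose_gauge[OF smooth_component[OF smooth_s[OF i]] xi this bt']
   show "|b e bt| <= K*N^length bt" by (simp add: b_def K_def N_def)
   have "wb k 0 1 (%y. c i y \<bullet> e) y (max 0 (max K1 K2))" for y by (rule wb_mono[OF K2[OF i e]]) auto
   from fds_compose_gauge[OF smooth_component[OF smooth_c[OF i]] xi this bt']
   show "|d e bt| <= K*N^length bt" by (simp add: d_def K_def N_def)
  qed
  have "(a e bt + eps*b e bt + eps^2*d e bt)^gauge_exp k bt + (a e bt + (- eps)*b e bt + (- eps)^2*d e bt)^gauge_exp k bt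
    <= 2*a e bt^gauge_exp k bt + 2*(A (gauge_exp k bt)*eps^2*gauge_at k xi x)" if e: "e:Basis" and bt: "bt:gauge_idx k" for e bt
  proof -
   have "(N^length bt)^gauge_exp k bt = gauge_at k xi x" using gauge_exp(1)[OF bt] NP by (simp flip: power_mult)
   with A2[OF bd[OF e bt] eps, of "gauge_exp k bt"] show ?thesis by simp
  qed
  hence "gauge_pm k i eps xi x <=
   (\<Sum>e\<in>Basis. \<Sum>bt\<in>gauge_idx k. 2*a e bt^gauge_exp k bt + 2*(A (gauge_exp k bt)*eps^2*gauge_at k xi x))"
   unfolding gauge_at_def[of k "%y. T i _ (xi y)"] expand sum.distrib[symmetric] by (intro sum_mono)
  also have "... = 2*gauge_at k xi x + 2*(C*eps^2*gauge_at k xi x)" unfolding sum.distrib C_def a_def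
   by (simp add: gauge_at_def[of k xi] sum_distrib_left[symmetric] sum_distrib_right[symmetric])
  finally show ?thesis by (simp add: algebra_simps)
 qed
 thus ?thesis using C0 by blast
qed

end

lemma bfam_smooth: "bfam A u ==> j:A ==> smooth (u j)" by (simp add: bfam_def)

lemma bfam_wb:
 assumes "bfam A u"
 obtains K where "0 <= K" "!!j x. j:A ==> wb k 0 1 (u j) x K"
proof -
 obtain K where "!!j x. j:A ==> wb k 0 1 (u j) x K" using assms unfolding bfam_def by meson
 thus ?thesis using that[of "max 0 K"] wb_mono[of k 0 1 _ _ K "max 0 K"] by fastforce
qed

lemma bfam_bounded:
 assumes "bfam A u"
 obtains K where "0 <= K" "!!j x. j:A ==> |u j x| <= K" using bfam_wb[OF assms, of 0] by (metis wb_abs_le mult.right_neutral power_0)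

lemma bfam_cong:
 assumes "bfam A u" "!!j. j:A ==> v j = u j" shows "bfam A v" using assms unfolding bfam_def by (simp cong: ball_cong)

lemma bfam_const: "bfam A (%j x. c)" unfolding bfam_def by (auto intro!: smooth_on_const wb_const exI[of _ "|c|"])

lemma bfam_add:
 assumes "bfam A u" "bfam A v" shows "bfam A (%j x. u j x + v j x)" unfolding bfam_def
proof (intro conjI ballI allI)
 show "smooth (%x. u j x + v j x)" if "j:A" for j using assms that by (intro smooth_add bfam_smooth)
 fix k
 obtain K where K: "!!j x. j:A ==> wb k 0 1 (u j) x K" using bfam_wb[OF assms(1)] by metis
 obtain K' where K': "!!j x. j:A ==> wb k 0 1 (v j) x K'" using bfam_wb[OF assms(2)] by metis
 show "EX K. ALL j:A. ALL x. wb k 0 1 (%x. u j x + v j x) x K" using wb_add[OF bfam_smooth[OF assms(1)] bfam_smooth[OF assms(2)] K K'] by blast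
qed

lemma bfam_mult:
 assumes "bfam A u" "bfam A v" shows "bfam A (%j x. u j x * v j x)" unfolding bfam_def
proof (intro conjI ballI allI)
 show "smooth (%x. u j x * v j x)" if "j:A" for j using assms that by (intro smooth_on_mult bfam_smooth open_UNIV)
 fix k
 obtain K where K: "!!j x. j:A ==> wb k 0 1 (u j) x K" using bfam_wb[OF assms(1)] by metis
 obtain K' where K': "!!j x. j:A ==> wb k 0 1 (v j) x K'" using bfam_wb[OF assms(2)] by metis
 have "wb k 0 1 (%x. u j x * v j x) x (2^k*K*K')" if "j:A" for j x
  using wb_mult[OF bfam_smooth[OF assms(1) that] bfam_smooth[OF assms(2) that] K[OF that] K'[OF that], of x] by simp
 thus "EX K. ALL j:A. ALL x. wb k 0 1 (%x. u j x * v j x) x K" by blast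
qed

lemma bfam_cmult: "bfam A u ==> bfam A (%j x. c*u j x)" by (intro bfam_mult bfam_const)

lemma bfam_sum:
 assumes "finite I" "!!i. i:I ==> bfam A (u i)"
 shows "bfam A (%j x. \<Sum>i\<in>I. u i j x)" using assms by (induction I rule: finite_induct) (simp_all add: bfam_const bfam_add)

lemma bfam_fd_const:
 assumes "bfam A u" "e:Basis" shows "bfam A (%j x. fd (u j) x e)" unfolding bfam_def
proof (intro conjI ballI allI)
 show "smooth (%x. fd (u j) x e)" if "j:A" for j using assms that by (intro smooth_on_fd bfam_smooth)
 fix k
 obtain K where K: "!!j x. j:A ==> wb (Suc k) 0 1 (u j) x K" using bfam_wb[OF assms(1)] by metis
 have "wb k 0 1 (%x. fd (u j) x e) x K" if "j:A" for j x by (rule wb_one[THEN iffD1, of _ "Suc 0"]) (use K[OF that, of x] assms(2) in simp)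
 thus "EX K. ALL j:A. ALL x. wb k 0 1 (%x. fd (u j) x e) x K" by blast
qed

definition bfield :: "('a::euclidean_space => 'a) => bool" where
 "bfield V <-> bvec UNIV (%_::unit. V)"

lemma bfield_smooth: "bfield V ==> smooth V" by (simp add: bfield_def bvec_def)

lemma bfield_bfam: "bfield V ==> e:Basis ==> bfam A (%j x. V x \<bullet> e)"
 unfolding bfield_def bvec_def bfam_def by (fastforce intro: smooth_component)

lemma bfieldI:
 assumes "smooth V" "!!e. e:Basis ==> bfam (UNIV :: unit set) (%j x. V x \<bullet> e)"
 shows "bfield V" unfolding bfield_def bvec_def
proof (intro conjI ballI allI)
 fix k
 have "ALL e:Basis. EX K>=0. ALL x. wb k 0 1 (%y. V y \<bullet> e) x K" using bfam_wb[OF assms(2), of _ k] by (metis UNIV_I)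
 then obtain K where K: "!!e. e:Basis ==> K e >= 0 & (ALL x. wb k 0 1 (%y. V y \<bullet> e) x (K e))" by metis
 have "wb k 0 1 (%y. V y \<bullet> e) x (\<Sum>e\<in>Basis. K e)" if "e:Basis" for e x
 proof (rule wb_mono)
  show "wb k 0 1 (%y. V y \<bullet> e) x (K e)" using K that by blast
  show "K e <= (\<Sum>e\<in>Basis. K e)" by (rule member_le_sum[OF that]) (use K in auto)
 qed simp
 thus "EX K. ALL j:UNIV. ALL e:Basis. ALL x. wb k 0 1 (%y. V y \<bullet> e) x K" by blast
qed (rule assms(1))

lemma bvec_of_bfields:
 assumes "finite A" "!!j. j:A ==> bfield (V j)" shows "bvec A V" unfolding bvec_def
proof (intro conjI ballI allI)
 show "smooth (V j)" if "j:A" for j using assms that bfield_smooth by blast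
 fix k
 have "ALL j:A. EX K. ALL e:Basis. ALL x. wb k 0 1 (%y. V j y \<bullet> e) x K" using assms(2) unfolding bfield_def bvec_def by blast
 then obtain K where K: "!!j e x. j:A ==> e:Basis ==> wb k 0 1 (%y. V j y \<bullet> e) x (K j)" by metis
 have "wb k 0 1 (%y. V j y \<bullet> e) x (\<Sum>j\<in>A. |K j| )" if "j:A" "e:Basis" for j e x
 proof (rule wb_mono[OF K[OF that]])
  have "K j <= |K j|" by simp
  also have "... <= (\<Sum>j\<in>A. |K j| )" by (rule member_le_sum[OF that(1)]) (use assms in auto)
  finally show "K j <= (\<Sum>j\<in>A. |K j| )" .
 qed simp
 thus "EX K. ALL j:A. ALL e:Basis. ALL x. wb k 0 1 (%y. V j y \<bullet> e) x K" by blast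
qed

lemma fd_expand_real:
 fixes u :: "'a::euclidean_space => real"
 assumes "smooth u" shows "fd u x v = (\<Sum>e\<in>Basis. (v \<bullet> e)*fd u x e)" using fd_linear_expand[OF smooth_diff[OF assms], of x v] by simp

lemma bfam_fd:
 assumes "bfam A u" "bfield V" shows "bfam A (%j x. fd (u j) x (V x))"
proof -
 have b: "bfam A (%j x. \<Sum>e\<in>Basis. (V x \<bullet> e)*fd (u j) x e)" by (intro bfam_sum bfam_mult bfield_bfam bfam_fd_const assms) auto
 show ?thesis by (rule bfam_cong[OF b]) (rule ext, rule fd_expand_real[OF bfam_smooth[OF assms(1)]])
qed

lemma wb_compact_support:
 fixes f :: "'a::euclidean_space => real"
 assumes "smooth f" "!!x. norm x > R ==> f x = 0"
 shows "EX K>=0. ALL x. wb k d 1 f x K" using assms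
proof (induction k arbitrary: f d)
 case 0
 have "continuous_on (cball 0 R) f" using smooth_on_imp_continuous[OF 0(1)] continuous_on_subset by blast
 hence "bounded (f ` cball 0 R)" by (intro compact_imp_bounded compact_continuous_image) auto
 then obtain B where "ALL y:f ` cball 0 R. norm y <= B" unfolding bounded_iff by blast
 hence B: "|f x| <= B" if "norm x <= R" for x using that by auto
 have "|f x| <= max 0 B" for x using B[of x] 0(2)[of x] by (cases "norm x <= R") auto
 thus ?case by (intro exI[of _ "max 0 B"]) auto
next
 case (Suc k)
 have zero: "fd f x e = 0" if "norm x > R" for x e
 proof -
  have "fd f x e = fd (%_. 0) x e" by (rule fd_cong_open[of "- cball 0 R"]) (use that Suc.prems(2) in "auto simp: open_Compl")
  thus ?thesis by (simp add: fd_const)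
 qed
 have "ALL e. EX K>=0. ALL x. wb k (Suc d) 1 (%y. fd f y e) x K" using Suc.IH[OF smooth_on_fd[OF Suc.prems(1)] zero] by blast
 then obtain K where K: "!!e. K e >= 0" "!!e x. wb k (Suc d) 1 (%y. fd f y e) x (K e)" by metis
 obtain K0 where K0: "K0 >= 0" "!!x. wb k d 1 f x K0" using Suc.IH[OF Suc.prems] by blast
 define KK where "KK = K0 + (\<Sum>e\<in>(Basis::'a set). K e)"
 have s0: "(\<Sum>e\<in>(Basis::'a set). K e) >= 0" by (intro sum_nonneg K)
 have "wb k (Suc d) 1 (%y. fd f y e) x KK" if "e:Basis" for x e
 proof (rule wb_mono[OF K(2)])
  have "K e <= (\<Sum>e\<in>(Basis::'a set). K e)" by (rule member_le_sum[OF that]) (use K in auto)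
  thus "K e <= KK" using K0 by (simp add: KK_def)
 qed simp
 moreover have "|f x| <= KK" for x using wb_abs_le[OF K0(2)[of x]] s0 by (simp add: KK_def)
 moreover have "KK >= 0" using K0 s0 by (simp add: KK_def)
 ultimately show ?case by (intro exI[of _ KK]) simp
qed

lemma bfam_compact_support:
 fixes f :: "'a::euclidean_space => real"
 assumes "smooth f" "!!x. norm x > R ==> f x = 0"
 shows "bfam A (%j. f)" unfolding bfam_def using wb_compact_support[OF assms] assms(1) by blast

lemma bfield_compact_support:
 fixes V :: "'a::euclidean_space => 'a"
 assumes "smooth V" "!!x. norm x > R ==> V x = 0"
 shows "bfield V" by (intro bfieldI bfam_compact_support[where R=R] smooth_component) (use assms in auto)

context scheme
begin

text \<open>The test maps \<open>xi\<close> make the estimate stable under the walk: one step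
  replaces \<open>xi\<close> by a step after \<open>xi\<close>, whose gauge is compared with that of
  \<open>xi\<close> by \<open>gauge_step\<close>. So a single constant \<open>K\<close> is
  multiplied by \<open>1 + C eps^2\<close> per step.\<close>

definition ctrl :: "nat => ('a => real) => real => bool" where
 "ctrl k u K <-> (ALL xi :: 'a => 'a. smooth xi --> (ALL x bt. set bt <= Basis --> length bt <= k -->
  |fds bt (%y. u (xi y)) x| <= K*(1 + gauge_at k xi x)))"

lemma ctrl_init:
 assumes "smooth u" "!!y. wb k 0 1 u y K" "0 <= K"
 shows "ctrl k u (comp_const DIM('a) k*K)" unfolding ctrl_def
proof (intro allI impI)
 fix xi :: "'a => 'a" and x :: 'a and bt :: "'a list"
 assume h: "smooth xi" "set bt <= Basis" "length bt <= k"
 let ?N = "gauge_root k xi x"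
 have "?N^length bt <= 1 + gauge_at k xi x"
 proof (cases "?N <= 1")
  case True
  hence "?N^length bt <= 1" by (intro power_le_one gauge_root_nonneg)
  thus ?thesis using gauge_at_nonneg[of k xi x] by linarith
 next
  case False
  have "length bt <= 2*fact k" using h(3) fact_ge_self[of k] by linarith
  hence "?N^length bt <= ?N^(2*fact k)" using False by (intro power_increasing) auto
  thus ?thesis by (simp add: gauge_root_power)
 qed
 moreover have "comp_const DIM('a) k*K >= 0" using comp_const_ge1[of "DIM('a)" k] assms(3) by simp
 ultimately have "comp_const DIM('a) k*K*?N^length bt <= comp_const DIM('a) k*K*(1 + gauge_at k xi x)" by (rule mult_left_mono)
 with fds_compose_gauge[OF assms(1) h(1) assms(2) h(2,3), of x]
 show "|fds bt (%y. u (xi y)) x| <= comp_const DIM('a) k*K*(1 + gauge_at k xi x)" by linarith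
qed

lemma fds_Q:
 assumes "smooth u" "smooth xi"
 shows "fds bt (%y. Q eps u (xi y)) x = (1/(2*card I))*(\<Sum>i\<in>I. fds bt (%y. u (T i eps (xi y))) x + fds bt (%y. u (T i (- eps) (xi y))) x)"
proof -
 have "smooth (%y. u (T i dl (xi y)))" if "i:I" for i dl using smooth_comp[OF assms(1) smooth_comp[OF smooth_T[OF that] assms(2)]] .
 thus ?thesis unfolding Q_def using I by (subst fds_cmult) (auto intro!: smooth_sum smooth_add simp: fds_sum fds_add smooth_add)
qed

lemma ctrl_step:
 assumes C: "C >= 0" "!!i eps x xi. i:I ==> smooth xi ==> 0 <= eps ==> eps <= 1 ==>
  gauge_pm k i eps xi x <= 2*(1 + C*eps^2)*gauge_at k (xi :: 'a => 'a) x"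
  and u: "ctrl k u K" "smooth u" "0 <= K" and eps: "0 <= eps" "eps <= 1"
 shows "ctrl k (Q eps u) (K*(1 + C*eps^2))" unfolding ctrl_def
proof (intro allI impI)
 fix xi :: "'a => 'a" and x :: 'a and bt :: "'a list"
 assume h: "smooth xi" "set bt <= Basis" "length bt <= k"
 let ?R = "(1 + C*eps^2)*(1 + gauge_at k xi x)"
 have "|fds bt (%y. u (T i eps (xi y))) x + fds bt (%y. u (T i (- eps) (xi y))) x| <= 2*(K*?R)" if i: "i:I" for i
 proof -
  have b: "|fds bt (%y. u (T i dl (xi y))) x| <= K*(1 + gauge_at k (%y. T i dl (xi y)) x)" for dl
   using u(1) smooth_comp[OF smooth_T[OF i] h(1)] h(2,3) unfolding ctrl_def by blast
  have "0 <= C*eps^2" using C(1) by simp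
  hence "(1 + gauge_at k (%y. T i eps (xi y)) x) + (1 + gauge_at k (%y. T i (- eps) (xi y)) x) <= 2*?R"
   using C(2)[OF i h(1) eps, of x] by (simp add: algebra_simps)
  hence "K*((1 + gauge_at k (%y. T i eps (xi y)) x) + (1 + gauge_at k (%y. T i (- eps) (xi y)) x)) <= K*(2*?R)" using u(3) by (rule mult_left_mono)
  thus ?thesis using b[of eps] b[of "- eps"] by (simp add: distrib_left)
 qed
 hence "|\<Sum>i\<in>I. fds bt (%y. u (T i eps (xi y))) x + fds bt (%y. u (T i (- eps) (xi y))) x| <= (\<Sum>i\<in>I. 2*(K*?R))"
  by (intro order_trans[OF sum_abs] sum_mono) auto
 thus "|fds bt (%y. Q eps u (xi y)) x| <= K*(1 + C*eps^2)*(1 + gauge_at k xi x)"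
  unfolding fds_Q[OF u(2) h(1)] using card_I by (simp add: abs_mult field_simps)
qed

lemma fds_ident:
 fixes bt :: "'a list"
 assumes "bt ~= []" shows "fds bt (%y. y \<bullet> e) x = fds bt (%y. y \<bullet> e) 0"
proof -
 obtain v vs where bt: "bt = v # vs" using assms by (cases bt) auto
 have "(%x. fd (%y. y \<bullet> e) x v) = (%x. v \<bullet> e)" by (simp add: fd_bounded_linear bounded_linear_inner_left)
 thus ?thesis unfolding bt by (cases "vs = []") (auto simp: fds_const)
qed

lemma gauge_ident: "gauge_at k (%y. y :: 'a) x = gauge_at k (%y. y :: 'a) 0"
proof -
 have "fds bt (%y. y \<bullet> e) x = fds bt (%y. y \<bullet> e) 0" if "bt:gauge_idx k" for bt :: "'a list" and e
  by (rule fds_ident) (use that in "auto simp: gauge_idx_def")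
 thus ?thesis unfolding gauge_at_def by (simp cong: sum.cong)
qed

text \<open>After \<open>n\<close> steps the constant has grown by \<open>(1 + C eps^2)^n\<close>,
  which is at most \<open>exp (C S)\<close> as long as the elapsed time \<open>n eps^2\<close> is at
  most \<open>S\<close>.\<close>

lemma bfam_Q_pow:
 assumes "bfam A u"
 shows "bfam {(j, eps, n). j:A & 0 <= eps & eps <= 1 & real n*eps^2 <= S} (%(j, eps, n). (Q eps ^^ n) (u j))" unfolding bfam_def
proof (intro conjI ballI allI)
 fix p :: "'b \<times> real \<times> nat" assume p: "p:{(j, eps, n). j:A & 0 <= eps & eps <= 1 & real n*eps^2 <= S}"
 thus "smooth (case p of (j, eps, n) => (Q eps ^^ n) (u j))" using bfam_smooth[OF assms] by (auto intro: smooth_Q_pow)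
next
 fix k
 obtain K where K: "0 <= K" "!!j x. j:A ==> wb k 0 1 (u j) x K" using bfam_wb[OF assms, of k] by metis
 obtain C where C: "C >= 0" "!!i eps x xi. i:I ==> smooth xi ==> 0 <= eps ==> eps <= 1 ==>
  gauge_pm k i eps xi x <= 2*(1 + C*eps^2)*gauge_at k (xi :: 'a => 'a) x"
  using gauge_step[of k, where 'b='a] by blast
 define K1 where "K1 = comp_const DIM('a) k*K"
 have K1: "K1 >= 0" using comp_const_ge1[of "DIM('a)" k] K by (simp add: K1_def)
 have iter: "ctrl k ((Q eps ^^ n) (u j)) (K1*(1 + C*eps^2)^n)" if "j:A" "0 <= eps" "eps <= 1" for j eps n
 proof (induction n)
  case 0
  show ?case using ctrl_init[OF bfam_smooth[OF assms that(1)] K(2)[OF that(1)] K(1)] by (simp add: K1_def)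
 next
  case (Suc n)
  have "K1*(1 + C*eps^2)^n >= 0" using K1 C by (intro mult_nonneg_nonneg zero_le_power) auto
  from ctrl_step[OF C Suc.IH smooth_Q_pow[OF bfam_smooth[OF assms that(1)]] this that(2,3)]
  show ?case by (simp add: mult_ac)
 qed
 define KK where "KK = K1*exp (C*S)*(1 + gauge_at k (%y. y :: 'a) 0)"
 have "wb k 0 1 ((Q eps ^^ n) (u j)) x KK" if h: "j:A" "0 <= eps" "eps <= 1" "real n*eps^2 <= S" for j eps n x unfolding wb_iff_fds
 proof (intro allI impI)
  fix bt :: "'a list" assume bt: "set bt <= Basis & length bt <= k"
  have "(1 + C*eps^2)^n <= exp (C*eps^2)^n" using C by (intro power_mono) (auto simp: exp_ge_add_one_self)
  also have "... = exp (C*(real n*eps^2))" by (simp add: exp_of_nat_mult[symmetric] mult_ac)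
  also have "... <= exp (C*S)" using C h by (simp add: mult_left_mono)
  finally have e: "(1 + C*eps^2)^n <= exp (C*S)" .
  \<comment> \<open>Plain derivatives are recovered with the identity as \<open>xi\<close>, whose
    gauge is the same at every point.\<close>
  have "|fds bt ((Q eps ^^ n) (u j)) x| <= K1*(1 + C*eps^2)^n*(1 + gauge_at k (%y. y) x)"
   using iter[OF h(1-3), of n] bt smooth_on_ident[OF open_UNIV] unfolding ctrl_def by auto
  also have "... <= KK" unfolding KK_def gauge_ident[of k x]
   using e K1 gauge_at_nonneg[of k "%y. y :: 'a" 0] by (intro mult_right_mono mult_left_mono) auto
  finally show "|fds bt ((Q eps ^^ n) (u j)) x| <= KK*1^(0 + length bt)" by simp
 qed
 thus "EX K. ALL p:{(j, eps, n). j:A & 0 <= eps & eps <= 1 & real n*eps^2 <= S}. ALL x.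
   wb k 0 1 (case p of (j, eps, n) => (Q eps ^^ n) (u j)) x K" by (intro exI[of _ KK]) auto
qed

end

section \<open>Taylor expansion of the walk in its step size\<close>

lemma smooth_fst: "smooth (fst :: real \<times> 'a::euclidean_space => real)"
 and smooth_snd: "smooth (snd :: real \<times> 'a::euclidean_space => 'a)"
 by (intro smooth_on_bounded_linear open_UNIV bounded_linear_fst bounded_linear_snd)+

lemma fds_Suc_replicate: "fd (fds (replicate m t) F) p t = fds (replicate (Suc m) t) F p" by (induction m arbitrary: F) simp_all

abbreviation tdir :: "real \<times> 'a::euclidean_space" where "tdir \<equiv> (1, 0)"

lemma fst_line_derivative:
 fixes F :: "real \<times> 'a::euclidean_space => real"
 assumes "smooth F"
 shows "((%tau. F (tau, x)) has_real_derivative fd F (tau, x) tdir) (at tau)"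
proof -
 have "((%tau. (tau, x)) has_derivative (%h. (h, 0))) (at tau)" by (auto intro!: derivative_eq_intros)
 from has_derivative_compose[OF this has_derivative_fd[OF smooth_diff[OF assms]]]
 have "((%tau. F (tau, x)) has_derivative (%h. fd F (tau, x) (h, 0))) (at tau)" .
 moreover have "(%h. fd F (tau, x) (h, 0)) = (*) (fd F (tau, x) tdir)"
 proof
  show "fd F (tau, x) (h, 0) = fd F (tau, x) tdir*h" for h using linear_scale[OF fd_linear[OF smooth_diff[OF assms]], of "(tau, x)" h tdir]
   by (simp add: mult.commute)
 qed
 ultimately show ?thesis unfolding has_field_derivative_def by metis
qed

text \<open>The odd orders cancel between \<open>eps\<close> and \<open>- eps\<close>, and the two
  Lagrange remainders are at most \<open>K/24 * eps^4\<close> each.\<close>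

lemma symmetric_taylor:
 fixes F :: "real \<times> 'a::euclidean_space => real"
 assumes F: "smooth F" and K: "!!tau. |tau| <= 1 ==> |fds (replicate 4 tdir) F (tau, x)| <= K"
  and eps: "|eps| <= 1"
 shows "|F (eps, x) + F (- eps, x) - 2*F (0, x) - eps^2*fds [tdir, tdir] F (0, x)| <= K*eps^4"
proof -
 define diff where "diff m tau = fds (replicate m tdir) F (tau, x)" for m tau
 have d: "ALL m tau. (diff m has_real_derivative diff (Suc m) tau) (at tau)"
 proof (intro allI)
  fix m tau
  show "(diff m has_real_derivative diff (Suc m) tau) (at tau)" using fst_line_derivative[OF smooth_fds[OF F], of "replicate m tdir" x tau]
   unfolding diff_def[abs_def] fds_Suc_replicate .
 qed
 have exp: "EX R. |R| <= K/24 & F (dl, x) = diff 0 0 + diff 1 0*dl + diff 2 0/2*dl^2 + diff 3 0/6*dl^3 + R*dl^4" if "|dl| <= 1" for dl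
 proof -
  have "diff 0 = (%tau. F (tau, x))" by (simp add: diff_def[abs_def])
  from Maclaurin_all_le[OF this d, of dl 4]
  obtain t where t: "|t| <= |dl|"
   "F (dl, x) = (\<Sum>m<4. diff m 0/fact m*dl^m) + diff 4 t/fact 4*dl^4" by blast
  have "|diff 4 t| <= K" unfolding diff_def using t(1) that by (intro K) linarith
  moreover have "(\<Sum>m<4. diff m 0/fact m*dl^m) = diff 0 0 + diff 1 0*dl + diff 2 0/2*dl^2 + diff 3 0/6*dl^3" by (simp add: eval_nat_numeral)
  ultimately show ?thesis using t(2) by (intro exI[of _ "diff 4 t/24"]) (auto simp: fact_numeral)
 qed
 obtain R where R: "|R| <= K/24"
  "F (eps, x) = diff 0 0 + diff 1 0*eps + diff 2 0/2*eps^2 + diff 3 0/6*eps^3 + R*eps^4" using exp[OF eps] by blast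
 obtain R' where R': "|R'| <= K/24"
  "F (- eps, x) = diff 0 0 + diff 1 0*(- eps) + diff 2 0/2*(- eps)^2 + diff 3 0/6*(- eps)^3 + R'*(- eps)^4" using exp[of "- eps"] eps by auto
 have "F (eps, x) + F (- eps, x) - 2*F (0, x) - eps^2*fds [tdir, tdir] F (0, x) = (R + R')*eps^4"
  unfolding R(2) R'(2) by (simp add: diff_def power3_eq_cube eval_nat_numeral algebra_simps)
 moreover have "|(R + R')*eps^4| <= K*eps^4"
 proof -
  have "|R + R'| <= K" using R(1) R'(1) by linarith
  hence "|R + R'|*eps^4 <= K*eps^4" by (intro mult_right_mono) auto
  thus ?thesis by (simp add: abs_mult)
 qed
 ultimately show ?thesis by simp
qed

context scheme
begin

text \<open>With the step size as a further coordinate, differentiation in the step size and in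
  space are directional derivatives of one smooth function and hence commute.\<close>

definition W :: "('a => real) => 'i => real \<times> 'a => real" where
 "W u i p = u (T i (fst p) (snd p))"

lemma smooth_Tp: "i:I ==> smooth (%p. T i (fst p) (snd p))" unfolding T_def
 by (intro smooth_add smooth_on_scaleR smooth_on_power smooth_fst smooth_snd smooth_comp[OF smooth_s smooth_snd]
   smooth_comp[OF smooth_c smooth_snd] open_UNIV)

lemma smooth_W: "smooth u ==> i:I ==> smooth (W u i)" unfolding W_def[abs_def] using smooth_comp[OF _ smooth_Tp] .

lemma W_bounded:
 assumes "bfam A u"
 obtains K where "0 <= K" "!!j i tau x bt. j:A ==> i:I ==> |tau| <= 1 ==> set bt <= Basis ==> length bt <= k ==> |fds bt (W (u j) i) (tau, x)| <= K"
proof -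
 have wb_fst: "wb l 0 1 fst p 1" if "|fst p| <= 1" for l and p :: "real \<times> 'a"
 proof (cases l)
  case (Suc l')
  have "|fst e| <= 1" if "e:Basis" for e :: "real \<times> 'a" using that by (auto simp: Basis_prod_def)
  thus ?thesis using Suc that by (simp add: fd_bounded_linear[OF bounded_linear_fst] wb_const)
 qed (use that in simp)
 have wb_snd: "wb l 1 1 (%y. fd snd y e' \<bullet> e) p 1" if "e:Basis" "e':Basis" for l and e :: 'a and p e' :: "real \<times> 'a"
 proof -
  have "|snd e' \<bullet> e| <= 1" using that by (auto simp: Basis_prod_def inner_Basis)
  thus ?thesis by (simp add: fd_bounded_linear[OF bounded_linear_snd] wb_const)
 qed
 obtain K1 where K1: "!!i e x. i:I ==> e:Basis ==> wb (Suc k) 0 1 (%y. s i y \<bullet> e) x K1" using s unfolding bvec_def by meson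
 obtain K2 where K2: "!!i e x. i:I ==> e:Basis ==> wb (Suc k) 0 1 (%y. c i y \<bullet> e) x K2" using c unfolding bvec_def by meson
 obtain K0 where K0: "0 <= K0" "!!j x. j:A ==> wb k 0 1 (u j) x K0" using bfam_wb[OF assms, of k] by metis
 \<comment> \<open>The displacement of the step, without its identity part. It is estimated for step
   sizes of absolute value at most 1 only, since \<open>fst\<close> is unbounded.\<close>
 define G where "G i e p = fst p*(s i (snd p) \<bullet> e) + (fst p*fst p)*(c i (snd p) \<bullet> e)" for i e and p :: "real \<times> 'a"
 obtain KG where KG: "!!i e p. i:I ==> e:Basis ==> |fst p| <= 1 ==> wb (Suc k) 0 1 (G i e) p KG"
 proof -
  let ?c = "comp_const DIM('a) (Suc k)"
  have "wb (Suc k) 0 1 (G i e) p (2^Suc k*1*(?c*K1) + 2^Suc k*(2^Suc k*1*1)*(?c*K2))" if h: "i:I" "e:Basis" "|fst p| <= 1" for i e p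
  proof -
   have sm: "smooth (%p :: real \<times> 'a. s i (snd p) \<bullet> e)" "smooth (%p :: real \<times> 'a. c i (snd p) \<bullet> e)"
    by (intro smooth_component smooth_comp[OF smooth_s[OF h(1)] smooth_snd] smooth_comp[OF smooth_c[OF h(1)] smooth_snd])+
   have w1: "wb (Suc k) 0 1 (%p. s i (snd p) \<bullet> e) p (?c*K1)"
    by (rule wb_compose[OF smooth_component[OF smooth_s[OF h(1)]] smooth_snd K1[OF h(1,2)]]) (simp_all add: wb_snd[simplified])
   have w2: "wb (Suc k) 0 1 (%p. c i (snd p) \<bullet> e) p (?c*K2)"
    by (rule wb_compose[OF smooth_component[OF smooth_c[OF h(1)]] smooth_snd K2[OF h(1,2)]]) (simp_all add: wb_snd[simplified])
   have f2: "smooth (%p :: real \<times> 'a. fst p*fst p)" by (intro smooth_on_mult smooth_fst open_UNIV)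
   have w3: "wb (Suc k) 0 1 (%p. fst p*fst p) p (2^Suc k*1*1)"
    using wb_mult[OF smooth_fst smooth_fst wb_fst[OF h(3), of "Suc k"] wb_fst[OF h(3)]] by (simp only: add_0)
   have w4: "wb (Suc k) 0 1 (%p. fst p*(s i (snd p) \<bullet> e)) p (2^Suc k*1*(?c*K1))"
    using wb_mult[OF smooth_fst sm(1) wb_fst[OF h(3)] w1] by (simp only: add_0)
   have w5: "wb (Suc k) 0 1 (%p. fst p*fst p*(c i (snd p) \<bullet> e)) p (2^Suc k*(2^Suc k*1*1)*(?c*K2))"
    using wb_mult[OF f2 sm(2) w3 w2] by (simp only: add_0)
   show ?thesis unfolding G_def by (rule wb_add[OF smooth_on_mult[OF open_UNIV smooth_fst sm(1)] smooth_on_mult[OF open_UNIV f2 sm(2)] w4 w5])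
  qed
  thus ?thesis using that by blast
 qed
 \<comment> \<open>At least 1, so that a plain bound implies the weighted bound that
   \<open>wb_compose\<close> asks for.\<close>
 define N where "N = 1 + |KG|"
 have comp: "wb l 1 N (%p. fd (%p. T i (fst p) (snd p)) p e' \<bullet> e) p 1" if h: "l < k" "i:I" "e:Basis" "e':Basis" "|fst p| <= 1" for l i e e' p
 proof -
  have sG: "smooth (G i e)" unfolding G_def[abs_def]
   by (intro smooth_add smooth_on_mult smooth_fst smooth_component smooth_comp[OF smooth_s[OF h(2)] smooth_snd]
     smooth_comp[OF smooth_c[OF h(2)] smooth_snd] open_UNIV)
  have Teq: "(%p. T i (fst p) (snd p) \<bullet> e) = (%p. snd p \<bullet> e + G i e p)"
   by (simp add: T_def G_def inner_add_left power2_eq_square add.assoc)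
  have "fd (%p. T i (fst p) (snd p)) p e' \<bullet> e = fd snd p e' \<bullet> e + fd (G i e) p e'" for p
   unfolding fd_component[OF smooth_Tp[OF h(2)], symmetric] fd_component[OF smooth_snd, symmetric] Teq
   by (intro fd_add smooth_diff sG smooth_component smooth_snd)
  moreover have "wb l 1 1 (%p. fd snd p e' \<bullet> e + fd (G i e) p e') p (1 + KG)"
  proof (rule wb_add)
   show "smooth (%p :: real \<times> 'a. fd snd p e' \<bullet> e)" by (intro smooth_component smooth_on_fd smooth_snd)
   show "smooth (%p. fd (G i e) p e')" by (intro smooth_on_fd sG)
   show "wb l 1 1 (%p. fd snd p e' \<bullet> e) p 1" by (rule wb_snd[OF h(3,4)])
   have "wb k 1 1 (%p. fd (G i e) p e') p KG" using KG[OF h(2,3,5)] h(4) by simp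
   thus "wb l 1 1 (%p. fd (G i e) p e') p KG" using wb_le h(1) less_imp_le by blast
  qed
  ultimately have w: "wb l 1 1 (%p. fd (%p. T i (fst p) (snd p)) p e' \<bullet> e) p (1 + KG)" by simp
  show ?thesis unfolding wb_iff_fds
  proof (intro allI impI)
   fix bt :: "(real \<times> 'a) list" assume bt: "set bt <= Basis & length bt <= l"
   have "|fds bt (%p. fd (%p. T i (fst p) (snd p)) p e' \<bullet> e) p| <= 1 + KG" using w bt unfolding wb_iff_fds by simp
   also have "... <= N^1" by (simp add: N_def)
   also have "... <= N^(1 + length bt)" by (intro power_increasing) (auto simp: N_def)
   finally show "|fds bt (%p. fd (%p. T i (fst p) (snd p)) p e' \<bullet> e) p| <= 1*N^(1 + length bt)" by simp
  qed
 qed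
 define K where "K = comp_const DIM('a) k*K0*N^k"
 have cK: "0 <= comp_const DIM('a) k*K0" using comp_const_ge1[of "DIM('a)" k] K0 by simp
 have N1: "N >= 1" by (simp add: N_def)
 show ?thesis
 proof (rule that[of K])
  show "0 <= K" using cK N1 by (simp add: K_def)
  fix j i and tau :: real and x and bt :: "(real \<times> 'a) list"
  assume h: "j:A" "i:I" "|tau| <= 1" "set bt <= Basis" "length bt <= k"
  have "wb k 0 N (%p. u j (T i (fst p) (snd p))) (tau, x) (comp_const DIM('a) k*K0)"
   by (rule wb_compose[OF bfam_smooth[OF assms h(1)] smooth_Tp[OF h(2)] K0(2)[OF h(1)]])
    (use N1 comp h in auto)
  hence "|fds bt (W (u j) i) (tau, x)| <= comp_const DIM('a) k*K0*N^length bt" using h unfolding W_def[abs_def] wb_iff_fds by simp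
  also have "... <= K" unfolding K_def using N1 h(5) cK by (intro mult_left_mono power_increasing) auto
  finally show "|fds bt (W (u j) i) (tau, x)| <= K" .
 qed
qed

text \<open>The generator of the walk when one step takes the time \<open>eps^2\<close>: the mean of
  half the second derivatives in the step size.\<close>

definition Lop :: "('a => real) => 'a => real" where
 "Lop u x = (1/(2*card I))*(\<Sum>i\<in>I. fds [tdir, tdir] (W u i) (0, x))"

lemma smooth_slice: "smooth F ==> smooth (%x :: 'a. F (tau :: real, x) :: real)" by (rule smooth_comp[where xi="%x. (tau, x)"])
  (auto intro!: smooth_on_SucI[where D="%x v. (0, v)"] derivative_eq_intros smooth_on_const)

lemma fd_slice:
 fixes F :: "real \<times> 'a => real"
 assumes "smooth F" shows "fd (%x. F (tau, x)) x e = fd F (tau, x) (0, e)"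
proof -
 have "((%x. (tau, x)) has_derivative (%h. (0, h))) (at x)" by (auto intro!: derivative_eq_intros)
 from has_derivative_compose[OF this has_derivative_fd[OF smooth_diff[OF assms]]]
 show ?thesis by (rule fd_eqI)
qed

lemma smooth_Lop: "smooth u ==> smooth (Lop u)" unfolding Lop_def[abs_def] by (intro smooth_cmult smooth_sum smooth_slice smooth_fds smooth_W)

text \<open>The remainder is controlled together with its gradient, because the energy of an iterate
  contains first derivatives. The gradient estimate is the same Taylor expansion applied to the
  spatial derivative of \<open>W\<close>.\<close>

lemma Q_taylor:
 assumes "bfam A u"
 obtains K where "0 <= K"
  "!!j eps x. j:A ==> |eps| <= 1 ==> |Q eps (u j) x - u j x - eps^2*Lop (u j) x| <= K*eps^4"
  "!!j eps x e. j:A ==> |eps| <= 1 ==> e:Basis ==> |fd (%x. Q eps (u j) x - u j x - eps^2*Lop (u j) x) x e| <= K*eps^4"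
proof -
 obtain K where K: "0 <= K" "!!j i tau x bt. j:A ==> i:I ==> |tau| <= 1 ==> set bt <= Basis ==> length bt <= 5 ==>
  |fds bt (W (u j) i) (tau, x)| <= K" using W_bounded[OF assms, of 5] by metis
 have tB: "(tdir :: real \<times> 'a):Basis" by (simp add: Basis_prod_def)
 have eB: "(0 :: real, e):Basis" if "e:Basis" for e :: 'a using that by (simp add: Basis_prod_def)
 let ?d = "%u i eps x. W u i (eps, x) + W u i (- eps, x) - 2*W u i (0, x) - eps^2*fds [tdir, tdir] (W u i) (0, x)"
 have rep: "Q eps u x - u x - eps^2*Lop u x = (1/(2*card I))*(\<Sum>i\<in>I. ?d u i eps x)" for eps u x
 proof -
  have "u x = (1/(2*card I))*(\<Sum>i\<in>I. 2*W u i (0, x))" using card_I by (simp add: W_def T_def)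
  hence "Q eps u x - u x - eps^2*Lop u x = (1/(2*card I))*(\<Sum>i\<in>I. W u i (eps, x) + W u i (- eps, x))
    - (1/(2*card I))*(\<Sum>i\<in>I. 2*W u i (0, x))
    - eps^2*((1/(2*card I))*(\<Sum>i\<in>I. fds [tdir, tdir] (W u i) (0, x)))" by (simp only: Q_def Lop_def W_def fst_conv snd_conv)
  also have "... = (1/(2*card I))*(\<Sum>i\<in>I. ?d u i eps x)" by (simp add: sum_subtractf sum.distrib sum_distrib_left algebra_simps)
  finally show ?thesis .
 qed
 have avg: "|(1/(2*card I))*(\<Sum>i\<in>I. a i)| <= B" if "!!i. i:I ==> |a i| <= B" "0 <= B" for a :: "'i => real" and B
 proof -
  have "|\<Sum>i\<in>I. a i| <= card I*B" using that(1) sum_abs[of a I] sum_bounded_above[of I "%i. |a i|" B] by (auto intro: order_trans)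
  hence "|(1/(2*card I))*(\<Sum>i\<in>I. a i)| <= B/2" using card_I by (simp add: abs_mult field_simps)
  thus ?thesis using that(2) by linarith
 qed
 show ?thesis
 proof (rule that[OF K(1)])
  fix j eps x assume h: "j:A" "|eps| <= (1 :: real)"
  show "|Q eps (u j) x - u j x - eps^2*Lop (u j) x| <= K*eps^4" unfolding rep
   by (intro avg symmetric_taylor smooth_W bfam_smooth[OF assms] h K(2)[OF h(1)])
    (use tB K(1) in auto)
 next
  fix j eps x e assume h: "j:A" "|eps| <= (1 :: real)" "e:(Basis :: 'a set)"
  have smu: "smooth (u j)" by (rule bfam_smooth[OF assms h(1)])
  have der: "fd (%x. ?d (u j) i eps x) x e =
    (%F. F (eps, x) + F (- eps, x) - 2*F (0, x) - eps^2*fds [tdir, tdir] F (0, x)) (%p. fd (W (u j) i) p (0, e))" if i: "i:I" for i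
  proof -
   note sW = smooth_W[OF smu i]
   have sd: "smooth (%x. F (tau, x))" if "smooth F" for F :: "real \<times> 'a => real" and tau by (rule smooth_slice[OF that])
   \<comment> \<open>The spatial derivative is moved past both derivatives in the step size, one
     exchange at a time.\<close>
   have sw: "fds [tdir, tdir] (%p. fd (W (u j) i) p (0, e)) q = fd (fds [tdir, tdir] (W (u j) i)) q (0, e)" for q
   proof -
    have 1: "fd (%p. fd (W (u j) i) p (0, e)) q tdir = fd (%p. fd (W (u j) i) p tdir) q (0, e)" for q
     by (rule fd_second_symmetric[OF open_UNIV _ sW]) simp
    have 2: "fd (%q. fd (%p. fd (W (u j) i) p tdir) q (0, e)) q tdir =
      fd (%q. fd (%p. fd (W (u j) i) p tdir) q tdir) q (0, e)" by (rule fd_second_symmetric[OF open_UNIV _ smooth_on_fd[OF sW]]) simp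
    show ?thesis using 2 by (simp add: 1)
   qed
   show ?thesis unfolding sw fd_slice[OF sW, symmetric] fd_slice[OF smooth_fds[OF sW], symmetric]
    by (subst fd_diff fd_add fd_cmult; (intro smooth_diff smooth_on_diff smooth_add smooth_cmult open_UNIV sd sW smooth_fds)?)+ simp
  qed
  have "fd (%x. Q eps (u j) x - u j x - eps^2*Lop (u j) x) x e = (1/(2*card I))*(\<Sum>i\<in>I. fd (%x. ?d (u j) i eps x) x e)"
  proof -
   have sd: "smooth (%x. ?d (u j) i eps x)" if "i:I" for i
    by (intro smooth_on_diff smooth_add smooth_cmult open_UNIV smooth_slice smooth_W smu that smooth_fds)
   show ?thesis unfolding rep
    by (subst fd_cmult, intro smooth_diff smooth_sum sd, assumption, subst fd_sum, intro smooth_diff sd, assumption, rule refl)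
  qed
  also have "|...| <= K*eps^4"
  proof (rule avg)
   fix i assume i: "i:I"
   show "|fd (%x. ?d (u j) i eps x) x e| <= K*eps^4" unfolding der[OF i]
   proof (rule symmetric_taylor)
    show "smooth (%p. fd (W (u j) i) p (0, e))" by (intro smooth_on_fd smooth_W smu i)
    show "|fds (replicate 4 tdir) (%p. fd (W (u j) i) p (0, e)) (tau, x)| <= K" if "|tau| <= 1" for tau
     using K(2)[OF h(1) i that, of "(0, e) # replicate 4 tdir" x] tB eB[OF h(3)] by auto
   qed (rule h(2))
  qed (use K(1) in simp)
  finally show "|fd (%x. Q eps (u j) x - u j x - eps^2*Lop (u j) x) x e| <= K*eps^4" .
 qed
qed

text \<open>A straight step along \<open>s i\<close> sees the second derivative of \<open>u\<close>
  in a fixed direction, which differs from the iterated derivative along the field by the derivative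
  of the field along itself. This Ito correction is what \<open>c\<close> has to compensate if a sum
  of squares is wanted.\<close>

lemma Lop_eq:
 assumes u: "smooth u"
 shows "Lop u x = (1/card I)*(\<Sum>i\<in>I. fd (%y. fd u y (s i y)) x (s i x)/2 + fd u x (c i x) - fd u x (fd (s i) x (s i x))/2)"
proof -
 have "fds [tdir, tdir] (W u i) (0, x) = fd (%y. fd u y (s i y)) x (s i x) + 2*fd u x (c i x) - fd u x (fd (s i) x (s i x))" if i: "i:I" for i
 proof -
  have su: "smooth (%y. fd u y e)" for e by (rule smooth_on_fd[OF u])
  have line: "((%tau. T i tau x) has_derivative (%h. h *R (s i x + (2*tau) *R c i x))) (at tau)" for tau
   unfolding T_def by (auto intro!: derivative_eq_intros simp: algebra_simps)
  have comp: "((%tau. v (T i tau x)) has_real_derivative fd v (T i tau x) (s i x + (2*tau) *R c i x)) (at tau)"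
   if v: "smooth v" for v :: "'a => real" and tau
  proof -
   have "((%tau. v (T i tau x)) has_derivative (%h. fd v (T i tau x) (h *R (s i x + (2*tau) *R c i x)))) (at tau)"
    using has_derivative_compose[OF line has_derivative_fd[OF smooth_diff[OF v]]] .
   thus ?thesis by (simp add: has_field_derivative_def linear_scale[OF fd_linear[OF smooth_diff[OF v]]] mult_commute_abs)
  qed
  have 1: "fd (W u i) (tau, x) tdir = fd u (T i tau x) (s i x + (2*tau) *R c i x)" for tau
  proof -
   have "(%tau. W u i (tau, x)) = (%tau. u (T i tau x))" by (simp add: W_def)
   thus ?thesis using DERIV_unique[OF _ comp[OF u, of tau]] fst_line_derivative[OF smooth_W[OF u i], of x tau] by simp
  qed
  have "((%tau. fd (W u i) (tau, x) tdir) has_real_derivative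
    (\<Sum>e\<in>Basis. (2*(c i x \<bullet> e))*fd u x e + (s i x \<bullet> e)*fd (%y. fd u y e) x (s i x))) (at 0)"
   (is "(_ has_real_derivative ?R) _")
  proof -
   have "((%tau. \<Sum>e\<in>Basis. ((s i x + (2*tau) *R c i x) \<bullet> e)*fd u (T i tau x) e) has_real_derivative ?R) (at 0)"
   proof (rule DERIV_sum)
    fix e :: 'a
    have "((%tau. (s i x + (2*tau) *R c i x) \<bullet> e) has_real_derivative 2*(c i x \<bullet> e)) (at 0)"
     by (auto intro!: derivative_eq_intros simp: inner_add_left)
    from DERIV_mult[OF this comp[OF su[of e], of 0]]
    show "((%tau. ((s i x + (2*tau) *R c i x) \<bullet> e)*fd u (T i tau x) e) has_real_derivative
      (2*(c i x \<bullet> e))*fd u x e + (s i x \<bullet> e)*fd (%y. fd u y e) x (s i x)) (at 0)" by (simp add: T_def algebra_simps)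
   qed
   thus ?thesis unfolding 1 fd_expand_real[OF u, symmetric] .
  qed
  from DERIV_unique[OF fst_line_derivative[OF smooth_on_fd[OF smooth_W[OF u i]]] this]
  have 2: "fds [tdir, tdir] (W u i) (0, x) = ?R" by simp
  have 3: "fd (%y. fd u y (s i y)) x (s i x) =
    (\<Sum>e\<in>Basis. (s i x \<bullet> e)*fd (%y. fd u y e) x (s i x) + (fd (s i) x (s i x) \<bullet> e)*fd u x e)"
  proof -
   have ss: "smooth (%y. s i y \<bullet> e)" for e by (intro smooth_component smooth_s i)
   have "(%y. fd u y (s i y)) = (%y. \<Sum>e\<in>Basis. (s i y \<bullet> e)*fd u y e)" by (rule ext) (rule fd_expand_real[OF u])
   hence "fd (%y. fd u y (s i y)) x (s i x) = (\<Sum>e\<in>Basis. fd (%y. (s i y \<bullet> e)*fd u y e) x (s i x))"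
    using fd_sum[of Basis "%e y. (s i y \<bullet> e)*fd u y e" x "s i x"] by (simp add: smooth_diff smooth_on_mult ss su)
   also have "... = (\<Sum>e\<in>Basis. (s i x \<bullet> e)*fd (%y. fd u y e) x (s i x) + (fd (s i) x (s i x) \<bullet> e)*fd u x e)"
    by (intro sum.cong refl) (simp add: fd_mult[OF smooth_diff[OF ss] smooth_diff[OF su]] fd_component[OF smooth_s[OF i]])
   finally show ?thesis .
  qed
  show ?thesis unfolding 2 3 fd_expand_real[OF u, of x "c i x"] fd_expand_real[OF u, of x "fd (s i) x (s i x)"]
   by (simp add: sum.distrib sum_distrib_left algebra_simps)
 qed
 hence "(\<Sum>i\<in>I. fds [tdir, tdir] (W u i) (0, x)) =
   (\<Sum>i\<in>I. 2*(fd (%y. fd u y (s i y)) x (s i x)/2 + fd u x (c i x) - fd u x (fd (s i) x (s i x))/2))"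
  by (intro sum.cong refl) (simp only: diff_divide_distrib, simp)
 thus ?thesis unfolding Lop_def sum_distrib_left[symmetric] using card_I by simp
qed

end

lemma fd_along_field:
 fixes f :: "'a::euclidean_space => 'b::real_normed_vector" and V :: "'a => 'a"
 assumes S: "open S" "x:S" and f: "smooth_on S f" and V: "V differentiable (at x)"
 shows "fd (%y. fd f y (V y)) x w = fd (%y. fd f y (V x)) x w + fd f x (fd V x w)"
proof -
 have d: "(%y. fd f y v) differentiable (at x)" for v by (rule smooth_on_differentiable[OF smooth_on_fd[OF f] S(2)])
 have df: "f differentiable (at y)" if "y:S" for y by (rule smooth_on_differentiable[OF f that])
 have ex: "fd f y v = (\<Sum>e\<in>Basis. (v \<bullet> e) *R fd f y e)" if "y:S" for y v by (rule fd_linear_expand[OF df[OF that]])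
 have dV: "(%y. V y \<bullet> e) differentiable (at x)" for e by (intro differentiable_inner V differentiable_const)
 have "fd (%y. fd f y (V y)) x w = fd (%y. \<Sum>e\<in>Basis. (V y \<bullet> e) *R fd f y e) x w" by (rule fd_cong_open[OF S]) (rule ex)
 also have "... = (\<Sum>e\<in>Basis. (V x \<bullet> e) *R fd (%y. fd f y e) x w + (fd V x w \<bullet> e) *R fd f x e)"
  using dV d by (simp add: fd_sum fd_scaleR fd_linear_comp[OF bounded_linear_inner_left V])
 also have "... = fd (%y. \<Sum>e\<in>Basis. (V x \<bullet> e) *R fd f y e) x w + fd f x (fd V x w)"
  using d by (simp add: fd_sum fd_scaleR sum.distrib fd_const ex[OF S(2), of "fd V x w"])
 also have "fd (%y. \<Sum>e\<in>Basis. (V x \<bullet> e) *R fd f y e) x w = fd (%y. fd f y (V x)) x w"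
  by (rule fd_cong_open[OF S]) (rule ex[symmetric])
 finally show ?thesis .
qed

lemma fd_second_symmetric_vector:
 fixes f :: "'a::euclidean_space => 'b::euclidean_space"
 assumes S: "open S" "x:S" and f: "smooth_on S f"
 shows "fd (%y. fd f y v) x w = fd (%y. fd f y w) x v"
proof (rule euclidean_eqI)
 fix e :: 'b
 have d: "(%y. fd f y v) differentiable (at x)" for v by (rule smooth_on_differentiable[OF smooth_on_fd[OF f] S(2)])
 have "fd (%y. fd f y v) x w \<bullet> e = fd (%y. fd (%z. f z \<bullet> e) y v) x w" for v w
 proof -
  have "fd (%y. fd f y v) x w \<bullet> e = fd (%y. fd f y v \<bullet> e) x w" by (rule fd_linear_comp[OF bounded_linear_inner_left d, symmetric])
  also have "... = fd (%y. fd (%z. f z \<bullet> e) y v) x w"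
   by (rule fd_cong_open[OF S]) (rule fd_linear_comp[OF bounded_linear_inner_left smooth_on_differentiable[OF f], symmetric])
  finally show ?thesis .
 qed
 moreover have "smooth_on S (%z. f z \<bullet> e)" by (intro smooth_on_inner smooth_on_const f S)
 ultimately show "fd (%y. fd f y v) x w \<bullet> e = fd (%y. fd f y w) x v \<bullet> e" using fd_second_symmetric[OF S] by simp
qed

section \<open>Smooth functions and vector fields on a compact set\<close>

locale compact_set =
 fixes M :: "'a::euclidean_space set"
 assumes compact: "compact M"
begin

abbreviation "sm \<equiv> smooth_map M"
abbreviation "svf \<equiv> smooth_vector_field M"
abbreviation "T \<equiv> tangent_space M"
abbreviation "D \<equiv> dir_deriv M"

text \<open>A compactly supported ambient extension lets the rules for \<open>fd\<close> carry over
  to \<open>D\<close>. The choice is immaterial, since derivatives at points of \<open>M\<close> in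
  tangent directions depend on the values on \<open>M\<close> only.\<close>

definition ext :: "('a => 'b::real_normed_vector) => 'a => 'b" where
 "ext f = (SOME f'. smooth f' & (ALL x:M. f' x = f x) & (EX R. ALL x. norm x > R --> f' x = 0))"

lemma ext:
 assumes "sm f" shows "smooth (ext f)" "x:M ==> ext f x = f x" "EX R. ALL x. norm x > R --> ext f x = 0"
proof -
 have "EX f'. smooth f' & (ALL x:M. f' x = f x) & (EX R. ALL x. norm x > R --> f' x = 0)" using smooth_map_extension[OF compact assms] by metis
 from someI_ex[OF this] show "smooth (ext f)" "x:M ==> ext f x = f x" "EX R. ALL x. norm x > R --> ext f x = 0" unfolding ext_def[symmetric] by auto
qed

lemma smI: "smooth f' ==> (!!x. x:M ==> f' x = f x) ==> sm f" unfolding smooth_map_def using open_UNIV by blast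

lemma sm_cong: "sm f ==> (!!x. x:M ==> f x = f' x) ==> sm f'" using smI[of "ext f" f'] ext[of f] by simp

lemma sm_cont: "sm f ==> continuous_on M f"
 by (rule continuous_on_eq[OF continuous_on_subset[OF smooth_on_imp_continuous[OF ext(1)]]]) (auto simp: ext(2))

lemma sm_bounded:
 assumes "sm f" obtains C where "C >= 0" "!!x. x:M ==> norm (f x) <= C"
proof -
 have "bounded (f ` M)" using compact_continuous_image[OF sm_cont[OF assms] compact] compact_imp_bounded by blast
 then obtain C where "ALL y:f ` M. norm y <= C" unfolding bounded_iff by blast
 thus ?thesis using that[of "max 0 C"] by force
qed

lemma sm_bounded_family:
 assumes "finite I" "!!i. i:I ==> sm (c i :: 'a => real)"
 shows "EX C>=0. ALL i:I. ALL p:M. |c i p| <= C"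
proof -
 have "ALL i:I. EX C>=0. ALL p:M. |c i p| <= C" using sm_bounded[OF assms(2)] by (metis real_norm_def)
 then obtain C where C: "!!i. i:I ==> 0 <= C i & (ALL p:M. |c i p| <= C i)" by metis
 have "C i <= sum C I" if "i:I" for i using C assms(1) that by (intro member_le_sum) auto
 thus ?thesis using C sum_nonneg[of I C] by (meson order_trans)
qed

lemma sm_const [intro]: "sm (%x. c)" by (rule smI[of "%x. c"]) (auto intro: smooth_on_const)
lemma sm_ident: "sm (%x. x)" by (rule smI[of "%x. x"]) (auto intro: smooth_on_ident)
lemma sm_linear: "bounded_linear L ==> sm f ==> sm (%x. L (f x))"
 by (rule smI[of "%x. L (ext f x)"]) (auto intro: smooth_on_linear_comp ext simp: ext(2))
lemma sm_add [intro]: "sm f ==> sm h ==> sm (%x. f x + h x)" by (rule smI[of "%x. ext f x + ext h x"]) (auto intro: smooth_on_add ext simp: ext(2))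
lemma sm_scaleR [intro]: "sm f ==> sm h ==> sm (%x. f x *R h x)"
 by (rule smI[of "%x. ext f x *R ext h x"]) (auto intro: smooth_on_scaleR ext simp: ext(2))
lemma sm_mult [intro]: "sm f ==> sm h ==> sm (%x. f x*h x :: real)" using sm_scaleR[of f h] by simp
lemma sm_inner: "sm f ==> sm (%x. f x \<bullet> e)" by (rule sm_linear[OF bounded_linear_inner_left])
lemma sm_cmult [intro]: "sm h ==> sm (%x. c *R h x)" by (intro sm_scaleR sm_const)
lemma sm_minus [intro]: "sm h ==> sm (%x. - h x)" using sm_cmult[of h "-1"] by simp
lemma sm_diff [intro]: "sm f ==> sm h ==> sm (%x. f x - h x)" using sm_add[OF _ sm_minus] by fastforce
lemma sm_sum [intro]: "(!!i. i:I ==> sm (f i)) ==> sm (%x. \<Sum>i\<in>I. f i x)" by (induction I rule: infinite_finite_induct) auto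
lemma sm_exp: "sm f ==> sm (%x. exp (f x :: real))" by (rule smI[of "%x. exp (ext f x)"]) (auto intro: smooth_on_exp ext simp: ext(2))
lemma sm_cos: "sm f ==> sm (%x. cos (f x :: real))" by (rule smI[of "%x. cos (ext f x)"]) (auto intro: smooth_on_cos ext simp: ext(2))
lemma sm_sin: "sm f ==> sm (%x. sin (f x :: real))" by (rule smI[of "%x. sin (ext f x)"]) (auto intro: smooth_on_sin ext simp: ext(2))

lemma D_fd:
 assumes "p:M" "v:T p" "smooth f'" "!!x. x:M ==> f' x = f x" shows "D f p v = fd f' p v"
 by (rule dir_deriv_eq_fd[OF assms(1,2) open_UNIV]) (auto simp: assms smooth_diff)

lemma D_ext: "p:M ==> v:T p ==> sm f ==> D f p v = fd (ext f) p v" by (rule D_fd) (auto simp: ext)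

lemma D_cong: "p:M ==> v:T p ==> sm f ==> (!!x. x:M ==> f x = f' x) ==> D f p v = D f' p v"
 using D_ext[of p v f] D_fd[of p v "ext f" f'] by (simp add: ext)

context
 fixes p v assumes p: "p:M" and v: "v:T p"
begin

lemma D_const: "D (%x. c) p v = 0" using D_fd[OF p v, of "%x. c" "%x. c"] by (simp add: smooth_on_const fd_const)
lemma D_linear: "bounded_linear L ==> D L p v = L v" using D_fd[OF p v, of L L] by (simp add: smooth_on_bounded_linear fd_bounded_linear)
lemma D_add: "sm f ==> sm h ==> D (%x. f x + h x) p v = D f p v + D h p v" using D_fd[OF p v, of "%x. ext f x + ext h x" "%x. f x + h x"]
 by (simp add: ext smooth_on_add D_ext[OF p v] fd_add smooth_diff)
lemma D_scaleR: "sm f ==> sm h ==> D (%x. f x *R h x) p v = f p *R D h p v + D f p v *R h p"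
 using D_fd[OF p v, of "%x. ext f x *R ext h x" "%x. f x *R h x"]
 by (simp add: ext p smooth_on_scaleR D_ext[OF p v] fd_scaleR smooth_diff)
lemma D_mult: "sm f ==> sm h ==> D (%x. f x*h x) p v = f p*D h p v + D f p v * (h p :: real)" using D_scaleR[of f h] by simp
lemma D_cmult: "sm h ==> D (%x. c *R h x) p v = c *R D h p v" using D_scaleR[of "%x. c" h] by (simp add: D_const sm_const)
lemma D_sum: "(!!i. i:I ==> sm (f i)) ==> D (%x. \<Sum>i\<in>I. f i x) p v = (\<Sum>i\<in>I. D (f i) p v)"
 by (induction I rule: infinite_finite_induct) (auto simp: D_const D_add sm_sum)
lemma D_comp:
 fixes \<theta> :: "real => real"
 assumes "sm f" "smooth \<theta>" "(\<theta> has_field_derivative d) (at (f p))"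
 shows "D (%x. \<theta> (f x)) p v = d*D f p v"
proof -
 have "D (%x. \<theta> (f x)) p v = fd (%x. \<theta> (ext f x)) p v"
  by (rule D_fd[OF p v]) (use assms ext[OF assms(1)] in "auto intro: smooth_on_compose[where T=UNIV]")
 also have "... = fd \<theta> (f p) (fd (ext f) p v)"
  using fd_compose[OF smooth_diff[OF ext(1)[OF assms(1)]] smooth_diff[OF assms(2)]] ext(2)[OF assms(1) p] by simp
 also have "... = d*D f p v" using assms(3) unfolding has_field_derivative_def by (simp add: fd_eqI D_ext[OF p v assms(1)])
 finally show ?thesis .
qed

end

lemma D_linear_arg:
 assumes p: "p:M" and f: "sm f" and v: "!!i. i:I ==> v i:T p" and s: "(\<Sum>i\<in>I. c i *R v i):T p"
 shows "D f p (\<Sum>i\<in>I. c i *R v i) = (\<Sum>i\<in>I. c i *R D f p (v i))"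
proof -
 have l: "linear (%v. fd (ext f) p v)" by (rule fd_linear[OF smooth_diff[OF ext(1)[OF f]]])
 show ?thesis using v by (simp add: D_ext[OF p s f] D_ext[OF p _ f] linear_sum[OF l] linear_scale[OF l])
qed

lemma svf: "svf V ==> sm V" "svf V ==> p:M ==> V p:T p" unfolding smooth_vector_field_def by auto

lemma sm_D [intro]: assumes "svf V" "sm f" shows "sm (%p. D f p (V p))"
proof (rule smI)
 show "smooth (%p. fd (ext f) p (ext V p))" using assms svf(1) by (intro smooth_on_fd_field ext) auto
 show "fd (ext f) p (ext V p) = D f p (V p)" if "p:M" for p using that assms svf[OF assms(1)] by (simp add: D_ext ext)
qed

lemma D_D:
 assumes p: "p:M" and v: "v:T p" and V: "svf V" and f: "sm f"
 shows "D (%q. D f q (V q)) p v = fd (%q. fd (ext f) q (V p)) p v + fd (ext f) p (D V p v)"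
proof -
 note [simp] = ext[OF svf(1)[OF V]] ext[OF f]
 have "D (%q. D f q (V q)) p v = fd (%q. fd (ext f) q (ext V q)) p v"
  by (rule D_fd[OF p v]) (use f V in "auto intro!: smooth_on_fd_field simp: D_ext svf(2)")
 also have "... = fd (%q. fd (ext f) q (V p)) p v + fd (ext f) p (fd (ext V) p v)"
  using fd_along_field[OF open_UNIV, of p "ext f" "ext V" v] p by (simp add: smooth_diff)
 finally show ?thesis by (simp add: D_ext[OF p v svf(1)[OF V]])
qed

lemma lie_bracket_D: "lie_bracket M V W p = D W p (V p) - D V p (W p)" by (simp add: lie_bracket_def lie_deriv_def)

text \<open>For the extensions both iterated derivatives contain the same second derivative of
  \<open>f\<close>, which cancels by symmetry.\<close>

lemma lie_bracket_commutator:
 assumes p: "p:M" and V: "svf V" and W: "svf W" and f: "sm (f :: 'a => real)" and t: "lie_bracket M V W p:T p"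
 shows "D f p (lie_bracket M V W p) = D (%q. D f q (W q)) p (V p) - D (%q. D f q (V q)) p (W p)"
 using fd_second_symmetric[OF open_UNIV UNIV_I ext(1)[OF f], of "W p" p "V p"] p V W f by (simp add: D_D svf(2) D_ext[OF p t f])
  (simp add: lie_bracket_D linear_diff[OF fd_linear[OF smooth_diff[OF ext(1)[OF f]]]])

end

section \<open>An inner product on a subspace\<close>

locale inner_on =
 fixes S :: "'a::euclidean_space set" and g :: "'a => 'a => real"
 assumes S: "subspace S" and sym: "!!u v. u:S ==> v:S ==> g u v = g v u"
  and pos: "!!u. u:S ==> u ~= 0 ==> g u u > 0"
  and scale: "!!u v a. u:S ==> v:S ==> g (a *R u) v = a*g u v"
  and add: "!!u v w. u:S ==> v:S ==> w:S ==> g (u + v) w = g u w + g v w"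
begin

lemma zero: "v:S ==> g 0 v = 0" using scale[of 0 v 0] subspace_0[OF S] by simp

lemma sum: "(!!i. i:I ==> u i:S) ==> v:S ==> g (\<Sum>i\<in>I. c i *R u i) v = (\<Sum>i\<in>I. c i*g (u i) v)"
 by (induction I rule: infinite_finite_induct)
  (simp_all add: zero add scale subspace_scale[OF S] subspace_sum[OF S])

lemma sum_right: "(!!i. i:I ==> u i:S) ==> v:S ==> g v (\<Sum>i\<in>I. c i *R u i) = (\<Sum>i\<in>I. c i*g v (u i))"
 using sum[of I u v c] sym[of v] subspace_sum[OF S, of I "%i. c i *R u i"] by (simp add: subspace_scale[OF S])

lemma diff: "u:S ==> v:S ==> w:S ==> g (u - v) w = g u w - g v w" using add[of "u - v" v w] subspace_diff[OF S] by simp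

lemma unique: "u:S ==> v:S ==> (!!w. w:S ==> g u w = g v w) ==> u = v" using pos[of "u - v"] diff[of u v "u - v"] subspace_diff[OF S] by fastforce

text \<open>\<open>L\<close> sends a vector to its products with an orthonormal basis. It is
  injective on \<open>S\<close> by positivity, hence onto \<open>S\<close> by dimension. The
  existence is needed because the gradient is a definite description.\<close>

lemma riesz:
 assumes l: "linear l" shows "EX v:S. ALL w:S. g v w = l w"
proof -
 obtain B where B: "B <= S" "pairwise orthogonal B" "!!x. x:B ==> norm x = 1" "independent B" "card B = dim S" "span B = S"
  using orthonormal_basis_subspace[OF S] by metis
 have fB: "finite B" using B(4) by (rule independent_imp_finite)
 have BS: "b:S" if "b:B" for b using B(1) that by blast
 have ex: "(\<Sum>b\<in>B. (v \<bullet> b) *R b) = v" if "v:S" for v using orthonormal_basis_expand[OF B(2,3) _ fB, of v] that B(6) by simp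
 have nb: "(\<Sum>b\<in>B. c b *R b) \<bullet> b' = c b'" if "b':B" for c b'
 proof -
  have "(\<Sum>b\<in>B. c b *R b) \<bullet> b' = (\<Sum>b\<in>B. if b = b' then c b' else 0)" unfolding inner_sum_left
  proof (rule sum.cong[OF refl])
   fix b assume "b:B"
   thus "(c b *R b) \<bullet> b' = (if b = b' then c b' else 0)" using B(2,3) that by (auto simp: pairwise_def orthogonal_def norm_eq_1)
  qed
  thus ?thesis using that fB by simp
 qed
 define L where "L v = (\<Sum>b\<in>B. (\<Sum>b'\<in>B. (v \<bullet> b')*g b' b) *R b)" for v
 have gL: "L v \<bullet> b = g v b" if "v:S" "b:B" for v b using sum[of B "%b. b" b "%b. v \<bullet> b"] BS that by (simp add: L_def nb ex)
 have lL: "linear L" unfolding L_def by (intro linearI) (simp_all add: inner_left_distrib distrib_right sum.distrib scaleR_left_distrib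
   sum_distrib_left scaleR_sum_right mult.assoc)
 have LS: "L ` S <= S" unfolding L_def using BS by (auto intro!: subspace_sum[OF S] subspace_scale[OF S])
 have "inj_on L S"
 proof (rule inj_onI)
  fix u v assume uv: "u:S" "v:S" "L u = L v"
  show "u = v"
  proof (rule unique[OF uv(1,2)])
   fix w assume w: "w:S"
   have "g u w = (\<Sum>b\<in>B. (w \<bullet> b)*g u b)" if "u:S" for u
    using sum_right[of B "%b. b" u "%b. w \<bullet> b"] that BS by (simp add: ex[OF w])
   moreover have "g u b = g v b" if "b:B" for b using gL uv that by metis
   ultimately show "g u w = g v w" using uv by simp
  qed
 qed
 hence "dim (L ` S) = dim S" using dim_image_eq[OF lL, of S] by (simp add: span_eq_iff[THEN iffD2, OF S])
 hence "L ` S = S" using subspace_dim_equal[OF linear_subspace_image[OF lL S] S LS] by simp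
 moreover have "(\<Sum>b\<in>B. l b *R b):S" using BS by (auto intro!: subspace_sum[OF S] subspace_scale[OF S])
 ultimately obtain v where v: "v:S" "L v = (\<Sum>b\<in>B. l b *R b)" by (metis (no_types, lifting) imageE)
 have "g v w = l w" if w: "w:S" for w
 proof -
  have "g v b = l b" if "b:B" for b using gL[OF v(1) that] nb[OF that, of l] v(2) by simp
  hence "g v w = (\<Sum>b\<in>B. (w \<bullet> b)*l b)" using sum_right[of B "%b. b" v "%b. w \<bullet> b"] v BS by (simp add: ex[OF w])
  also have "... = l (\<Sum>b\<in>B. (w \<bullet> b) *R b)" by (simp add: linear_sum[OF l] linear_scale[OF l])
  finally show ?thesis by (simp add: ex[OF w])
 qed
 thus ?thesis using v by blast
qed

end

section \<open>Riemannian geometry expressed by the frame\<close>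

locale framed = compact_set M for M :: "'a::euclidean_space set" +
 fixes f :: "'i => 'a => 'a" and R :: "'i set" and g :: "'a => 'a => 'a => real" and nabla
 assumes finite_R: "finite R" and svf_f: "!!i. i:R ==> svf (f i)"
  and span_f: "!!x. x:M ==> span ((%i. f i x) ` R) = T x"
  and metric: "riemannian_metric M g"
  and gradient: "!!(ps :: 'a => real) x. smooth_map M ps ==> x:M ==> gradient M g ps x = (\<Sum>i\<in>R. lie_deriv M (f i) ps x *R f i x)"
  and nabla: "levi_civita M g nabla"
begin

abbreviation "X i ps p \<equiv> D ps p (f i p)"

lemma subspace_T: "p:M ==> subspace (T p)" using span_f subspace_span by metis

lemma f_T: "i:R ==> p:M ==> f i p:T p" using svf_f svf(2) by blast

lemma inner_on_T: "p:M ==> inner_on (T p) (g p)" using metric subspace_T by (intro inner_on.intro) (auto simp: riemannian_metric_def)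

lemma svfI: "sm V ==> (!!p. p:M ==> V p:T p) ==> svf V" unfolding smooth_vector_field_def by blast

lemma svf_add: "svf V ==> svf W ==> svf (%p. V p + W p)" by (intro svfI sm_add subspace_add[OF subspace_T]) (auto simp: svf)
lemma svf_scaleR: "sm ps ==> svf V ==> svf (%p. ps p *R V p)" by (intro svfI sm_scaleR subspace_scale[OF subspace_T]) (auto simp: svf)
lemma svf_cmult: "svf V ==> svf (%p. c *R V p)" by (rule svf_scaleR) auto
lemma svf_sum: "(!!i. i:I ==> svf (V i)) ==> svf (%p. \<Sum>i\<in>I. V i p)" by (intro svfI sm_sum subspace_sum[OF subspace_T]) (auto simp: svf)

lemma sm_g: "svf V ==> svf W ==> sm (%p. g p (V p) (W p))" using metric by (simp add: riemannian_metric_def)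

text \<open>Existence by Riesz and uniqueness by positivity show that the description of the
  gradient denotes; the assumed formula for it then becomes a statement about the metric.\<close>

lemma gradient_inner:
 assumes ps: "sm (ps :: 'a => real)" and p: "p:M" and w: "w:T p"
 shows "g p (\<Sum>i\<in>R. X i ps p *R f i p) w = D ps p w"
proof -
 interpret inner_on "T p" "g p" by (rule inner_on_T[OF p])
 have "linear (fd (ext ps) p)" by (rule fd_linear[OF smooth_diff[OF ext(1)[OF ps]]])
 then obtain v where "v:T p" "ALL w:T p. g p v w = fd (ext ps) p w" using riesz by blast
 hence v: "v:T p" "ALL w:T p. g p v w = D ps p w" by (simp_all add: D_ext[OF p _ ps])
 have "gradient M g ps p = v" unfolding gradient_def using v by (intro the_equality unique) auto
 thus ?thesis using gradient[OF ps p] v(2) w by (simp add: lie_deriv_def)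
qed

text \<open>The fields form a tight frame for the metric. This is the gradient identity for the
  coordinate functions, whose derivative along \<open>w\<close> is the corresponding component of
  \<open>w\<close>.\<close>

lemma frame:
 assumes p: "p:M" and w: "w:T p" shows "(\<Sum>i\<in>R. g p (f i p) w *R f i p) = w"
proof (rule euclidean_eqI)
 fix e :: 'a
 interpret inner_on "T p" "g p" by (rule inner_on_T[OF p])
 have "g p (\<Sum>i\<in>R. (f i p \<bullet> e) *R f i p) w = w \<bullet> e"
  using gradient_inner[OF sm_inner[OF sm_ident] p w, of e] D_linear[OF p _ bounded_linear_inner_left[of e]] w f_T[OF _ p] by simp
 thus "(\<Sum>i\<in>R. g p (f i p) w *R f i p) \<bullet> e = w \<bullet> e"
  using sum[of R "%i. f i p" w] f_T[OF _ p] w by (simp add: inner_sum_left mult.commute)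
qed

lemma frame_D:
 assumes p: "p:M" and w: "w:T p" and ps: "sm (ps :: 'a => real)"
 shows "(\<Sum>i\<in>R. g p (f i p) w*X i ps p) = D ps p w"
 using D_linear_arg[OF p ps, of R "%i. f i p" "%i. g p (f i p) w"] frame[OF p w] f_T[OF _ p] w by simp

lemma nabla_bracket: "svf V ==> svf W ==> p:M ==> lie_bracket M V W p = nabla V W p - nabla W V p"
 and svf_nabla: "svf V ==> svf W ==> svf (nabla V W)"
 and nabla_metric: "svf V ==> svf W ==> svf Z ==> p:M ==>
  D (%q. g q (W q) (Z q)) p (V p) = g p (nabla V W p) (Z p) + g p (W p) (nabla V Z p)" using nabla by (simp_all add: levi_civita_def lie_deriv_def)

lemma svf_bracket:
 assumes "svf V" "svf W" shows "svf (lie_bracket M V W)"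
proof (rule svfI)
 have "sm (%p. nabla V W p - nabla W V p)" using svf_nabla assms svf(1) by blast
 thus "sm (lie_bracket M V W)" by (rule sm_cong) (simp add: nabla_bracket assms)
 show "lie_bracket M V W p:T p" if "p:M" for p using that svf(2)[OF svf_nabla] assms by (simp add: nabla_bracket subspace_diff[OF subspace_T])
qed

lemma bracket_D:
 assumes "p:M" "svf V" "svf W" "sm (ps :: 'a => real)"
 shows "D ps p (lie_bracket M V W p) = D (%q. D ps q (W q)) p (V p) - D (%q. D ps q (V q)) p (W p)"
 using lie_bracket_commutator[OF assms] svf(2)[OF svf_bracket] assms by blast

definition grad :: "('a => real) => 'a => 'a" where "grad ps p = (\<Sum>i\<in>R. X i ps p *R f i p)"

lemma svf_grad: "sm ps ==> svf (grad ps)" unfolding grad_def[abs_def] by (intro svf_sum svf_scaleR sm_D svf_f)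

definition carre ("\<Gamma>") where "\<Gamma> u v p = (\<Sum>i\<in>R. X i u p*X i v (p :: 'a) :: real)"

lemma sm_carre: "sm u ==> sm v ==> sm (\<Gamma> u v)" unfolding carre_def[abs_def] by (intro sm_sum sm_mult sm_D svf_f)

lemma D_grad:
 assumes p: "p:M" and u: "sm u" and v: "sm v" shows "D v p (grad u p) = \<Gamma> u v p" unfolding grad_def carre_def
 using D_linear_arg[OF p v, of R "%i. f i p" "%i. X i u p"] svf(2)[OF svf_grad[OF u] p] f_T[OF _ p] by (simp add: grad_def)

text \<open>By vanishing torsion and the tight frame property this is the trace of \<nabla>V up to a
  derivative of the squared lengths of the frame. Being made of brackets alone, it can be matched
  with coordinates without Christoffel symbols.\<close>

definition divg :: "('a => 'a) => 'a => real" where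
 "divg V p = (\<Sum>j\<in>R. g p (lie_bracket M (f j) V p) (f j p))"

lemma divg_mult:
 assumes p: "p:M" and V: "svf V" and ps: "sm ps"
 shows "divg (%q. ps q *R V q) p = ps p*divg V p + D ps p (V p)"
proof -
 interpret inner_on "T p" "g p" by (rule inner_on_T[OF p])
 note Vp = svf(2)[OF V p]
 have "lie_bracket M (f j) (%q. ps q *R V q) p = ps p *R lie_bracket M (f j) V p + X j ps p *R V p" if j: "j:R" for j
 proof -
  have "D (f j) p (ps p *R V p) = ps p *R D (f j) p (V p)"
   using D_linear_arg[OF p svf(1)[OF svf_f[OF j]], of "{()}" "%_. V p" "%_. ps p"] Vp subspace_scale[OF S] by simp
  thus ?thesis by (simp add: lie_bracket_D D_scaleR[OF p f_T[OF j p] ps svf(1)[OF V]] scaleR_diff_right)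
 qed
 moreover have "g p (c *R lie_bracket M (f j) V p + d *R V p) (f j p) = c*g p (lie_bracket M (f j) V p) (f j p) + g p (f j p) (V p)*d"
  if j: "j:R" for j c d using svf(2)[OF svf_bracket[OF svf_f[OF j] V] p] f_T[OF j p] Vp sym[OF Vp f_T[OF j p]]
  by (simp add: add scale subspace_scale[OF S])
 ultimately show ?thesis unfolding divg_def using frame_D[OF p Vp ps] by (simp add: sum.distrib sum_distrib_left)
qed

lemma divg_sum:
 assumes p: "p:M" and V: "!!i. i:I ==> svf (V i)"
 shows "divg (%q. \<Sum>i\<in>I. V i q) p = (\<Sum>i\<in>I. divg (V i) p)"
proof -
 interpret inner_on "T p" "g p" by (rule inner_on_T[OF p])
 have "g p (lie_bracket M (f j) (%q. \<Sum>i\<in>I. V i q) p) (f j p) = (\<Sum>i\<in>I. g p (lie_bracket M (f j) (V i) p) (f j p))" if j: "j:R" for j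
 proof -
  have "lie_bracket M (f j) (%q. \<Sum>i\<in>I. V i q) p = (\<Sum>i\<in>I. lie_bracket M (f j) (V i) p)"
   using D_linear_arg[OF p svf(1)[OF svf_f[OF j]], of I "%i. V i p" "%_. 1"] V svf(2)[OF V p] subspace_sum[OF S, of I "%i. V i p"]
   by (simp add: lie_bracket_D D_sum[OF p f_T[OF j p]] svf(1) sum_subtractf)
  thus ?thesis using sum[of I "%i. lie_bracket M (f j) (V i) p" "f j p" "%_. 1"] svf(2)[OF svf_bracket[OF svf_f[OF j] V] p] f_T[OF j p] by simp
 qed
 thus ?thesis unfolding divg_def by (simp add: sum.swap[of _ I])
qed

definition accel :: "'a => 'a" where "accel p = (\<Sum>i\<in>R. nabla (f i) (f i) p)"

lemma svf_accel: "svf accel" unfolding accel_def[abs_def] by (intro svf_sum svf_nabla svf_f)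

text \<open>Since \<open>\<Sum>\<^sub>j g (f\<^sub>j, f\<^sub>j)\<close> is the constant \<open>n\<close>, the part \<open>\<nabla>\<^bsub>grad ps\<^esub> f\<^sub>j\<close> of the brackets does not contribute.\<close>

lemma divg_grad:
 assumes p: "p:M" and ps: "sm ps" and n: "!!q. q:M ==> (\<Sum>j\<in>R. g q (f j q) (f j q)) = n"
 shows "divg (grad ps) p = (\<Sum>i\<in>R. X i (X i ps) p) - D ps p (accel p)"
proof -
 interpret inner_on "T p" "g p" by (rule inner_on_T[OF p])
 note G = svf_grad[OF ps]
 have nT: "nabla V W p:T p" if "svf V" "svf W" for V W using svf(2)[OF svf_nabla[OF that] p] .
 have gf: "svf V ==> q:M ==> g q (grad ps q) (V q) = D ps q (V q)" for V q unfolding grad_def by (rule gradient_inner[OF ps _ svf(2)])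
 have "0 = D (%q. \<Sum>j\<in>R. g q (f j q) (f j q)) p (grad ps p)"
 proof -
  have "D (%q. \<Sum>j\<in>R. g q (f j q) (f j q)) p (grad ps p) = D (%q. n) p (grad ps p)"
   by (rule D_cong[OF p svf(2)[OF G p]], intro sm_sum sm_g svf_f) (use n in auto)
  thus ?thesis by (simp add: D_const[OF p svf(2)[OF G p]])
 qed
 also have "... = (\<Sum>j\<in>R. 2*g p (nabla (grad ps) (f j) p) (f j p))" by (subst D_sum[OF p svf(2)[OF G p]])
   (auto intro!: sm_g svf_f sum.cong simp: svf_f nabla_metric[OF G _ _ p] sym[OF f_T[OF _ p] nT[OF G]])
 finally have z: "(\<Sum>j\<in>R. g p (nabla (grad ps) (f j) p) (f j p)) = 0" by (simp add: sum_distrib_left[symmetric])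
 have a: "g p (nabla (f j) (grad ps) p) (f j p) = X j (X j ps) p - D ps p (nabla (f j) (f j) p)" if j: "j:R" for j
 proof -
  have "X j (%q. g q (grad ps q) (f j q)) p = X j (X j ps) p" by (rule D_cong[OF p f_T[OF j p]]) (use gf svf_f[OF j] G in "auto intro: sm_g")
  thus ?thesis using nabla_metric[OF svf_f[OF j] G svf_f[OF j] p] gf[OF svf_nabla[OF svf_f[OF j] svf_f[OF j]] p] by simp
 qed
 have "divg (grad ps) p = (\<Sum>j\<in>R. g p (nabla (f j) (grad ps) p) (f j p) - g p (nabla (grad ps) (f j) p) (f j p))"
  unfolding divg_def by (intro sum.cong refl)
   (use G svf_f in "simp add: nabla_bracket[OF svf_f G p] diff nT f_T[OF _ p]")
 also have "... = (\<Sum>j\<in>R. X j (X j ps) p - D ps p (nabla (f j) (f j) p))" by (simp add: sum_subtractf z a)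
 also have "... = (\<Sum>i\<in>R. X i (X i ps) p) - D ps p (accel p)"
  using D_linear_arg[OF p ps, of R "%i. nabla (f i) (f i) p" "%_. 1"] nT svf_f svf(2)[OF svf_accel p] by (simp add: accel_def sum_subtractf)
 finally show ?thesis .
qed

end

section \<open>Determinants and local coordinates\<close>

text \<open>Along the segment from the identity to \<open>A\<close> the quadratic form stays
  positive, so the determinant never vanishes and keeps the sign it has at the identity.\<close>

lemma det_pos:
 fixes A :: "real^'n^'n"
 assumes "!!x. x ~= 0 ==> x \<bullet> (A *v x) > 0" shows "det A > 0"
proof (rule ccontr)
 assume neg: "\<not> det A > 0"
 define B where "B t = (\<chi> i j. (1 - t)*(mat 1 :: real^'n^'n) $ i $ j + t*A $ i $ j)" for t :: real
 have "smooth_on UNIV (%t. det (B t))"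
  by (intro smooth_on_det open_UNIV) (simp add: B_def smooth_on_add smooth_on_mult smooth_on_diff smooth_on_const smooth_on_ident)
 hence "continuous_on {0..1} (%t. det (B t))" using smooth_on_imp_continuous continuous_on_subset by blast
 moreover have "B 0 = mat 1" "B 1 = A" by (simp_all add: B_def vec_eq_iff)
 ultimately obtain t where t: "0 <= t" "t <= 1" "det (B t) = 0" using IVT2'[of "%t. det (B t)" 1 0 0] neg by auto
 then obtain x where x: "x ~= 0" "B t *v x = 0"
  using invertible_det_nz[of "B t"] invertible_left_inverse[of "B t"] matrix_left_invertible_ker[of "B t"] by auto
 have "B t *v x = (1 - t) *R x + t *R (A *v x)"
  by (simp add: B_def vec_eq_iff matrix_vector_mult_def mat_def sum.distrib distrib_right sum_distrib_left mult.assoc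
   if_distrib[of "%x. x*_"] if_distrib[of "%x. _*x"] cong: if_cong)
 hence "(1 - t)*(x \<bullet> x) + t*(x \<bullet> (A *v x)) = 0" using x(2) by (metis inner_add_right inner_scaleR_right inner_zero_right)
 moreover have "x \<bullet> x > 0" "x \<bullet> (A *v x) > 0" using x(1) assms by auto
 ultimately show False using t(1,2) mult_nonneg_nonneg[of "1 - t" "x \<bullet> x"] mult_pos_pos[of t "x \<bullet> (A *v x)"]
  by (cases "t = 0") (simp, linarith)
qed

text \<open>Jacobi's formula. Differentiation replaces one row by its derivative; this row is a
  combination of the rows of \<open>A u\<close> with coefficients read off from \<open>G\<close>,
  and Cramer's lemma retains the coefficient of the replaced row.\<close>

lemma det_derivative:
 fixes A :: "'a::euclidean_space => real^'n^'n"
 assumes A: "!!i j. (%w. A w $ i $ j) differentiable (at u)" and G: "A u ** G = mat 1"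
 shows "fd (%w. det (A w)) u x = det (A u)*(\<Sum>k\<in>UNIV. \<Sum>m\<in>UNIV. fd (%w. A w $ k $ m) u x*G $ m $ k)"
proof -
 define d where "d k m = fd (%w. A w $ k $ m) u x" for k m
 have GA: "G ** A u = mat 1" using G matrix_left_right_inverse by blast
 have "fd (%w. det (A w)) u x = (\<Sum>p | p permutes UNIV. of_int (sign p)*(\<Sum>k\<in>UNIV. d k (p k)*(\<Prod>j\<in>UNIV - {k}. A u $ j $ p j)))"
  unfolding det_def d_def by (rule fd_eqI) (intro has_derivative_sum has_derivative_mult_right has_derivative_prod has_derivative_fd A)
 also have "... = (\<Sum>k\<in>UNIV. \<Sum>p | p permutes UNIV. of_int (sign p)*(d k (p k)*(\<Prod>j\<in>UNIV - {k}. A u $ j $ p j)))"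
  unfolding sum_distrib_left by (rule sum.swap)
 also have "... = (\<Sum>k\<in>UNIV. det (\<chi> i. if i = k then (\<chi> m. d k m) else row i (A u)))"
 proof (intro sum.cong refl)
  fix k
  have "(\<Prod>i\<in>UNIV. (\<chi> i. if i = k then (\<chi> m. d k m) else row i (A u)) $ i $ p i) = d k (p k)*(\<Prod>j\<in>UNIV - {k}. A u $ j $ p j)" for p
   by (subst prod.remove[of _ k]) (auto simp: row_def intro!: prod.cong)
  thus "(\<Sum>p | p permutes UNIV. of_int (sign p)*(d k (p k)*(\<Prod>j\<in>UNIV - {k}. A u $ j $ p j))) = det (\<chi> i. if i = k then (\<chi> m. d k m) else row i (A u))"
   unfolding det_def by simp
 qed
 also have "... = (\<Sum>k\<in>UNIV. (\<Sum>m\<in>UNIV. d k m*G $ m $ k)*det (A u))"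
 proof (intro sum.cong refl)
  fix k
  define c where "c = (\<chi> l. \<Sum>m\<in>UNIV. d k m*G $ m $ l)"
  have "(\<Sum>i\<in>UNIV. c $ i *s row i (A u)) = (\<chi> m. d k m)"
  proof -
   have "(\<Sum>i\<in>UNIV. c $ i*A u $ i $ j) = d k j" for j
   proof -
    have "(\<Sum>i\<in>UNIV. c $ i*A u $ i $ j) = (\<Sum>m\<in>UNIV. d k m*(G ** A u) $ m $ j)"
     by (simp add: c_def matrix_matrix_mult_def sum_distrib_left sum_distrib_right mult.assoc) (rule sum.swap)
    thus ?thesis by (simp add: GA mat_def if_distrib[of "%x. _*x"] cong: if_cong)
   qed
   thus ?thesis by (simp add: vec_eq_iff row_def sum_component)
  qed
  hence "det (\<chi> i. if i = k then (\<chi> m. d k m) else row i (A u)) = c $ k*det (A u)"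
   using cramer_lemma_transpose[of k c "A u"] by (simp only:)
  thus "det (\<chi> i. if i = k then (\<chi> m. d k m) else row i (A u)) = (\<Sum>m\<in>UNIV. d k m*G $ m $ k)*det (A u)" by (simp add: c_def)
 qed
 finally show ?thesis unfolding d_def sum_distrib_right[symmetric] by (rule trans[OF _ mult.commute])
qed

locale chart = framed M f R g nabla for M :: "'a::euclidean_space set" and f :: "'i => 'a => 'a" and R g nabla +
 fixes U :: "(real^'n) set" and h :: "real^'n => 'a"
 assumes lp: "local_param M U h"
begin

abbreviation "H \<equiv> fd h"

lemma U: "open U" "smooth_on U h" "w:U ==> h w:M" "w:U ==> inj (H w)" using lp openin_imp_subset unfolding local_param_def by fast+

lemma h_diff: "w:U ==> h differentiable (at w)" using smooth_on_differentiable[OF U(2)] .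

lemma lin_H: "w:U ==> linear (H w)" by (rule fd_linear[OF h_diff])

lemma H_in_T: assumes w: "w:U" shows "H w x:T (h w)"
proof -
 obtain d where d: "d > 0" "ball w d <= U" using U(1) w open_contains_ball by blast
 define e where "e = d/(norm x + 1)"
 have p: "norm x + 1 > 0" using norm_ge_zero[of x] by linarith
 have e: "e > 0" using d p by (simp add: e_def)
 have b: "w + t *R x:U" if "t:{-e<..<e}" for t
 proof -
  have "|t|*norm x <= |t|*(norm x + 1)" by (simp add: distrib_left)
  also have "... < e*(norm x + 1)" using that p by (intro mult_strict_right_mono) auto
  also have "... = d" using p by (simp add: e_def)
  finally show ?thesis using d(2) by (auto simp: subset_iff dist_norm)
 qed
 have s: "smooth_on {-e<..<e} (%t. w + t *R x)"
  by (intro smooth_on_add smooth_on_const smooth_on_bounded_linear[of _ "%t. t *R x"] bounded_linear_scaleR_left) auto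
 have "((%t. h (w + t *R x)) has_vector_derivative H w x) (at 0)"
 proof -
  have "((%t. w + t *R x) has_derivative (%t. t *R x)) (at 0)" by (auto intro!: derivative_eq_intros)
  from has_derivative_compose[OF this, of h "H w"] has_derivative_fd[OF h_diff[OF w]]
  show ?thesis by (simp add: has_vector_derivative_def linear_scale[OF lin_H[OF w]])
 qed
 moreover have "smooth_on {-e<..<e} (%t. h (w + t *R x))" by (rule smooth_on_compose[OF _ U(1) U(2) s]) (use b in auto)
 moreover have "(%t. h (w + t *R x)) ` {-e<..<e} <= M" using b U(3) by auto
 ultimately show ?thesis unfolding tangent_space_def using e by (intro CollectI exI[of _ "%t. h (w + t *R x)"] exI[of _ e]) simp
qed

text \<open>For the inclusion of \<open>T (h u)\<close>, the curve can be pulled back through the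
  inverse of \<open>h\<close>, but that inverse is only known to be continuous. The difference
  quotients of the curve are shown to be relatively close to the range of \<open>H u\<close>; hence
  their limit has distance zero from this closed subspace.\<close>

lemma range_H: assumes u: "u:U" shows "range (H u) = T (h u)"
proof
 show "range (H u) <= T (h u)" using H_in_T[OF u] by auto
 show "T (h u) <= range (H u)"
 proof
  fix v assume "v:T (h u)"
  then obtain c e where c: "e > 0" "smooth_on {-e<..<e} c" "c ` {-e<..<e} <= M" "c 0 = h u" "(c has_vector_derivative v) (at (0::real))"
   unfolding tangent_space_def by blast
  obtain k where k: "homeomorphism U (h ` U) h k" using lp unfolding local_param_def by blast
  obtain Q where Q: "open Q" "h ` U = M \<inter> Q" using lp unfolding local_param_def openin_open by blast
  have ct: "(c \<longlongrightarrow> h u) (at 0)" using has_vector_derivative_continuous[OF c(5)] c(4) by (simp add: isCont_def)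
  have "h u:Q" using Q(2) u by auto
  from topological_tendstoD[OF ct Q(1) this] have "eventually (%t. c t:Q) (at 0)" .
  moreover have "eventually (%t. t:{-e<..<e}) (at (0::real))" using c(1) eventually_at_in_open'[of "{-e<..<e}" "0::real"] by simp
  ultimately have ev: "eventually (%t. c t:h ` U) (at 0)" by eventually_elim (use c(3) Q(2) in auto)
  have kt: "((%t. k (c t)) \<longlongrightarrow> u) (at 0)"
  proof -
   have "continuous_on (h ` U) k" "k (h u) = u" using k u by (auto simp: homeomorphism_def)
   thus ?thesis using continuous_on_tendsto_compose[of "h ` U" k c "h u" "at 0"] ct ev u by auto
  qed
  obtain B where B: "B > 0" "!!x. B*norm x <= norm (H u x)" using linear_inj_bounded_below_pos[OF lin_H[OF u] U(4)[OF u]] by blast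
  have q: "((%t. (c t - h u) /\<^sub>R t) \<longlongrightarrow> v) (at 0)"
  proof (rule LIM_zero_cancel, rule tendsto_norm_zero_cancel)
   have "((%t. norm ((1/norm (t - 0)) *R (c t - (c 0 + (t - 0) *R v)))) \<longlongrightarrow> 0) (at 0)"
    using c(5) unfolding has_vector_derivative_def has_derivative_at2 by (intro tendsto_norm_zero) blast
   moreover have "norm ((1/norm (t - 0)) *R (c t - (c 0 + (t - 0) *R v))) = norm ((c t - h u) /\<^sub>R t - v)" if "t ~= 0" for t
   proof -
    have "(c t - h u) /\<^sub>R t - v = inverse t *R (c t - (c 0 + (t - 0) *R v))"
     using that c(4) by (simp add: scaleR_diff_right scaleR_add_right algebra_simps)
    thus ?thesis by (simp add: divide_inverse)
   qed
   ultimately show "((%t. norm ((c t - h u) /\<^sub>R t - v)) \<longlongrightarrow> 0) (at 0)"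
    by (rule Lim_transform_eventually[OF _ eventually_at_filter[THEN iffD2, OF always_eventually, rule_format]])
  qed
  have le: "infdist v (range (H u)) <= eps*norm v" if eps: "eps > 0" for eps
  proof (rule tendsto_le[OF trivial_limit_at _ tendsto_infdist[OF q, of "range (H u)"]])
   show "((%t. eps*norm ((c t - h u) /\<^sub>R t)) \<longlongrightarrow> eps*norm v) (at 0)" by (intro tendsto_mult tendsto_const tendsto_norm q)
   \<comment> \<open>The bound \<open>B/2\<close> lets the linearisation error be absorbed by the
     lower bound \<open>B\<close> of \<open>H u\<close>; the bound \<open>eps*B/2\<close> turns it
     into an error relative to the increment of the curve.\<close>
   define e' where "e' = min (B/2) (eps*B/2)"
   have e': "e' > 0" "e' <= B/2" "e' <= eps*B/2" using B eps by (auto simp: e'_def)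
   obtain d where d: "d > 0" "!!y. norm (y - u) < d ==> norm (h y - h u - H u (y - u)) <= e'*norm (y - u)"
    using has_derivative_fd[OF h_diff[OF u]] e'(1) unfolding has_derivative_at_alt by blast
   have "eventually (%t. norm (k (c t) - u) < d) (at 0)" using tendstoD[OF kt d(1)] by (simp add: dist_norm)
   thus "eventually (%t. infdist ((c t - h u) /\<^sub>R t) (range (H u)) <= eps*norm ((c t - h u) /\<^sub>R t)) (at 0)" using ev
   proof eventually_elim
    case (elim t)
    let ?y = "k (c t)"
    have hy: "h ?y = c t" using k elim(2) by (auto simp: homeomorphism_def)
    have n1: "norm (c t - h u - H u (?y - u)) <= e'*norm (?y - u)" using d(2)[OF elim(1)] hy by simp
    have "B*norm (?y - u) <= norm (H u (?y - u))" by (rule B(2))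
    also have "... <= norm (c t - h u) + norm (c t - h u - H u (?y - u))" using norm_triangle_ineq4[of "c t - h u" "c t - h u - H u (?y - u)"] by simp
    finally have "B*norm (?y - u) <= norm (c t - h u) + B/2*norm (?y - u)" using n1 mult_right_mono[OF e'(2) norm_ge_zero[of "?y - u"]] by linarith
    hence n2: "B/2*norm (?y - u) <= norm (c t - h u)" by linarith
    have "e'*norm (?y - u) <= eps*(B/2*norm (?y - u))" using mult_right_mono[OF e'(3) norm_ge_zero[of "?y - u"]] by (simp add: mult.assoc)
    also have "... <= eps*norm (c t - h u)" using n2 eps by (intro mult_left_mono) auto
    finally have n3: "norm (c t - h u - H u (?y - u)) <= eps*norm (c t - h u)" using n1 by linarith
    have "infdist ((c t - h u) /\<^sub>R t) (range (H u)) <= dist ((c t - h u) /\<^sub>R t) (H u ((?y - u) /\<^sub>R t))" by (rule infdist_le) auto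
    also have "... = norm (c t - h u - H u (?y - u))*|inverse t|"
     by (simp add: dist_norm linear_scale[OF lin_H[OF u]] scaleR_diff_right[symmetric] del: scaleR_diff_right)
    also have "... <= eps*norm (c t - h u)*|inverse t|" by (intro mult_right_mono n3) auto
    finally show ?case by (simp add: mult_ac)
   qed
  qed
  have "infdist v (range (H u)) <= 0"
  proof (rule field_le_epsilon)
   fix eps :: real assume e: "eps > 0"
   have n: "norm v + 1 > 0" using norm_ge_zero[of v] by linarith
   have "infdist v (range (H u)) <= eps/(norm v + 1)*norm v" using le[of "eps/(norm v + 1)"] e n by simp
   also have "... <= eps" using e n by (simp add: field_simps)
   finally show "infdist v (range (H u)) <= 0 + eps" by simp
  qed
  hence "infdist v (range (H u)) = 0" using infdist_nonneg[of v "range (H u)"] by linarith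
  moreover have "closed (range (H u))" by (intro closed_subspace linear_subspace_image lin_H u subspace_UNIV)
  ultimately show "v:range (H u)" using in_closed_iff_infdist_zero[of "range (H u)" v] by auto
 qed
qed

lemma H_expand: "w:U ==> H w x = (\<Sum>i\<in>UNIV. x $ i *R H w (axis i 1))"
 using linear_sum[OF lin_H, of w "%i. x $ i *R axis i 1" UNIV] linear_scale[OF lin_H]
 by (simp add: basis_expansion[of x, unfolded scalar_mult_eq_scaleR])

definition comp :: "('a => 'a) => real^'n => real^'n" where "comp V w = inv (H w) (V (h w))"

lemma H_comp: "w:U ==> svf V ==> H w (comp V w) = V (h w)" unfolding comp_def using range_H svf(2) U(3) f_inv_into_f[of "V (h w)" "H w" UNIV] by blast

lemma smooth_comp_h: "sm ps ==> smooth_on U (%w. ps (h w))"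
 by (rule smooth_on_cong[OF U(1) _ smooth_on_compose[OF U(1) open_UNIV ext(1) U(2)]]) (auto simp: ext(2) U(3))

lemma smooth_H: "smooth_on U (%w. H w x)" by (rule smooth_on_fd[OF U(2)])

text \<open>The components solve a linear system whose matrix is the Euclidean Gram matrix of the
  coordinate vectors. It depends smoothly on the point and is invertible, so Cramer's rule writes
  the components as quotients of smooth functions.\<close>

lemma smooth_on_comp: assumes V: "svf V" shows "smooth_on U (comp V)"
proof -
 define N where "N w = (\<chi> i j. H w (axis j 1) \<bullet> H w (axis i 1) :: real^'n^'n)" for w
 define b where "b w = (\<chi> i. V (h w) \<bullet> H w (axis i 1))" for w
 have Nx: "N w *v x = (\<chi> i. H w x \<bullet> H w (axis i 1))" if "w:U" for w x
  by (simp add: N_def vec_eq_iff matrix_vector_mult_def H_expand[OF that, of x] inner_sum_left mult.commute)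
 have N0: "det (N w) ~= 0" if w: "w:U" for w
 proof -
  have "x \<bullet> (N w *v x) = H w x \<bullet> H w x" for x
   by (simp add: Nx[OF w] inner_vec_def) (subst (2) H_expand[OF w], simp add: inner_sum_right)
  moreover have "H w x ~= 0" if "x ~= 0" for x using injD[OF U(4)[OF w], of x 0] linear_0[OF lin_H[OF w]] that by auto
  ultimately have "x \<bullet> (N w *v x) > 0" if "x ~= 0" for x using that by simp
  thus ?thesis using det_pos[of "N w"] by simp
 qed
 have eq: "(\<chi> k. det (\<chi> i j. if j = k then b w $ i else N w $ i $ j)/det (N w)) = comp V w" if w: "w:U" for w
  using cramer[OF N0[OF w], of "comp V w" "b w"] by (simp add: Nx[OF w] b_def H_comp[OF w V])
 have sb: "smooth_on U (%w. b w $ i)" for i unfolding b_def using smooth_on_inner[OF U(1) smooth_comp_h[OF svf(1)[OF V]] smooth_H] by simp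
 have sN: "smooth_on U (%w. N w $ i $ j)" for i j unfolding N_def using smooth_on_inner[OF U(1) smooth_H smooth_H] by simp
 have "smooth_on U (%w. \<chi> k. det (\<chi> i j. if j = k then b w $ i else N w $ i $ j)/det (N w))"
 proof (intro smooth_on_vec_lambda smooth_on_divide smooth_on_det U(1) sN N0)
  show "smooth_on U (%w. (\<chi> i j. if j = k then b w $ i else N w $ i $ j) $ i $ j)" for k i j using sb sN by (cases "j = k") auto
 qed
 thus ?thesis by (rule smooth_on_cong[OF U(1), rotated]) (rule eq)
qed

lemma D_chart:
 assumes u: "u:U" and ps: "sm ps" shows "D ps (h u) (H u x) = fd (%w. ps (h w)) u x"
proof -
 have "D ps (h u) (H u x) = fd (ext ps) (h u) (H u x)" by (rule D_ext[OF U(3)[OF u] H_in_T[OF u] ps])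
 also have "... = fd (%w. ext ps (h w)) u x" by (rule fd_compose[symmetric]) (auto intro: h_diff u smooth_diff ext ps)
 also have "... = fd (%w. ps (h w)) u x" by (rule fd_cong_open[OF U(1) u]) (simp add: ext(2)[OF ps] U(3))
 finally show ?thesis .
qed

lemma bracket_chart:
 assumes u: "u:U" and V: "svf V" and W: "svf W"
 shows "lie_bracket M V W (h u) = H u (fd (comp W) u (comp V u)) - H u (fd (comp V) u (comp W u))"
proof -
 have "D W (h u) (V (h u)) = fd (%w. H w (comp W u)) u (comp V u) + H u (fd (comp W) u (comp V u))" if V: "svf V" and W: "svf W" for V W
 proof -
  have "D W (h u) (V (h u)) = fd (%w. W (h w)) u (comp V u)" using D_chart[OF u svf(1)[OF W]] H_comp[OF u V] by metis
  also have "... = fd (%w. H w (comp W w)) u (comp V u)" by (rule fd_cong_open[OF U(1) u]) (simp add: H_comp W)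
  also have "... = fd (%w. H w (comp W u)) u (comp V u) + H u (fd (comp W) u (comp V u))"
   by (rule fd_along_field[OF U(1) u U(2) smooth_on_differentiable[OF smooth_on_comp[OF W] u]])
  finally show ?thesis .
 qed
 thus ?thesis using V W fd_second_symmetric_vector[OF U(1) u U(2), of "comp W u" "comp V u"] by (simp add: lie_bracket_D)
qed

lemma frame_comp:
 assumes u: "u:U" shows "(\<Sum>j\<in>R. g (h u) (f j (h u)) (H u z) *R comp (f j) u) = z"
proof (rule injD[OF U(4)[OF u]])
 show "H u (\<Sum>j\<in>R. g (h u) (f j (h u)) (H u z) *R comp (f j) u) = H u z"
  using frame[OF U(3)[OF u] H_in_T[OF u, of z]] H_comp[OF u svf_f] by (simp add: linear_sum[OF lin_H[OF u]] linear_scale[OF lin_H[OF u]])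
qed

text \<open>The inverse of the Gram matrix in the chart is \<open>\<Sum>\<^sub>j f\<^sub>j f\<^sub>j\<^sup>T\<close>.\<close>

definition Gram :: "real^'n => real^'n^'n" where "Gram w = (\<chi> i j. g (h w) (H w (axis i 1)) (H w (axis j 1)))"
definition Cog :: "real^'n => real^'n^'n" where "Cog w = (\<chi> i j. \<Sum>k\<in>R. comp (f k) w $ i*comp (f k) w $ j)"

lemma g_H: assumes w: "w:U" shows "g (h w) (H w x) (H w y) = (\<Sum>i\<in>UNIV. \<Sum>j\<in>UNIV. x $ i*y $ j*Gram w $ i $ j)"
proof -
 interpret inner_on "T (h w)" "g (h w)" by (rule inner_on_T[OF U(3)[OF w]])
 have "g (h w) (H w x) (H w y) = (\<Sum>i\<in>UNIV. x $ i*g (h w) (H w (axis i 1)) (H w y))"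
  by (subst H_expand[OF w, of x]) (simp add: sum H_in_T[OF w])
 also have "... = (\<Sum>i\<in>UNIV. x $ i*(\<Sum>j\<in>UNIV. y $ j*g (h w) (H w (axis i 1)) (H w (axis j 1))))"
  by (subst H_expand[OF w, of y]) (simp add: sum_right H_in_T[OF w])
 finally show ?thesis by (simp add: Gram_def sum_distrib_left mult.assoc)
qed

lemma Gram_sym: "w:U ==> Gram w $ i $ j = Gram w $ j $ i" using inner_on.sym[OF inner_on_T[OF U(3)]] H_in_T by (simp add: Gram_def)

lemma Cog_Gram: assumes w: "w:U" shows "Cog w ** Gram w = mat 1"
proof -
 have "(\<Sum>i\<in>UNIV. Cog w $ l $ i*Gram w $ i $ m) = (if l = m then 1 else 0)" for l m
 proof -
  have g: "g (h w) (f k (h w)) (H w (axis m 1)) = (\<Sum>i\<in>UNIV. comp (f k) w $ i*Gram w $ i $ m)" if "k:R" for k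
   using g_H[OF w, of "comp (f k) w" "axis m 1"] H_comp[OF w svf_f[OF that]]
   by (simp add: axis_def if_distrib[of "%x. x*_"] if_distrib[of "%x. _*x"] cong: if_cong)
  have "(\<Sum>i\<in>UNIV. Cog w $ l $ i*Gram w $ i $ m) = (\<Sum>k\<in>R. g (h w) (f k (h w)) (H w (axis m 1)) *R comp (f k) w) $ l"
   by (simp add: Cog_def sum_component g sum_distrib_left sum_distrib_right mult_ac) (rule sum.swap)
  also have "... = (if l = m then 1 else 0)" unfolding frame_comp[OF w] by (simp add: axis_def)
  finally show ?thesis .
 qed
 thus ?thesis by (simp add: matrix_matrix_mult_def vec_eq_iff mat_def)
qed

lemma det_Gram: assumes w: "w:U" shows "det (Gram w) > 0"
proof (rule det_pos)
 fix x :: "real^'n" assume x: "x ~= 0"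
 have "x \<bullet> (Gram w *v x) = g (h w) (H w x) (H w x)" by (simp add: g_H[OF w] inner_vec_def matrix_vector_mult_def sum_distrib_left mult_ac)
 moreover have "H w x ~= 0" using injD[OF U(4)[OF w], of x 0] linear_0[OF lin_H[OF w]] x by auto
 ultimately show "x \<bullet> (Gram w *v x) > 0" using inner_on.pos[OF inner_on_T[OF U(3)[OF w]] H_in_T[OF w]] by simp
qed

abbreviation "J \<equiv> vol_coeff g h"

text \<open>The entries of \<open>Cog\<close> are sums of products of smooth components. Expressing
  the volume coefficient through its determinant gives smoothness and a derivative formula without
  differentiating the metric.\<close>

lemma J: assumes w: "w:U" shows "J w = inverse (sqrt (det (Cog w)))" "det (Cog w) > 0" "J w > 0"
proof -
 have "det (Cog w)*det (Gram w) = 1" using Cog_Gram[OF w] det_mul[of "Cog w" "Gram w"] by simp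
 hence "det (Gram w) = inverse (det (Cog w))" using inverse_unique[of "det (Cog w)"] by simp
 moreover have "J w = sqrt (det (Gram w))" by (simp add: vol_coeff_def Gram_def)
 ultimately show "J w = inverse (sqrt (det (Cog w)))" "det (Cog w) > 0" "J w > 0" using det_Gram[OF w] by (simp_all add: real_sqrt_inverse)
qed

lemma smooth_Cog: "smooth_on U (%w. Cog w $ i $ j)" unfolding Cog_def using smooth_on_vec_nth[OF U(1) smooth_on_comp[OF svf_f]]
 by (simp add: smooth_on_sum smooth_on_mult U(1))

lemma smooth_J: "smooth_on U J"
proof (rule smooth_on_cong[OF U(1)])
 show "smooth_on U (%w. inverse (sqrt (det (Cog w))))"
  by (intro smooth_on_inverse smooth_on_sqrt smooth_on_det smooth_Cog U(1)) (use J(2) in "auto simp: less_imp_neq[symmetric]")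
qed (simp add: J)

lemma smooth_Gram: "smooth_on U (%w. Gram w $ k $ j)"
proof (rule smooth_on_cong[OF U(1)])
 show "smooth_on U (%w. det (\<chi> i l. if l = k then axis j 1 $ i else Cog w $ i $ l)/det (Cog w))"
 proof (intro smooth_on_divide smooth_on_det smooth_Cog U(1))
  show "smooth_on U (%w. (\<chi> i l. if l = k then axis j 1 $ i else Cog w $ i $ l) $ i $ l)" for i l
   by (cases "l = k") (simp_all add: smooth_on_const U(1) smooth_Cog)
 qed (use J(2) in force)
 fix w assume w: "w:U"
 have "Cog w *v (\<chi> l. Gram w $ l $ j) = (axis j 1 :: real^'n)" using arg_cong[OF Cog_Gram[OF w], of "%A. A $ _ $ j"]
  by (simp add: vec_eq_iff matrix_matrix_mult_def matrix_vector_mult_def mat_def axis_def)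
 moreover have "det (Cog w) ~= 0" using J(2)[OF w] by simp
 ultimately have "(\<chi> l. Gram w $ l $ j) = (\<chi> k. det (\<chi> i l. if l = k then axis j 1 $ i else Cog w $ i $ l)/det (Cog w))"
  using cramer[of "Cog w" "\<chi> l. Gram w $ l $ j" "axis j 1"] by simp
 from arg_cong[OF this, of "%x. x $ k"]
 show "det (\<chi> i l. if l = k then axis j 1 $ i else Cog w $ i $ l)/det (Cog w) = Gram w $ k $ j" by simp
qed

text \<open>Cauchy-Schwarz in the expansion of a coordinate direction in the frame. The constant
  comes from the Gram matrix on \<open>K\<close> and serves all functions \<open>v\<close>
  simultaneously.\<close>

lemma chart_gradient_bound:
 assumes K: "compact K" "K <= U"
 shows "EX C>=0. ALL w:K. ALL z v. sm v --> |fd (%w. v (h w)) w z| <= C*norm z * sqrt (\<Gamma> v v (h w))"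
proof -
 have "EX C. ALL w:K. |Gram w $ i $ j| <= C" for i j
 proof -
  have "bounded ((%w. Gram w $ i $ j) ` K)"
   by (intro compact_imp_bounded compact_continuous_image K continuous_on_subset[OF smooth_on_imp_continuous[OF smooth_Gram] K(2)])
  thus ?thesis unfolding bounded_iff by auto
 qed
 then obtain C where C: "!!i j w. w:K ==> |Gram w $ i $ j| <= C i j" by metis
 let ?C = "\<Sum>i\<in>UNIV. \<Sum>j\<in>UNIV. |C i j|"
 have "|fd (%w. v (h w)) w z| <= sqrt ?C*norm z * sqrt (\<Gamma> v v (h w))" if w: "w:K" and v: "sm v" for w z v
 proof -
  have wU: "w:U" using w K by blast
  note T = H_in_T[OF wU, of z] and hM = U(3)[OF wU]
  interpret inner_on "T (h w)" "g (h w)" by (rule inner_on_T[OF hM])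
  let ?c = "%i. g (h w) (f i (h w)) (H w z)"
  have "(\<Sum>i\<in>R. (?c i)^2) = g (h w) (H w z) (H w z)"
   using sum[of R "%i. f i (h w)" "H w z" ?c] frame[OF hM T] f_T[OF _ hM] T by (simp add: power2_eq_square)
  also have "... <= ?C*(norm z)^2" unfolding g_H[OF wU] sum_distrib_right
  proof (intro sum_mono)
   fix i j
   have "z $ i*z $ j*Gram w $ i $ j <= |z $ i|*|z $ j|*|Gram w $ i $ j|" by (metis abs_ge_self abs_mult)
   also have "... <= norm z*norm z*|C i j|" using C[OF w, of i j] component_le_norm_cart by (intro mult_mono) auto
   finally show "z $ i*z $ j*Gram w $ i $ j <= |C i j|*(norm z)^2" by (simp add: power2_eq_square mult_ac)
  qed
  finally have c: "(\<Sum>i\<in>R. (?c i)^2) <= ?C*(norm z)^2" .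
  have "(fd (%w. v (h w)) w z)^2 = (\<Sum>i\<in>R. ?c i*X i v (h w))^2" using frame_D[OF hM T v] D_chart[OF wU v, of z] by simp
  also have "... <= (\<Sum>i\<in>R. (?c i)^2)*(\<Sum>i\<in>R. (X i v (h w))^2)" by (rule Cauchy_Schwarz_ineq_sum)
  also have "... <= ?C*(norm z)^2*\<Gamma> v v (h w)"
   using mult_right_mono[OF c, of "\<Gamma> v v (h w)"] by (simp add: carre_def power2_eq_square sum_nonneg)
  finally have "sqrt ((fd (%w. v (h w)) w z)^2) <= sqrt (?C*(norm z)^2*\<Gamma> v v (h w))" by (rule real_sqrt_le_mono)
  thus ?thesis by (simp add: real_sqrt_mult)
 qed
 moreover have "0 <= sqrt ?C" by (intro real_sqrt_ge_zero sum_nonneg) auto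
 ultimately show ?thesis by (intro exI[of _ "sqrt ?C"]) simp
qed

text \<open>\<open>J\<close> is the power -1/2 of \<open>det (Cog w)\<close>. Jacobi's formula gives
  two equal terms, as the Gram matrix is symmetric, and their factor 2 cancels the 1/2 of the
  exponent.\<close>

lemma fd_J:
 assumes u: "u:U" shows "fd J u x = - J u*(\<Sum>j\<in>R. g (h u) (f j (h u)) (H u (fd (comp (f j)) u x)))"
proof -
 have dC: "(%w. Cog w $ i $ j) differentiable (at u)" for i j by (rule smooth_on_differentiable[OF smooth_Cog u])
 have dF: "k:R ==> comp (f k) differentiable (at u)" for k by (rule smooth_on_differentiable[OF smooth_on_comp[OF svf_f] u])
 have dFi: "k:R ==> (%w. comp (f k) w $ i) differentiable (at u)" for k i
  by (rule smooth_on_differentiable[OF smooth_on_vec_nth[OF U(1) smooth_on_comp[OF svf_f]] u])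
 define d where "d k i = fd (comp (f k)) u x $ i" for k i
 let ?F = "%k. comp (f k) u"
 have "fd (%w. Cog w $ i $ j) u x = (\<Sum>k\<in>R. ?F k $ i*d k j + d k i*?F k $ j)" for i j unfolding Cog_def d_def using dF dFi
  by (simp add: fd_sum fd_mult fd_linear_comp[OF bounded_linear_vec_nth])
 moreover have "fd (%w. det (Cog w)) u x = det (Cog u)*(\<Sum>i\<in>UNIV. \<Sum>j\<in>UNIV. fd (%w. Cog w $ i $ j) u x*Gram u $ j $ i)"
  by (rule det_derivative[OF dC Cog_Gram[OF u]])
 moreover have "(\<Sum>i\<in>UNIV. \<Sum>j\<in>UNIV. (\<Sum>k\<in>R. ?F k $ i*d k j + d k i*?F k $ j)*Gram u $ j $ i)
   = 2*(\<Sum>k\<in>R. g (h u) (f k (h u)) (H u (fd (comp (f k)) u x)))"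
 proof -
  have "(\<Sum>i\<in>UNIV. \<Sum>j\<in>UNIV. (\<Sum>k\<in>R. ?F k $ i*d k j + d k i*?F k $ j)*Gram u $ j $ i)
   = (\<Sum>k\<in>R. \<Sum>i\<in>UNIV. \<Sum>j\<in>UNIV. (?F k $ i*d k j + d k i*?F k $ j)*Gram u $ j $ i)"
   unfolding sum_distrib_right by (simp add: sum.swap[of _ R])
  also have "... = (\<Sum>k\<in>R. 2*g (h u) (f k (h u)) (H u (fd (comp (f k)) u x)))"
  proof (rule sum.cong[OF refl])
   fix k assume k: "k:R"
   have 1: "(\<Sum>i\<in>UNIV. \<Sum>j\<in>UNIV. ?F k $ i*d k j*Gram u $ j $ i) = g (h u) (f k (h u)) (H u (fd (comp (f k)) u x))"
    using g_H[OF u, of "?F k" "fd (comp (f k)) u x"] H_comp[OF u svf_f[OF k]] by (simp add: d_def Gram_sym[OF u])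
   have "(\<Sum>i\<in>UNIV. \<Sum>j\<in>UNIV. d k i*?F k $ j*Gram u $ j $ i) = (\<Sum>i\<in>UNIV. \<Sum>j\<in>UNIV. ?F k $ i*d k j*Gram u $ j $ i)"
    by (subst sum.swap) (simp add: mult_ac Gram_sym[OF u])
   thus "(\<Sum>i\<in>UNIV. \<Sum>j\<in>UNIV. (?F k $ i*d k j + d k i*?F k $ j)*Gram u $ j $ i) = 2*g (h u) (f k (h u)) (H u (fd (comp (f k)) u x))"
    using 1 by (simp add: distrib_right sum.distrib)
  qed
  finally show ?thesis by (simp add: sum_distrib_left)
 qed
 ultimately have dd: "fd (%w. det (Cog w)) u x = det (Cog u)*(2*(\<Sum>k\<in>R. g (h u) (f k (h u)) (H u (fd (comp (f k)) u x))))" by simp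
 let ?\<theta> = "%y. inverse (sqrt y)" and ?d = "det (Cog u)"
 have p: "?d > 0" by (rule J(2)[OF u])
 have \<theta>: "(?\<theta> has_field_derivative - (inverse (sqrt ?d)/(2*?d))) (at ?d)"
  using p by (auto intro!: derivative_eq_intros simp: field_simps real_sqrt_mult[symmetric])
 have dd': "(%w. det (Cog w)) differentiable (at u)" by (rule smooth_on_differentiable[OF smooth_on_det[OF U(1) smooth_Cog] u])
 have "fd J u x = fd (%w. ?\<theta> (det (Cog w))) u x" by (rule fd_cong_open[OF U(1) u]) (rule J(1))
 also have "... = - (inverse (sqrt ?d)/(2*?d))*fd (%w. det (Cog w)) u x"
  by (rule fd_eqI[OF has_derivative_compose[OF has_derivative_fd[OF dd'] \<theta>[unfolded has_field_derivative_def]]])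
 also have "... = - J u*(\<Sum>j\<in>R. g (h u) (f j (h u)) (H u (fd (comp (f j)) u x)))" using p by (simp add: dd J(1)[OF u])
 finally show ?thesis .
qed

text \<open>The frame turns the trace of the derivative of \<open>comp V\<close> into products with
  the fields \<open>f j\<close>. The derivative of \<open>J\<close> along \<open>V\<close> supplies
  the same expression with \<open>V\<close> and \<open>f j\<close> exchanged and the opposite sign;
  the difference consists of the coordinate brackets.\<close>

lemma chart_divergence:
 assumes u: "u:U" and V: "svf V"
 shows "(\<Sum>i\<in>UNIV. fd (%w. J w*comp V w $ i) u (axis i 1)) = J u*divg V (h u)"
proof -
 interpret inner_on "T (h u)" "g (h u)" by (rule inner_on_T[OF U(3)[OF u]])
 let ?v = "comp V" and ?F = "%j. comp (f j)"
 note HT = H_in_T[OF u] and lH = lin_H[OF u]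
 have dJ: "J differentiable (at u)" by (rule smooth_on_differentiable[OF smooth_J u])
 have dv: "?v differentiable (at u)" by (rule smooth_on_differentiable[OF smooth_on_comp[OF V] u])
 have dvi: "(%w. ?v w $ i) differentiable (at u)" for i by (rule smooth_on_differentiable[OF smooth_on_vec_nth[OF U(1) smooth_on_comp[OF V]] u])
 have eJ: "(\<Sum>i\<in>UNIV. fd J u (axis i 1)*?v u $ i) = fd J u (?v u)"
  using linear_sum[OF fd_linear[OF dJ], of "%i. ?v u $ i *R axis i 1" UNIV] linear_scale[OF fd_linear[OF dJ]]
  by (simp add: basis_expansion[of "?v u", unfolded scalar_mult_eq_scaleR] mult.commute)
 have "(\<Sum>i\<in>UNIV. fd (%w. J w*?v w $ i) u (axis i 1)) = J u*(\<Sum>i\<in>UNIV. fd ?v u (axis i 1) $ i) + fd J u (?v u)"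
  using dJ dvi dv by (simp add: fd_mult fd_linear_comp[OF bounded_linear_vec_nth] sum.distrib sum_distrib_left eJ)
 also have "(\<Sum>i\<in>UNIV. fd ?v u (axis i 1) $ i) = (\<Sum>j\<in>R. g (h u) (H u (fd ?v u (?F j u))) (f j (h u)))"
 proof -
  have lin: "(\<Sum>i\<in>UNIV. ?F j u $ i *R H u (fd ?v u (axis i 1))) = H u (fd ?v u (?F j u))" for j
   using linear_sum[OF linear_compose[OF fd_linear[OF dv] lH], of "%i. ?F j u $ i *R axis i 1" UNIV]
    linear_scale[OF linear_compose[OF fd_linear[OF dv] lH]] by (simp add: basis_expansion[of "?F j u", unfolded scalar_mult_eq_scaleR] o_def)
  have "fd ?v u (axis i 1) $ i = (\<Sum>j\<in>R. ?F j u $ i*g (h u) (H u (fd ?v u (axis i 1))) (f j (h u)))" for i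
   using arg_cong[OF frame_comp[OF u, of "fd ?v u (axis i 1)"], of "%z. z $ i"] sym[OF HT f_T[OF _ U(3)[OF u]]]
   by (simp add: sum_component mult.commute)
  hence "(\<Sum>i\<in>UNIV. fd ?v u (axis i 1) $ i) = (\<Sum>j\<in>R. \<Sum>i\<in>UNIV. ?F j u $ i*g (h u) (H u (fd ?v u (axis i 1))) (f j (h u)))"
   by (simp add: sum.swap[of _ R])
  also have "... = (\<Sum>j\<in>R. g (h u) (\<Sum>i\<in>UNIV. ?F j u $ i *R H u (fd ?v u (axis i 1))) (f j (h u)))"
   using HT f_T[OF _ U(3)[OF u]] by (simp add: sum)
  finally show ?thesis unfolding lin .
 qed
 also have "fd J u (?v u) = - J u*(\<Sum>j\<in>R. g (h u) (H u (fd (?F j) u (?v u))) (f j (h u)))"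
  using sym[OF HT f_T[OF _ U(3)[OF u]]] by (simp add: fd_J[OF u])
 also have "J u*(\<Sum>j\<in>R. g (h u) (H u (fd ?v u (?F j u))) (f j (h u))) + - J u*(\<Sum>j\<in>R. g (h u) (H u (fd (?F j) u (?v u))) (f j (h u))) = J u*divg V (h u)"
  using HT f_T[OF _ U(3)[OF u]] by (simp add: divg_def bracket_chart[OF u svf_f V] diff sum_subtractf algebra_simps)
 finally show ?thesis .
qed

lemma trace_frame: assumes u: "u:U" shows "(\<Sum>j\<in>R. g (h u) (f j (h u)) (f j (h u))) = CARD('n)"
proof -
 interpret inner_on "T (h u)" "g (h u)" by (rule inner_on_T[OF U(3)[OF u]])
 let ?F = "%j. comp (f j) u"
 have "g (h u) (f j (h u)) (f j (h u)) = (\<Sum>i\<in>UNIV. ?F j $ i*g (h u) (f j (h u)) (H u (axis i 1)))" if "j:R" for j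
  using sum_right[of UNIV "%i. H u (axis i 1)" "f j (h u)" "%i. ?F j $ i"] H_in_T[OF u] f_T[OF that U(3)[OF u]]
   H_expand[OF u, of "?F j"] H_comp[OF u svf_f[OF that]] by simp
 hence "(\<Sum>j\<in>R. g (h u) (f j (h u)) (f j (h u))) = (\<Sum>i\<in>UNIV. (\<Sum>j\<in>R. g (h u) (f j (h u)) (H u (axis i 1)) *R ?F j) $ i)"
  by (simp add: sum_component sum.swap[of _ R] mult.commute)
 thus ?thesis by (simp add: frame_comp[OF u])
qed

end

section \<open>Divergence and Laplace-Beltrami operator\<close>

locale framed_manifold = framed M f R g nabla for M :: "'a::euclidean_space set" and f :: "'i => 'a => 'a" and R g nabla +
 fixes N :: "'n::finite itself"
 assumes manifold: "embedded_submanifold TYPE('n) M"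
begin

abbreviation chart' where "chart' U h == chart M f R g nabla (U :: (real^'n) set) h"

lemma chart_at:
 assumes "p:M" obtains U h u where "chart' U h" "u:U" "h u = p" "local_param M U h"
proof -
 obtain U :: "(real^'n) set" and h where "local_param M U h" "p:h ` U" using assms manifold unfolding embedded_submanifold_def by blast
 thus ?thesis using that framed_axioms unfolding chart_def chart_axioms_def by blast
qed

lemma trace: assumes "p:M" shows "(\<Sum>j\<in>R. g p (f j p) (f j p)) = CARD('n)"
proof -
 obtain U h u where c: "chart' U h" "u:U" "h u = p" and lp: "local_param M U h" using chart_at[OF assms] .
 thus ?thesis using chart.trace_frame[OF c(1,2)] by simp
qed

lemma divergence_eq:
 assumes p: "p:M" and V: "svf V" shows "divergence TYPE('n) M g V p = divg V p"
proof -
 have eq: "divg V p = (\<Sum>i\<in>UNIV. fd (%w. vol_coeff g h w*(inv (fd h w) (V (h w)) $ i)) u (axis i 1))/vol_coeff g h u"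
  if "local_param M U h" "u:U" "h u = p" for U :: "(real^'n) set" and h u
 proof -
  interpret chart M f R g nabla U h using that(1) by unfold_locales
  show ?thesis using chart_divergence[OF that(2) V] J(3)[OF that(2)] that(3) by (simp add: comp_def)
 qed
 obtain U h u where c: "chart' U h" "u:U" "h u = p" and lp: "local_param M U h" using chart_at[OF p] .
 show ?thesis unfolding divergence_def
 proof (rule the_equality)
  fix d assume *: "ALL (U::(real^'n) set) h u. local_param M U h & u:U & h u = p -->
    d = (\<Sum>i\<in>UNIV. fd (%w. vol_coeff g h w*(inv (fd h w) (V (h w)) $ i)) u (axis i 1))/vol_coeff g h u"
  show "d = divg V p" using *[rule_format, OF conjI[OF lp conjI[OF c(2,3)]]] eq[OF lp c(2,3)] by (rule trans[OF _ sym])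
 qed (use eq in blast)
qed

text \<open>The described gradient agrees with \<open>grad\<close> on \<open>M\<close> only, so the
  brackets are compared on \<open>M\<close> before the formula for \<open>divg (grad ps)\<close> is
  used; the constant trace it asks for is the dimension.\<close>

lemma laplace_eq:
 assumes p: "p:M" and ps: "sm ps"
 shows "laplace_beltrami TYPE('n) M g ps p = (\<Sum>i\<in>R. X i (X i ps) p) - D ps p (accel p)"
proof -
 have "gradient M g ps q = grad ps q" if "q:M" for q using gradient[OF ps that] by (simp add: grad_def lie_deriv_def)
 moreover have "svf V ==> (!!q. q:M ==> W q = V q) ==> svf W" for V W unfolding smooth_vector_field_def using sm_cong[of V W] by auto
 ultimately have G: "svf (gradient M g ps)" and e: "!!q. q:M ==> gradient M g ps q = grad ps q" using svf_grad[OF ps] by blast+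
 have "lie_bracket M (f j) (gradient M g ps) p = lie_bracket M (f j) (grad ps) p" if "j:R" for j
  using D_cong[OF p f_T[OF that p] svf(1)[OF G] e] by (simp add: lie_bracket_D e p)
 hence "divg (gradient M g ps) p = divg (grad ps) p" by (simp add: divg_def)
 thus ?thesis using divg_grad[OF p ps trace] by (simp add: laplace_beltrami_def divergence_eq[OF p G])
qed

end

text \<open>Young's inequality, weighted so that the square of \<open>Q\<close> costs exactly
  \<open>2*a*S\<close>.\<close>

lemma cross_term_bound:
 fixes a C n P Q S :: real
 assumes "0 < a" "0 < n" "Q^2 <= n*S" shows "2*C*P*Q <= 2*a*S + C^2*n/(2*a)*P^2"
proof -
 have "0 <= (sqrt (2*a/n)*Q - C*P/sqrt (2*a/n))^2" by simp
 also have "... = 2*a/n*Q^2 + C^2*n/(2*a)*P^2 - 2*C*P*Q" using assms(1,2) by (simp add: power2_diff power_mult_distrib power_divide)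
 also have "2*a/n*Q^2 <= 2*a/n*(n*S)" using assms by (intro mult_left_mono) auto
 finally show ?thesis using assms(2) by simp
qed

section \<open>The operator of the diffusion and Bernstein's estimate\<close>

locale drift = framed_manifold M f R g nabla N for M :: "'a::euclidean_space set" and f :: "'i => 'a => 'a" and R g nabla
  and N :: "'n::finite itself" +
 fixes a :: real and \<phi> :: "'a => real"
 assumes a: "0 < a" and \<phi>: "smooth_map M \<phi>"
begin

definition B :: "'a => 'a" where "B p = - a *R accel p - grad \<phi> p"

lemma svf_B: "svf B" using svf_add[OF svf_cmult[OF svf_accel, of "-a"] svf_cmult[OF svf_grad[OF \<phi>], of "-1"]] by (simp add: B_def[abs_def])

definition L :: "('a => real) => 'a => real" where "L u p = a*(\<Sum>i\<in>R. X i (X i u) p) + D u p (B p)"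

lemma sm_X [intro]: "i:R ==> sm u ==> sm (X i u)" by (rule sm_D[OF svf_f])

lemma sm_L [intro]: "sm u ==> sm (L u)" unfolding L_def[abs_def] by (intro sm_add sm_mult sm_const sm_sum sm_X sm_D svf_B)

lemma D_B:
 assumes p: "p:M" and u: "sm u" shows "D u p (B p) = - a*D u p (accel p) - \<Gamma> \<phi> u p"
proof -
 have B: "B p = (\<Sum>k\<in>{True, False}. (if k then - a else - 1) *R (if k then accel p else grad \<phi> p))" by (simp add: B_def)
 have "D u p (\<Sum>k\<in>{True, False}. (if k then - a else - 1) *R (if k then accel p else grad \<phi> p))
  = (\<Sum>k\<in>{True, False}. (if k then - a else - 1) *R D u p (if k then accel p else grad \<phi> p))"
  by (rule D_linear_arg[OF p u]) (use svf(2) svf_accel svf_grad[OF \<phi>] svf_B p B[symmetric] in auto)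
 thus ?thesis by (simp add: D_grad[OF p \<phi> u] flip: B)
qed

text \<open>The \<open>accel\<close> part of the drift is the difference between the sum of squares
  and the Laplacian; the rest of the drift is the gradient of \<phi>.\<close>

lemma L_laplace: "p:M ==> sm u ==> L u p = a*laplace_beltrami TYPE('n) M g u p - g p (gradient M g \<phi> p) (gradient M g u p)"
proof -
 assume p: "p:M" and u: "sm u"
 have e: "gradient M g ps p = grad ps p" if "sm ps" for ps using gradient[OF that p] by (simp add: grad_def lie_deriv_def)
 have "g p (grad \<phi> p) (grad u p) = \<Gamma> \<phi> u p"
  using gradient_inner[OF \<phi> p svf(2)[OF svf_grad[OF u] p]] D_grad[OF p u \<phi>] by (simp add: grad_def carre_def mult.commute)
 thus ?thesis by (simp add: e \<phi> u laplace_eq[OF p u] L_def D_B[OF p u] algebra_simps)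
qed

lemma L_add:
 assumes p: "p:M" and u: "sm u" and v: "sm v" shows "L (%q. u q + v q) p = L u p + L v p"
proof -
 have "X i (X i (%q. u q + v q)) p = X i (X i u) p + X i (X i v) p" if i: "i:R" for i
 proof -
  have "X i (X i (%q. u q + v q)) p = X i (%q. X i u q + X i v q) p" using i u v by (intro D_cong p f_T sm_X) (auto simp: D_add f_T)
  thus ?thesis using i u v p by (simp add: D_add f_T sm_X)
 qed
 thus ?thesis using p u v svf(2)[OF svf_B p] by (simp add: L_def D_add sum.distrib algebra_simps)
qed

lemma L_mult:
 assumes p: "p:M" and u: "sm u" and v: "sm v"
 shows "L (%q. u q * v q) p = u p*L v p + v p*L u p + 2*a*\<Gamma> u v p"
proof -
 have "X i (X i (%q. u q * v q)) p = u p*X i (X i v) p + v p*X i (X i u) p + 2*(X i u p*X i v p)" if i: "i:R" for i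
 proof -
  have "X i (X i (%q. u q * v q)) p = X i (%q. u q*X i v q + X i u q * v q) p" using i u v by (intro D_cong p f_T sm_X) (auto simp: D_mult f_T)
  thus ?thesis using i u v p by (simp add: D_add D_mult f_T sm_X sm_mult)
 qed
 thus ?thesis using p u v svf(2)[OF svf_B p] by (simp add: L_def D_mult sum.distrib carre_def sum_distrib_left algebra_simps)
qed

lemma L_const: "p:M ==> L (%q. c) p = 0"
proof -
 assume p: "p:M"
 have "X i (X i (%q. c)) p = X i (%q. 0) p" if i: "i:R" for i using i by (intro D_cong p f_T sm_X) (auto simp: D_const f_T)
 thus ?thesis using p svf(2)[OF svf_B p] by (simp add: L_def D_const f_T)
qed

lemma L_sum: "p:M ==> (!!i. i:I ==> sm (u i)) ==> L (%q. \<Sum>i\<in>I. u i q) p = (\<Sum>i\<in>I. L (u i) p)"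
 by (induction I rule: infinite_finite_induct) (auto simp: L_add L_const sm_sum)

definition cf :: "('a => 'a) => 'i => 'i => 'a => real" where "cf V i l p = g p (f l p) (lie_bracket M V (f i) p)"

lemma sm_cf: "svf V ==> i:R ==> l:R ==> sm (cf V i l)" unfolding cf_def[abs_def] by (intro sm_g svf_f svf_bracket)

lemma commute_X:
 assumes p: "p:M" and V: "svf V" and i: "i:R" and u: "sm u"
 shows "D (X i u) p (V p) = X i (%q. D u q (V q)) p + (\<Sum>l\<in>R. cf V i l p*X l u p)"
 using bracket_D[OF p V svf_f[OF i] u] frame_D[OF p svf(2)[OF svf_bracket[OF V svf_f[OF i]] p] u] by (simp add: cf_def)

text \<open>Each exchange of two fields produces first derivatives with coefficients
  \<open>cf\<close>. Moving \<open>X i\<close> past two fields therefore leaves terms of order at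
  most two, with coefficients that are bounded on the compact \<open>M\<close>.\<close>

lemma L_X:
 assumes p: "p:M" and i: "i:R" and u: "sm u"
 shows "L (X i u) p = X i (L u) p + (\<Sum>l\<in>R. cf B i l p*X l u p) + a*(\<Sum>j\<in>R. \<Sum>l\<in>R.
  cf (f j) i l p*X l (X j u) p + X j (cf (f j) i l) p*X l u p + cf (f j) i l p*X j (X l u) p)"
proof -
 have "X j (X j (X i u)) p = X i (X j (X j u)) p + (\<Sum>l\<in>R. cf (f j) i l p*X l (X j u) p + X j (cf (f j) i l) p*X l u p + cf (f j) i l p*X j (X l u) p)"
  if j: "j:R" for j
 proof -
  have "X j (X j (X i u)) p = X j (%q. X i (X j u) q + (\<Sum>l\<in>R. cf (f j) i l q*X l u q)) p"
   by (rule D_cong[OF p f_T[OF j p] sm_X[OF j sm_X[OF i u]]]) (rule commute_X[OF _ svf_f[OF j] i u])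
  also have "... = X j (X i (X j u)) p + (\<Sum>l\<in>R. X j (%q. cf (f j) i l q*X l u q) p)"
   using i j u p by (simp add: D_add D_sum f_T sm_mult sm_cf svf_f sm_X sm_sum)
  also have "... = X j (X i (X j u)) p + (\<Sum>l\<in>R. X j (cf (f j) i l) p*X l u p + cf (f j) i l p*X j (X l u) p)"
   using i j u p by (simp add: D_mult f_T sm_cf svf_f sm_X add.commute)
  also have "X j (X i (X j u)) p = X i (X j (X j u)) p + (\<Sum>l\<in>R. cf (f j) i l p*X l (X j u) p)"
   by (rule commute_X[OF p svf_f[OF j] i sm_X[OF j u]])
  finally show ?thesis by (simp add: sum.distrib)
 qed
 moreover have "D (X i u) p (B p) = X i (%q. D u q (B q)) p + (\<Sum>l\<in>R. cf B i l p*X l u p)" by (rule commute_X[OF p svf_B i u])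
 moreover have "X i (L u) p = a*(\<Sum>j\<in>R. X i (X j (X j u)) p) + X i (%q. D u q (B q)) p" unfolding L_def[abs_def] using i u p svf_B
  by (simp add: D_add D_mult D_const D_sum f_T sm_X sm_sum sm_mult sm_const sm_D)
 ultimately show ?thesis by (simp add: L_def[of "X i u"] sum.distrib distrib_left)
qed

text \<open>The commutators of \<open>L\<close> with the frame contain at most second derivatives, which the term \<open>2 a \<Sum>\<^sub>i \<Gamma> (f\<^sub>i u)\<close> absorbs.\<close>

lemma bernstein:
 "EX A>=0. ALL u. sm u --> (ALL p:M. L (%q. \<Gamma> u u q + A*(u q*u q)) p >= 2*\<Gamma> u (L u) p + 2*A*u p*L u p)"
proof -
 obtain C1 where C1: "C1 >= 0" "!!i l p. i:R ==> l:R ==> p:M ==> |cf B i l p| <= C1"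
  using sm_bounded_family[of "R \<times> R" "%(i, l). cf B i l"] finite_R sm_cf[OF svf_B] by (auto simp: Ball_def)
 obtain C2 where C2: "C2 >= 0" "!!i j l p. i:R ==> j:R ==> l:R ==> p:M ==> |cf (f j) i l p| <= C2"
  using sm_bounded_family[of "R \<times> R \<times> R" "%(i, j, l). cf (f j) i l"] finite_R sm_cf svf_f by (auto simp: Ball_def)
 obtain C3 where C3: "C3 >= 0" "!!i j l p. i:R ==> j:R ==> l:R ==> p:M ==> |X j (cf (f j) i l) p| <= C3"
  using sm_bounded_family[of "R \<times> R \<times> R" "%(i, j, l). X j (cf (f j) i l)"] finite_R sm_X[OF _ sm_cf[OF svf_f]] by (auto simp: Ball_def)
 define n where "n = real (card R) + 1"
 define C where "C = C1 + a*n*C3 + 2*a*C2"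
 have n: "n > 0" "real (card R) <= n" by (auto simp: n_def)
 have C0: "C >= 0" using C1 C2 C3 a n by (simp add: C_def)
 \<comment> \<open>Both leftovers in the squared first derivatives, namely \<open>2*C*P^2\<close>
   and the remainder of Young's inequality, are turned into multiples of \<Gamma> by
   \<open>P^2 <= n*\<Gamma> u u p\<close>; \<open>2*a*A\<close> is the sum of these
   multiples.\<close>
 define A where "A = (2*C*n + C^2*n^2/(2*a)*n)/(2*a)"
 have A: "2*a*A = 2*C*n + C^2*n^2/(2*a)*n" "A >= 0" using a C0 n by (simp_all add: A_def)
 have main: "L (%q. \<Gamma> u u q + A*(u q*u q)) p >= 2*\<Gamma> u (L u) p + 2*A*u p*L u p" if u: "sm u" and p: "p:M" for u p
 proof -
  let ?x = "%i. X i u p" and ?y = "%i j. X i (X j u) p"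
  define P where "P = (\<Sum>i\<in>R. |?x i| )"
  define Q where "Q = (\<Sum>i\<in>R. \<Sum>j\<in>R. |?y i j| )"
  define S where "S = (\<Sum>j\<in>R. \<Sum>i\<in>R. (?y i j)^2)"
  define E where "E i = L (X i u) p - X i (L u) p" for i
  have P0: "P >= 0" "Q >= 0" unfolding P_def Q_def by (auto intro!: sum_nonneg)
  have PG: "P^2 <= n*\<Gamma> u u p"
  proof -
   have "P^2 <= (\<Sum>i\<in>R. |?x i|\<^sup>2)*card R" using Cauchy_Schwarz_ineq_sum[of "%i. |?x i|" "%_. 1" R] by (simp add: P_def)
   also have "... = real (card R)*\<Gamma> u u p" by (simp add: carre_def power2_eq_square)
   also have "... <= n*\<Gamma> u u p" by (intro mult_right_mono n) (auto simp: carre_def intro: sum_nonneg)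
   finally show ?thesis .
  qed
  have QS: "Q^2 <= n^2*S"
  proof -
   have "Q^2 <= (\<Sum>z\<in>R \<times> R. |?y (fst z) (snd z)|\<^sup>2)*real (card (R \<times> R))"
    using Cauchy_Schwarz_ineq_sum[of "%z. |?y (fst z) (snd z)|" "%_. 1" "R \<times> R"] by (simp add: Q_def sum.cartesian_product case_prod_unfold)
   also have "(\<Sum>z\<in>R \<times> R. |?y (fst z) (snd z)|\<^sup>2) = S"
    unfolding S_def by (subst sum.swap) (simp add: sum.cartesian_product case_prod_unfold)
   also have "S*real (card (R \<times> R)) <= S*n^2"
   proof (rule mult_left_mono)
    show "real (card (R \<times> R)) <= n^2" using mult_mono[OF n(2) n(2)] n by (simp add: card_cartesian_product power2_eq_square)
   qed (auto simp: S_def intro!: sum_nonneg)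
   finally show ?thesis by (simp add: mult.commute)
  qed
  have Eb: "|E i| <= C*(P + Q)" if i: "i:R" for i
  proof -
   have m: "|c*z| <= K*|z|" if "|c| <= K" for c z K :: real using that by (simp add: abs_mult mult_right_mono)
   have 1: "|\<Sum>l\<in>R. cf B i l p*?x l| <= C1*P" unfolding P_def sum_distrib_left by (intro order_trans[OF sum_abs] sum_mono m C1 i p)
   have 2: "|\<Sum>j\<in>R. \<Sum>l\<in>R. cf (f j) i l p*?y l j + X j (cf (f j) i l) p*?x l + cf (f j) i l p*?y j l|
    <= (\<Sum>j\<in>R. \<Sum>l\<in>R. C2*|?y l j| + C3*|?x l| + C2*|?y j l| )"
    by (intro order_trans[OF sum_abs] sum_mono order_trans[OF abs_triangle_ineq] add_mono m C2 C3 i p)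
   have 3: "(\<Sum>j\<in>R. \<Sum>l\<in>R. C2*|?y l j| + C3*|?x l| + C2*|?y j l| ) = 2*C2*Q + card R*C3*P"
   proof -
    have "(\<Sum>j\<in>R. \<Sum>l\<in>R. |?y l j| ) = Q" unfolding Q_def by (rule sum.swap)
    thus ?thesis by (simp add: sum.distrib sum_distrib_left[symmetric] P_def Q_def[symmetric])
   qed
   have "|E i| <= C1*P + a*(2*C2*Q + card R*C3*P)"
   proof -
    have "E i = (\<Sum>l\<in>R. cf B i l p*?x l) + a*(\<Sum>j\<in>R. \<Sum>l\<in>R. cf (f j) i l p*?y l j + X j (cf (f j) i l) p*?x l + cf (f j) i l p*?y j l)"
     unfolding E_def L_X[OF p i u] by simp
    moreover have "|z + a*w| <= K + a*K'" if "|z| <= K" "|w| <= K'" for z w K K' :: real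
    proof -
     have "|a*w| <= a*K'" using a that(2) by (simp add: abs_mult)
     thus ?thesis using that(1) by linarith
    qed
    ultimately show ?thesis using 1 2[unfolded 3] by simp
   qed
   also have "... <= C1*P + a*(2*C2*Q + n*C3*P)" using a C3 P0 n(2) by (intro add_left_mono mult_left_mono mult_right_mono) auto
   also have "... <= C*(P + Q)"
   proof -
    have "0 <= C1*Q + a*n*C3*Q + 2*a*C2*P" using C1 C2 C3 a n P0 by simp
    thus ?thesis by (simp add: C_def algebra_simps)
   qed
   finally show ?thesis .
  qed
  have smG: "sm (%q. X i u q*X i u q)" if "i:R" for i by (intro sm_mult sm_X that u)
  have "L (%q. \<Gamma> u u q + A*(u q*u q)) p = (\<Sum>i\<in>R. L (%q. X i u q*X i u q) p) + A*L (%q. u q*u q) p"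
  proof -
   have "L (%q. A*(u q*u q)) p = A*L (%q. u q*u q) p" using L_mult[OF p sm_const sm_mult[OF u u], of A] p by (simp add: L_const carre_def D_const f_T)
   thus ?thesis using u smG by (simp add: carre_def L_add[OF p] L_sum[OF p] sm_sum sm_mult sm_const)
  qed
  also have "(\<Sum>i\<in>R. L (%q. X i u q*X i u q) p) = (\<Sum>i\<in>R. 2*(?x i*X i (L u) p) + 2*(?x i*E i) + 2*a*(\<Sum>j\<in>R. (?y j i)^2))"
   using u by (intro sum.cong refl) (simp add: L_mult[OF p] sm_X E_def carre_def square_simps)
  also have "... = 2*\<Gamma> u (L u) p + 2*(\<Sum>i\<in>R. ?x i*E i) + 2*a*S" by (simp add: sum.distrib sum_distrib_left carre_def S_def)
  also have "L (%q. u q*u q) p = 2*u p*L u p + 2*a*\<Gamma> u u p" by (simp add: L_mult[OF p u u])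
  finally have Lw: "L (%q. \<Gamma> u u q + A*(u q*u q)) p = 2*\<Gamma> u (L u) p + 2*A*u p*L u p
    + (2*(\<Sum>i\<in>R. ?x i*E i) + 2*a*S + 2*a*A*\<Gamma> u u p)" by (simp add: algebra_simps)
  have "|\<Sum>i\<in>R. ?x i*E i| <= (\<Sum>i\<in>R. |?x i|*(C*(P + Q)))"
   by (intro order_trans[OF sum_abs] sum_mono) (simp add: abs_mult mult_left_mono Eb)
  also have "... = C*P^2 + C*P*Q" unfolding sum_distrib_right[symmetric] P_def[symmetric] by (simp add: square_simps)
  finally have x: "2*(\<Sum>i\<in>R. ?x i*E i) >= - (2*C*P^2 + 2*C*P*Q)" by linarith
  have y: "2*C*P*Q <= 2*a*S + C^2*n^2/(2*a)*P^2" by (rule cross_term_bound[OF a _ QS]) (use n in simp)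
  have z: "2*C*P^2 + C^2*n^2/(2*a)*P^2 <= 2*a*A*\<Gamma> u u p"
  proof -
   have "(2*C + C^2*n^2/(2*a))*P^2 <= (2*C + C^2*n^2/(2*a))*(n*\<Gamma> u u p)" using C0 a by (intro mult_left_mono[OF PG]) auto
   thus ?thesis unfolding A(1) by (simp add: algebra_simps)
  qed
  show ?thesis unfolding Lw using x y z by linarith
 qed
 show ?thesis using main A(2) by blast
qed

end

section \<open>Integration on the manifold and the divergence theorem\<close>

lemma smooth_compact_support_bounded:
 fixes G :: "'a::euclidean_space => real"
 assumes "continuous_on UNIV G" "compact K" "!!x. x \<notin> K ==> G x = 0"
 shows "EX C>=0. ALL x. |G x| <= C"
proof -
 have "bounded (G ` K)" using assms continuous_on_subset compact_continuous_image compact_imp_bounded by blast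
 then obtain C where C: "!!x. x:K ==> |G x| <= C" unfolding bounded_iff by auto
 have "|G x| <= max 0 C" for x by (cases "x:K") (use C[of x] assms(3)[of x] in auto)
 thus ?thesis using max.cobounded1 by blast
qed

lemma difference_quotients:
 fixes G :: "'a::euclidean_space => real"
 assumes G: "smooth G" and K: "compact K" "!!x. x \<notin> K ==> G x = 0" and C: "!!x. |fd G x e| <= C"
 shows "(%n. (G (x + (1/real (Suc n)) *R e) - G x)*real (Suc n)) ----> fd G x e"
  "|G (x + s *R e) - G x| <= C*|s|"
proof -
 have d: "((%s. G (x + s *R e)) has_real_derivative fd G (x + s *R e) e) (at s)" for s
 proof -
  have "((%s. x + s *R e) has_derivative (%s. s *R e)) (at s)" by (auto intro!: derivative_eq_intros)
  from has_derivative_compose[OF this has_derivative_fd[OF smooth_diff[OF G]]]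
  show ?thesis by (simp add: has_field_derivative_def linear_scale[OF fd_linear[OF smooth_diff[OF G]]] mult.commute[of _ "fd G _ _"])
 qed
 have "((%h. (G (x + h *R e) - G x)/h) \<longlongrightarrow> fd G x e) (at 0)" using d[of 0] by (simp add: DERIV_def)
 moreover have "filterlim (%n. 1/real (Suc n)) (at 0) sequentially"
  unfolding filterlim_at using LIMSEQ_inverse_real_of_nat by (auto simp: divide_inverse)
 ultimately have "((%n. (G (x + (1/real (Suc n)) *R e) - G x)/(1/real (Suc n))) \<longlongrightarrow> fd G x e) sequentially"
  by (rule filterlim_compose)
 thus "(%n. (G (x + (1/real (Suc n)) *R e) - G x)*real (Suc n)) ----> fd G x e" by (simp del: of_nat_Suc)
 have "norm (G (x + s *R e) - G (x + 0 *R e)) <= C*norm (s - 0)"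
  by (rule field_differentiable_bound[of UNIV "%s. G (x + s *R e)" "%s. fd G (x + s *R e) e"]) (use d C in auto)
 thus "|G (x + s *R e) - G x| <= C*|s|" by simp
qed

lemma integrable_compact_support:
 fixes G :: "'a::euclidean_space => real"
 assumes "continuous_on UNIV G" "compact K" "!!x. x \<notin> K ==> G x = 0"
 shows "integrable lborel G"
proof -
 have "integrable lborel (%x. indicator K x *R G x)" using borel_integrable_compact[OF assms(2) continuous_on_subset[OF assms(1)], of] by simp
 moreover have "(%x. indicator K x *R G x) = G" using assms(3) by (auto simp: fun_eq_iff indicator_def)
 ultimately show ?thesis by simp
qed

lemma integral_translate:
 fixes G :: "'a::euclidean_space => real"
 assumes "G:borel_measurable borel" shows "(LINT x|lborel. G (x + c)) = (LINT x|lborel. G x)"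
proof -
 have "(LINT x|lborel. G x) = (LINT x|(distr lborel borel ((+) c)). G x)" by (simp add: lborel_distr_plus)
 also have "... = (LINT x|lborel. G (c + x))" by (rule integral_distr) (use assms in auto)
 finally show ?thesis by (simp add: add.commute)
qed

text \<open>Difference quotients integrate to zero by translation invariance, and they converge to
  the derivative under the fixed bound \<open>C\<close> on a ball containing all their
  supports.\<close>

lemma integral_derivative_zero:
 fixes G :: "'a::euclidean_space => real"
 assumes G: "smooth G" and K: "compact K" "!!x. x \<notin> K ==> G x = 0"
 shows "integrable lborel (%x. fd G x e)" "(LINT x|lborel. fd G x e) = 0"
proof -
 have fd0: "fd G x e = 0" if "x \<notin> K" for x
  using fd_cong_open[of "- K" x G "%_. 0" e] that K compact_imp_closed[of K] by (simp add: fd_const open_Compl)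
 have cf: "continuous_on UNIV (%x. fd G x e)" by (rule smooth_on_imp_continuous[OF smooth_on_fd[OF G]])
 show "integrable lborel (%x. fd G x e)" by (rule integrable_compact_support[OF cf K(1) fd0])
 obtain C where C: "!!x. |fd G x e| <= C" using smooth_compact_support_bounded[OF cf K(1) fd0] by blast
 obtain b where b: "!!x. x:K ==> norm x <= b" using compact_imp_bounded[OF K(1)] unfolding bounded_iff by blast
 have C0: "0 <= C" using C[of 0] by linarith
 have Gb: "G:borel_measurable borel" by (rule borel_measurable_continuous_onI[OF smooth_on_imp_continuous[OF G]])
 have iG: "integrable lborel G" by (rule integrable_compact_support[OF smooth_on_imp_continuous[OF G] K])
 let ?F = "%n x. (G (x + (1/real (Suc n)) *R e) - G x)*real (Suc n)"
 let ?B = "%x. C*indicator (cball 0 (b + norm e)) x :: real"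
 have Fb: "norm (?F n x) <= ?B x" for n x
 proof (cases "x:cball 0 (b + norm e)")
  case True
  have "|G (x + (1/real (Suc n)) *R e) - G x|*real (Suc n) <= C*|1/real (Suc n)|*real (Suc n)"
   by (intro mult_right_mono difference_quotients(2)[OF G K C]) auto
  thus ?thesis using True by (simp add: abs_mult)
 next
  case False
  have s: "norm ((1/real (Suc n)) *R e) <= norm e" using mult_left_le_one_le[OF norm_ge_zero[of e], of "1/real (Suc n)"] by simp
  have "norm x <= norm (x + (1/real (Suc n)) *R e) + norm e"
   using norm_triangle_ineq4[of "x + (1/real (Suc n)) *R e" "(1/real (Suc n)) *R e"] s by simp
  hence "x \<notin> K" "x + (1/real (Suc n)) *R e \<notin> K" using False b[of x] b[of "x + (1/real (Suc n)) *R e"] norm_ge_zero[of e] by auto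
  thus ?thesis using False K(2) by simp
 qed
 have "(%n. (LINT x|lborel. ?F n x)) ----> (LINT x|lborel. fd G x e)"
 proof (rule integral_dominated_convergence[where w="?B"])
  show "(%x. fd G x e):borel_measurable lborel" using borel_measurable_continuous_onI[OF cf] by simp
  show "?F n:borel_measurable lborel" for n using Gb by measurable
  show "integrable lborel ?B" by (intro integrable_mult_right integrable_real_indicator) (use emeasure_lborel_cball_finite in auto)
  show "AE x in lborel. (%n. ?F n x) ----> fd G x e" by (intro AE_I2 difference_quotients(1)[OF G K C])
  show "AE x in lborel. norm (?F n x) <= ?B x" for n by (intro AE_I2 Fb)
 qed
 moreover have "(LINT x|lborel. ?F n x) = 0" for n
 proof -
  have "integrable lborel (%x. G (x + c))" for c
  proof (rule integrable_compact_support)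
   show "continuous_on UNIV (%x. G (x + c))" by (rule continuous_on_compose2[OF smooth_on_imp_continuous[OF G]]) (auto intro!: continuous_intros)
   show "compact ((%x. x - c) ` K)" by (intro compact_continuous_image K continuous_intros)
   show "G (x + c) = 0" if "x \<notin> (%x. x - c) ` K" for x using that K(2)[of "x + c"] by (auto simp: image_iff algebra_simps)
  qed
  thus ?thesis using integral_translate[OF Gb] iG by (simp add: left_diff_distrib[symmetric] del: of_nat_Suc)
 qed
 ultimately show "(LINT x|lborel. fd G x e) = 0" by (simp add: LIMSEQ_const_iff)
qed

locale weighted = drift M f R g nabla N a \<phi> for M :: "'a::euclidean_space set" and f :: "'i => 'a => 'a" and R g nabla
  and N :: "'n::finite itself" and a \<phi> +
 fixes vol :: "'a measure"
 assumes vol: "riemannian_density TYPE('n) M g vol" and M_ne: "M ~= {}"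
begin

lemma sets_vol: "sets vol = sets (restrict_space borel M)" using vol by (simp add: riemannian_density_def)

lemma space_vol: "space vol = M" using sets_eq_imp_space_eq[OF sets_vol] by (simp add: space_restrict_space)

lemma M_borel: "M:sets borel" using compact by (simp add: compact_imp_closed borel_closed)

lemma rv_cont: "continuous_on M F ==> F:borel_measurable vol" for F :: "'a => 'b::topological_space"
 using borel_measurable_continuous_on_restrict[of M F] measurable_cong_sets[OF sets_vol refl] by blast

lemma rv_sm: "sm u ==> u:borel_measurable vol" for u :: "'a => real" by (rule rv_cont[OF sm_cont])

lemma open_in_sets: "openin (top_of_set M) A ==> A:sets vol"
proof -
 assume "openin (top_of_set M) A"
 then obtain Q where "open Q" "A = M \<inter> Q" unfolding openin_open by blast
 thus ?thesis by (simp add: sets_vol sets_restrict_space)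
qed

context
 fixes U :: "(real^'n) set" and h
 assumes lp: "local_param M U h"
begin

interpretation c: chart M f R g nabla U h using lp by unfold_locales

lemma chart_image: "h ` U:sets vol" "h ` U <= M"
proof -
 have "openin (top_of_set M) (h ` U)" using lp unfolding local_param_def by blast
 thus "h ` U:sets vol" "h ` U <= M" using open_in_sets openin_imp_subset by blast+
qed

lemma chart_measurable: "h:measurable (restrict_space lborel U) vol"
proof -
 have "h:borel_measurable (restrict_space borel U)" by (rule borel_measurable_continuous_on_restrict[OF smooth_on_imp_continuous[OF c.U(2)]])
 hence "h:measurable (restrict_space borel U) (restrict_space borel M)"
  by (rule measurable_restrict_space2[rotated]) (use chart_image(2) in "auto simp: space_restrict_space")
 moreover have "sets (restrict_space lborel U) = sets (restrict_space borel U)" by (rule restrict_space_sets_cong) auto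
 ultimately show ?thesis using measurable_cong_sets[OF _ sets_vol] by blast
qed

lemma J_measurable: "vol_coeff g h:borel_measurable (restrict_space lborel U)"
proof -
 have "vol_coeff g h:borel_measurable (restrict_space borel U)"
  by (rule borel_measurable_continuous_on_restrict[OF smooth_on_imp_continuous[OF c.smooth_J]])
 moreover have "sets (restrict_space lborel U) = sets (restrict_space borel U)" by (rule restrict_space_sets_cong) auto
 ultimately show ?thesis using measurable_cong_sets[OF _ refl] by blast
qed

lemma U_lborel: "U \<inter> space lborel:sets lborel" using c.U(1) by auto

text \<open>The density is prescribed by its values on subsets of chart images. Restated as an
  equality with an image measure, the prescription transfers integrals of all functions at
  once.\<close>

lemma chart_measure:
 "density vol (indicator (h ` U)) = distr (density (restrict_space lborel U) (%u. ennreal (vol_coeff g h u))) vol h" (is "?l = ?r")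
proof (rule measure_eqI)
 note [measurable] = chart_image(1) chart_measurable J_measurable
 show "sets ?l = sets ?r" by simp
 fix A assume "A:sets ?l"
 hence A [measurable]: "A:sets vol" by simp
 have hA: "h -` A \<inter> U:sets (restrict_space lborel U)" using measurable_sets[OF chart_measurable A] by (simp add: space_restrict_space)
 have "emeasure ?l A = emeasure vol (A \<inter> h ` U)"
 proof -
  have "emeasure ?l A = (\<integral>\<^sup>+x. indicator (h ` U) x*indicator A x \<partial>vol)" by (rule emeasure_density) auto
  also have "... = (\<integral>\<^sup>+x. indicator (A \<inter> h ` U) x \<partial>vol)" by (intro nn_integral_cong) (auto split: split_indicator)
  also have "... = emeasure vol (A \<inter> h ` U)" by (rule nn_integral_indicator) auto
  finally show ?thesis .
 qed
 also have "... = (\<integral>\<^sup>+u\<in>U \<inter> h -` (A \<inter> h ` U). ennreal (vol_coeff g h u) \<partial>lborel)"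
  using vol lp A chart_image unfolding riemannian_density_def by blast
 also have "... = (\<integral>\<^sup>+u. ennreal (vol_coeff g h u)*indicator (h -` A \<inter> U) u \<partial>restrict_space lborel U)"
  unfolding nn_integral_restrict_space[OF U_lborel] by (intro nn_integral_cong) (auto split: split_indicator)
 also have "... = emeasure ?r A" using hA by (simp add: emeasure_distr emeasure_density space_restrict_space)
 finally show "emeasure ?l A = emeasure ?r A" .
qed

lemma chart_nn_integral:
 assumes [measurable]: "F:borel_measurable vol"
 shows "(\<integral>\<^sup>+x. indicator (h ` U) x*F x \<partial>vol) = (\<integral>\<^sup>+u\<in>U. ennreal (vol_coeff g h u)*F (h u) \<partial>lborel)"
proof -
 note [measurable] = chart_image(1) chart_measurable J_measurable
 have "(\<integral>\<^sup>+x. indicator (h ` U) x*F x \<partial>vol) = (\<integral>\<^sup>+x. F x \<partial>density vol (indicator (h ` U)))"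
  by (subst nn_integral_density) auto
 also have "... = (\<integral>\<^sup>+u. ennreal (vol_coeff g h u)*F (h u) \<partial>restrict_space lborel U)"
  unfolding chart_measure by (subst nn_integral_distr) (auto simp: nn_integral_density)
 finally show ?thesis by (simp add: nn_integral_restrict_space[OF U_lborel])
qed

lemma chart_integral:
 assumes [measurable]: "F:borel_measurable vol"
 shows "(LINT x|vol. indicator (h ` U) x*F x) = (LINT u|lborel. indicator U u*(vol_coeff g h u*F (h u)))"
proof -
 note [measurable] = chart_image(1) chart_measurable J_measurable
 have J0: "AE u in restrict_space lborel U. 0 <= vol_coeff g h u" by (rule AE_I2) (use c.J(3) in "auto simp: space_restrict_space less_imp_le")
 have "(LINT x|vol. indicator (h ` U) x*F x) = (LINT x|(density vol (%x. ennreal (indicator (h ` U) x))). F x)" by (subst integral_density) auto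
 also have "... = (LINT u|(restrict_space lborel U). vol_coeff g h u*F (h u))"
  unfolding ennreal_indicator chart_measure using J0 by (subst integral_distr) (auto simp: integral_density)
 finally show ?thesis by (simp add: integral_restrict_space[OF U_lborel])
qed

lemma chart_ball:
 assumes u: "u:U"
 obtains e where "e > 0" "cball u e <= U" "openin (top_of_set M) (h ` ball u e)" "emeasure vol (h ` ball u e) < \<infinity>"
proof -
 obtain e where e: "e > 0" "cball u e <= U" using c.U(1) u open_contains_cball by blast
 have "openin (top_of_set U) (ball u e)" using order_trans[OF ball_subset_cball e(2)] by (simp add: openin_open_eq[OF c.U(1)])
 hence o: "openin (top_of_set M) (h ` ball u e)" using lp homeomorphism_imp_open_map openin_trans unfolding local_param_def by blast
 have "continuous_on (cball u e) (vol_coeff g h)" using smooth_on_imp_continuous[OF c.smooth_J] e(2) continuous_on_subset by blast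
 hence "bounded (vol_coeff g h ` cball u e)" using compact_continuous_image compact_imp_bounded compact_cball by blast
 then obtain K where Kb: "ALL y:vol_coeff g h ` cball u e. norm y <= K" unfolding bounded_iff by blast
 have K: "vol_coeff g h w <= K" if "w:cball u e" for w by (rule abs_le_D1[OF bspec[OF Kb imageI[OF that], unfolded real_norm_def]])
 have sub: "h ` ball u e <= h ` U" using e(2) ball_subset_cball[of u e] by blast
 have "emeasure vol (h ` ball u e) = (\<integral>\<^sup>+w\<in>U \<inter> h -` (h ` ball u e). ennreal (vol_coeff g h w) \<partial>lborel)"
  using vol lp open_in_sets[OF o] sub unfolding riemannian_density_def by blast
 also have "... <= (\<integral>\<^sup>+w. ennreal K*indicator (cball u e) w \<partial>lborel)"
 proof (rule nn_integral_mono)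
  fix w
  have "w:ball u e" if "w:U" "h w:h ` ball u e"
  proof -
   obtain k where "homeomorphism U (h ` U) h k" using lp unfolding local_param_def by blast
   hence "inj_on h U" by (metis homeomorphism_def inj_on_inverseI)
   thus ?thesis using that inj_on_image_mem_iff[of h U w "ball u e"] order_trans[OF ball_subset_cball e(2)] by blast
  qed
  thus "ennreal (vol_coeff g h w)*indicator (U \<inter> h -` (h ` ball u e)) w <= ennreal K*indicator (cball u e) w"
   using K[of w] by (auto split: split_indicator intro: ennreal_leI)
 qed
 also have "... = ennreal K*emeasure lborel (cball u e)" by (rule nn_integral_cmult_indicator) auto
 also have "... < \<infinity>" using emeasure_lborel_cball_finite[of u e] by (simp add: ennreal_mult_less_top)
 finally show ?thesis by (rule that[OF e o])
qed

end

text \<open>Every point has a neighbourhood of finite volume, as the volume coefficient is bounded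
  on a closed coordinate ball; finitely many such neighbourhoods cover \<open>M\<close>.\<close>

lemma finite_vol: "finite_measure vol"
proof (rule finite_measureI)
 have "EX Q. open Q & p:Q & emeasure vol (M \<inter> Q) < \<infinity>" if p: "p:M" for p
 proof -
  obtain U h u where c: "chart' U h" "u:U" "h u = p" and lp: "local_param M U h" using chart_at[OF p] .
  obtain e where e: "e > 0" "openin (top_of_set M) (h ` ball u e)" "emeasure vol (h ` ball u e) < \<infinity>" using chart_ball[OF lp c(2)] by metis
  obtain Q where Q: "open Q" "h ` ball u e = M \<inter> Q" using e(2) unfolding openin_open by blast
  have "p:Q" using Q(2) c(3) e(1) by (metis IntD2 centre_in_ball image_eqI)
  thus ?thesis using Q e(3) by metis
 qed
 then obtain Q where Q: "!!p. p:M ==> open (Q p) & p:Q p & emeasure vol (M \<inter> Q p) < \<infinity>" by metis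
 hence "M <= (\<Union>p\<in>M. Q p)" by blast
 then obtain I where I: "I <= M" "finite I" "M <= (\<Union>p\<in>I. Q p)" using compactE_image[OF compact, of M Q] Q by metis
 have s: "M \<inter> Q p:sets vol" if "p:I" for p using Q[of p] I that by (intro open_in_sets) (auto simp: openin_open)
 have "emeasure vol (space vol) <= emeasure vol (\<Union>p\<in>I. M \<inter> Q p)"
  using I(3) by (intro emeasure_mono sets.finite_UN I(2) s) (auto simp: space_vol)
 also have "... <= (\<Sum>p\<in>I. emeasure vol (M \<inter> Q p))" using s I(2) by (intro emeasure_subadditive_finite) auto
 also have "... < \<infinity>" using Q I by (auto simp: less_top[symmetric] subset_iff)
 finally show "emeasure vol (space vol) ~= \<infinity>" by simp
qed

sublocale vol: finite_measure vol by (rule finite_vol)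

lemma integrable_sm: "sm u ==> integrable vol u" for u :: "'a => real"
proof -
 assume u: "sm u"
 obtain C where "!!x. x:M ==> norm (u x) <= C" using sm_bounded[OF u] by metis
 thus ?thesis by (intro vol.integrable_const_bound[where B=C] rv_sm[OF u]) (auto simp: space_vol)
qed

lemma sm_divg: "svf V ==> sm (divg V)" unfolding divg_def[abs_def] by (intro sm_sum sm_g svf_bracket svf_f)

lemma divg_cong: "svf V ==> (!!q. q:M ==> V q = W q) ==> p:M ==> divg V p = divg W p"
 unfolding divg_def using D_cong[OF _ f_T svf(1)] by (simp add: lie_bracket_D)

text \<open>A partition of unity splits \<open>V\<close> into fields supported in single charts.
  There the divergence times the volume coefficient is a sum of partial derivatives of compactly
  supported functions, whose integrals vanish.\<close>

theorem divergence_theorem: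
 assumes V: "svf V" shows "(LINT p|vol. divg V p) = 0"
proof -
 have "EX e>0. EX (U :: (real^'n) set) h. local_param M U h & M \<inter> cball p e <= h ` U" if p: "p:M" for p
 proof -
  obtain U h u where c: "chart' U h" "u:U" "h u = p" and lp: "local_param M U h" using chart_at[OF p] .
  obtain Q where Q: "open Q" "h ` U = M \<inter> Q" using lp unfolding local_param_def openin_open by blast
  then obtain e where "e > 0" "cball p e <= Q" using c open_contains_cball by blast
  thus ?thesis using Q lp by blast
 qed
 then obtain e and U :: "'a => (real^'n) set" and h where e: "!!p. p:M ==> e p > 0"
  "!!p. p:M ==> local_param M (U p) (h p) & M \<inter> cball p (e p) <= h p ` U p" by metis
 obtain I xi where I: "finite I" "I <= M" "!!p. p:I ==> smooth (xi p)"
  "!!p x. p:I ==> x \<notin> ball p (e p) ==> xi p x = (0::real)" "!!x. x:M ==> (\<Sum>p\<in>I. xi p x) = 1"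
  by (rule smooth_partition[OF compact, of e]) (use e(1) in blast, blast)
 have sx: "sm (xi p)" if "p:I" for p by (rule smI[OF I(3)[OF that]]) simp
 define Z where "Z p q = xi p q *R V q" for p q
 have Z: "svf (Z p)" if "p:I" for p unfolding Z_def[abs_def] by (rule svf_scaleR[OF sx[OF that] V])
 have "(LINT q|vol. divg (Z p) q) = 0" if p: "p:I" for p
 proof -
  have lp: "local_param M (U p) (h p)" and hU: "M \<inter> cball p (e p) <= h p ` U p" using e I p by auto
  interpret c: chart M f R g nabla "U p" "h p" using lp by unfold_locales
  obtain k where k: "homeomorphism (U p) (h p ` U p) (h p) k" using lp unfolding local_param_def by blast
  let ?U = "U p" and ?h = "h p" and ?K = "k ` (M \<inter> cball p (e p))"
  let ?J = "vol_coeff g ?h"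
  have kh: "k (?h u) = u" if "u:?U" for u using k that by (auto simp: homeomorphism_def)
  have hk: "?h (k y) = y" "k y:?U" if "y:?h ` ?U" for y using k that by (auto simp: homeomorphism_def)
  have Kc: "compact ?K" using k hU compact by (intro compact_continuous_image compact_Int) (auto simp: homeomorphism_def intro: continuous_on_subset)
  have KU: "?K <= ?U" using hk hU by blast
  have out: "xi p (?h u) = 0" if "u:?U" "u \<notin> ?K" for u
   using I(4)[OF p, of "?h u"] that kh[OF that(1)] c.U(3)[OF that(1)] ball_subset_cball[of p "e p"] by (metis IntI image_eqI subsetD)
  define G where "G i u = (if u:?U then ?J u*c.comp (Z p) u $ i else 0)" for i u
  have G0: "G i u = 0" if "u \<notin> ?K" for i u
  proof (cases "u:?U")
   case True
   have "inv (fd ?h u) 0 = 0" using c.U(4)[OF True] linear_0[OF c.lin_H[OF True]] by (metis inv_f_f)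
   thus ?thesis using out[OF True that] by (simp add: G_def c.comp_def Z_def)
  qed (simp add: G_def)
  have Gs: "smooth (G i)" for i
  proof (rule smooth_on_zero_extend[OF c.U(1) compact_imp_closed[OF Kc] KU])
   show "smooth_on ?U (G i)"
    by (rule smooth_on_cong[OF c.U(1) _ smooth_on_mult[OF c.U(1) c.smooth_J smooth_on_vec_nth[OF c.U(1) c.smooth_on_comp[OF Z[OF p]], of i]]])
     (simp add: G_def)
  qed (rule G0)
  have supp: "divg (Z p) q = 0" if q: "q:M" "q \<notin> ?h ` ?U" for q
  proof -
   have "q:- cball p (e p)" using q hU by blast
   moreover have "xi p y = 0" if "y:- cball p (e p)" for y using I(4)[OF p, of y] that ball_subset_cball[of p "e p"] by blast
   ultimately have "xi p q = 0" "D (xi p) q (V q) = 0"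
    using D_fd[OF q(1) svf(2)[OF V q(1)] I(3)[OF p]] fd_cong_open[of "- cball p (e p)" q "xi p" "%_. 0"] by (auto simp: fd_const open_Compl)
   thus ?thesis using divg_mult[OF q(1) V sx[OF p]] by (simp add: Z_def[abs_def])
  qed
  have "(LINT q|vol. divg (Z p) q) = (LINT q|vol. indicator (?h ` ?U) q*divg (Z p) q)"
   by (intro lint_cong refl) (use supp in "auto simp: space_vol indicator_def")
  also have "... = (LINT u|lborel. indicator ?U u*(?J u*divg (Z p) (?h u)))" by (rule chart_integral[OF lp rv_sm[OF sm_divg[OF Z[OF p]]]])
  also have "... = (LINT u|lborel. (\<Sum>i\<in>UNIV. fd (G i) u (axis i 1)))"
  proof (intro lint_cong refl)
   fix u
   show "indicator ?U u*(?J u*divg (Z p) (?h u)) = (\<Sum>i\<in>UNIV. fd (G i) u (axis i 1))"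
   proof (cases "u:?U")
    case True
    have "fd (G i) u (axis i 1) = fd (%w. ?J w*c.comp (Z p) w $ i) u (axis i 1)" for i by (rule fd_cong_open[OF c.U(1) True]) (simp add: G_def)
    thus ?thesis using c.chart_divergence[OF True Z[OF p]] True by simp
   next
    case False
    hence "u:- ?K" using KU by blast
    hence "fd (G i) u (axis i 1) = 0" for i
     using fd_cong_open[of "- ?K" u "G i" "%_. 0"] G0 compact_imp_closed[OF Kc] by (simp add: fd_const open_Compl)
    thus ?thesis using False by simp
   qed
  qed
  also have "... = 0" using integral_derivative_zero[OF Gs Kc G0] by (simp add: lint_sum)
  finally show ?thesis .
 qed
 moreover have "(LINT q|vol. divg V q) = (LINT q|vol. (\<Sum>p\<in>I. divg (Z p) q))"
 proof (intro lint_cong refl)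
  fix q assume "q:space vol"
  hence q: "q:M" by (simp add: space_vol)
  have "divg V q = divg (%q. \<Sum>p\<in>I. Z p q) q" by (rule divg_cong[OF V _ q]) (simp add: Z_def scaleR_sum_left[symmetric] I(5))
  also have "... = (\<Sum>p\<in>I. divg (Z p) q)" by (rule divg_sum[OF q Z])
  finally show "divg V q = (\<Sum>p\<in>I. divg (Z p) q)" .
 qed
 ultimately show ?thesis using integrable_sm[OF sm_divg[OF Z]] by (simp add: lint_sum)
qed

definition rho :: "'a => real" where "rho p = exp (- \<phi> p/a)"

lemma rho: "sm rho" "rho p > 0" using sm_exp[OF sm_cmult[OF \<phi>, of "- 1/a"]] by (simp_all add: rho_def[abs_def])

text \<open>\<open>rho*L u\<close> is the divergence of \<open>a*rho\<close> times the gradient of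
  \<open>u\<close>: differentiating \<open>rho\<close> produces exactly the term with the gradient
  of \<phi>.\<close>

lemma integral_L:
 assumes u: "sm u" shows "(LINT p|vol. rho p*L u p) = 0"
proof -
 have "(LINT p|vol. rho p*L u p) = (LINT p|vol. divg (%q. (a*rho q) *R grad u q) p)"
 proof (intro lint_cong refl)
  fix p assume "p:space vol"
  hence p: "p:M" by (simp add: space_vol)
  note T = svf(2)[OF svf_grad[OF u] p]
  have "D rho p (grad u p) = - rho p/a*D \<phi> p (grad u p)" unfolding rho_def[abs_def]
   by (rule D_comp[OF p T \<phi>, of "%x. exp (- x/a)"]) (use a in "auto intro!: smooth_on_exp smooth_on_divide smooth_on_uminus smooth_on_ident smooth_on_const derivative_eq_intros")
  hence "D (%q. a*rho q) p (grad u p) = - rho p*\<Gamma> u \<phi> p" using D_cmult[OF p T rho(1), of a] a by (simp add: D_grad[OF p u \<phi>])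
  thus "rho p*L u p = divg (%q. (a*rho q) *R grad u q) p"
   using divg_mult[OF p svf_grad[OF u] sm_mult[OF sm_const rho(1)], of a] divg_grad[OF p u trace]
   by (simp add: L_def D_B[OF p u] carre_def algebra_simps)
 qed
 also have "... = 0" by (intro divergence_theorem svf_scaleR svf_grad u sm_mult sm_const rho(1))
 finally show ?thesis .
qed

text \<open>As \<open>rho\<close> is positive, a vanishing integral would make \<open>vol\<close>
  zero, and then the volume coefficient, positive on the open parameter domain of some chart, would
  force that domain to be a null set.\<close>

lemma mass_pos: "(LINT p|vol. rho p) > 0"
proof (rule ccontr)
 assume "\<not> ?thesis"
 moreover have "(LINT p|vol. rho p) >= 0" by (rule integral_nonneg_AE) (simp add: less_imp_le rho)
 ultimately have "(LINT p|vol. rho p) = 0" by linarith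
 hence "AE p in vol. rho p = 0" using integral_nonneg_eq_0_iff_AE[OF integrable_sm[OF rho(1)]] rho(2) by (simp add: less_imp_le)
 hence F: "AE p in vol. False" using rho(2) by (auto elim!: eventually_mono simp: less_imp_neq[symmetric])
 obtain p where p: "p:M" using M_ne by blast
 obtain U h u where c: "chart' U h" "u:U" "h u = p" and lp: "local_param M U h" using chart_at[OF p] .
 interpret c: chart M f R g nabla U h by (rule c(1))
 have "(\<integral>\<^sup>+x. indicator (h ` U) x*1 \<partial>vol) = (\<integral>\<^sup>+x. 0 \<partial>vol)" using F by (intro nn_integral_cong_AE) (auto elim: eventually_mono)
 hence z: "(\<integral>\<^sup>+w\<in>U. ennreal (vol_coeff g h w) \<partial>lborel) = 0" using chart_nn_integral[OF lp, of "%_. 1"] by simp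
 have "(%w. ennreal (vol_coeff g h w)*indicator U w):borel_measurable lborel"
  using J_measurable[OF lp] borel_measurable_restrict_space_iff_ennreal[OF U_lborel[OF lp], of "%w. ennreal (vol_coeff g h w)"] by simp
 hence "AE w in lborel. ennreal (vol_coeff g h w)*indicator U w = 0" using z by (simp add: nn_integral_0_iff_AE)
 hence "AE w in lborel. w \<notin> U" by eventually_elim (use c.J(3) in "auto split: split_indicator_asm simp: ennreal_eq_0_iff not_le[symmetric]")
 hence "U:null_sets lborel" using AE_iff_null_sets[of U lborel] c.U(1) by simp
 hence "negligible U" by (simp add: negligible_iff_null_sets null_sets_completionI)
 thus False using open_not_negligible[OF c.U(1)] c(2) by blast
qed

definition "\<mu> = density vol (%x. ennreal (inverse (LINT p|vol. rho p)*rho x))"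

lemma \<mu>: "prob_space \<mu>" "sets \<mu> = sets (restrict_space borel M)"
 and integral_\<mu>: "u:borel_measurable vol ==> (LINT x|\<mu>. u x) = (LINT p|vol. rho p*u p)/(LINT p|vol. rho p)" for u :: "'a => real"
proof -
 have m: "rho:borel_measurable vol" by (rule rv_sm[OF rho(1)])
 show i: "(LINT x|\<mu>. u x) = (LINT p|vol. rho p*u p)/(LINT p|vol. rho p)" if "u:borel_measurable vol" for u :: "'a => real"
 proof -
  let ?c = "inverse (LINT p|vol. rho p)"
  have "(LINT x|\<mu>. u x) = (LINT x|vol. (?c*rho x) *R u x)"
   unfolding \<mu>_def using that m mass_pos rho(2) by (intro integral_density) (auto simp: less_imp_le)
  also have "... = (LINT x|vol. ?c*(rho x*u x))" by (simp add: mult.assoc)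
  also have "... = ?c*(LINT x|vol. rho x*u x)" by (rule integral_mult_right_zero)
  finally show ?thesis by (simp only: divide_inverse mult.commute)
 qed
 show "sets \<mu> = sets (restrict_space borel M)" by (simp add: \<mu>_def sets_vol)
 show "prob_space \<mu>"
 proof
  have "emeasure \<mu> (space \<mu>) = (\<integral>\<^sup>+x. ennreal (inverse (LINT p|vol. rho p)*rho x) \<partial>vol)"
   unfolding \<mu>_def using m by (subst emeasure_density) (auto intro!: nn_integral_cong)
  also have "... = ennreal (LINT x|vol. inverse (LINT p|vol. rho p)*rho x)"
   using mass_pos rho(2) by (intro nn_integral_eq_integral) (auto intro!: integrable_sm rho(1) simp: less_imp_le)
  also have "... = 1" using mass_pos by simp
  finally show "emeasure \<mu> (space \<mu>) = 1" .
 qed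
qed

lemma integral_\<mu>_L: "sm u ==> (LINT x|\<mu>. L u x) = 0" by (simp add: integral_\<mu> rv_sm sm_L integral_L)

text \<open>On a compact part of a chart the density of \<mu> is bounded below, so smallness of an
  integral against \<mu> passes to Lebesgue measure in coordinates. The constant is independent of
  \<open>u\<close>.\<close>

lemma chart_lower_bound:
 assumes lp: "local_param M U h" and K: "compact K" "K <= (U :: (real^'n) set)"
 shows "EX C. ALL u :: 'a => real. sm u --> (ALL x:M. 0 <= u x) --> (LINT w|lborel. indicator K w*u (h w)) <= C*(LINT x|\<mu>. u x)"
proof -
 interpret c: chart M f R g nabla U h using lp by unfold_locales
 let ?Z = "(LINT p|vol. rho p)"
 have cont: "continuous_on U (%w. vol_coeff g h w*rho (h w))"
  by (rule smooth_on_imp_continuous[OF smooth_on_mult[OF c.U(1) c.smooth_J c.smooth_comp_h[OF rho(1)]]])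
 obtain m where m: "m > 0" "!!w. w:K ==> m <= vol_coeff g h w*rho (h w)"
 proof (cases "K = {}")
  case False
  obtain w where "w:K" "ALL y:K. vol_coeff g h w*rho (h w) <= vol_coeff g h y*rho (h y)"
   using continuous_attains_inf[OF K(1) False continuous_on_subset[OF cont K(2)]] by blast
  thus ?thesis using that[of "vol_coeff g h w*rho (h w)"] c.J(3) rho(2) K(2) by auto
 qed (auto intro: that[of 1])
 have "(LINT w|lborel. indicator K w*u (h w)) <= ?Z/m*(LINT x|\<mu>. u x)" if u: "sm u" "ALL x:M. 0 <= u x" for u
 proof -
  let ?F = "%x. rho x*u x"
  have mF: "?F:borel_measurable vol" by (intro rv_sm sm_mult rho u)
  have cu: "continuous_on K (%w. u (h w))" by (rule continuous_on_subset[OF smooth_on_imp_continuous[OF c.smooth_comp_h[OF u(1)]] K(2)])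
  have iK: "integrable lborel (%w. indicator K w*u (h w))" using borel_integrable_compact[OF K(1) cu] by simp
  have nn: "0 <= indicator K w*u (h w)" for w using u(2) c.U(3) K(2) by (auto split: split_indicator)
  have "ennreal (m*(LINT w|lborel. indicator K w*u (h w))) = (\<integral>\<^sup>+w. ennreal (m*(indicator K w*u (h w))) \<partial>lborel)"
   using iK nn m(1) by (subst nn_integral_eq_integral) auto
  also have "... <= (\<integral>\<^sup>+w\<in>U. ennreal (vol_coeff g h w)*ennreal (?F (h w)) \<partial>lborel)"
  proof (rule nn_integral_mono)
   fix w
   have "m*u (h w) <= vol_coeff g h w*(rho (h w)*u (h w))" if "w:K"
    using mult_right_mono[OF m(2)[OF that], of "u (h w)"] u(2) c.U(3) K(2) that by (auto simp: mult.assoc)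
   thus "ennreal (m*(indicator K w*u (h w))) <= ennreal (vol_coeff g h w)*ennreal (?F (h w))*indicator U w"
    using K(2) c.J(3)[of w] c.U(3)[of w] u(2) rho(2)[of "h w"]
    by (auto split: split_indicator simp: ennreal_mult[symmetric] less_imp_le intro!: ennreal_leI)
  qed
  also have "... = (\<integral>\<^sup>+x. indicator (h ` U) x*ennreal (?F x) \<partial>vol)" by (rule chart_nn_integral[OF lp, symmetric]) (use mF in measurable)
  also have "... <= (\<integral>\<^sup>+x. ennreal (?F x) \<partial>vol)" by (intro nn_integral_mono) (auto split: split_indicator)
  also have "... = ennreal (LINT x|vol. ?F x)"
   using u rho(2) by (intro nn_integral_eq_integral integrable_sm sm_mult rho) (auto simp: space_vol less_imp_le)
  finally have "m*(LINT w|lborel. indicator K w*u (h w)) <= (LINT x|vol. ?F x)"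
   using u rho(2) by (subst (asm) ennreal_le_iff) (auto intro!: integral_nonneg_AE AE_I2 simp: space_vol less_imp_le)
  thus ?thesis using m(1) mass_pos by (simp add: integral_\<mu> rv_sm u field_simps)
 qed
 thus ?thesis by (intro exI[of _ "?Z/m"] allI impI)
qed

end

subsection \<open>Convergence in probability\<close>

lemma null_over_Suc: "(%n. c/real (Suc n)) ----> 0" for c :: real
 by (intro real_tendsto_divide_at_top[OF tendsto_const] filterlim_compose[OF filterlim_real_sequentially filterlim_Suc])

lemma null_sandwich:
 fixes f g :: "nat => real"
 assumes "!!n. 0 <= f n" "!!n. f n <= g n" "g ----> 0" shows "f ----> 0"
 by (rule real_tendsto_sandwich[OF always_eventually always_eventually tendsto_const assms(3)]) (use assms in auto)

text \<open>The bounded metric \<open>E min 1 |X|\<close> turns convergence in probability into convergence of expectations.\<close>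

context prob_space
begin

abbreviation rv :: "('a => real) => bool" where "rv X \<equiv> X:borel_measurable M"

definition pnorm :: "('a => real) => real" where "pnorm X = (LINT v|M. min 1 |X v| )"

definition pnull :: "(nat => 'a => real) => bool" where
 "pnull S <-> (ALL n. rv (S n)) & (%n. pnorm (S n)) ----> 0"

abbreviation off where "off e Q == EX B:events. prob B <= e & (ALL w:space M - B. Q w)"

definition ptight :: "(nat => 'a => real) => bool" where
 "ptight S <-> (ALL n. rv (S n)) & (ALL eps>0. EX K>=1. ALL n. prob {v:space M. |S n v| > K} <= eps)"

lemma integrable_min1 [simp]: "rv X ==> integrable M (%v. min 1 |X v| )" by (rule integrable_const_bound[where B=1]) auto

lemma integrable_ind: "B:events ==> integrable M (indicator B :: 'a => real)" by (simp add: less_top[symmetric])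

lemma pnorm_nonneg: "0 <= pnorm X" unfolding pnorm_def by (rule integral_nonneg_AE) simp

lemma pnorm_mono_AE:
 assumes "rv X" "rv Y" "AE v in M. |X v| <= |Y v|" shows "pnorm X <= pnorm Y" unfolding pnorm_def using assms by (intro integral_mono_AE) auto

lemma pnorm_add:
 assumes "rv X" "rv Y" shows "pnorm (%v. X v + Y v) <= pnorm X + pnorm Y"
proof -
 have "pnorm (%v. X v + Y v) <= (LINT v|M. min 1 |X v| + min 1 |Y v| )" unfolding pnorm_def using assms by (intro integral_mono) auto
 also have "... = pnorm X + pnorm Y" unfolding pnorm_def using assms by (intro Bochner_Integration.integral_add) auto
 finally show ?thesis .
qed

lemma pnorm_le_L1:
 assumes "integrable M X" shows "pnorm X <= (LINT v|M. |X v| )" unfolding pnorm_def using assms by (intro integral_mono) auto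

lemma pnorm_le_prob:
 assumes "rv X" "0 <= eps" shows "pnorm X <= eps + prob {v:space M. |X v| > eps}"
proof -
 have [measurable]: "rv X" by fact
 have "pnorm X <= (LINT v|M. eps + indicator {v:space M. |X v| > eps} v)" unfolding pnorm_def
 proof (rule integral_mono)
  have "{v:space M. |X v| > eps}:events" by measurable
  thus "integrable M (%v. eps + indicator {v:space M. |X v| > eps} v)" by (intro Bochner_Integration.integrable_add integrable_const integrable_ind)
 qed (use assms in "auto simp: indicator_def")
 also have "... = eps + prob {v:space M. |X v| > eps}" by (subst Bochner_Integration.integral_add) (auto simp: prob_space intro!: integrable_ind)
 finally show ?thesis .
qed

lemma pnullD: "pnull S ==> rv (S n)" "pnull S ==> (%n. pnorm (S n)) ----> 0" by (auto simp: pnull_def)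

lemma ptightD: "ptight S ==> rv (S n)" by (auto simp: ptight_def)

lemma pnull_mono:
 assumes "pnull T" "!!n. rv (S n)" "!!n. AE v in M. |S n v| <= |T n v|" shows "pnull S" unfolding pnull_def
proof (intro conjI allI assms(2))
 have "pnorm (S n) <= pnorm (T n)" for n by (rule pnorm_mono_AE[OF assms(2) pnullD(1)[OF assms(1)] assms(3)])
 thus "(%n. pnorm (S n)) ----> 0" by (rule null_sandwich[OF pnorm_nonneg _ pnullD(2)[OF assms(1)]])
qed

lemma pnull_add:
 assumes "pnull S" "pnull T" shows "pnull (%n v. S n v + T n v)"
proof -
 have "(%n. pnorm (S n) + pnorm (T n)) ----> 0 + 0" by (intro tendsto_add pnullD assms)
 hence lim: "(%n. pnorm (S n) + pnorm (T n)) ----> 0" by simp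
 have "(%n. pnorm (%v. S n v + T n v)) ----> 0"
  by (rule null_sandwich[OF pnorm_nonneg pnorm_add[OF pnullD(1)[OF assms(1)] pnullD(1)[OF assms(2)]] lim])
 thus ?thesis using pnullD(1)[OF assms(1)] pnullD(1)[OF assms(2)] by (auto simp: pnull_def)
qed

lemma pnull_zero: "pnull (%n v. 0)" by (simp add: pnull_def pnorm_def)

lemma pnull_sum:
 assumes "finite A" "!!a. a:A ==> pnull (S a)" shows "pnull (%n v. \<Sum>a\<in>A. S a n v)"
 using assms by (induction A rule: finite_induct) (auto intro!: pnull_add pnull_zero)

lemma pnull_L1:
 assumes "!!n. integrable M (S n)" "(%n. (LINT v|M. |S n v| )) ----> 0" shows "pnull S" unfolding pnull_def
proof (intro conjI allI)
 show "rv (S n)" for n using assms(1) by (rule borel_measurable_integrable)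
 show "(%n. pnorm (S n)) ----> 0" by (rule null_sandwich[OF pnorm_nonneg pnorm_le_L1[OF assms(1)] assms(2)])
qed

lemma L1_le_L2:
 assumes "rv X" "integrable M (%v. (X v)^2)"
 shows "integrable M X" "(LINT v|M. |X v| ) <= sqrt (LINT v|M. (X v)^2)"
proof -
 show i: "integrable M X" by (rule square_integrable_imp_integrable[OF assms])
 have "(LINT v|M. |X v| )^2 <= (LINT v|M. |X v|\<^sup>2)"
 proof -
  define m where "m = (LINT v|M. |X v| )"
  have "0 <= (LINT v|M. ( |X v| - m)^2)" by (rule integral_nonneg_AE) simp
  also have "... = (LINT v|M. (X v)^2 - 2*m*|X v| + m^2)" by (intro lint_cong refl) (simp add: power2_diff algebra_simps)
  also have "... = (LINT v|M. (X v)^2) - 2*m*m + m^2" using assms(2) i by (simp add: m_def prob_space)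
  finally show ?thesis by (simp add: m_def power2_eq_square)
 qed
 thus "(LINT v|M. |X v| ) <= sqrt (LINT v|M. (X v)^2)" by (simp add: real_le_rsqrt)
qed

lemma pnull_L2:
 assumes "!!n. rv (S n)" "!!n. integrable M (%v. (S n v)^2)" "(%n. (LINT v|M. (S n v)^2)) ----> 0"
 shows "pnull S"
proof (rule pnull_L1)
 show "integrable M (S n)" for n by (rule L1_le_L2(1)[OF assms(1,2)])
 have "(%n. sqrt (LINT v|M. (S n v)^2)) ----> sqrt 0" by (intro tendsto_real_sqrt assms(3))
 hence lim: "(%n. sqrt (LINT v|M. (S n v)^2)) ----> 0" by simp
 show "(%n. (LINT v|M. |S n v| )) ----> 0" by (rule null_sandwich[OF _ L1_le_L2(2)[OF assms(1,2)] lim]) simp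
qed

lemma pnull_pointwise:
 assumes [measurable]: "!!n. rv (S n)" and "!!v. v:space M ==> (%n. S n v) ----> 0"
 shows "pnull S"
proof -
 have "(%n. (LINT v|M. min 1 |S n v| )) ----> (LINT v|M. 0)"
 proof (rule integral_dominated_convergence[where w="%_. 1"])
  show "AE v in M. (%n. min 1 |S n v| ) ----> 0"
  proof (rule AE_I2)
   fix v assume "v:space M"
   hence "(%n. min 1 |S n v| ) ----> min 1 |0|" by (intro tendsto_intros assms)
   thus "(%n. min 1 |S n v| ) ----> 0" by simp
  qed
 qed auto
 thus ?thesis by (simp add: pnull_def pnorm_def assms)
qed

text \<open>Off the event where the tight factor exceeds \<open>K\<close>, the product is at most
  \<open>K\<close> times the null factor; \<open>K\<close> is fixed before \<open>n\<close>
  grows.\<close>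

lemma pnull_mult_ptight:
 assumes S: "pnull S" and T: "ptight T" shows "pnull (%n v. S n v * T n v)"
proof -
 note [measurable] = pnullD(1)[OF S] ptightD[OF T]
 have bound: "pnorm (%v. S n v * T n v) <= K*pnorm (S n) + prob {v:space M. |T n v| > K}" if "K >= 1" for K n
 proof -
  have "pnorm (%v. S n v * T n v) <= (LINT v|M. K*min 1 |S n v| + indicator {v:space M. |T n v| > K} v)" unfolding pnorm_def
  proof (rule integral_mono)
   fix v assume v: "v:space M"
   show "min 1 |S n v * T n v| <= K*min 1 |S n v| + indicator {v:space M. |T n v| > K} v"
   proof (cases "|T n v| > K")
    case True
    thus ?thesis using v that by (simp add: min_le_iff_disj add_increasing)
   next
    case False
    hence "|S n v|*|T n v| <= |S n v|*K" by (intro mult_left_mono) auto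
    thus ?thesis using that False v by (cases "|S n v| <= 1") (auto simp: abs_mult min_le_iff_disj mult.commute min_def)
   qed
  qed (auto intro!: integrable_ind)
  also have "... = K*pnorm (S n) + prob {v:space M. |T n v| > K}"
   unfolding pnorm_def by (subst Bochner_Integration.integral_add) (auto intro!: integrable_ind)
  finally show ?thesis .
 qed
 have "(%n. pnorm (%v. S n v * T n v)) ----> 0"
 proof (rule LIMSEQ_I)
  fix r :: real assume r: "0 < r"
  obtain K where K: "K >= 1" "!!n. prob {v:space M. |T n v| > K} <= r/2" using T r unfolding ptight_def by (meson half_gt_zero)
  have "(%n. K*pnorm (S n)) ----> K*0" by (intro tendsto_intros pnullD(2)[OF S])
  hence "eventually (%n. K*pnorm (S n) < r/2) sequentially" using r by (intro order_tendstoD(2)[of _ "0"]) auto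
  then obtain N where N: "!!n. n >= N ==> K*pnorm (S n) < r/2" by (auto simp: eventually_sequentially)
  have "norm (pnorm (%v. S n v * T n v) - 0) < r" if "n >= N" for n
   using bound[OF K(1), of n] K(2)[of n] N[OF that] pnorm_nonneg[of "%v. S n v * T n v"] by simp
  thus "EX N. ALL n>=N. norm (pnorm (%v. S n v * T n v) - 0) < r" by blast
 qed
 thus ?thesis by (simp add: pnull_def)
qed

lemma ptightI:
 assumes "!!n. rv (S n)"
  "!!eps. eps > 0 ==> EX K. ALL n. off eps (%v. |S n v| <= K)"
 shows "ptight S" unfolding ptight_def
proof (intro conjI allI impI assms(1))
 fix eps :: real assume "eps > 0"
 then obtain K where K: "!!n. off eps (%v. |S n v| <= K)" using assms(2) by blast
 show "EX K>=1. ALL n. prob {v:space M. |S n v| > K} <= eps"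
 proof (intro exI[of _ "max 1 K"] conjI allI)
  fix n
  obtain B where B: "B:events" "prob B <= eps" "!!v. v:space M - B ==> |S n v| <= K" using K by blast
  have "{v:space M. |S n v| > max 1 K} <= B" using B(3) by fastforce
  hence "prob {v:space M. |S n v| > max 1 K} <= prob B" using B(1) by (intro finite_measure_mono)
  thus "prob {v:space M. |S n v| > max 1 K} <= eps" using B(2) by linarith
 qed simp
qed

lemma ptight_E:
 assumes "ptight S" "eps > 0"
 obtains K where "K >= 1" "!!n. off eps (%v. |S n v| <= K)"
proof -
 obtain K where K: "K >= 1" "!!n. prob {v:space M. |S n v| > K} <= eps" using assms unfolding ptight_def by meson
 have [measurable]: "rv (S n)" for n using assms ptightD by auto
 have "off eps (%v. |S n v| <= K)" for n using K(2)[of n] by (intro bexI[of _ "{v:space M. |S n v| > K}"]) auto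
 thus ?thesis using that K(1) by blast
qed

lemma ptight_add:
 assumes "ptight S" "ptight T" shows "ptight (%n v. S n v + T n v)"
proof (rule ptightI)
 show "rv (%v. S n v + T n v)" for n using assms[THEN ptightD] by auto
 fix eps :: real assume "eps > 0"
 hence e: "eps/2 > 0" by simp
 obtain K where K: "!!n. off (eps/2) (%v. |S n v| <= K)" using ptight_E[OF assms(1) e] by metis
 obtain L where L: "!!n. off (eps/2) (%v. |T n v| <= L)" using ptight_E[OF assms(2) e] by metis
 show "EX K. ALL n. off eps (%v. |S n v + T n v| <= K)"
 proof (intro exI allI)
  fix n
  obtain B where B: "B\<in>events" "prob B <= eps/2" "ALL v:space M - B. |S n v| <= K" using K by blast
  obtain C where C: "C\<in>events" "prob C <= eps/2" "ALL v:space M - C. |T n v| <= L" using L by blast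
  have "prob (B \<union> C) <= eps" using measure_Un_le[OF B(1) C(1)] B(2) C(2) by simp
  moreover have "|S n v + T n v| <= K + L" if "v:space M - (B \<union> C)" for v
  proof -
   have "|S n v| <= K" "|T n v| <= L" using that B(3) C(3) by auto
   thus ?thesis by linarith
  qed
  ultimately show "off eps (%v. |S n v + T n v| <= K + L)" using B(1) C(1) by (intro bexI[of _ "B \<union> C"]) auto
 qed
qed

lemma ptight_L1:
 assumes "!!n. integrable M (S n)" "!!n. (LINT v|M. |S n v| ) <= C" shows "ptight S" unfolding ptight_def
proof (intro conjI allI impI)
 show "rv (S n)" for n using assms by auto
 fix eps :: real assume e: "eps > 0"
 have C: "C >= 0" by (rule order_trans[OF _ assms(2)]) simp
 define K where "K = max 1 (C/eps)"
 have "prob {v:space M. |S n v| > K} <= eps" for n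
 proof -
  have [measurable]: "rv (S n)" using assms by auto
  have "prob {v:space M. |S n v| > K} <= prob {v:space M. |S n v| >= K}" by (intro finite_measure_mono) auto
  also have "... <= (LINT v|M. |S n v| )/K" using assms(1)[of n] by (intro integral_Markov_inequality_measure[where A="{}"]) (auto simp: K_def)
  also have "... <= C/K" using assms(2) by (intro divide_right_mono) (auto simp: K_def)
  also have "... <= eps" using e C by (simp add: K_def divide_le_eq max_def field_simps)
  finally show ?thesis .
 qed
 thus "EX K>=1. ALL n. prob {v:space M. |S n v| > K} <= eps" by (intro exI[of _ K]) (auto simp: K_def)
qed

text \<open>The events that some \<open>S n\<close> exceeds \<open>K\<close> decrease to the empty
  set, since every path of the sequence is bounded; continuity from above makes one of them
  small.\<close>

lemma uniformly_bounded_outside: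
 fixes S :: "nat => 'a => real"
 assumes [measurable]: "!!n. rv (S n)" and b: "!!v. v:space M ==> EX C. ALL n. |S n v| <= C" and "eps > 0"
 obtains K B where "B:events" "prob B <= eps" "!!n v. v:space M - B ==> |S n v| <= real K"
proof -
 define B where "B K = {v:space M. EX n. |S n v| > real K}" for K :: nat
 have [measurable]: "B K:events" for K unfolding B_def by measurable
 have "(%K. prob (B K)) ----> prob (\<Inter>K. B K)"
  by (intro finite_Lim_measure_decseq) (auto simp: B_def decseq_def, meson of_nat_mono order_le_less_trans)
 moreover have "(\<Inter>K. B K) = {}"
 proof -
  have "v \<notin> (\<Inter>K. B K)" for v
  proof
   assume "v:(\<Inter>K. B K)"
   hence 1: "!!K. EX n. |S n v| > real K" "v:space M" by (auto simp: B_def)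
   obtain C where C: "!!n. |S n v| <= C" using b[OF 1(2)] by blast
   obtain K where "C <= real K" using real_arch_simple by blast
   thus False using 1(1)[of K] C by (meson not_le order_trans)
  qed
  thus ?thesis by blast
 qed
 ultimately have "(%K. prob (B K)) ----> 0" by simp
 hence "eventually (%K. prob (B K) < eps) sequentially" using assms(3) by (intro order_tendstoD) auto
 then obtain K where K: "prob (B K) < eps" by (auto simp: eventually_sequentially)
 have "|S n v| <= real K" if "v:space M - B K" for n v using that by (auto simp: B_def not_less)
 thus ?thesis using that[of "B K" K] K by auto
qed

text \<open>Bounded second moments make the sequence uniformly integrable. Fatou's lemma along an
  almost surely convergent subsequence first puts \<open>L\<close> in L2; the expectations are then
  compared by truncation at a level \<open>K\<close> that tends to infinity after
  \<open>n\<close>.\<close>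

lemma expectation_of_limit_in_prob:
 assumes S: "!!n. rv (S n)" "!!n. integrable M (%v. (S n v)^2)" "!!n. (LINT v|M. (S n v)^2) <= C"
  and lim: "pnull (%n v. S n v - L v)" and L: "rv L"
  and E: "!!n. (LINT v|M. S n v) = 0"
 shows "integrable M L" "(LINT v|M. L v) = 0"
proof -
 note [measurable] = S(1) L
 have C: "C >= 0" by (rule order_trans[OF _ S(3)]) simp
 have "EX r::nat=>nat. strict_mono r & (AE v in M. (%n. min 1 |S (r n) v - L v| ) ----> 0)"
  using pnullD(2)[OF lim] by (intro tendsto_L1_AE_subseq) (auto simp: pnorm_def)
 then obtain r :: "nat => nat" where r: "AE v in M. (%n. min 1 |S (r n) v - L v| ) ----> 0" by blast
 have conv: "AE v in M. (%n. S (r n) v) ----> L v" using r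
 proof eventually_elim
  case (elim v)
  have "eventually (%n. min 1 |S (r n) v - L v| < 1) sequentially" using elim by (intro order_tendstoD(2)) auto
  hence "(%n. |S (r n) v - L v| ) ----> 0" by (intro Lim_transform_eventually[OF elim]) (auto elim!: eventually_mono simp: min_def)
  hence "(%n. S (r n) v - L v) ----> 0" by (simp add: tendsto_rabs_zero_iff)
  thus ?case by (simp add: LIM_zero_iff)
 qed
 have fin: "(\<integral>\<^sup>+v. ennreal ((L v)^2) \<partial>M) <= ennreal C"
 proof -
  have "(\<integral>\<^sup>+v. ennreal ((L v)^2) \<partial>M) = (\<integral>\<^sup>+v. liminf (%n. ennreal ((S (r n) v)^2)) \<partial>M)"
  proof (rule nn_integral_cong_AE)
   show "AE v in M. ennreal ((L v)^2) = liminf (%n. ennreal ((S (r n) v)^2))" using conv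
   proof eventually_elim
    case (elim v)
    have "(%n. ennreal ((S (r n) v)^2)) ----> ennreal ((L v)^2)" by (intro tendsto_ennrealI tendsto_power elim)
    from lim_imp_Liminf[OF _ this] show ?case by simp
   qed
  qed
  also have "... <= liminf (%n. \<integral>\<^sup>+v. ennreal ((S (r n) v)^2) \<partial>M)" by (rule nn_integral_liminf) simp
  also have "... <= liminf (%n. ennreal C)"
  proof (intro Liminf_mono always_eventually allI)
   fix n
   have "(\<integral>\<^sup>+v. ennreal ((S (r n) v)^2) \<partial>M) = ennreal (LINT v|M. (S (r n) v)^2)" by (intro nn_integral_eq_integral S) simp
   also have "... <= ennreal C" by (intro ennreal_leI S)
   finally show "(\<integral>\<^sup>+v. ennreal ((S (r n) v)^2) \<partial>M) <= ennreal C" .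
  qed
  also have "... = ennreal C" by (rule Liminf_const) simp
  finally show ?thesis .
 qed
 have L2: "integrable M (%v. (L v)^2)" by (rule integrableI_bounded) (use fin in "auto intro: le_less_trans")
 have EL2: "(LINT v|M. (L v)^2) <= C" using fin C nn_integral_eq_integral[OF L2] by simp
 show iL: "integrable M L" by (rule L1_le_L2(1)[OF L L2])
 have iS: "integrable M (S n)" for n by (rule L1_le_L2(1)[OF S(1,2)])
 have bound: "|(LINT v|M. L v)| <= K*pnorm (%v. S n v - L v) + 4*C/K" if K: "K >= 1" for K n
 proof -
  have "|(LINT v|M. L v)| = |(LINT v|M. S n v - L v)|" using iS iL E by simp
  also have "... <= (LINT v|M. |S n v - L v| )" by (rule integral_abs_bound)
  also have "... <= (LINT v|M. K*min 1 |S n v - L v| + (2*(S n v)^2 + 2*(L v)^2)/K)"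
  proof (rule integral_mono)
   fix v
   define x where "x = S n v - L v"
   have "x^2 <= 2*(S n v)^2 + 2*(L v)^2" using sum_squares_ge_zero[of "S n v + L v" 0] by (simp add: x_def square_simps)
   hence 1: "x^2/K <= (2*(S n v)^2 + 2*(L v)^2)/K" using K by (intro divide_right_mono) auto
   \<comment> \<open>Moderate values are paid for by the metric of convergence in probability, large
     ones by the second moment.\<close>
   have "|x| <= K*min 1 |x| + x^2/K"
   proof (cases "|x| <= K")
    case True
    have "|x| <= K*min 1 |x|"
    proof (cases "|x| <= 1")
     case True
     thus ?thesis using K mult_right_mono[of 1 K "|x|"] by simp
    qed (use `|x| <= K` in simp)
    thus ?thesis using K by (simp add: add_increasing2)
   next
    case False
    hence "|x|*K <= |x|*|x|" by (intro mult_left_mono) auto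
    hence "|x| <= x^2/K" using K by (simp add: pos_le_divide_eq power2_eq_square abs_mult_self_eq)
    thus ?thesis using K by (simp add: add_increasing)
   qed
   with 1 show "|S n v - L v| <= K*min 1 |S n v - L v| + (2*(S n v)^2 + 2*(L v)^2)/K" by (simp add: x_def)
  qed (use iS iL S(2) L2 in auto)
  also have "... = K*pnorm (%v. S n v - L v) + (2*(LINT v|M. (S n v)^2) + 2*(LINT v|M. (L v)^2))/K" unfolding pnorm_def using S(2) L2 by simp
  also have "... <= K*pnorm (%v. S n v - L v) + (2*C + 2*C)/K" using S(3)[of n] EL2 K by (intro add_left_mono divide_right_mono) auto
  finally show ?thesis by simp
 qed
 have lim0: "|(LINT v|M. L v)| <= 4*C/K" if K: "K >= 1" for K
 proof (rule LIMSEQ_le_const)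
  have "(%n. K*pnorm (%v. S n v - L v) + 4*C/K) ----> K*0 + 4*C/K" by (intro tendsto_intros pnullD(2)[OF lim])
  thus "(%n. K*pnorm (%v. S n v - L v) + 4*C/K) ----> 4*C/K" by simp
 qed (use bound[OF K] in auto)
 have "|(LINT v|M. L v)| <= 0"
 proof (rule LIMSEQ_le_const)
  show "(%n. 4*C/real (Suc n)) ----> 0" by (rule null_over_Suc)
  show "EX N. ALL n>=N. |(LINT v|M. L v)| <= 4*C/real (Suc n)" using lim0 by auto
 qed
 thus "(LINT v|M. L v) = 0" by simp
qed

end

section \<open>Grids and tightness of quadratic variations\<close>

definition grid :: "real => nat => nat => real" where "grid t n i = t*real i/real n"

lemma grid_0 [simp]: "grid t n 0 = 0" by (simp add: grid_def)

lemma grid_n: "n > 0 ==> grid t n n = t" by (simp add: grid_def)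

lemma grid_nonneg: "0 <= t ==> 0 <= grid t n i" by (simp add: grid_def)

lemma grid_mono: "0 <= t ==> i <= j ==> grid t n i <= grid t n j" by (simp add: grid_def divide_right_mono mult_left_mono)

lemma grid_le: "0 <= t ==> i <= n ==> 0 < n ==> grid t n i <= t" using grid_mono[of t i n n] grid_n by simp

lemma grid_step: "grid t n (Suc i) - grid t n i = t/real n" by (simp add: grid_def diff_divide_distrib[symmetric] algebra_simps)

lemma grid_strict: "0 < t ==> 0 < n ==> grid t n i < grid t n (Suc i)" using grid_step[of t n i] by (simp add: algebra_simps)

lemma grid_refine: "0 < n ==> 0 < m ==> grid t (n*m) (i*m) = grid t n i" by (simp add: grid_def)

definition qv :: "(real => 'w => real) => real => nat => 'w => real" where
 "qv Y t n w = (\<Sum>i<n. (Y (grid t n (Suc i)) w - Y (grid t n i) w)^2)"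

lemma qv_nonneg: "qv Y t n w >= 0" unfolding qv_def by (intro sum_nonneg) auto

text \<open>The gap in the tangent inequality for the strictly convex function \<open>sqrt (1 + x\<^sup>2)\<close>, whose linear
  growth makes it integrable along any martingale.\<close>

definition tangent_gap :: "real => real => real" where
 "tangent_gap a b = sqrt (1 + b^2) - sqrt (1 + a^2) - a/sqrt (1 + a^2)*(b - a)"

lemma tangent_gap_identity:
 "(b - a)^2 = tangent_gap a b * sqrt (1 + a^2)*(sqrt (1 + a^2) * sqrt (1 + b^2) + 1 + a*b)"
proof -
 define u v where "u = sqrt (1 + a^2)" and "v = sqrt (1 + b^2)"
 have uv: "u^2 = 1 + a^2" "v^2 = 1 + b^2" "u > 0" by (auto simp: u_def v_def add_pos_nonneg)
 have "tangent_gap a b*u = u * v - u^2 - a*(b - a)" using uv(3) unfolding tangent_gap_def u_def[symmetric] v_def[symmetric]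
  by (simp add: field_simps power2_eq_square)
 also have "... = u * v - 1 - a*b" using uv by (simp add: square_simps)
 finally have e: "tangent_gap a b*u = u * v - 1 - a*b" .
 have "tangent_gap a b*u*(u * v + 1 + a*b) = (u * v - (1 + a*b))*(u * v + (1 + a*b))" unfolding e by (simp add: algebra_simps)
 also have "... = u^2 * v^2 - (1 + a*b)^2" by (simp add: square_simps)
 also have "... = (b - a)^2" unfolding uv by (simp add: square_simps)
 finally show ?thesis by (simp add: u_def v_def)
qed

lemma abs_prod_le_sqrt: "|1 + a*b| <= sqrt (1 + a^2) * sqrt (1 + b^2)"
proof -
 have "(1 + a*b)^2 <= (1 + a^2)*(1 + b^2)" using zero_le_power2[of "a - b"] by (simp add: square_simps)
 thus ?thesis by (simp add: real_le_rsqrt real_sqrt_mult[symmetric])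
qed

lemma tangent_gap_nonneg: "tangent_gap a b >= 0"
proof (rule ccontr)
 assume n: "\<not> ?thesis"
 let ?p = "sqrt (1 + a^2) * sqrt (1 + b^2)"
 have p: "?p + 1 + a*b >= 0" using abs_prod_le_sqrt[of a b] by linarith
 have s: "sqrt (1 + a^2) > 0" by (simp add: add_pos_nonneg)
 have "tangent_gap a b * sqrt (1 + a^2)*(?p + 1 + a*b) <= 0" using n s p by (intro mult_nonpos_nonneg) (auto simp: mult_le_0_iff)
 hence "(b - a)^2 <= 0" using tangent_gap_identity[of b a] by simp
 hence "a = b" by simp
 thus False using n by (simp add: tangent_gap_def)
qed

text \<open>Strict convexity made quantitative on a bounded range: the factor of the gap in
  \<open>tangent_gap_identity\<close> is at most \<open>2*(1 + K^2)^2\<close> there.\<close>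

lemma square_le_tangent_gap:
 assumes "|a| <= K" "|b| <= K" shows "(b - a)^2 <= 2*(1 + K^2)^2*tangent_gap a b"
proof -
 define u v where "u = sqrt (1 + a^2)" and "v = sqrt (1 + b^2)"
 have sq: "a^2 <= K^2" "b^2 <= K^2" using assms abs_le_square_iff[of a K] abs_le_square_iff[of b K] by auto
 have u: "u >= 1" "u^2 <= 1 + K^2" and v: "v >= 1" "v^2 <= 1 + K^2" using sq by (auto simp: u_def v_def)
 have v': "v <= 1 + K^2" using v self_le_power[of v 2] by simp
 have "u*(u * v + 1 + a*b) <= u*(2*(u * v))" using abs_prod_le_sqrt[of a b] u by (intro mult_left_mono) (auto simp: u_def v_def)
 also have "... = 2*(u^2 * v)" by (simp add: power2_eq_square)
 also have "... <= 2*((1 + K^2)*(1 + K^2))" using u v v' by (intro mult_left_mono mult_mono) auto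
 finally have "tangent_gap a b*(u*(u * v + 1 + a*b)) <= tangent_gap a b*(2*((1 + K^2)*(1 + K^2)))" by (rule mult_left_mono[OF _ tangent_gap_nonneg])
 thus ?thesis using tangent_gap_identity[of b a] by (simp add: u_def v_def square_simps)
qed

locale filt = prob_space M for M :: "'w measure" +
 fixes F :: "real => 'w measure"
 assumes filtration: "filtration (space M) F" and sub: "!!t. subalgebra M (F t)"
begin

lemma space_F: "space (F t) = space M" using sub by (simp add: subalgebra_def)

lemma F_mono: "s <= t ==> subalgebra (F t) (F s)" using filtration.sets_F_mono[OF filtration] by (simp add: subalgebra_def space_F)

lemma F_measurable_M: "X:borel_measurable (F s) ==> X:borel_measurable M" using measurable_from_subalg[OF sub] .

lemma F_measurable_mono: "X:borel_measurable (F s) ==> s <= t ==> X:borel_measurable (F t)" using measurable_from_subalg[OF F_mono] .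

lemma cont_adapted_rv: "cont_adapted M F Y ==> 0 <= t ==> Y t:borel_measurable M" unfolding cont_adapted_def using F_measurable_M by blast

lemma martingale_increment:
 assumes Y: "cont_martingale M F Y" and st: "0 <= s" "s <= t"
  and Z: "Z:borel_measurable (F s)" "!!w. |Z w| <= C"
 shows "integrable M (%w. Z w*(Y t w - Y s w))" "(LINT w|M. Z w*(Y t w - Y s w)) = 0"
proof -
 interpret S: sigma_finite_subalgebra M "F s"
  using sub[of s] by (intro finite_measure_subalgebra_is_sigma_finite) (auto simp: finite_measure_subalgebra_def finite_measure_subalgebra_axioms_def intro: finite_measure_axioms)
 have i: "integrable M (Y t)" "integrable M (Y s)" using Y st by (auto simp: cont_martingale_def)
 have ZM: "Z:borel_measurable M" using F_measurable_M Z(1) .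
 have iZ: "integrable M (%w. Z w*Y r w)" if "integrable M (Y r)" for r
 proof (rule Bochner_Integration.integrable_bound[of M "%w. C*Y r w"])
  show "AE w in M. norm (Z w*Y r w) <= norm (C*Y r w)"
  proof (rule AE_I2)
   fix w
   have "|Z w|*|Y r w| <= |C|*|Y r w|" using Z(2)[of w] by (intro mult_right_mono) auto
   thus "norm (Z w*Y r w) <= norm (C*Y r w)" by (simp add: abs_mult)
  qed
 qed (use that ZM in auto)
 have "(LINT w|M. Z w*Y t w) = (LINT w|M. Z w*real_cond_exp M (F s) (Y t) w)"
  using S.real_cond_exp_intg(2)[OF iZ[OF i(1)] Z(1) borel_measurable_integrable[OF i(1)]] by simp
 also have "... = (LINT w|M. Z w*Y s w)"
 proof (rule integral_cong_AE)
  have "AE w in M. real_cond_exp M (F s) (Y t) w = Y s w" using Y st by (auto simp: cont_martingale_def)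
  thus "AE w in M. Z w*real_cond_exp M (F s) (Y t) w = Z w*Y s w" by eventually_elim simp
 qed (use ZM i in auto)
 finally have "(LINT w|M. Z w*Y t w) = (LINT w|M. Z w*Y s w)" .
 thus "(LINT w|M. Z w*(Y t w - Y s w)) = 0" "integrable M (%w. Z w*(Y t w - Y s w))"
  using iZ[OF i(1)] iZ[OF i(2)] by (simp_all add: right_diff_distrib)
qed

lemma qv_measurable:
 assumes "!!s. 0 <= s ==> rv (Y s)" "0 <= t" shows "rv (qv Y t n)"
 unfolding qv_def[abs_def] using assms grid_nonneg by (intro borel_measurable_sum) auto

text \<open>The tangent gaps along a grid telescope up to a martingale transform with coefficients
  bounded by 1, so their sum has an expectation bounded independently of the grid. Where the path
  stays below \<open>K\<close> the squared increments are dominated by these gaps.\<close>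

lemma cont_martingale_qv_ptight:
 assumes Y: "cont_martingale M F Y" and t: "0 < t"
 shows "ptight (qv Y t)"
proof (rule ptightI)
 have ad: "cont_adapted M F Y" using Y by (simp add: cont_martingale_def)
 have [measurable]: "rv (Y s)" if "0 <= s" for s using cont_adapted_rv[OF ad that] .
 show "rv (qv Y t n)" for n using t by (intro qv_measurable) auto
 fix eps :: real assume eps: "eps > 0"
 text \<open>All values of \<open>Y\<close> on all grids, enumerated by one natural number.\<close>
 define V where "V p = (case prod_decode p of (n, i) => Y (min t (grid t n i)))" for p
 have "rv (V p)" for p unfolding V_def using t grid_nonneg[of t] by (auto split: prod.split)
 moreover have "EX C. ALL p. |V p w| <= C" if "w:space M" for w
 proof -
  have "continuous_on {0..t} (%s. Y s w)" using ad that unfolding cont_adapted_def by (auto intro: continuous_on_subset)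
  hence "bounded ((%s. Y s w) ` {0..t})" by (intro compact_imp_bounded compact_continuous_image) auto
  then obtain C where C: "!!s. s:{0..t} ==> |Y s w| <= C" unfolding bounded_iff by fastforce
  have "|V p w| <= C" for p unfolding V_def using t grid_nonneg[of t] by (auto split: prod.split intro!: C)
  thus ?thesis by blast
 qed
 ultimately obtain K B where B: "B:events" "prob B <= eps/2" "!!p w. w:space M - B ==> |V p w| <= real K"
  using uniformly_bounded_outside[of V "eps/2"] eps by (metis half_gt_zero)
 define G where "G n w = (\<Sum>i<n. tangent_gap (Y (grid t n i) w) (Y (grid t n (Suc i)) w))" for n w
 define c where "c = (LINT w|M. 1 + |Y t w| )"
 have iY: "integrable M (Y s)" if "0 <= s" for s using Y that by (auto simp: cont_martingale_def)
 have sq: "sqrt (1 + x^2) <= 1 + |x|" for x :: real by (rule real_le_lsqrt) (auto simp: square_simps)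
 have isq: "integrable M (%w. sqrt (1 + (Y s w)^2))" if "0 <= s" for s by (rule Bochner_Integration.integrable_bound[of M "%w. 1 + |Y s w|"])
   (use that iY[OF that] sq in auto)
 have G: "integrable M (G n) & (LINT w|M. G n w) <= c" if n: "n > 0" for n
 proof -
  define H where "H i w = Y (grid t n i) w/sqrt (1 + (Y (grid t n i) w)^2)" for i w
  have Hb: "|H i w| <= 1" for i w
  proof -
   have "|y| <= sqrt (1 + y^2)" for y :: real by (rule real_le_rsqrt) simp
   thus ?thesis by (simp add: H_def divide_le_eq add_pos_nonneg)
  qed
  have Hm: "H i:borel_measurable (F (grid t n i))" for i using ad grid_nonneg[of t n i] t unfolding cont_adapted_def H_def[abs_def] by auto
  have mi: "integrable M (%w. H i w*(Y (grid t n (Suc i)) w - Y (grid t n i) w))"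
   "(LINT w|M. H i w*(Y (grid t n (Suc i)) w - Y (grid t n i) w)) = 0" for i
   using martingale_increment[OF Y _ _ Hm Hb, of i "grid t n (Suc i)"] grid_nonneg[of t n i] grid_mono[of t i "Suc i" n] t by auto
  have Geq: "G n w = sqrt (1 + (Y t w)^2) - sqrt (1 + (Y 0 w)^2) - (\<Sum>i<n. H i w*(Y (grid t n (Suc i)) w - Y (grid t n i) w))" for w
  proof -
   have "(\<Sum>i<n. sqrt (1 + (Y (grid t n (Suc i)) w)^2) - sqrt (1 + (Y (grid t n i) w)^2)) =
     sqrt (1 + (Y (grid t n n) w)^2) - sqrt (1 + (Y (grid t n 0) w)^2)" by (rule sum_lessThan_telescope)
   thus ?thesis unfolding G_def tangent_gap_def H_def by (simp add: sum_subtractf grid_n n)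
  qed
  have i1: "integrable M (%w. sqrt (1 + (Y t w)^2))" "integrable M (%w. sqrt (1 + (Y 0 w)^2))" using isq t by auto
  have iG: "integrable M (G n)"
   unfolding Geq[abs_def] using i1 mi by (intro Bochner_Integration.integrable_diff Bochner_Integration.integrable_sum) auto
  have "(LINT w|M. G n w) = (LINT w|M. sqrt (1 + (Y t w)^2)) - (LINT w|M. sqrt (1 + (Y 0 w)^2))"
   unfolding Geq using i1 mi by (simp add: lint_sum Bochner_Integration.integrable_sum)
  also have "... <= (LINT w|M. sqrt (1 + (Y t w)^2))" by simp
  also have "... <= c" unfolding c_def using i1 iY t sq by (intro integral_mono) auto
  finally show ?thesis using iG by blast
 qed
 have c0: "c >= 0" unfolding c_def by (rule integral_nonneg_AE) auto
 \<comment> \<open>Markov's inequality bounds the probability that the sum of gaps reaches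
   \<open>R\<close> by \<open>c/R\<close>, which is at most \<open>eps/2\<close>; the added 1 keeps
   \<open>R\<close> positive.\<close>
 define R where "R = 2*c/eps + 1"
 have R0: "R > 0" using c0 eps by (simp add: R_def add_nonneg_pos)
 show "EX K. ALL n. off eps (%w. |qv Y t n w| <= K)"
 proof (intro exI[of _ "2*(1 + (real K)^2)^2* R"] allI)
  fix n
  show "off eps (%w. |qv Y t n w| <= 2*(1 + (real K)^2)^2* R)"
  proof (cases "n = 0")
   case True
   thus ?thesis using R0 eps by (intro bexI[of _ "{}"]) (auto simp: qv_def)
  next
   case False
   hence n: "n > 0" by simp
   note iG = conjunct1[OF G[OF n]]
   define D where "D = {w:space M. G n w >= R}"
   have D: "D:events" unfolding D_def using iG by measurable
   have "0 <= G n w" for w unfolding G_def by (intro sum_nonneg tangent_gap_nonneg)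
   hence "prob D <= (LINT w|M. G n w)/R" unfolding D_def using iG R0 by (intro integral_Markov_inequality_measure[where A="{}"]) auto
   also have "... <= c/R" using G[OF n] R0 by (intro divide_right_mono) auto
   also have "... <= eps/2" using eps R0 by (simp add: divide_le_eq R_def field_simps)
   finally have PD: "prob D <= eps/2" .
   have "prob (B \<union> D) <= eps" using measure_Un_le[OF B(1) D] B(2) PD by simp
   moreover have "|qv Y t n w| <= 2*(1 + (real K)^2)^2* R" if w: "w:space M - (B \<union> D)" for w
   proof -
    have yb: "|Y (grid t n i) w| <= real K" if "i <= n" for i
     using B(3)[of w "prod_encode (n, i)"] w grid_le[of t i n] t that n by (simp add: V_def min_absorb2)
    have "qv Y t n w <= (\<Sum>i<n. 2*(1 + (real K)^2)^2*tangent_gap (Y (grid t n i) w) (Y (grid t n (Suc i)) w))"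
     unfolding qv_def by (intro sum_mono square_le_tangent_gap yb) auto
    also have "... = 2*(1 + (real K)^2)^2*G n w" by (simp add: G_def sum_distrib_left)
    also have "... <= 2*(1 + (real K)^2)^2* R" using w by (intro mult_left_mono) (auto simp: D_def)
    finally show ?thesis using qv_nonneg[of Y t n w] by simp
   qed
   ultimately show ?thesis using B(1) D by (intro bexI[of _ "B \<union> D"]) auto
  qed
 qed
qed

lemma qv_add_le: "qv (%s w. Y s w + Z s w) t n w <= 2*qv Y t n w + 2*qv Z t n w"
proof -
 have "(y' + z' - (y + z))^2 <= 2*(y' - y)^2 + 2*(z' - z)^2" for y y' z z' :: real
  using zero_le_power2[of "(y' - y) - (z' - z)"] by (simp add: square_simps)
 thus ?thesis unfolding qv_def sum_distrib_left sum.distrib[symmetric] by (intro sum_mono)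
qed

lemma sum_squares_le_square_sum:
 fixes f :: "'b => real"
 assumes "finite A" "!!a. a:A ==> 0 <= f a" shows "(\<Sum>a\<in>A. (f a)^2) <= (\<Sum>a\<in>A. f a)^2" using assms
proof (induction A rule: finite_induct)
 case (insert a A)
 have "0 <= f a*(\<Sum>a\<in>A. f a)" using insert by (intro mult_nonneg_nonneg sum_nonneg) auto
 thus ?case using insert by (simp add: power2_sum)
qed simp

text \<open>Three exceptional events of probability at most \<open>eps/3\<close>: the localising
  time has come before \<open>t\<close>, the stopped martingale has large quadratic variation, or
  the other part has large total variation. The square of the latter bounds the quadratic variation
  of that part.\<close>

lemma cont_semimartingale_qv_ptight:
 assumes Y: "cont_semimartingale M F Y" and t: "0 < t" and Ym: "!!s. 0 <= s ==> rv (Y s)"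
 shows "ptight (qv Y t)"
proof (rule ptightI)
 show "rv (qv Y t n)" for n using t Ym by (intro qv_measurable) auto
 fix eps :: real assume eps: "eps > 0"
 obtain N A where N: "cont_local_martingale M F N" and A: "cont_adapted M F A"
  "!!w. w:space M ==> locally_bounded_variation (%t. A t w)"
  and eq: "!!w s. w:space M ==> 0 <= s ==> Y s w = N s w + A s w" using Y unfolding cont_semimartingale_def by blast
 obtain tau where tau: "!!k. stopping_time F (tau k)"
  "!!w k. w:space M ==> 0 <= tau k w & tau k w <= tau (Suc k) w"
  "AE w in M. filterlim (%k. tau k w) at_top sequentially"
  "!!k. cont_martingale M F (%t w. N (min t (tau k w)) w - N 0 w)" using N unfolding cont_local_martingale_def by blast
 have taum: "{w:space M. tau k w <= t}:events" for k
 proof -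
  have "{w:space (F t). tau k w <= t}:sets (F t)" using tau(1)[of k] unfolding stopping_time_def by (auto simp: pred_def)
  thus ?thesis using sub[of t] by (auto simp: subalgebra_def)
 qed
 obtain k where k: "prob {w:space M. tau k w <= t} <= eps/3"
 proof -
  have "(%k. prob {w:space M. tau k w <= t}) ----> prob (\<Inter>k. {w:space M. tau k w <= t})"
  proof (intro finite_Lim_measure_decseq)
   show "decseq (%k. {w:space M. tau k w <= t})" unfolding decseq_Suc_iff using tau(2) by (auto intro: order_trans)
  qed (use taum in auto)
  moreover have "prob (\<Inter>k. {w:space M. tau k w <= t}) = 0"
  proof -
   have "AE w in M. w \<notin> (\<Inter>k. {w:space M. tau k w <= t})" using tau(3)
   proof eventually_elim
    case (elim w)
    hence "eventually (%k. t < tau k w) sequentially" by (simp add: filterlim_at_top_dense)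
    then obtain k where "t < tau k w" by (auto simp: eventually_sequentially)
    thus ?case by (auto simp: not_le)
   qed
   moreover have "(\<Inter>k. {w:space M. tau k w <= t}):events" using taum by (intro sets.countable_INT) auto
   ultimately show ?thesis by (simp add: prob_eq_0)
  qed
  ultimately have "(%k. prob {w:space M. tau k w <= t}) ----> 0" by simp
  hence "eventually (%k. prob {w:space M. tau k w <= t} < eps/3) sequentially" using eps by (intro order_tendstoD) auto
  thus ?thesis using that by (auto simp: eventually_sequentially intro: less_imp_le)
 qed
 define L where "L s w = N (min s (tau k w)) w - N 0 w" for s w
 have L: "cont_martingale M F L" using tau(4)[of k] by (simp add: L_def[abs_def])
 obtain K1 where K1: "!!n. off (eps/3) (%w. |qv L t n w| <= K1)"
  using ptight_E[OF cont_martingale_qv_ptight[OF L t], of "eps/3"] eps by (metis divide_pos_pos zero_less_numeral)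
 define V where "V n w = (\<Sum>i<n. |A (grid t n (Suc i)) w - A (grid t n i) w| )" for n w
 have Am: "rv (A s)" if "0 <= s" for s using cont_adapted_rv[OF A(1) that] .
 have "rv (V n)" for n unfolding V_def[abs_def]
  using Am grid_nonneg[of t] t by (intro borel_measurable_sum borel_measurable_abs borel_measurable_diff) auto
 moreover have "EX C. ALL n. |V n w| <= C" if w: "w:space M" for w
 proof -
  obtain C where C: "!!N \<pi>. is_partition t t N \<pi> ==> (\<Sum>k<N. |A (\<pi> (Suc k)) w - A (\<pi> k) w| ) <= C"
   using A(2)[OF w] t unfolding locally_bounded_variation_def by (meson less_imp_le)
  have "|V n w| <= |C|" for n
  proof (cases "n = 0")
   case False
   have "t/real n <= t" using False t by (simp add: divide_le_eq)
   hence "is_partition t t n (grid t n)" using False t grid_step[of t n] grid_mono[of t _ "Suc _" n] by (auto simp: is_partition_def grid_n)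
   from C[OF this] have "V n w <= C" by (simp add: V_def)
   moreover have "V n w >= 0" unfolding V_def by (intro sum_nonneg) auto
   ultimately show ?thesis by simp
  qed (simp add: V_def)
  thus ?thesis by blast
 qed
 ultimately obtain K2 B2 where B2: "B2:events" "prob B2 <= eps/3" "!!n w. w:space M - B2 ==> |V n w| <= real K2"
  using uniformly_bounded_outside[of V "eps/3"] eps by (metis divide_pos_pos zero_less_numeral)
 show "EX K. ALL n. off eps (%w. |qv Y t n w| <= K)"
 proof (intro exI[of _ "2*K1 + 2*(real K2)^2"] allI)
  fix n
  obtain B1 where B1: "B1\<in>events" "prob B1 <= eps/3" "!!w. w\<in>space M - B1 ==> |qv L t n w| <= K1" using K1[of n] by blast
  define B3 where "B3 = {w:space M. tau k w <= t}"
  have B3: "B3:events" using taum by (simp add: B3_def)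
  have "prob (B1 \<union> B2 \<union> B3) <= prob B1 + prob B2 + prob B3"
   using measure_Un_le[of "B1 \<union> B2" M B3] measure_Un_le[OF B1(1) B2(1)] B1(1) B2(1) B3 by auto
  also have "... <= eps" using B1(2) B2(2) k by (simp add: B3_def)
  finally have P: "prob (B1 \<union> B2 \<union> B3) <= eps" .
  have "|qv Y t n w| <= 2*K1 + 2*(real K2)^2" if w: "w:space M - (B1 \<union> B2 \<union> B3)" for w
  proof (cases "n = 0")
   case True
   have "0 <= K1" using order_trans[OF abs_ge_zero B1(3)] w by blast
   thus ?thesis using True by (simp add: qv_def)
  next
   case False
   have w': "w:space M" "t < tau k w" using w by (auto simp: B3_def)
   have Yeq: "Y s w = (L s w + N 0 w) + A s w" if "0 <= s" "s <= t" for s using eq[OF w'(1) that(1)] that w'(2) by (simp add: L_def min_def)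
   have "qv Y t n w = qv (%s w. (L s w + N 0 w) + A s w) t n w" unfolding qv_def using grid_nonneg[of t n] grid_le[of t _ n] t False
    by (intro sum.cong refl) (simp add: Yeq)
   also have "... <= 2*qv (%s w. L s w + N 0 w) t n w + 2*qv A t n w" by (rule qv_add_le)
   also have "qv (%s w. L s w + N 0 w) t n w = qv L t n w" by (simp add: qv_def)
   also have "qv A t n w <= (V n w)^2" using sum_squares_le_square_sum[of "{..<n}" "%i. |A (grid t n (Suc i)) w - A (grid t n i) w|"]
    by (simp add: qv_def V_def)
   also have "(V n w)^2 <= (real K2)^2" using B2(3)[of w n] w by (simp add: abs_le_square_iff[symmetric])
   finally have "qv Y t n w <= 2*qv L t n w + 2*(real K2)^2" by simp
   moreover have "qv L t n w <= K1" using B1(3)[of w] w by fastforce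
   ultimately show ?thesis using qv_nonneg[of Y t n w] by linarith
  qed
  thus "off eps (%w. |qv Y t n w| <= 2*K1 + 2*(real K2)^2)" using P B1(1) B2(1) B3 by (intro bexI[of _ "B1 \<union> B2 \<union> B3"]) auto
 qed
qed

end

section \<open>Increments of the Wiener process\<close>

lemma (in prob_space) expectation_square_sum_orthogonal:
 fixes Z :: "'i => 'a => real"
 assumes "finite A" "!!i. i:A ==> rv (Z i)" "!!i. i:A ==> integrable M (%w. (Z i w)^2)"
  "!!i j. i:A ==> j:A ==> i ~= j ==> (LINT w|M. Z i w*Z j w) = 0"
 shows "integrable M (%w. (\<Sum>i\<in>A. Z i w)^2)"
  "(LINT w|M. (\<Sum>i\<in>A. Z i w)^2) = (\<Sum>i\<in>A. (LINT w|M. (Z i w)^2))"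
proof -
 have iprod: "integrable M (%w. Z i w*Z j w)" if "i:A" "j:A" for i j
 proof (rule Bochner_Integration.integrable_bound[of M "%w. (Z i w)^2 + (Z j w)^2"])
  have "norm (x*y) <= norm (x^2 + y^2)" for x y :: real
  proof -
   have "2*|x*y| <= x^2 + y^2" using zero_le_power2[of "|x| - |y|"] by (simp add: power2_diff abs_mult)
   thus ?thesis by simp
  qed
  thus "AE w in M. norm (Z i w*Z j w) <= norm ((Z i w)^2 + (Z j w)^2)" by simp
 qed (use assms that in auto)
 have exp: "(\<Sum>i\<in>A. Z i w)^2 = (\<Sum>i\<in>A. \<Sum>j\<in>A. Z i w*Z j w)" for w by (simp add: power2_eq_square sum_product)
 show "integrable M (%w. (\<Sum>i\<in>A. Z i w)^2)" unfolding exp by (intro Bochner_Integration.integrable_sum iprod)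
 have "(LINT w|M. (\<Sum>i\<in>A. Z i w)^2) = (\<Sum>i\<in>A. \<Sum>j\<in>A. (LINT w|M. Z i w*Z j w))"
  unfolding exp using iprod by (simp add: lint_sum Bochner_Integration.integrable_sum)
 also have "... = (\<Sum>i\<in>A. (LINT w|M. (Z i w)^2))"
 proof (rule sum.cong[OF refl])
  fix i assume i: "i:A"
  have "(\<Sum>j\<in>A. (LINT w|M. Z i w*Z j w)) = (\<Sum>j\<in>A. if j = i then (LINT w|M. Z i w*Z i w) else 0)"
   using assms(4) i by (intro sum.cong refl) auto
  thus "(\<Sum>j\<in>A. (LINT w|M. Z i w*Z j w)) = (LINT w|M. (Z i w)^2)" using i assms(1) by (simp add: power2_eq_square)
 qed
 finally show "(LINT w|M. (\<Sum>i\<in>A. Z i w)^2) = (\<Sum>i\<in>A. (LINT w|M. (Z i w)^2))" .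
qed

text \<open>Independence of the past is kept in the form in which it is used, a factorisation of
  expectations. Functions of two increments over the same interval cover both left-point sums and
  covariation sums.\<close>

locale wiener_family = filt M F for M :: "'w measure" and F +
 fixes I :: "'k set" and W :: "'k => real => 'w => real"
 assumes finI: "finite I"
  and W_adapted: "!!k. k:I ==> cont_adapted M F (W k)"
  and W_dist: "!!k s t. k:I ==> 0 <= s ==> s < t ==> distributed M lborel (%w. W k t w - W k s w) (%x. ennreal (normal_density 0 (sqrt (t - s)) x))"
  and W_indep: "!!k l s t (G :: 'w => real) (h :: real \<times> real => real). k:I ==> l:I ==> 0 <= s ==> s < t ==> G:borel_measurable (F s) ==> integrable M G ==>
   h:borel_measurable (borel \<Otimes>\<^sub>M borel) ==> integrable M (%w. h (W k t w - W k s w, W l t w - W l s w)) ==>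
   integrable M (%w. G w*h (W k t w - W k s w, W l t w - W l s w)) & (LINT w|M. G w*h (W k t w - W k s w, W l t w - W l s w)) =
    (LINT w|M. G w)*(LINT w|M. h (W k t w - W k s w, W l t w - W l s w))"
  and W_orth: "!!k l s t. k:I ==> l:I ==> k ~= l ==> 0 <= s ==> s < t ==> (LINT w|M. (W k t w - W k s w)*(W l t w - W l s w)) = 0"
begin

abbreviation dW :: "'k => real => real => 'w => real" where "dW k s t w \<equiv> W k t w - W k s w"

abbreviation (input) hW where "hW h k l T i w == h i (dW k (T i) (T (Suc i)) w, dW l (T i) (T (Suc i)) w)"

abbreviation gW where "gW k t n i == dW k (grid t n i) (grid t n (Suc i))"

lemma dW_F: "k:I ==> 0 <= s ==> s <= t ==> dW k s t:borel_measurable (F t)"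
 using W_adapted[of k] F_measurable_mono[of "W k s" s t] unfolding cont_adapted_def by (intro borel_measurable_diff) auto

lemma dW_rv: "k:I ==> 0 <= s ==> s <= t ==> rv (dW k s t)" using dW_F F_measurable_M by blast

lemma dW_moments:
 assumes "k:I" "0 <= s" "s < t"
 shows "integrable M (dW k s t)" "(LINT w|M. dW k s t w) = 0"
  "integrable M (%w. (dW k s t w)^2)" "(LINT w|M. (dW k s t w)^2) = t - s"
  "integrable M (%w. (dW k s t w)^4)" "(LINT w|M. (dW k s t w)^4) = 3*(t - s)^2"
proof -
 define \<sigma> where "\<sigma> = sqrt (t - s)"
 have \<sigma>: "\<sigma> > 0" "\<sigma>^2 = t - s" using assms by (auto simp: \<sigma>_def)
 note D = W_dist[OF assms, folded \<sigma>_def]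
 have i: "integrable M (%w. g (dW k s t w)) & (LINT w|M. g (dW k s t w)) = c"
  if "has_bochner_integral lborel (%x. normal_density 0 \<sigma> x*g x) c" "g:borel_measurable lborel" for g c
  using distributed_integrable[OF D that(2)] distributed_integral[OF D that(2)] that(1) by (auto simp: has_bochner_integral_iff normal_density_nonneg)
 have "integrable M (dW k s t) & (LINT w|M. dW k s t w) = 0" using i[of "%x. x" 0] normal_moment_odd[OF \<sigma>(1), of 0 0] by simp
 thus "integrable M (dW k s t)" "(LINT w|M. dW k s t w) = 0" by auto
 have "integrable M (%w. (dW k s t w)^2) & (LINT w|M. (dW k s t w)^2) = \<sigma>^2"
  using i[of "%x. x^2" "\<sigma>^2"] normal_moment_even[OF \<sigma>(1), of 0 1] by (simp add: fact_numeral)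
 thus "integrable M (%w. (dW k s t w)^2)" "(LINT w|M. (dW k s t w)^2) = t - s" using \<sigma> by auto
 have "integrable M (%w. (dW k s t w)^4) & (LINT w|M. (dW k s t w)^4) = 3*(\<sigma>^2)^2"
  using i[of "%x. x^4" "3*(\<sigma>^2)^2"] normal_moment_even[OF \<sigma>(1), of 0 2] \<sigma>(1)
  by (simp add: fact_numeral power2_eq_square field_simps)
 thus "integrable M (%w. (dW k s t w)^4)" "(LINT w|M. (dW k s t w)^4) = 3*(t - s)^2" using \<sigma> by auto
qed

lemma dW_product:
 assumes "k:I" "l:I" "0 <= s" "s < t"
 shows "integrable M (%w. dW k s t w*dW l s t w)"
  "(LINT w|M. dW k s t w*dW l s t w) = (if k = l then t - s else 0)"
  "integrable M (%w. (dW k s t w*dW l s t w - (if k = l then t - s else 0))^2)"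
  "(LINT w|M. (dW k s t w*dW l s t w - (if k = l then t - s else 0))^2) <= 3*(t - s)^2"
proof -
 note m = dW_moments[OF assms(1,3,4)] dW_moments[OF assms(2,3,4)]
 have [measurable]: "rv (dW k s t)" "rv (dW l s t)" using m by auto
 have ab: "2*|x*y| <= x^2 + y^2" for x y :: real using zero_le_power2[of "|x| - |y|"] by (simp add: power2_diff abs_mult)
 have ab4: "(x*y)^2 <= (x^4 + y^4)/2" for x y :: real using ab[of "x^2" "y^2"] by (simp add: power_mult_distrib power_mult[symmetric])
 show i1: "integrable M (%w. dW k s t w*dW l s t w)"
 proof (rule Bochner_Integration.integrable_bound[of M "%w. (dW k s t w)^2 + (dW l s t w)^2"])
  have "norm (x*y) <= norm (x^2 + y^2)" for x y :: real using ab[of x y] by simp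
  thus "AE w in M. norm (dW k s t w*dW l s t w) <= norm ((dW k s t w)^2 + (dW l s t w)^2)" by simp
 qed (use m in auto)
 show mean: "(LINT w|M. dW k s t w*dW l s t w) = (if k = l then t - s else 0)"
  using W_orth[OF assms(1,2) _ assms(3,4)] m by (simp add: power2_eq_square)
 have i2: "integrable M (%w. (dW k s t w*dW l s t w)^2)"
 proof (rule Bochner_Integration.integrable_bound[of M "%w. ((dW k s t w)^4 + (dW l s t w)^4)/2"])
  have "norm ((x*y)^2) <= norm ((x^4 + y^4)/2)" for x y :: real using ab4[of x y] by (simp add: abs_of_nonneg)
  thus "AE w in M. norm ((dW k s t w*dW l s t w)^2) <= norm (((dW k s t w)^4 + (dW l s t w)^4)/2)" by simp
 qed (use m in auto)
 let ?c = "if k = l then t - s else 0"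
 have e: "(dW k s t w*dW l s t w - ?c)^2 = (dW k s t w*dW l s t w)^2 - 2*?c*(dW k s t w*dW l s t w) + ?c^2" for w by (simp add: power2_diff)
 show "integrable M (%w. (dW k s t w*dW l s t w - ?c)^2)" unfolding e using i1 i2 by auto
 have "(LINT w|M. (dW k s t w*dW l s t w - ?c)^2) = (LINT w|M. (dW k s t w*dW l s t w)^2) - 2*?c*?c + ?c^2"
  unfolding e using i1 i2 mean by (simp add: prob_space)
 also have "... <= (LINT w|M. (dW k s t w*dW l s t w)^2)" by (simp add: power2_eq_square)
 also have "... <= (LINT w|M. ((dW k s t w)^4 + (dW l s t w)^4)/2)" using i2 m ab4 by (intro integral_mono) auto
 also have "... = 3*(t - s)^2" using m by simp
 finally show "(LINT w|M. (dW k s t w*dW l s t w - ?c)^2) <= 3*(t - s)^2" .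
qed

text \<open>The summands are orthogonal, each being a centred function of the next increments times
  a factor known before. With \<open>h = fst\<close> these are Ito sums; with a product of
  increments minus its mean they are the fluctuations of covariation sums.\<close>

lemma increment_sum_L2:
 fixes T :: "nat => real" and h :: "nat => real \<times> real => real" and G :: "nat => 'w => real"
 assumes T: "strict_mono T" "0 <= T 0" and kl: "k:I" "l:I" and A: "finite A"
  and h: "!!i. h i:borel_measurable (borel \<Otimes>\<^sub>M borel)"
  and G: "!!i. G i:borel_measurable (F (T i))" "!!i w. w:space M ==> |G i w| <= C"
  and i2: "!!i. integrable M (%w. (hW h k l T i w)^2)"
  and E: "!!i. (LINT w|M. hW h k l T i w) = 0"
  and v: "!!i. (LINT w|M. (hW h k l T i w)^2) <= v"
 shows "integrable M (%w. (\<Sum>i\<in>A. G i w*hW h k l T i w)^2)"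
  "(LINT w|M. (\<Sum>i\<in>A. G i w*hW h k l T i w)^2) <= (\<Sum>i\<in>A. v * (LINT w|M. (G i w)^2))"
  "!!i. (LINT w|M. G i w*hW h k l T i w) = 0"
proof -
 let ?xi = "%i w. hW h k l T i w"
 have T0: "0 <= T i" for i using T strict_mono_less_eq[OF T(1), of 0 i] by linarith
 have TS: "T i < T (Suc i)" for i using T(1) by (simp add: strict_mono_Suc_iff)
 have xiF: "?xi i:borel_measurable (F (T (Suc i)))" for i
  using dW_F[OF kl(1) T0 less_imp_le[OF TS], of i] dW_F[OF kl(2) T0 less_imp_le[OF TS], of i] h[of i]
  by (intro measurable_compose[OF measurable_Pair h])
 have [measurable]: "rv (?xi i)" for i by (rule F_measurable_M[OF xiF])
 have [measurable]: "rv (G i)" for i by (rule F_measurable_M[OF G(1)])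
 have i1: "integrable M (?xi i)" for i by (rule L1_le_L2(1)[OF _ i2]) simp
 have iG: "integrable M (%w. G i w*X w)" if "integrable M X" for i X
 proof (rule Bochner_Integration.integrable_bound[of M "%w. C*X w"])
  show "AE w in M. norm (G i w*X w) <= norm (C*X w)"
  proof (rule AE_I2)
   fix w assume "w:space M"
   hence "|G i w|*|X w| <= |C|*|X w|" using G(2)[of w i] by (intro mult_right_mono) auto
   thus "norm (G i w*X w) <= norm (C*X w)" by (simp add: abs_mult)
  qed
 qed (use that in auto)
 have iGG: "integrable M (%w. (G i w)^2)" for i using iG[of "G i" i] iG[of "%_. 1" i] by (simp add: power2_eq_square)
 have E0: "(LINT w|M. H w*?xi j w) = 0" if "H:borel_measurable (F (T j))" "integrable M H" for H j using W_indep[OF kl T0 TS that h i1] E by simp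
 show "(LINT w|M. G i w*?xi i w) = 0" for i using E0[OF G(1)] iG[of "%_. 1" i] by simp
 have h2: "(%p. (h i p)^2):borel_measurable (borel \<Otimes>\<^sub>M borel)" for i using h[of i] by (rule borel_measurable_power)
 have Z2: "integrable M (%w. (G i w*?xi i w)^2) & (LINT w|M. (G i w*?xi i w)^2) <= v * (LINT w|M. (G i w)^2)" for i
 proof -
  have "integrable M (%w. (G i w)^2*(?xi i w)^2) & (LINT w|M. (G i w)^2*(?xi i w)^2) = (LINT w|M. (G i w)^2)*(LINT w|M. (?xi i w)^2)"
   using W_indep[OF kl T0 TS borel_measurable_power[OF G(1)] iGG h2 i2] .
  moreover have "(LINT w|M. (G i w)^2)*(LINT w|M. (?xi i w)^2) <= (LINT w|M. (G i w)^2) * v" by (intro mult_left_mono v) simp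
  ultimately show ?thesis by (simp add: power_mult_distrib mult.commute)
 qed
 have lt: "(LINT w|M. (G i w*?xi i w)*(G j w*?xi j w)) = 0" if "i < j" for i j
 proof -
  have "T (Suc i) <= T j" using T(1) that by (simp add: strict_mono_less_eq)
  hence m: "(%w. G j w*(G i w*?xi i w)):borel_measurable (F (T j))"
   using F_measurable_mono[OF xiF] F_measurable_mono[OF G(1), of i "T j"] G(1)[of j] TS[of i] by (intro borel_measurable_times) auto
  have "(LINT w|M. (G j w*(G i w*?xi i w))*?xi j w) = 0" by (rule E0[OF m]) (intro iG i1)
  thus ?thesis by (simp add: mult_ac)
 qed
 have ne: "(LINT w|M. (G i w*?xi i w)*(G j w*?xi j w)) = 0" if "i ~= j" for i j
  using lt[of i j] lt[of j i] that by (cases i j rule: linorder_cases) (auto simp: mult.commute)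
 have rvZ: "rv (%w. G i w*?xi i w)" for i by measurable
 show "integrable M (%w. (\<Sum>i\<in>A. G i w*?xi i w)^2)" by (rule expectation_square_sum_orthogonal(1)[OF A rvZ]) (use Z2 ne in auto)
 have "(LINT w|M. (\<Sum>i\<in>A. G i w*?xi i w)^2) = (\<Sum>i\<in>A. (LINT w|M. (G i w*?xi i w)^2))"
  by (rule expectation_square_sum_orthogonal(2)[OF A rvZ]) (use Z2 ne in auto)
 also have "... <= (\<Sum>i\<in>A. v * (LINT w|M. (G i w)^2))" using Z2 by (intro sum_mono) auto
 finally show "(LINT w|M. (\<Sum>i\<in>A. G i w*?xi i w)^2) <= (\<Sum>i\<in>A. v * (LINT w|M. (G i w)^2))" .
qed

end

text \<open>Measurability with respect to the increments reduces the factorisation to independent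
  generated sigma-algebras. The injection \<open>io\<close> allows the noise to be indexed by pairs
  while the process itself is indexed by numbers.\<close>

lemma wiener_process_family:
 assumes P: "filtered_prob_space M F" and W: "wiener_process M F J W" and J: "finite J"
  and io: "inj_on io I" "io ` I <= J" and I: "finite I"
 shows "wiener_family M F I (%k. W (io k))"
proof -
 interpret filt M F using P unfolding filtered_prob_space_def filt_def filt_axioms_def by blast
 let ?e = "%k s t w. W (io k) t w - W (io k) s w"
 show ?thesis
 proof
  show "finite I" by (rule I)
  show "cont_adapted M F (W (io k))" if "k:I" for k using W io that unfolding wiener_process_def by blast
  show "distributed M lborel (%w. ?e k s t w) (%x. ennreal (normal_density 0 (sqrt (t - s)) x))"
   if "k:I" "0 <= s" "s < t" for k s t using W io that unfolding wiener_process_def by blast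
  show "(LINT w|M. (?e k s t w)*(?e l s t w)) = 0" if h: "k:I" "l:I" "k ~= l" "0 <= s" "s < t" for k l s t
  proof -
   let ?D = "%k w. W k t w - W k s w"
   have dist: "distributed M lborel (?D j) (%x. ennreal (normal_density 0 (sqrt (t - s)) x))" if "j:J" for j
    using W h that unfolding wiener_process_def by blast
   have iv: "indep_vars (%_. borel) ?D J" using W h unfolding wiener_process_def by blast
   have kl: "io k ~= io l" "io k:J" "io l:J" using io h by (auto simp: inj_on_def)
   have ind: "indep_vars (%_. borel) ?D {io k, io l}" by (rule indep_vars_subset[OF iv]) (use kl in simp)
   have i: "integrable M (?D j)" "(LINT w|M. ?D j w) = 0" if "j:J" for j
   proof -
    have "has_bochner_integral lborel (%x. normal_density 0 (sqrt (t - s)) x*x) 0" using normal_moment_odd[of "sqrt (t - s)" 0 0] h by simp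
    thus "integrable M (?D j)" "(LINT w|M. ?D j w) = 0"
     using distributed_integrable[OF dist[OF that], of "%x. x"] distributed_integral[OF dist[OF that], of "%x. x"]
     by (auto simp: has_bochner_integral_iff normal_density_nonneg)
   qed
   have "(LINT w|M. (\<Prod>j\<in>{io k, io l}. ?D j w)) = (\<Prod>j\<in>{io k, io l}. (LINT w|M. ?D j w))"
    by (rule indep_vars_lebesgue_integral[OF _ ind]) (use kl i in auto)
   thus ?thesis using kl i by simp
  qed
  show "integrable M (%w. G w*h (?e k s t w, ?e l s t w)) & (LINT w|M. G w*h (?e k s t w, ?e l s t w)) =
    (LINT w|M. G w)*(LINT w|M. h (?e k s t w, ?e l s t w))" if h: "k:I" "l:I" "0 <= s" "s < t" and G: "G:borel_measurable (F s)" "integrable M G"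
    and hm: "h:borel_measurable (borel \<Otimes>\<^sub>M borel)"
    and ih: "integrable M (%w. h (?e k s t w, ?e l s t w))" for k l s t and G :: "'a => real" and h :: "real \<times> real => real"
  proof -
   let ?D = "%k w. W k t w - W k s w"
   let ?V = "%w. \<lambda>k\<in>J. ?D k w"
   have kl: "io k:J" "io l:J" using io h by auto
   have "rv (?D j)" if "j:J" for j
   proof -
    have "cont_adapted M F (W j)" using W that unfolding wiener_process_def by blast
    thus ?thesis using cont_adapted_rv[of "W j" t] cont_adapted_rv[of "W j" s] h by auto
   qed
   hence Vm: "?V:measurable M (\<Pi>\<^sub>M k\<in>J. borel)" by (intro measurable_restrict)
   define VA where "VA = vimage_algebra (space M) ?V (\<Pi>\<^sub>M k\<in>J. borel)"
   let ?H = "%w. h (?D (io k) w, ?D (io l) w)"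
   have ind0: "indep_set (sets (F s)) (sets VA)" using W h unfolding wiener_process_def VA_def by blast
   have V: "?V:measurable VA (\<Pi>\<^sub>M k\<in>J. borel)" unfolding VA_def using measurable_space[OF Vm] by (intro measurable_vimage_algebra1) auto
   have "(%v. h (v (io k), v (io l))):borel_measurable (\<Pi>\<^sub>M k\<in>J. borel)"
    using kl by (intro measurable_compose[OF measurable_Pair hm] measurable_component_singleton)
   from measurable_compose[OF V this] have H: "?H:borel_measurable VA" using kl by simp
   have sub_gen: "sigma_sets (space M) {X -` A \<inter> space M |A. A:sets borel} <= sets N"
    if "X:borel_measurable N" "space N = space M" for X :: "'a => real" and N
    using sets.sigma_sets_subset[of "{X -` A \<inter> space M |A. A:sets borel}" N] measurable_sets[OF that(1)] that(2) by auto
   have "rv G" by (rule F_measurable_M[OF G(1)])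
   moreover have "rv ?H" using ih by (rule borel_measurable_integrable)
   moreover have "indep_set (sigma_sets (space M) {G -` A \<inter> space M |A. A:sets borel})
     (sigma_sets (space M) {?H -` A \<inter> space M |A. A:sets borel})"
    using ind0 sub_gen[OF G(1) space_F] sub_gen[OF H] unfolding indep_sets2_eq VA_def by (meson space_vimage_algebra subset_iff)
   ultimately have ind: "indep_var borel G borel ?H" unfolding indep_var_eq by blast
   show ?thesis using indep_var_integrable[OF ind G(2) ih] indep_var_lebesgue_integral[OF ind G(2) ih] by blast
  qed
 qed
qed

lemma integral_grid_split:
 fixes f :: "real => real"
 assumes f: "continuous_on {0..t} f" and t: "0 < t" and n: "0 < n" and m: "m <= n"
 shows "integral {0..grid t n m} f = (\<Sum>i<m. integral {grid t n i..grid t n (Suc i)} f)" using m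
proof (induction m)
 case (Suc m)
 have le: "0 <= grid t n m" "grid t n m <= grid t n (Suc m)" "grid t n (Suc m) <= t"
  using grid_nonneg[of t n m] grid_mono[of t m "Suc m" n] grid_le[of t "Suc m" n] t n Suc.prems by auto
 have "f integrable_on {0..grid t n (Suc m)}" by (rule integrable_continuous_real) (use f le in "auto intro: continuous_on_subset")
 from Henstock_Kurzweil_Integration.integral_combine[OF le(1,2) this] Suc show ?case by simp
qed simp

lemma riemann_sum_grid:
 fixes f :: "real => real"
 assumes f: "continuous_on {0..t} f" and t: "0 < t"
 shows "(%n. (\<Sum>i<Suc n. f (grid t (Suc n) i)*(t/real (Suc n)))) ----> integral {0..t} f"
proof (rule LIMSEQ_I)
 fix r :: real assume r: "0 < r"
 have "uniformly_continuous_on {0..t} f" using f by (intro compact_uniformly_continuous) auto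
 moreover have "r/(2*t) > 0" using r t by simp
 ultimately obtain d where d: "d > 0" "!!x y. x:{0..t} ==> y:{0..t} ==> dist y x < d ==> dist (f y) (f x) < r/(2*t)"
  unfolding uniformly_continuous_on_def by meson
 obtain N :: nat where N: "t/d < real N" using reals_Archimedean2 by blast
 show "EX no. ALL n>=no. norm ((\<Sum>i<Suc n. f (grid t (Suc n) i)*(t/real (Suc n))) - integral {0..t} f) < r"
 proof (intro exI[of _ N] allI impI)
  fix n assume "N <= n"
  define k where "k = Suc n"
  have k: "k > 0" "t/d < real k" using N `N <= n` by (auto simp: k_def)
  have step: "t/real k < d" using k d(1) t by (simp add: field_simps)
  have "|f (grid t k i)*(t/real k) - integral {grid t k i..grid t k (Suc i)} f| <= r/(2*t)*(t/real k)" if i: "i < k" for i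
  proof -
   let ?a = "grid t k i" and ?b = "grid t k (Suc i)"
   have le: "0 <= ?a" "?a <= ?b" "?b <= t" "?b - ?a = t/real k"
    using grid_nonneg[of t k i] grid_mono[of t i "Suc i" k] grid_le[of t "Suc i" k] t k i grid_step by auto
   have c: "continuous_on {?a..?b} f" using f le by (auto intro: continuous_on_subset)
   have "integral {?a..?b} (%x. f x - f ?a) = integral {?a..?b} f - (?b - ?a)*f ?a"
    using le integrable_continuous_real[OF c] by (subst Henstock_Kurzweil_Integration.integral_diff) auto
   moreover have "norm (integral {?a..?b} (%x. f x - f ?a)) <= (r/(2*t))*(?b - ?a)"
   proof (rule integral_bound)
    show "continuous_on {?a..?b} (%x. f x - f ?a)" by (intro continuous_intros c)
    show "norm (f x - f ?a) <= r/(2*t)" if "x:{?a..?b}" for x using d(2)[of ?a x] that le step by (auto simp: dist_real_def intro!: less_imp_le)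
   qed (rule le(2))
   ultimately show ?thesis using le(4) by (simp add: abs_minus_commute mult.commute)
  qed
  hence "|\<Sum>i<k. f (grid t k i)*(t/real k) - integral {grid t k i..grid t k (Suc i)} f| <= (\<Sum>i<k. r/(2*t)*(t/real k))"
   by (intro order_trans[OF sum_abs] sum_mono) auto
  also have "... = r/2" using t k by simp
  finally have "|(\<Sum>i<k. f (grid t k i)*(t/real k)) - integral {0..t} f| <= r/2"
   using integral_grid_split[OF f t k(1), of k] k by (simp add: sum_subtractf grid_n)
  thus "norm ((\<Sum>i<Suc n. f (grid t (Suc n) i)*(t/real (Suc n))) - integral {0..t} f) < r" using r by (simp add: k_def)
 qed
qed

context prob_space
begin

lemma pnorm_sqrt:
 assumes "rv X" "!!z. z:space M ==> 0 <= X z" shows "pnorm (%z. sqrt (X z)) <= sqrt (pnorm X)"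
proof -
 have [measurable]: "rv X" by fact
 have e: "(min 1 |sqrt (X z)| )^2 = min 1 |X z|" if "z:space M" for z using assms(2)[OF that] by (auto simp: min_def)
 have i: "integrable M (%z. (min 1 |sqrt (X z)| )^2)"
  using integrable_min1[OF assms(1)] e by (subst Bochner_Integration.integrable_cong[OF refl e]) auto
 have "pnorm (%z. sqrt (X z)) = (LINT z|M. |min 1 |sqrt (X z)| | )" unfolding pnorm_def by simp
 also have "... <= sqrt (LINT z|M. (min 1 |sqrt (X z)| )^2)" by (rule L1_le_L2(2)[OF _ i]) simp
 also have "(LINT z|M. (min 1 |sqrt (X z)| )^2) = pnorm X" unfolding pnorm_def by (rule lint_cong[OF refl e])
 finally show ?thesis .
qed

lemma pnull_sqrt:
 assumes "pnull S" "!!n z. z:space M ==> 0 <= S n z" shows "pnull (%n z. sqrt (S n z))" unfolding pnull_def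
proof (intro conjI allI)
 show "rv (%z. sqrt (S n z))" for n using pnullD(1)[OF assms(1), of n] by simp
 have "(%n. sqrt (pnorm (S n))) ----> sqrt 0" by (intro tendsto_real_sqrt pnullD(2)[OF assms(1)])
 hence lim: "(%n. sqrt (pnorm (S n))) ----> 0" by simp
 show "(%n. pnorm (%z. sqrt (S n z))) ----> 0" by (rule null_sandwich[OF pnorm_nonneg pnorm_sqrt[OF pnullD(1)[OF assms(1)] assms(2)] lim])
qed

lemma pnull_uminus: "pnull S ==> pnull (%n z. - S n z)" by (rule pnull_mono[of S]) (auto dest: pnullD(1))

lemma pnull_diff: "pnull S ==> pnull T ==> pnull (%n z. S n z - T n z)" using pnull_add[OF _ pnull_uminus[of T], of S] by simp

lemma ptight_subseq: "ptight S ==> ptight (%n. S (r n))" unfolding ptight_def by meson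

lemma ptight_const: "ptight (%n z. c)" by (rule ptightI) (auto intro!: exI[of _ "|c|"] bexI[of _ "{}"])

lemma pnull_cmult: "pnull S ==> pnull (%n z. c*S n z)" using pnull_mult_ptight[OF _ ptight_const[of c], of S] by (simp add: mult.commute)

lemma bounded_integrable:
 assumes "rv X" "!!z. z:space M ==> |X z| <= C" shows "integrable M X" by (rule integrable_const_bound[where B=C]) (use assms in auto)

end

context filt
begin

text \<open>Path continuity and dominated convergence make the mean square distance continuous on a
  compact square, hence uniformly so, and it vanishes on the diagonal.\<close>

lemma L2_continuity:
 fixes U :: "real => 'w => real"
 assumes U: "cont_adapted M F U" "!!s z. z:space M ==> 0 <= s ==> |U s z| <= C" and t: "0 <= t" and e: "e > 0"
 obtains d where "d > 0" "!!s r. s:{0..t} ==> r:{0..t} ==> |s - r| < d ==> (LINT z|M. (U s z - U r z)^2) < e"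
proof -
 define g where "g p = (LINT z|M. (U (fst p) z - U (snd p) z)^2)" for p
 have Um: "rv (U s)" if "0 <= s" for s by (rule cont_adapted_rv[OF U(1) that])
 have "continuous_on ({0..t} \<times> {0..t}) g"
 proof (rule continuous_on_sequentiallyI)
  fix u a assume u: "ALL n. u n:{0..t} \<times> {0..t}" and a: "a:{0..t} \<times> {0..t}" and lim: "u ----> a"
  have lf: "(%n. fst (u n)) ----> fst a" and ls: "(%n. snd (u n)) ----> snd a" by (intro tendsto_fst tendsto_snd lim)+
  have mem: "fst (u n):{0..t}" "snd (u n):{0..t}" for n using u[rule_format, of n] by (auto simp: mem_Times_iff)
  have mema: "fst a:{0..t}" "snd a:{0..t}" using a by (auto simp: mem_Times_iff)
  show "(%n. g (u n)) ----> g a" unfolding g_def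
  proof (rule integral_dominated_convergence[where w="%_. (2*C)^2"])
   show "rv (%z. (U (fst a) z - U (snd a) z)^2)" using Um mema by auto
   show "rv (%z. (U (fst (u n)) z - U (snd (u n)) z)^2)" for n using Um mem[of n] by auto
   show "AE z in M. (%n. (U (fst (u n)) z - U (snd (u n)) z)^2) ----> (U (fst a) z - U (snd a) z)\<^sup>2"
   proof (rule AE_I2)
    fix z assume "z:space M"
    hence c: "continuous_on {0..t} (%s. U s z)" using U(1) unfolding cont_adapted_def by (auto intro: continuous_on_subset)
    have "(%n. U (fst (u n)) z) ----> U (fst a) z" by (rule continuous_on_tendsto_compose[OF c lf]) (use mem mema in auto)
    moreover have "(%n. U (snd (u n)) z) ----> U (snd a) z" by (rule continuous_on_tendsto_compose[OF c ls]) (use mem mema in auto)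
    ultimately show "(%n. (U (fst (u n)) z - U (snd (u n)) z)^2) ----> (U (fst a) z - U (snd a) z)\<^sup>2" by (intro tendsto_intros)
   qed
   show "AE z in M. norm ((U (fst (u n)) z - U (snd (u n)) z)^2) <= (2*C)^2" for n
   proof (rule AE_I2)
    fix z assume "z:space M"
    hence "|U (fst (u n)) z| <= C" "|U (snd (u n)) z| <= C" using U(2) mem[of n] by auto
    hence "|U (fst (u n)) z - U (snd (u n)) z| <= |2*C|" by linarith
    thus "norm ((U (fst (u n)) z - U (snd (u n)) z)^2) <= (2*C)^2" by (simp add: abs_le_square_iff)
   qed
  qed simp
 qed
 hence "uniformly_continuous_on ({0..t} \<times> {0..t}) g" by (intro compact_uniformly_continuous compact_Times) auto
 then obtain d where d: "d > 0" "!!p q. p:{0..t} \<times> {0..t} ==> q:{0..t} \<times> {0..t} ==> dist q p < d ==> dist (g q) (g p) < e"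
  using e unfolding uniformly_continuous_on_def by meson
 show ?thesis
 proof (rule that[OF d(1)])
  fix s r assume h: "s:{0..t}" "r:{0..t}" "|s - r| < d"
  have "dist (s, r) (s, s) < d" using h(3) by (simp add: dist_Pair_Pair dist_real_def abs_minus_commute)
  hence "dist (g (s, r)) (g (s, s)) < e" using d(2)[of "(s, s)" "(s, r)"] h by auto
  hence "|g (s, r) - g (s, s)| < e" by (simp add: dist_real_def)
  moreover have "g (s, s) = 0" by (simp add: g_def)
  ultimately show "(LINT z|M. (U s z - U r z)^2) < e" by (simp add: g_def)
 qed
qed

lemma time_integral_rv:
 fixes U :: "real => 'w => real"
 assumes U: "cont_adapted M F U" and t: "0 < t" shows "rv (%z. integral {0..t} (%s. U s z))"
proof (rule borel_measurable_LIMSEQ_real)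
 show "rv (%z. \<Sum>i<Suc n. U (grid t (Suc n) i) z*(t/real (Suc n)))" for n using cont_adapted_rv[OF U grid_nonneg[of t "Suc n"]] t
  by (intro bm) auto
 show "(%n. \<Sum>i<Suc n. U (grid t (Suc n) i) z*(t/real (Suc n))) ----> integral {0..t} (%s. U s z)"
  if "z:space M" for z using U that unfolding cont_adapted_def by (intro riemann_sum_grid t) (auto intro: continuous_on_subset)
qed

lemma time_integral_riemann:
 fixes U :: "real => 'w => real"
 assumes U: "cont_adapted M F U" and t: "0 < t"
 shows "pnull (%n z. (\<Sum>i<Suc n. U (grid t (Suc n) i) z*(t/real (Suc n))) - integral {0..t} (%s. U s z))"
proof (rule pnull_pointwise)
 show "rv (%z. (\<Sum>i<Suc n. U (grid t (Suc n) i) z*(t/real (Suc n))) - integral {0..t} (%s. U s z))" for n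
  using cont_adapted_rv[OF U grid_nonneg[of t "Suc n"]] t time_integral_rv[OF assms] by (intro borel_measurable_diff bm) auto
 show "(%n. (\<Sum>i<Suc n. U (grid t (Suc n) i) z*(t/real (Suc n))) - integral {0..t} (%s. U s z)) ----> 0"
  if "z:space M" for z using U that unfolding cont_adapted_def by (intro LIM_zero riemann_sum_grid t) (auto intro: continuous_on_subset)
qed

end

context wiener_family
begin

lemma strict_mono_grid: "0 < t ==> 0 < n ==> strict_mono (grid t n)" unfolding strict_mono_Suc_iff using grid_strict by blast

lemma W_rv: "k:I ==> 0 <= s ==> rv (W k s)" using W_adapted cont_adapted_rv by blast

lemma dW_grid_moments:
 assumes "k:I" "0 < t" "0 < n"
 shows "integrable M (%z. (gW k t n i z)^2)"
  "(LINT z|M. (gW k t n i z)^2) = t/real n"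
  "integrable M (%z. (gW k t n i z)^4)"
  "(LINT z|M. (gW k t n i z)^4) = 3*(t/real n)^2"
  "integrable M (gW k t n i)"
  "(LINT z|M. gW k t n i z) = 0" using dW_moments[OF assms(1) _ grid_strict[OF assms(2,3), of i]] grid_nonneg[of t n i] assms(2)
 by (auto simp: grid_step)

lemma qv_W:
 assumes "k:I" "0 < t"
 shows "integrable M (qv (W k) t n)" "(LINT z|M. qv (W k) t n z) <= t"
proof -
 show "integrable M (qv (W k) t n)" unfolding qv_def[abs_def] using dW_grid_moments[OF assms, of n] by (intro Bochner_Integration.integrable_sum) auto
 show "(LINT z|M. qv (W k) t n z) <= t"
 proof (cases "n = 0")
  case False
  thus ?thesis unfolding qv_def using dW_grid_moments[OF assms, of n] by (simp add: lint_sum)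
 qed (use assms in "simp add: qv_def")
qed

lemma qv_W_ptight: "k:I ==> 0 < t ==> ptight (qv (W k) t)" using qv_W qv_nonneg[of "W k" t] by (intro ptight_L1[where C=t]) (auto simp: abs_of_nonneg)

text \<open>The fourth root of the sum of fourth powers dominates the largest increment, and the
  expectation of that sum is \<open>3*t^2\<close> divided by the number of steps.\<close>

lemma max_dW_pnull:
 assumes "k:I" "0 < t"
 shows "pnull (%n z. sqrt (sqrt (\<Sum>i<Suc n. (gW k t (Suc n) i z)^4)))"
proof (intro pnull_sqrt pnull_L1)
 note m = dW_grid_moments[OF assms, of "Suc _", simplified]
 have i: "integrable M (%z. \<Sum>i<Suc n. (gW k t (Suc n) i z)^4)" for n using m by (intro Bochner_Integration.integrable_sum) auto
 thus "integrable M (%z. \<Sum>i<Suc n. (gW k t (Suc n) i z)^4)" for n .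
 have nn: "0 <= (\<Sum>i<Suc n. (gW k t (Suc n) i z)^4)" for n z by (intro sum_nonneg) auto
 thus "0 <= (\<Sum>i<Suc n. (gW k t (Suc n) i z)^4)" for n z .
 have "(LINT z|M. |\<Sum>i<Suc n. (gW k t (Suc n) i z)^4| ) = (3*t^2)/real (Suc n)" for n
 proof -
  have "(LINT z|M. |\<Sum>i<Suc n. (gW k t (Suc n) i z)^4| ) =
    (\<Sum>i<Suc n. (LINT z|M. (gW k t (Suc n) i z)^4))" unfolding abs_of_nonneg[OF nn] by (rule lint_sum) (use m in auto)
  also have "... = (\<Sum>i<Suc n. 3*(t/real (Suc n))^2)" by (intro sum.cong refl dW_grid_moments(4)[OF assms]) simp
  also have "... = real (Suc n)*(3*(t/real (Suc n))^2)" by simp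
  also have "... = (3*t^2)/real (Suc n)"
  proof -
   have "N*(3*(t/N)^2) = (3*t^2)/N" if "N ~= 0" for N :: real using that by (simp add: power2_eq_square field_simps)
   thus ?thesis by (metis of_nat_0_eq_iff nat.distinct(1))
  qed
  finally show ?thesis .
 qed
 moreover have "(%n. (3*t^2)/real (Suc n)) ----> 0" by (rule null_over_Suc)
 ultimately show "(%n. (LINT z|M. |\<Sum>i<Suc n. (gW k t (Suc n) i z)^4| )) ----> 0" by simp
qed (auto intro!: sum_nonneg simp del: sum.lessThan_Suc)

lemma dW_le_max:
 fixes d :: "nat => real"
 assumes "i < n" shows "|d i| <= sqrt (sqrt (\<Sum>i<n. (d i)^4))"
proof -
 have "(d i)^4 <= (\<Sum>i<n. (d i)^4)" by (rule member_le_sum) (use assms in auto)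
 hence "sqrt (sqrt ((d i)^4)) <= sqrt (sqrt (\<Sum>i<n. (d i)^4))" by simp
 moreover have "sqrt (sqrt ((d i)^4)) = |d i|" using real_sqrt_abs[of "d i"] real_sqrt_abs[of "(d i)^2"] by (simp add: power_mult[symmetric])
 ultimately show ?thesis by simp
qed

lemma ito_sum_L2:
 assumes k: "k:I" and t: "0 < t" and n: "0 < n" and A: "finite A"
  and G: "!!i. G i:borel_measurable (F (grid t n i))" "!!i z. z:space M ==> |G i z| <= C"
 shows "integrable M (%z. (\<Sum>i\<in>A. G i z*gW k t n i z)^2)"
  "(LINT z|M. (\<Sum>i\<in>A. G i z*gW k t n i z)^2) <= (\<Sum>i\<in>A. t/real n*(LINT z|M. (G i z)^2))"
  "(LINT z|M. G i z*gW k t n i z) = 0" using increment_sum_L2[where h="%_. fst" and G=G and v="t/real n" and C=C, OF strict_mono_grid[OF t n] _ k k A]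
  dW_grid_moments[OF k t n] G by auto

lemma covariation_sum_L2:
 assumes kl: "k:I" "l:I" and t: "0 < t" and n: "0 < n" and A: "finite A"
  and G: "!!i. G i:borel_measurable (F (grid t n i))" "!!i z. z:space M ==> |G i z| <= C"
 shows "integrable M (%z. (\<Sum>i\<in>A. G i z*(gW k t n i z*gW l t n i z - (if k = l then t/real n else 0)))^2)"
  "(LINT z|M. (\<Sum>i\<in>A. G i z*(gW k t n i z*gW l t n i z
   - (if k = l then t/real n else 0)))^2) <= (\<Sum>i\<in>A. 3*(t/real n)^2*(LINT z|M. (G i z)^2))"
proof -
 let ?h = "%(i::nat) p :: real \<times> real. fst p * snd p - (if k = l then t/real n else 0)"
 note p = dW_product[OF kl grid_nonneg grid_strict[OF t n], unfolded grid_step, OF less_imp_le[OF t]]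
 have m: "?h i:borel_measurable (borel \<Otimes>\<^sub>M borel)" for i by measurable
 have E: "(LINT z|M. ?h i (gW k t n i z, gW l t n i z)) = 0" for i using p(1,2)[of i] by (auto simp: prob_space)
 note S = increment_sum_L2[where h="?h" and G=G and v="3*(t/real n)^2" and C=C, OF strict_mono_grid[OF t n] _ kl A m G _ E]
 show "integrable M (%z. (\<Sum>i\<in>A. G i z*(gW k t n i z*gW l t n i z - (if k = l then t/real n else 0)))^2)" using S(1) p(3,4) by simp
 show "(LINT z|M. (\<Sum>i\<in>A. G i z*(gW k t n i z*gW l t n i z
   - (if k = l then t/real n else 0)))^2) <= (\<Sum>i\<in>A. 3*(t/real n)^2*(LINT z|M. (G i z)^2))" using S(2) p(3,4) by simp
qed

end

section \<open>Trapezoidal sums and covariations\<close>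

lemma sum_block:
 fixes f :: "nat => real"
 shows "(\<Sum>j<Suc i*m. f j) - (\<Sum>j<i*m. f j) = (\<Sum>j=i*m..<Suc i*m. f j)"
proof -
 have "sum f {0..<i*m} + sum f {i*m..<Suc i*m} = sum f {0..<Suc i*m}" by (rule sum.atLeastLessThan_concat) auto
 hence "sum f {..<i*m} + sum f {i*m..<Suc i*m} = sum f {..<Suc i*m}" by (simp only: lessThan_atLeast0)
 thus ?thesis by linarith
qed

lemma sum_blocks:
 fixes f :: "nat => real"
 shows "(\<Sum>i<n. \<Sum>j=i*m..<Suc i*m. f j) = (\<Sum>j<n*m. f j)"
proof (induction n)
 case (Suc n)
 thus ?case using sum_block[where f=f and i=n and m=m] by simp
qed simp

lemma abs_sum_product_le:
 fixes a b :: "nat => real"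
 assumes "!!i. i < n ==> |b i| <= B"
 shows "|\<Sum>i<n. a i*b i| <= (\<Sum>i<n. |a i| )*B"
proof -
 have "|\<Sum>i<n. a i*b i| <= (\<Sum>i<n. |a i|*|b i| )" using sum_abs[of "%i. a i*b i" "{..<n}"] by (simp add: abs_mult)
 also have "... <= (\<Sum>i<n. |a i|*B)" using assms by (intro sum_mono mult_left_mono) auto
 finally show ?thesis by (simp add: sum_distrib_right)
qed

context wiener_family
begin

text \<open>Splits into a left-point sum and one half of a covariation sum.\<close>

definition trap :: "(real => 'w => real) => 'k => real => nat => nat => 'w => real" where
 "trap U k t n j w = (\<Sum>i<j. (U (grid t n i) w + U (grid t n (Suc i)) w)/2*gW k t n i w)"

lemma trap_rv:
 assumes "!!s. 0 <= s ==> rv (U s)" "k:I" "0 <= t" shows "rv (trap U k t n j)"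
 unfolding trap_def[abs_def] using assms W_rv[OF assms(2)] grid_nonneg[of t n]
 by (intro bm borel_measurable_divide borel_measurable_add borel_measurable_diff) auto

text \<open>The grid with \<open>n*m\<close> steps contains the coarse point
  \<open>grid t n i\<close> as its point number \<open>i*m\<close>, so one family of fine grids
  approximates the integral up to every coarse point.\<close>

lemma stratonovich_trap:
 assumes J: "has_stratonovich_integral M U (W k) J" and U: "!!s. 0 <= s ==> rv (U s)" and k: "k:I"
  and t: "0 < t" and i: "i <= n" "0 < n" and e: "e > 0"
 obtains m0 where "!!m. m >= m0 ==> 0 < m ==> pnorm (%w. J (grid t n i) w - trap U k t (n*m) (i*m) w) <= e"
proof -
 have s0: "0 <= grid t n i" using t by (simp add: grid_nonneg)
 obtain dl where dl: "dl > 0" "!!N \<pi>. is_partition (grid t n i) dl N \<pi> ==>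
   prob {w:space M. |(\<Sum>k'<N. (U (\<pi> k') w + U (\<pi> (Suc k')) w)/2*(W k (\<pi> (Suc k')) w - W k (\<pi> k') w))
       - J (grid t n i) w| > e/2} < e/2" using J s0 e unfolding has_stratonovich_integral_def by (meson half_gt_zero)
 have Jm: "rv (J (grid t n i))" using J s0 unfolding has_stratonovich_integral_def by blast
 obtain m0 :: nat where m0: "t/dl < real m0" using reals_Archimedean2 by blast
 show ?thesis
 proof (rule that[of m0])
  fix m assume m: "m0 <= m" "0 < m"
  have "t/real (n*m) <= t/real m" using t i m by (intro divide_left_mono) auto
  also have "t/real m <= dl"
  proof -
   have "t < dl*real m0" using m0 dl(1) by (simp add: divide_less_eq mult.commute)
   also have "dl*real m0 <= dl*real m" using m dl(1) by (intro mult_left_mono) auto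
   finally show ?thesis using m by (simp add: divide_le_eq mult.commute)
  qed
  finally have "is_partition (grid t n i) dl (i*m) (grid t (n*m))" using t grid_refine[of n m t i] i m grid_mono[of t _ "Suc _" "n*m"]
   by (auto simp: is_partition_def grid_step)
  from dl(2)[OF this] have P: "prob {w:space M. |trap U k t (n*m) (i*m) w - J (grid t n i) w| > e/2} < e/2" by (simp add: trap_def)
  have r: "rv (%w. J (grid t n i) w - trap U k t (n*m) (i*m) w)" using Jm trap_rv[OF U k] t by auto
  show "pnorm (%w. J (grid t n i) w - trap U k t (n*m) (i*m) w) <= e" using pnorm_le_prob[OF r, of "e/2"] P e by (simp add: abs_minus_commute)
 qed
qed

text \<open>A Stratonovich integral is given only as a limit in probability, separately for each
  time, whereas the covariation involves all its coarse increments. Each coarse increment is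
  therefore replaced by a block of a finer trapezoidal sum, with a refinement \<open>m n\<close>
  depending on the coarse grid.\<close>

lemma covariation_converges:
 assumes t: "0 < t" and k: "k:I"
  and U: "!!l. l:I ==> cont_adapted M F (U l)" "!!l s w. l:I ==> w:space M ==> 0 <= s ==> |U l s w| <= C"
   "!!l. l:I ==> ptight (qv (U l) t)"
  and J: "!!l. l:I ==> has_stratonovich_integral M (U l) (W l) (J l)"
  and B: "!!s. 0 <= s ==> rv (B s)" "!!s r w. w:space M ==> 0 <= r ==> r <= s ==> |B s w - B r w| <= CB*(s - r)"
  and Ym: "!!s. 0 <= s ==> rv (Y s)"
  and Y: "!!s. 0 <= s ==> s <= t ==> AE w in M. Y s w = Y0 w + B s w + (\<Sum>l\<in>I. J l s w)"
 shows "pnull (%n w. (\<Sum>i<Suc n. (Y (grid t (Suc n) (Suc i)) w - Y (grid t (Suc n) i) w)*gW k t (Suc n) i w) - integral {0..t} (%s. U k s w))"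
proof -
 have Um: "rv (U l s)" if "l:I" "0 <= s" for l s using cont_adapted_rv[OF U(1)[OF that(1)] that(2)] .
 have Jm: "rv (J l s)" if "l:I" "0 <= s" for l s using J[OF that(1)] that(2) unfolding has_stratonovich_integral_def by blast
 define R where "R l n m i w = J l (grid t n i) w - trap (U l) l t (n*m) (i*m) w" for l n m i w
 \<comment> \<open>There are \<open>n + 2\<close> grid values, so an error of
   \<open>1/(n + 1)^2\<close> for each gives a total of at most \<open>2/(n + 1)\<close>.\<close>
 have "EX m>0. ALL l:I. ALL i<=Suc n. pnorm (R l (Suc n) m i) <= 1/(real (Suc n))^2" for n
 proof -
  have "EX m0. ALL m>=m0. 0 < m --> pnorm (R l (Suc n) m i) <= 1/(real (Suc n))^2" if l: "l:I" and i: "i <= Suc n" for l i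
  proof -
   have "1/(real (Suc n))^2 > 0" by simp
   then obtain m0 where "!!m. m >= m0 ==> 0 < m ==> pnorm (%w. J l (grid t (Suc n) i) w - trap (U l) l t (Suc n*m) (i*m) w) <= 1/(real (Suc n))^2"
    using stratonovich_trap[OF J[OF l] Um[OF l] l t i] by (metis zero_less_Suc)
   thus ?thesis unfolding R_def by blast
  qed
  then obtain m0 where m0: "!!l i m. l:I ==> i <= Suc n ==> m >= m0 l i ==> 0 < m ==> pnorm (R l (Suc n) m i) <= 1/(real (Suc n))^2" by metis
  define m where "m = Suc (\<Sum>l\<in>I. \<Sum>i\<le>Suc n. m0 l i)"
  have "m0 l i <= m" if "l:I" "i <= Suc n" for l i
  proof -
   have "m0 l i <= (\<Sum>i\<le>Suc n. m0 l i)" by (rule member_le_sum) (use that in auto)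
   also have "... <= (\<Sum>l\<in>I. \<Sum>i\<le>Suc n. m0 l i)" by (rule member_le_sum) (use that finI in auto)
   finally show ?thesis by (simp add: m_def)
  qed
  thus ?thesis using m0 by (intro exI[of _ m]) (auto simp: m_def)
 qed
 then obtain m where m: "!!n. m n > 0" "!!n l i. l:I ==> i <= Suc n ==> pnorm (R l (Suc n) (m n) i) <= 1/(real (Suc n))^2" by metis
 define g where "g n i = grid t (Suc n) i" for n i
 define f where "f n j = grid t (Suc n*m n) j" for n j
 define D where "D l n i w = dW l (g n i) (g n (Suc i)) w" for l n i w
 define d where "d l n j w = dW l (f n j) (f n (Suc j)) w" for l n j w
 define blk where "blk n i = {i*m n..<Suc i*m n}" for n i
 define a where "a l n i w = (\<Sum>j\<in>blk n i. (U l (f n j) w - U l (g n i) w)*d l n j w)" for l n i w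
 define q where "q l n i w = (\<Sum>j\<in>blk n i. (U l (f n (Suc j)) w - U l (f n j) w)*d l n j w)" for l n i w
 define Rn where "Rn l n i = R l (Suc n) (m n) i" for l n i
 have g0: "0 <= g n i" and f0: "0 <= f n j" for n i j using t by (simp_all add: g_def f_def grid_nonneg)
 have gf: "f n (i*m n) = g n i" for n i using grid_refine[of "Suc n" "m n" t i] m(1) by (simp add: f_def g_def)
 have gmono: "g n i <= g n j" if "i <= j" for n i j using t that by (simp add: g_def grid_mono)
 have fmono: "f n i <= f n j" if "i <= j" for n i j using t that by (simp add: f_def grid_mono)
 have gt: "g n i <= t" if "i <= Suc n" for n i using t that by (simp add: g_def grid_le)
 have Dm [measurable]: "rv (D l n i)" if "l:I" for l n i unfolding D_def[abs_def] using dW_rv[OF that g0 gmono] by simp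
 have dm [measurable]: "rv (d l n j)" if "l:I" for l n j unfolding d_def[abs_def] using dW_rv[OF that f0 fmono] by simp
 have am: "rv (a l n i)" and qm: "rv (q l n i)" if "l:I" for l n i unfolding a_def[abs_def] q_def[abs_def] using Um[OF that] f0 g0 dm[OF that]
  by (auto intro!: bm)
 have Rm: "rv (Rn l n i)" if "l:I" for l n i
  unfolding Rn_def R_def[abs_def] using Jm[OF that] trap_rv[OF Um[OF that] that] t grid_nonneg[of t "Suc n" i] by (intro borel_measurable_diff) auto
 \<comment> \<open>A coarse increment consists of the left-point term, the Ito term \<open>a\<close>
   due to the oscillation of \<open>U\<close> inside the coarse step, and half of the covariation
   \<open>q\<close> over the fine grid.\<close>
 have step: "trap (U l) l t (Suc n*m n) (Suc i*m n) w - trap (U l) l t (Suc n*m n) (i*m n) w =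
   U l (g n i) w*D l n i w + a l n i w + q l n i w/2" for l n i w
 proof -
  have tel: "(\<Sum>j\<in>blk n i. d l n j w) = D l n i w"
  proof -
   have "(\<Sum>j\<in>blk n i. d l n j w) = W l (f n (Suc i*m n)) w - W l (f n (i*m n)) w" unfolding blk_def d_def by (rule sum_Suc_diff') simp
   thus ?thesis by (simp only: gf D_def)
  qed
  have "trap (U l) l t (Suc n*m n) (Suc i*m n) w - trap (U l) l t (Suc n*m n) (i*m n) w =
    (\<Sum>j\<in>blk n i. (U l (f n j) w + U l (f n (Suc j)) w)/2*d l n j w)" unfolding trap_def blk_def d_def f_def by (rule sum_block)
  also have "... = (\<Sum>j\<in>blk n i. U l (g n i) w*d l n j w + (U l (f n j) w - U l (g n i) w)*d l n j w
    + (U l (f n (Suc j)) w - U l (f n j) w)*d l n j w/2)" by (intro sum.cong refl) (simp add: field_simps)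
  also have "... = U l (g n i) w*(\<Sum>j\<in>blk n i. d l n j w) + a l n i w + q l n i w/2"
   by (simp add: sum.distrib sum_distrib_left sum_divide_distrib a_def q_def)
  finally show ?thesis by (simp add: tel)
 qed
 have Dk4: "|D k n i w| <= sqrt (sqrt (\<Sum>i<Suc n. (D k n i w)^4))" if "i < Suc n" for n i w by (rule dW_le_max[OF that])
 define mx where "mx n w = sqrt (sqrt (\<Sum>i<Suc n. (D k n i w)^4))" for n w
 have mx: "pnull mx" unfolding mx_def[abs_def] D_def g_def by (rule max_dW_pnull[OF k t])
 have mx0: "mx n w >= 0" for n w unfolding mx_def by (intro real_sqrt_ge_zero sum_nonneg) auto
 have qvD: "qv (W l) t (Suc n) w = (\<Sum>i<Suc n. (D l n i w)^2)" for l n w by (simp add: qv_def D_def g_def)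
 let ?SB = "%n w. \<Sum>i<Suc n. (B (g n (Suc i)) w - B (g n i) w)*D k n i w"
 let ?SA = "%l n w. \<Sum>i<Suc n. a l n i w*D k n i w"
 let ?SQ = "%l n w. \<Sum>i<Suc n. q l n i w*D k n i w"
 let ?SR = "%l n w. \<Sum>i<Suc n. (Rn l n (Suc i) w - Rn l n i w)*D k n i w"
 let ?SU = "%l n w. \<Sum>i<Suc n. U l (g n i) w*(D k n i w*D l n i w)"
 let ?V = "%n w. 1 + qv (W k) t (Suc n) w"
 let ?I = "%w. integral {0..t} (%s. U k s w)"
 let ?u = "%l n i j w. U l (f n j) w - U l (g n i) w"
 let ?h = "%n. t/real (Suc n*m n)"
 \<comment> \<open>The drift has total increment at most a multiple of \<open>t\<close>, and it is
   multiplied by increments of \<open>W\<close> whose maximum tends to zero.\<close>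
 have T1: "pnull (%n w. ?SB n w)"
 proof (rule pnull_mono)
  show "pnull (%n w. ( |CB|*t)*mx n w)" by (rule pnull_cmult[OF mx])
  show "rv (%w. ?SB n w)" for n using B(1)[OF g0] Dm[OF k] by (intro bm) auto
  show "AE w in M. |?SB n w| <= |( |CB|*t)*mx n w|" for n
  proof (rule AE_I2)
   fix w assume w: "w:space M"
   have "|?SB n w| <= (\<Sum>i<Suc n. |B (g n (Suc i)) w - B (g n i) w| )*mx n w"
    by (rule abs_sum_product_le) (use Dk4 in "simp add: mx_def del: sum.lessThan_Suc")
   also have "... <= (\<Sum>i<Suc n. |CB|*(t/real (Suc n)))*mx n w"
   proof (intro mult_right_mono sum_mono mx0)
    fix i
    have "|B (g n (Suc i)) w - B (g n i) w| <= CB*(t/real (Suc n))"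
     using B(2)[OF w g0 gmono, of i "Suc i" n] grid_step[of t "Suc n" i] by (simp add: g_def)
    also have "... <= |CB|*(t/real (Suc n))" using t by (intro mult_right_mono) auto
    finally show "|B (g n (Suc i)) w - B (g n i) w| <= |CB|*(t/real (Suc n))" .
   qed
   also have "(\<Sum>i<Suc n. |CB|*(t/real (Suc n))) = |CB|*t" by simp
   finally show "|?SB n w| <= |( |CB|*t)*mx n w|" by linarith
  qed
 qed
 \<comment> \<open>By Cauchy-Schwarz the sum is at most the root of the summed squares of
   \<open>a\<close>, which tends to zero by mean square continuity, times the root of the tight
   quadratic variation of \<open>W\<close>.\<close>
 have T2: "pnull (%n w. ?SA l n w)" if l: "l:I" for l
 proof (rule pnull_mono)
  define A2 where "A2 n w = (\<Sum>i<Suc n. (a l n i w)^2)" for n w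
  have A20: "A2 n w >= 0" for n w unfolding A2_def by (intro sum_nonneg) auto
  have a2: "integrable M (%w. (a l n i w)^2) & (LINT w|M. (a l n i w)^2) <= (\<Sum>j\<in>blk n i. ?h n*(LINT w|M. (?u l n i j w)^2))" for n i
  proof -
   \<comment> \<open>Zero off the block, because \<open>ito_sum_L2\<close> asks for adaptedness at
     every fine index and the value at the coarse point is not known before it.\<close>
   define G where "G j w = (if j:blk n i then ?u l n i j w else 0)" for j w
   have nm: "0 < Suc n*m n" using m(1)[of n] by simp
   have GF: "G j:borel_measurable (F (grid t (Suc n*m n) j))" for j
   proof (cases "j:blk n i")
    case True
    have le: "g n i <= f n j" using fmono[of "i*m n" j n] True by (simp add: blk_def gf)
    have "U l (f n j):borel_measurable (F (f n j))" "U l (g n i):borel_measurable (F (g n i))"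
     using U(1)[OF l] f0 g0 unfolding cont_adapted_def by blast+
    thus ?thesis using F_measurable_mono[OF _ le] True by (auto simp: G_def[abs_def] f_def intro!: borel_measurable_diff)
   qed (simp add: G_def[abs_def])
   have Gb: "|G j w| <= 2*C" if "w:space M" for j w
   proof -
    have "|U l (f n j) w| <= C" "|U l (g n i) w| <= C" using U(2)[OF l that] f0 g0 by auto
    thus ?thesis by (auto simp: G_def)
   qed
   have fin: "finite (blk n i)" by (simp add: blk_def)
   have e1: "(\<Sum>j\<in>blk n i. G j w*gW l t (Suc n*m n) j w) = a l n i w" for w
    unfolding a_def d_def f_def by (intro sum.cong refl) (simp add: G_def f_def)
   have e2: "(\<Sum>j\<in>blk n i. ?h n*(LINT w|M. (G j w)^2)) =
     (\<Sum>j\<in>blk n i. ?h n*(LINT w|M. (?u l n i j w)^2))" by (intro sum.cong refl) (simp add: G_def)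
   show ?thesis using ito_sum_L2(1,2)[OF l t nm fin GF Gb] unfolding e1 e2 by blast
  qed
  have iA2: "integrable M (A2 n)" for n unfolding A2_def[abs_def] using a2 by (intro Bochner_Integration.integrable_sum) auto
  have "pnull A2"
  proof (rule pnull_L1[OF iA2])
   show "(%n. (LINT w|M. |A2 n w| )) ----> 0"
   proof (rule LIMSEQ_I)
    fix r :: real assume r: "0 < r"
    have "r/(2*t) > 0" using r t by simp
    then obtain dl where dl: "dl > 0" "!!s r'. s:{0..t} ==> r':{0..t} ==> |s - r'| < dl ==>
      (LINT w|M. (U l s w - U l r' w)^2) < r/(2*t)" using L2_continuity[OF U(1)[OF l] U(2)[OF l] less_imp_le[OF t]] by blast
    obtain N :: nat where N: "t/dl < real N" using reals_Archimedean2 by blast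
    have "norm ((LINT w|M. |A2 n w| ) - 0) < r" if n: "n >= N" for n
    proof -
     have stepd: "t/real (Suc n) < dl"
     proof -
      have "t < dl*real N" using N dl(1) by (simp add: divide_less_eq mult.commute)
      also have "... <= dl*real (Suc n)" using n dl(1) by (intro mult_left_mono) auto
      finally show ?thesis by (simp add: divide_less_eq mult.commute)
     qed
     have osc: "(LINT w|M. (?u l n i j w)^2) <= r/(2*t)" if i: "i < Suc n" and j: "j:blk n i" for i j
     proof -
      have "g n i <= f n j" using fmono[of "i*m n" j n] j by (simp add: blk_def gf)
      moreover have "f n j <= g n (Suc i)" using fmono[of j "Suc i*m n" n] j by (simp add: blk_def gf[of n "Suc i", simplified])
      moreover have "g n (Suc i) - g n i = t/real (Suc n)" by (simp only: g_def grid_step)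
      moreover have "g n (Suc i) <= t" using gt[of "Suc i" n] i by simp
      ultimately show ?thesis using dl(2)[of "f n j" "g n i"] stepd g0[of n i] f0[of n j] by auto
     qed
     have "(LINT w|M. |A2 n w| ) = (\<Sum>i<Suc n. (LINT w|M. (a l n i w)^2))"
      unfolding abs_of_nonneg[OF A20] unfolding A2_def by (rule lint_sum) (use a2 in auto)
     also have "... <= (\<Sum>i<Suc n. \<Sum>j\<in>blk n i. ?h n*(r/(2*t)))"
     proof (rule sum_mono)
      fix i assume i: "i:{..<Suc n}"
      have "(LINT w|M. (a l n i w)^2) <= (\<Sum>j\<in>blk n i. ?h n*(LINT w|M. (?u l n i j w)^2))" using a2 by blast
      also have "... <= (\<Sum>j\<in>blk n i. ?h n*(r/(2*t)))" using i osc t by (intro sum_mono mult_left_mono) auto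
      finally show "(LINT w|M. (a l n i w)^2) <= (\<Sum>j\<in>blk n i. ?h n*(r/(2*t)))" .
     qed
     also have "... = real (Suc n*m n)*(?h n*(r/(2*t)))" unfolding blk_def sum_blocks by simp
     also have "... = r/2"
     proof -
      have "real (Suc n*m n) ~= 0" using m(1)[of n] by (simp only: of_nat_eq_0_iff mult_eq_0_iff) simp
      hence "N*(t/N*(r/(2*t))) = r/2" if "N = real (Suc n*m n)" for N using t that by (simp add: field_simps del: of_nat_mult of_nat_Suc)
      thus ?thesis by blast
     qed
     finally show ?thesis using r by simp
    qed
    thus "EX no. ALL n>=no. norm ((LINT w|M. |A2 n w| ) - 0) < r" by blast
   qed
  qed
  hence s1: "pnull (%n w. sqrt (A2 n w))" using A20 by (intro pnull_sqrt)
  have "ptight (%n w. ?V n w)" by (intro ptight_add ptight_const ptight_subseq[OF qv_W_ptight[OF k t]])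
  thus "pnull (%n w. sqrt (A2 n w)*(?V n w))" by (rule pnull_mult_ptight[OF s1])
  show "rv (%w. ?SA l n w)" for n using am[OF l] Dm[OF k] by (intro bm) auto
  show "AE w in M. |?SA l n w| <= |sqrt (A2 n w)*(?V n w)|" for n
  proof (rule AE_I2)
   fix w
   have "(?SA l n w)^2 <= A2 n w*qv (W k) t (Suc n) w" unfolding A2_def qvD by (rule Cauchy_Schwarz_ineq_sum)
   hence "|?SA l n w| <= sqrt (A2 n w*qv (W k) t (Suc n) w)" by (intro real_le_rsqrt) (simp del: sum.lessThan_Suc)
   also have "... = sqrt (A2 n w) * sqrt (qv (W k) t (Suc n) w)" by (rule real_sqrt_mult)
   also have "... <= sqrt (A2 n w)*(?V n w)"
   proof (rule mult_left_mono)
    have "sqrt x <= 1 + x" if "0 <= x" for x :: real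
    proof (rule real_le_lsqrt)
     have "(1 + x)^2 = 1 + 2*x + x^2" by (simp add: power2_sum)
     thus "x <= (1 + x)^2" using that zero_le_power2[of x] by linarith
    qed (use that in simp_all)
    thus "sqrt (qv (W k) t (Suc n) w) <= ?V n w" by this (rule qv_nonneg)
   qed (rule real_sqrt_ge_zero[OF A20])
   finally show "|?SA l n w| <= |sqrt (A2 n w)*(?V n w)|" by linarith
  qed
 qed
 text \<open>The correction has tight variation, and \<open>W\<close> has small increments.\<close>
 have T3: "pnull (%n w. ?SQ l n w)" if l: "l:I" for l
 proof (rule pnull_mono)
  let ?v = "%n w. qv (U l) t (Suc n*m n) w + qv (W l) t (Suc n*m n) w"
  have "ptight ?v" by (intro ptight_add ptight_subseq[OF qv_W_ptight[OF l t]] ptight_subseq[OF U(3)[OF l]])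
  thus "pnull (%n w. mx n w*?v n w)" by (rule pnull_mult_ptight[OF mx])
  show "rv (%w. ?SQ l n w)" for n using qm[OF l] Dm[OF k] by (intro bm) auto
  show "AE w in M. |?SQ l n w| <= |mx n w*?v n w|" for n
  proof (rule AE_I2)
   fix w
   have "|?SQ l n w| <= (\<Sum>i<Suc n. |q l n i w| )*mx n w" by (rule abs_sum_product_le) (use Dk4 in "simp add: mx_def del: sum.lessThan_Suc")
   also have "(\<Sum>i<Suc n. |q l n i w| ) <= (\<Sum>i<Suc n. \<Sum>j\<in>blk n i. (U l (f n (Suc j)) w - U l (f n j) w)^2 + (d l n j w)^2)"
   proof (rule sum_mono)
    fix i
    have "|x*y| <= x^2 + y^2" for x y :: real
    proof -
     have "2*|x*y| <= x^2 + y^2" using sum_squares_bound[of "|x|" "|y|"] by (simp add: abs_mult mult.assoc)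
     thus ?thesis using abs_ge_zero[of "x*y"] by linarith
    qed
    thus "|q l n i w| <= (\<Sum>j\<in>blk n i. (U l (f n (Suc j)) w - U l (f n j) w)^2 + (d l n j w)^2)"
     unfolding q_def by (intro order_trans[OF sum_abs] sum_mono)
   qed
   also have "... = ?v n w" unfolding blk_def sum_blocks sum.distrib qv_def f_def d_def by simp
   finally have "|?SQ l n w| <= ?v n w*mx n w" using mx0 by (simp add: mult_right_mono)
   thus "|?SQ l n w| <= |mx n w*?v n w|" by (simp add: mult.commute)
  qed
 qed
 \<comment> \<open>The products of increments are replaced by their means, \<open>t/(n + 1)\<close>
   for equal indices and 0 otherwise, with an error of order \<open>1/(n + 1)\<close> in squared
   mean; what remains is a Riemann sum.\<close>
 have T4: "pnull (%n w. (?SU l n w) - (if k = l then ?I w else 0))" if l: "l:I" for l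
 proof -
  let ?S = "%n w. \<Sum>i<Suc n. U l (g n i) w*(D k n i w*D l n i w - (if k = l then t/real (Suc n) else 0))"
  have GF: "U l (g n i):borel_measurable (F (grid t (Suc n) i))" for n i using U(1)[OF l] g0[of n i] unfolding cont_adapted_def g_def by blast
  have Gb: "|U l (g n i) w| <= C" if "w:space M" for n i w using U(2)[OF l that g0] .
  note S = covariation_sum_L2[OF k l t zero_less_Suc finite_lessThan GF Gb, of _ "Suc _", folded g_def, folded D_def]
  have U2: "(LINT w|M. (U l (g n i) w)^2) <= C^2" for n i
  proof -
   have "(LINT w|M. (U l (g n i) w)^2) <= (LINT w|M. C^2)"
   proof (rule integral_mono)
    show b: "(U l (g n i) w)^2 <= C^2" if "w:space M" for w
    proof -
     have "|U l (g n i) w| <= |C|" using Gb[OF that, of n i] by linarith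
     thus ?thesis by (simp add: abs_le_square_iff)
    qed
    show "integrable M (%w. (U l (g n i) w)^2)" by (rule bounded_integrable[where C="C^2"]) (use b Um[OF l g0] in auto)
   qed simp
   thus ?thesis by (simp add: prob_space)
  qed
  have "pnull ?S"
  proof (rule pnull_L2)
   show "rv (?S n)" for n using Um[OF l g0] Dm[OF k] Dm[OF l] by (intro bm) auto
   show "integrable M (%w. (?S n w)^2)" for n by (rule S(1))
   have bnd: "(LINT w|M. (?S n w)^2) <= (3*t^2*C^2)/real (Suc n)" for n
   proof -
    have "(LINT w|M. (?S n w)^2) <= (\<Sum>i<Suc n. 3*(t/real (Suc n))^2*(LINT w|M. (U l (g n i) w)^2))" by (rule S(2))
    also have "... <= (\<Sum>i<Suc n. 3*(t/real (Suc n))^2*C^2)" using U2 by (intro sum_mono mult_left_mono) auto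
    also have "... = real (Suc n)*(3*(t/real (Suc n))^2*C^2)" by simp
    also have "... = (3*t^2*C^2)/real (Suc n)"
    proof -
     have "N*(3*(t/N)^2*C^2) = (3*t^2*C^2)/N" if "N ~= 0" for N :: real using that by (simp add: power2_eq_square field_simps)
     thus ?thesis by (metis of_nat_0_eq_iff nat.distinct(1))
    qed
    finally show ?thesis .
   qed
   have lim: "(%n. (3*t^2*C^2)/real (Suc n)) ----> 0" by (rule null_over_Suc)
   show "(%n. (LINT w|M. (?S n w)^2)) ----> 0" by (rule null_sandwich[OF _ bnd lim]) simp
  qed
  show ?thesis
  proof (cases "k = l")
   case True
   have "pnull (%n w. ?S n w + ((\<Sum>i<Suc n. U k (grid t (Suc n) i) w*(t/real (Suc n))) - ?I w))"
    by (rule pnull_add[OF `pnull ?S` time_integral_riemann[OF U(1)[OF k] t]])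
   moreover have "?S n w + ((\<Sum>i<Suc n. U k (grid t (Suc n) i) w*(t/real (Suc n))) - ?I w) =
     (?SU l n w) - (if k = l then ?I w else 0)" for n w using True by (simp add: g_def right_diff_distrib sum_subtractf del: sum.lessThan_Suc)
   ultimately show ?thesis by simp
  next
   case False
   thus ?thesis using `pnull ?S` by simp
  qed
 qed
 \<comment> \<open>A crude bound of each increment of \<open>W\<close> by 1 plus its quadratic
   variation suffices, since the summed approximation errors tend to zero.\<close>
 have T5: "pnull (%n w. ?SR l n w)" if l: "l:I" for l
 proof (rule pnull_mono)
  define SR where "SR n w = (\<Sum>i\<le>Suc n. |Rn l n i w| )" for n w
  have SRm: "rv (SR n)" for n unfolding SR_def[abs_def] using Rm[OF l] by (intro borel_measurable_sum) auto
  have "pnull SR" unfolding pnull_def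
  proof (intro conjI allI SRm)
   have "pnorm (SR n) <= (\<Sum>i\<le>Suc n. pnorm (Rn l n i))" for n
   proof -
    have "pnorm (%w. \<Sum>i\<in>A. |Rn l n i w| ) <= (\<Sum>i\<in>A. pnorm (Rn l n i))" if "finite A" for A using that
    proof (induction A rule: finite_induct)
     case empty
     show ?case by (simp add: pnorm_def)
    next
     case (insert i A)
     have "pnorm (%w. \<Sum>i\<in>insert i A. |Rn l n i w| ) = pnorm (%w. |Rn l n i w| + (\<Sum>i\<in>A. |Rn l n i w| ))" using insert by simp
     also have "... <= pnorm (%w. |Rn l n i w| ) + pnorm (%w. \<Sum>i\<in>A. |Rn l n i w| )"
      using Rm[OF l] by (intro pnorm_add borel_measurable_sum) auto
     also have "pnorm (%w. |Rn l n i w| ) = pnorm (Rn l n i)" by (simp add: pnorm_def)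
     finally show ?case using insert by simp
    qed
    thus ?thesis unfolding SR_def[abs_def] by blast
   qed
   also have "(\<Sum>i\<le>Suc n. pnorm (Rn l n i)) <= (\<Sum>i\<le>Suc n. 1/(real (Suc n))^2)" for n
    using m(2)[OF l] by (intro sum_mono) (auto simp: Rn_def)
   also have "(\<Sum>i\<le>Suc n. 1/(real (Suc n))^2) <= 2/real (Suc n)" for n
   proof -
    have "(N + 1)*(1/N^2) <= 2/N" if "N >= 1" for N :: real using that by (simp add: power2_eq_square field_simps)
    from this[of "real (Suc n)"] show ?thesis by (simp add: algebra_simps)
   qed
   finally have bnd: "pnorm (SR n) <= 2/real (Suc n)" for n .
   have lim: "(%n. 2/real (Suc n)) ----> 0" by (rule null_over_Suc)
   show "(%n. pnorm (SR n)) ----> 0" by (rule null_sandwich[OF pnorm_nonneg bnd lim])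
  qed
  hence "pnull (%n w. 2*SR n w)" by (rule pnull_cmult)
  moreover have "ptight (%n w. ?V n w)" by (intro ptight_add ptight_const ptight_subseq[OF qv_W_ptight[OF k t]])
  ultimately show "pnull (%n w. 2*SR n w*(?V n w))" by (rule pnull_mult_ptight)
  show "rv (%w. ?SR l n w)" for n using Rm[OF l] Dm[OF k] by (intro bm) auto
  show "AE w in M. |?SR l n w| <= |2*SR n w*(?V n w)|" for n
  proof (rule AE_I2)
   fix w
   have Db: "|D k n i w| <= ?V n w" if "i < Suc n" for i
   proof -
    have "|x| <= 1 + x^2" for x :: real using zero_le_power2[of "|x| - 1"] zero_le_power2[of x] by (simp add: power2_diff)
    hence "|D k n i w| <= 1 + (D k n i w)^2" .
    also have "(D k n i w)^2 <= (\<Sum>i<Suc n. (D k n i w)^2)" by (rule member_le_sum) (use that in auto)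
    finally show ?thesis by (simp add: qvD del: sum.lessThan_Suc)
   qed
   have "|?SR l n w| <= (\<Sum>i<Suc n. |Rn l n (Suc i) w - Rn l n i w| )*(?V n w)" by (rule abs_sum_product_le[OF Db])
   also have "(\<Sum>i<Suc n. |Rn l n (Suc i) w - Rn l n i w| ) <= 2*SR n w"
   proof -
    have "(\<Sum>i<Suc n. |Rn l n (Suc i) w - Rn l n i w| ) <= (\<Sum>i<Suc n. |Rn l n (Suc i) w| ) + (\<Sum>i<Suc n. |Rn l n i w| )"
     unfolding sum.distrib[symmetric] by (intro sum_mono) auto
    also have "(\<Sum>i<Suc n. |Rn l n (Suc i) w| ) <= SR n w"
     unfolding SR_def by (subst sum.atMost_Suc_shift) (simp add: lessThan_Suc_atMost del: sum.lessThan_Suc)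
    also have "(\<Sum>i<Suc n. |Rn l n i w| ) <= SR n w" unfolding SR_def by (rule sum_mono2) auto
    finally show ?thesis by simp
   qed
   finally show "|?SR l n w| <= |2*SR n w*(?V n w)|" using qv_nonneg[of "W k" t "Suc n" w] by (simp add: mult_right_mono del: sum.lessThan_Suc)
  qed
 qed
 let ?E = "%n w. (?SB n w) + (\<Sum>l\<in>I. ((?SU l n w) - (if k = l then ?I w else 0)) + (?SA l n w) + (1/2)*(?SQ l n w) + (?SR l n w))"
 have E: "pnull ?E" by (intro pnull_add pnull_sum finI T1 T2 T3 T4 T5 pnull_cmult)
 show ?thesis
 proof (rule pnull_mono[OF E])
  show "rv (%w. (\<Sum>i<Suc n. (Y (grid t (Suc n) (Suc i)) w - Y (grid t (Suc n) i) w)*gW k t (Suc n) i w)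
    - ?I w)" for n using Ym[OF g0] Dm[OF k] time_integral_rv[OF U(1)[OF k] t] unfolding g_def[symmetric] D_def[symmetric] by (intro bm) auto
  fix n
  have "AE w in M. ALL i:{..Suc n}. Y (g n i) w = Y0 w + B (g n i) w + (\<Sum>l\<in>I. J l (g n i) w)"
   by (rule AE_finite_allI) (use Y[OF g0 gt] in auto)
  thus "AE w in M. |(\<Sum>i<Suc n. (Y (grid t (Suc n) (Suc i)) w - Y (grid t (Suc n) i) w)*gW k t (Suc n) i w) - ?I w| <= |?E n w|"
  proof eventually_elim
   case (elim w)
   have dJ: "J l (g n (Suc i)) w - J l (g n i) w = U l (g n i) w*D l n i w + a l n i w + q l n i w/2 + (Rn l n (Suc i) w - Rn l n i w)" for l i
    using step[of l n i w] unfolding Rn_def R_def g_def[symmetric] by linarith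
   have "(\<Sum>i<Suc n. (Y (g n (Suc i)) w - Y (g n i) w)*D k n i w) =
     (\<Sum>i<Suc n. (B (g n (Suc i)) w - B (g n i) w)*D k n i w + (\<Sum>l\<in>I. (J l (g n (Suc i)) w - J l (g n i) w)*D k n i w))"
   proof (rule sum.cong[OF refl])
    fix i assume i: "i:{..<Suc n}"
    have "Y (g n (Suc i)) w - Y (g n i) w = (B (g n (Suc i)) w - B (g n i) w) + (\<Sum>l\<in>I. J l (g n (Suc i)) w - J l (g n i) w)"
     using elim i by (simp add: sum_subtractf)
    thus "(Y (g n (Suc i)) w - Y (g n i) w)*D k n i w = (B (g n (Suc i)) w - B (g n i) w)*D k n i w + (\<Sum>l\<in>I. (J l (g n (Suc i)) w - J l (g n i) w)*D k n i w)"
     by (simp add: distrib_right sum_distrib_right)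
   qed
   also have "... = (?SB n w)
     + (\<Sum>l\<in>I. \<Sum>i<Suc n. (J l (g n (Suc i)) w - J l (g n i) w)*D k n i w)" unfolding sum.distrib by (subst sum.swap[of _ I]) simp
   also have "(\<Sum>l\<in>I. \<Sum>i<Suc n. (J l (g n (Suc i)) w - J l (g n i) w)*D k n i w) = (\<Sum>l\<in>I. (?SU l n w) + (?SA l n w)
      + (1/2)*(?SQ l n w) + (?SR l n w))" unfolding dJ sum_distrib_left sum.distrib[symmetric] by (intro sum.cong refl) (simp add: algebra_simps)
   finally have main: "(\<Sum>i<Suc n. (Y (g n (Suc i)) w - Y (g n i) w)*D k n i w) = (?SB n w) + ..." .
   have "(\<Sum>l\<in>I. if k = l then ?I w else 0) = ?I w" using finI k by simp
   hence "(\<Sum>i<Suc n. (Y (g n (Suc i)) w - Y (g n i) w)*D k n i w) - ?I w = ?E n w"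
    unfolding main by (simp add: sum.distrib sum_subtractf del: sum.lessThan_Suc)
   thus ?case unfolding g_def D_def by (simp del: sum.lessThan_Suc)
  qed
 qed
qed

text \<open>The trapezoidal sums are left-point sums plus half of the covariation sums. The
  left-point sums are centred and bounded in L2, so their limit in probability is centred too, and
  only half of the covariation contributes.\<close>

lemma stratonovich_expectation:
 assumes t: "0 < t" and k: "k:I" and V: "cont_adapted M F V" "!!s w. w:space M ==> 0 <= s ==> |V s w| <= C"
  and J: "has_stratonovich_integral M V (W k) J"
  and L: "integrable M L" "pnull (%n w. (\<Sum>i<Suc n. (V (grid t (Suc n) (Suc i)) w - V (grid t (Suc n) i) w) *gW k t (Suc n) i w) - L w)"
 shows "integrable M (J t)" "(LINT w|M. J t w) = (LINT w|M. L w)/2"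
proof -
 let ?v = "%n i. V (grid t (Suc n) i)" and ?J = "%n w. J t w - trap V k t (Suc n) (Suc n) w"
 have Vm: "rv (V s)" if "0 <= s" for s using cont_adapted_rv[OF V(1) that] .
 have Jm: "rv (J t)" using J t unfolding has_stratonovich_integral_def by (simp add: less_imp_le)
 have Lm: "rv L" using L(1) by (rule borel_measurable_integrable)
 let ?S = "%n w. \<Sum>i<Suc n. ?v n i w*gW k t (Suc n) i w"
 let ?Q = "%n w. \<Sum>i<Suc n. (V (grid t (Suc n) (Suc i)) w - ?v n i w)*gW k t (Suc n) i w"
 have tr: "trap V k t (Suc n) (Suc n) w = ?S n w + ?Q n w/2" for n w
  unfolding trap_def sum_divide_distrib sum.distrib[symmetric] by (intro sum.cong refl) (simp add: field_simps)
 have N1: "pnull (%n w. ?J n w)" unfolding pnull_def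
 proof (intro conjI allI)
  show "rv (%w. ?J n w)" for n using Jm trap_rv[OF Vm k] t by (intro borel_measurable_diff) auto
  show "(%n. pnorm (%w. ?J n w)) ----> 0"
  proof (rule LIMSEQ_I)
   fix r :: real assume "0 < r"
   hence r: "r/2 > 0" by simp
   obtain m0 where m0: "!!m. m >= m0 ==> 0 < m ==> pnorm (%w. J (grid t 1 1) w - trap V k t (1*m) (1*m) w) <= r/2"
    using stratonovich_trap[OF J Vm k t order_refl zero_less_one r] by blast
   have "norm (pnorm (%w. ?J n w) - 0) < r" if "n >= m0" for n using m0[of "Suc n"] that pnorm_nonneg[of "%w. ?J n w"] `0 < r`
    by (simp add: grid_n[of 1, simplified])
   thus "EX no. ALL n>=no. norm (pnorm (%w. ?J n w) - 0) < r" by blast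
  qed
 qed
 have "pnull (%n w. - (?J n w) - (1/2)*(?Q n w - L w))" by (intro pnull_diff pnull_uminus pnull_cmult N1 L(2))
 moreover have "- (?J n w) - (1/2)*(?Q n w - L w) = ?S n w - (J t w - L w/2)" for n w unfolding tr by (simp add: field_simps del: sum.lessThan_Suc)
 ultimately have lim: "pnull (%n w. ?S n w - (J t w - L w/2))" by (simp only:)
 have GF: "?v n i:borel_measurable (F (grid t (Suc n) i))" for n i using V(1) grid_nonneg[of t "Suc n" i] t unfolding cont_adapted_def by auto
 have Gb: "|?v n i w| <= C" if "w:space M" for n i w using V(2)[OF that grid_nonneg] t by simp
 note I2 = ito_sum_L2[OF k t zero_less_Suc finite_lessThan GF Gb, of _ "Suc _"]
 have V2: "(LINT w|M. (?v n i w)^2) <= C^2" for n i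
 proof -
  have "(LINT w|M. (?v n i w)^2) <= (LINT w|M. C^2)"
  proof (rule integral_mono)
   show b: "(?v n i w)^2 <= C^2" if "w:space M" for w
   proof -
    have "|?v n i w| <= |C|" using Gb[OF that, of n i] by linarith
    thus ?thesis by (simp add: abs_le_square_iff)
   qed
   show "integrable M (%w. (?v n i w)^2)" by (rule bounded_integrable[where C="C^2"]) (use b Vm grid_nonneg[of t "Suc n" i] t in auto)
  qed simp
  thus ?thesis by (simp add: prob_space)
 qed
 have bnd: "(LINT w|M. (?S n w)^2) <= t*C^2" for n
 proof -
  have "(LINT w|M. (?S n w)^2) <= (\<Sum>i<Suc n. t/real (Suc n)*(LINT w|M. (?v n i w)^2))" by (rule I2(2))
  also have "... <= (\<Sum>i<Suc n. t/real (Suc n)*C^2)" using V2 t by (intro sum_mono mult_left_mono) auto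
  also have "... = t*C^2" by simp
  finally show ?thesis .
 qed
 have Sm: "rv (?S n)" for n using Vm[OF grid_nonneg] W_rv[OF k grid_nonneg] t by (intro bm) auto
 have iG: "integrable M (%w. ?v n i w*gW k t (Suc n) i w)" for n i
 proof (rule L1_le_L2(1))
  show "rv (%w. ?v n i w*gW k t (Suc n) i w)"
   using Vm[OF grid_nonneg] W_rv[OF k grid_nonneg] t by (intro borel_measurable_times borel_measurable_diff) auto
  show "integrable M (%w. (?v n i w*gW k t (Suc n) i w)^2)" using ito_sum_L2(1)[OF k t zero_less_Suc _ GF Gb, of "{i}"] by simp
 qed
 have E: "(LINT w|M. ?S n w) = 0" for n
 proof -
  have "(LINT w|M. ?S n w) = (\<Sum>i<Suc n. (LINT w|M. ?v n i w*gW k t (Suc n) i w))" by (rule lint_sum) (rule iG)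
  thus ?thesis by (simp only: ito_sum_L2(3)[OF k t zero_less_Suc finite.emptyI GF Gb] sum.neutral_const)
 qed
 have LJ: "rv (%w. J t w - L w/2)" using Jm Lm by simp
 note X = expectation_of_limit_in_prob[OF Sm I2(1) bnd lim LJ E]
 have "integrable M (%w. (J t w - L w/2) + L w/2)" using X(1) L(1) by (intro Bochner_Integration.integrable_add) auto
 thus iJ: "integrable M (J t)" by simp
 show "(LINT w|M. J t w) = (LINT w|M. L w)/2" using X(2) iJ L(1) by simp
qed

end

section \<open>Expectations of time integrals and Dynkin's formula\<close>

context filt
begin

lemma expectation_continuous:
 fixes U :: "real => 'w => real"
 assumes U: "cont_adapted M F U" and C: "!!s w. w:space M ==> 0 <= s ==> |U s w| <= C"
 shows "continuous_on {0..} (%s. (LINT w|M. U s w))" unfolding continuous_on_sequentially o_def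
proof (intro ballI allI impI)
 fix x :: "nat => real" and s :: real assume s: "s:{0..}" and x: "(ALL n. x n:{0..}) & x ----> s"
 show "(%n. (LINT w|M. U (x n) w)) ----> (LINT w|M. U s w)"
 proof (rule integral_dominated_convergence[where w="%_. C"])
  show "AE w in M. (%n. U (x n) w) ----> U s w" using U s x unfolding cont_adapted_def continuous_on_sequentially o_def by (intro AE_I2) blast
 qed (use s x cont_adapted_rv[OF U] C in "auto intro!: AE_I2")
qed

lemma expectation_time_integral:
 fixes U :: "real => 'w => real"
 assumes U: "cont_adapted M F U" and C: "!!s w. w:space M ==> 0 <= s ==> |U s w| <= C" and t: "0 < t"
 shows "integrable M (%w. integral {0..t} (%s. U s w))"
  "(LINT w|M. integral {0..t} (%s. U s w)) = integral {0..t} (%s. (LINT w|M. U s w))"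
proof -
 let ?S = "%n w. \<Sum>i<Suc n. U (grid t (Suc n) i) w*(t/real (Suc n))"
 have g: "0 <= grid t n i" for n i using t by (simp add: grid_nonneg)
 have cU: "continuous_on {0..t} (%s. U s w)" if "w:space M" for w using U that unfolding cont_adapted_def by (auto intro: continuous_on_subset)
 have lim: "(%n. ?S n w) ----> integral {0..t} (%s. U s w)" if "w:space M" for w by (rule riemann_sum_grid[OF cU[OF that] t])
 have Sb: "norm (?S n w) <= C*t" if "w:space M" for n w
 proof -
  have "|?S n w| <= (\<Sum>i<Suc n. C*(t/real (Suc n)))" using t C[OF that g] order_trans[OF abs_ge_zero C[OF that g]]
   by (intro order_trans[OF sum_abs] sum_mono order_trans[OF eq_refl[OF abs_mult] mult_mono]) auto
  thus ?thesis by simp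
 qed
 note * = AE_I2 cont_adapted_rv[OF U g] time_integral_rv[OF U t] lim Sb
 show "integrable M (%w. integral {0..t} (%s. U s w))" by (rule integrable_dominated_convergence[where w="%_. C*t" and s="?S"]) (use*in auto)
 have "(%n. (LINT w|M. ?S n w)) ----> (LINT w|M. integral {0..t} (%s. U s w))"
  by (rule integral_dominated_convergence[where w="%_. C*t"]) (use*in auto)
 moreover have "(LINT w|M. ?S n w) = (\<Sum>i<Suc n. (LINT w|M. U (grid t (Suc n) i) w)*(t/real (Suc n)))" for n
  using bounded_integrable[OF cont_adapted_rv[OF U g] C[OF _ g]] by (subst lint_sum) (auto simp del: sum.lessThan_Suc)
 ultimately show "(LINT w|M. integral {0..t} (%s. U s w)) = integral {0..t} (%s. (LINT w|M. U s w))"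
  using riemann_sum_grid[OF continuous_on_subset[OF expectation_continuous[OF U C]] t] LIMSEQ_unique by fastforce
qed

end

locale sde = wiener_family P F I W + compact_set M for P :: "'w measure" and F and I :: "'k set" and W and M :: "'a::euclidean_space set" +
 fixes b :: "'a => 'a" and \<sigma> :: "'k => 'a => 'a"
 assumes svf_b: "svf b" and svf_\<sigma>: "!!k. k:I ==> svf (\<sigma> k)"
begin

text \<open>The generator read off from the Stratonovich form: the drift plus half the sum of the
  squares of the diffusion fields as differential operators.\<close>

definition G :: "('a => real) => 'a => real" where
 "G ps p = D ps p (b p) + (\<Sum>k\<in>I. D (%q. D ps q (\<sigma> k q)) p (\<sigma> k p))/2"

context
 fixes x X assumes sol: "stratonovich_solution M P F b I \<sigma> W x X"
begin

lemma X_M: "0 <= t ==> w:space P ==> X t w:M"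
 and X_adapted: "cont_adapted P F X" and X_0: "AE w in P. X 0 w = x" using sol unfolding stratonovich_solution_def by auto

lemma solution_decomposition:
 assumes "sm (ps :: 'a => real)"
 shows "cont_semimartingale P F (%t w. ps (X t w))"
  "EX J. (ALL k:I. has_stratonovich_integral P (%t w. D ps (X t w) (\<sigma> k (X t w))) (W k) (J k)) &
   (ALL t>=0. AE w in P. ps (X t w) = ps (X 0 w) + integral {0..t} (%s. D ps (X s w) (b (X s w))) + (\<Sum>k\<in>I. J k t w))"
 using sol assms unfolding stratonovich_solution_def lie_deriv_def by simp_all

lemma sm_adapted:
 assumes eta: "sm (eta :: 'a => real)" shows "cont_adapted P F (%t w. eta (X t w))" unfolding cont_adapted_def
proof (intro conjI allI impI ballI)
 fix t :: real assume t: "0 <= t"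
 have "(%w. ext eta (X t w)):borel_measurable (F t)"
  using X_adapted t by (intro measurable_compose[OF _ borel_measurable_continuous_onI[OF smooth_on_imp_continuous[OF ext(1)[OF eta]]]])
   (auto simp: cont_adapted_def)
 moreover have "ext eta (X t w) = eta (X t w)" if "w:space (F t)" for w using ext(2)[OF eta X_M[OF t]] that space_F by auto
 ultimately show "(%w. eta (X t w)):borel_measurable (F t)" by (simp cong: measurable_cong)
next
 fix w assume w: "w:space P"
 show "continuous_on {0..} (%t. eta (X t w))"
  by (rule continuous_on_compose2[OF sm_cont[OF eta]]) (use X_adapted X_M w in "auto simp: cont_adapted_def")
qed

lemma rv_X: "sm eta ==> 0 <= t ==> rv (%w. eta (X t w))" for eta :: "'a => real" by (rule cont_adapted_rv[OF sm_adapted])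

lemma integrable_X: assumes "sm (eta :: 'a => real)" "0 <= t" shows "integrable P (%w. eta (X t w))"
proof -
 obtain C where "!!x. x:M ==> norm (eta x) <= C" using sm_bounded[OF assms(1)] by metis
 thus ?thesis using X_M assms by (intro bounded_integrable[OF rv_X, of _ _ C]) auto
qed

lemma expectation_X_continuous: assumes eta: "sm (eta :: 'a => real)" shows "continuous_on {0..} (%t. (LINT w|P. eta (X t w)))"
proof -
 obtain C where "!!x. x:M ==> norm (eta x) <= C" using sm_bounded[OF eta] by metis
 thus ?thesis using X_M by (intro expectation_continuous[OF sm_adapted[OF eta], of C]) auto
qed

text \<open>The integrands are smooth functions of the solution and hence semimartingales by the
  definition of a solution, which supplies the tight quadratic variations.\<close>

lemma covariation_X:
 assumes eta: "sm (eta :: 'a => real)" and k: "k:I" and t: "0 < t"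
 shows "pnull (%n w. (\<Sum>i<Suc n. (eta (X (grid t (Suc n) (Suc i)) w) - eta (X (grid t (Suc n) i) w))*gW k t (Suc n) i w)
  - integral {0..t} (%s. D eta (X s w) (\<sigma> k (X s w))))"
proof -
 let ?U = "%l p. D eta p (\<sigma> l p)" and ?b = "%p. D eta p (b p)"
 have sU: "sm (?U l)" if "l:I" for l by (rule sm_D[OF svf_\<sigma>[OF that] eta])
 have sb: "sm ?b" by (rule sm_D[OF svf_b eta])
 obtain C where C: "ALL l:I. ALL p:M. |?U l p| <= C" using sm_bounded_family[of I ?U, OF finI sU] by blast
 obtain K where K: "!!p. p:M ==> norm (?b p) <= K" using sm_bounded[OF sb] by metis
 obtain J where J: "!!l. l:I ==> has_stratonovich_integral P (%t w. ?U l (X t w)) (W l) (J l)"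
  and Y: "!!t. 0 <= t ==> AE w in P. eta (X t w) = eta (X 0 w) + integral {0..t} (%s. ?b (X s w)) + (\<Sum>k\<in>I. J k t w)"
  using solution_decomposition(2)[OF eta] by auto
 show ?thesis
 proof (rule covariation_converges[OF t k, where U="%l s w. ?U l (X s w)" and B="%s w. integral {0..s} (%s. ?b (X s w))"
   and C=C and CB=K and Y="%s w. eta (X s w)" and ?Y0.0="%w. eta (X 0 w)" and J=J])
  show "cont_adapted P F (%s w. ?U l (X s w))" if "l:I" for l by (rule sm_adapted[OF sU[OF that]])
  show "|?U l (X s w)| <= C" if "l:I" "w:space P" "0 <= s" for l s w using C X_M that by blast
  show "ptight (qv (%s w. ?U l (X s w)) t)" if "l:I" for l
   by (rule cont_semimartingale_qv_ptight[OF solution_decomposition(1)[OF sU[OF that]] t rv_X[OF sU[OF that]]])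
  show "rv (%w. integral {0..s} (%s. ?b (X s w)))" if "0 <= s" for s using time_integral_rv[OF sm_adapted[OF sb], of s] that by (cases "s = 0") auto
  show "|integral {0..s} (%s. ?b (X s w)) - integral {0..r} (%s. ?b (X s w))| <= K*(s - r)" if w: "w:space P" and r: "0 <= r" "r <= s" for s r w
  proof -
   have c: "continuous_on {0..s} (%s. ?b (X s w))" using sm_adapted[OF sb] w unfolding cont_adapted_def by (auto intro: continuous_on_subset)
   have "integral {0..r} (%s. ?b (X s w)) + integral {r..s} (%s. ?b (X s w)) = integral {0..s} (%s. ?b (X s w))"
    by (rule Henstock_Kurzweil_Integration.integral_combine[OF r integrable_continuous_real[OF c]])
   moreover have "norm (integral {r..s} (%s. ?b (X s w))) <= K*(s - r)"
    using r K X_M[OF _ w] by (intro integral_bound continuous_on_subset[OF c]) auto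
   ultimately show ?thesis by simp
  qed
 qed (use J rv_X[OF eta] Y in auto)
qed

text \<open>The integrand against \<open>W k\<close> is the derivative of \<open>ps\<close> along
  the field number \<open>k\<close>. Its covariation with \<open>W k\<close> is the time integral of
  the second derivative along that field, half of which is the expectation of the Stratonovich
  integral.\<close>

lemma dynkin:
 assumes ps: "sm ps" and t: "0 <= t"
 shows "(LINT w|P. ps (X t w)) = ps x + integral {0..t} (%s. (LINT w|P. G ps (X s w)))"
proof (cases "t = 0")
 case True
 have "(LINT w|P. ps (X 0 w)) = (LINT w|P. ps x)" using X_0 rv_X[OF ps] by (intro integral_cong_AE) (auto elim: eventually_mono)
 thus ?thesis using True by (simp add: prob_space)
next
 case False
 hence t: "0 < t" using t by simp
 let ?U = "%l p. D ps p (\<sigma> l p)" and ?b = "%p. D ps p (b p)"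
 let ?V = "%k p. D (?U k) p (\<sigma> k p)"
 have sU: "sm (?U l)" if "l:I" for l by (rule sm_D[OF svf_\<sigma>[OF that] ps])
 have sV: "sm (?V l)" if "l:I" for l by (rule sm_D[OF svf_\<sigma>[OF that] sU[OF that]])
 have sb: "sm ?b" by (rule sm_D[OF svf_b ps])
 have ti: "integrable P (%w. integral {0..t} (%s. eta (X s w)))"
  "(LINT w|P. integral {0..t} (%s. eta (X s w))) = integral {0..t} (%s. (LINT w|P. eta (X s w)))" if eta: "sm eta" for eta :: "'a => real"
 proof -
  obtain C where C: "!!x. x:M ==> norm (eta x) <= C" using sm_bounded[OF eta] by metis
  have "|eta (X s w)| <= C" if "w:space P" "0 <= s" for s w using C[OF X_M[OF that(2,1)]] by simp
  from expectation_time_integral[OF sm_adapted[OF eta] this t]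
  show "integrable P (%w. integral {0..t} (%s. eta (X s w)))"
   "(LINT w|P. integral {0..t} (%s. eta (X s w))) = integral {0..t} (%s. (LINT w|P. eta (X s w)))" by blast+
 qed
 have ei: "(%s. (LINT w|P. eta (X s w))) integrable_on {0..t}" if "sm eta" for eta :: "'a => real"
  by (rule integrable_continuous_real[OF continuous_on_subset[OF expectation_X_continuous[OF that]]]) auto
 obtain J where J: "!!l. l:I ==> has_stratonovich_integral P (%t w. ?U l (X t w)) (W l) (J l)"
  and Y: "!!t. 0 <= t ==> AE w in P. ps (X t w) = ps (X 0 w) + integral {0..t} (%s. ?b (X s w)) + (\<Sum>k\<in>I. J k t w)"
  using solution_decomposition(2)[OF ps] by auto
 have Jt: "integrable P (J k t)" "(LINT w|P. J k t w) = integral {0..t} (%s. (LINT w|P. ?V k (X s w)))/2" if k: "k:I" for k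
 proof -
  obtain C where C: "!!x. x:M ==> norm (?U k x) <= C" using sm_bounded[OF sU[OF k]] by metis
  have "|?U k (X s w)| <= C" if "w:space P" "0 <= s" for s w using C[OF X_M[OF that(2,1)]] by simp
  from stratonovich_expectation[OF t k sm_adapted[OF sU[OF k]] this J[OF k] ti(1)[OF sV[OF k]] covariation_X[OF sU[OF k] k t]]
  show "integrable P (J k t)" "(LINT w|P. J k t w) = integral {0..t} (%s. (LINT w|P. ?V k (X s w)))/2" by (simp_all add: ti(2)[OF sV[OF k]])
 qed
 have "(LINT w|P. ps (X t w)) = (LINT w|P. ps x + integral {0..t} (%s. ?b (X s w)) + (\<Sum>k\<in>I. J k t w))"
 proof (rule integral_cong_AE)
  show "AE w in P. ps (X t w) = ps x + integral {0..t} (%s. ?b (X s w)) + (\<Sum>k\<in>I. J k t w)"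
   using Y[OF less_imp_le[OF t]] X_0 by eventually_elim simp
 qed (use rv_X[OF ps, of t] ti(1)[OF sb] Jt(1) t in "auto intro!: borel_measurable_sum")
 also have "... = ps x + integral {0..t} (%s. (LINT w|P. ?b (X s w))) + (\<Sum>k\<in>I. integral {0..t} (%s. (LINT w|P. ?V k (X s w)))/2)"
  using ti[OF sb] Jt(1) by (simp add: Bochner_Integration.integral_add lint_sum prob_space Jt(2) del: divide_eq_eq_numeral1)
 also have "... = ps x + integral {0..t} (%s. (LINT w|P. ?b (X s w)) + (\<Sum>k\<in>I. (LINT w|P. ?V k (X s w)))/2)" using ei[OF sb] ei[OF sV] finI
  by (simp add: Henstock_Kurzweil_Integration.integral_add Henstock_Kurzweil_Integration.integral_sum integrable_sum
   integrable_on_divide sum_divide_distrib)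
 also have "... = ps x + integral {0..t} (%s. (LINT w|P. G ps (X s w)))"
 proof (intro arg_cong2[where f=plus] refl Henstock_Kurzweil_Integration.integral_cong)
  fix s assume "s:{0..t}"
  thus "(LINT w|P. ?b (X s w)) + (\<Sum>k\<in>I. (LINT w|P. ?V k (X s w)))/2 = (LINT w|P. G ps (X s w))"
   unfolding G_def using integrable_X[OF sb] integrable_X[OF sV] by (simp add: lint_sum)
 qed
 finally show ?thesis .
qed

end

end

text \<open>The four terms beyond first order contribute 1, 1, 2 and 2 times \<open>K^2*h^2\<close>,
  whence the 6.\<close>

lemma square_step:
 fixes x y z h K :: real
 assumes "|x| <= K" "|y| <= K" "|z| <= K*h^2" "0 <= h" "h <= 1"
 shows "(x + h*y + z)^2 <= x^2 + h*(2*x*y) + 6*K^2*h^2"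
proof -
 have K: "0 <= K" using assms(1) abs_ge_zero order_trans by blast
 have h: "h^2 <= 1" using assms(4,5) by (simp add: power_le_one)
 have z1: "|z| <= K" using assms(3) mult_left_mono[OF h K] by simp
 have m: "|p*q| <= A*B" if "|p| <= A" "|q| <= B" for p q A B :: real unfolding abs_mult using that by (intro mult_mono) auto
 have 1: "x*z <= K^2*h^2" using m[OF assms(1,3)] by (simp add: power2_eq_square mult_ac)
 have 2: "z^2 <= K^2*h^2" using m[OF z1 assms(3)] by (simp add: power2_eq_square mult_ac)
 have 3: "h*(y*z) <= K^2*h^2"
 proof -
  have "|h*(y*z)| <= 1*(K*(K*h^2))" by (intro m assms(2,3)) (use assms in auto)
  thus ?thesis by (simp add: power2_eq_square mult_ac)
 qed
 have 4: "h^2*y^2 <= K^2*h^2" using mult_left_mono[OF m[OF assms(2,2)], of "h^2"] by (simp add: power2_eq_square mult_ac)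
 have "(x + h*y + z)^2 = x^2 + h*(2*x*y) + h^2*y^2 + z^2 + 2*(x*z) + 2*(h*(y*z))" by (simp add: square_simps)
 thus ?thesis using 1 2 3 4 by linarith
qed

section \<open>Expectations along the process and the approximating walk\<close>

locale langevin = weighted M f R g nabla N a \<phi> vol + sde P F I W M b \<sigma>
 for M :: "'a::euclidean_space set" and f :: "'i => 'a => 'a" and R g nabla and N :: "'n::finite itself" and a \<phi> vol
  and P :: "'w measure" and F and I :: "'k set" and W b \<sigma> +
 fixes Y :: "'a => real => 'w => 'a"
 assumes sol: "x:M ==> stratonovich_solution M P F b I \<sigma> W x (Y x)"
  and G_L: "smooth_map M ps ==> p:M ==> G ps p = L ps p" and R_ne: "R ~= {}"
begin

definition Pt :: "real => ('a => real) => 'a => real" where "Pt t ps x = (LINT w|P. ps (Y x t w))"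

context
 fixes x assumes x: "x:M"
begin

lemma Y_M: "0 <= t ==> w:space P ==> Y x t w:M" by (rule X_M[OF sol[OF x]])

lemma integrable_Y: "sm ps ==> 0 <= t ==> integrable P (%w. ps (Y x t w))" for ps :: "'a => real" by (rule integrable_X[OF sol[OF x]])

lemma Pt_add: "sm u ==> sm v ==> 0 <= t ==> Pt t (%p. u p + v p) x = Pt t u x + Pt t v x" by (simp add: Pt_def integrable_Y)

lemma Pt_cmult: "Pt t (%p. c*u p) x = c*Pt t u x" by (simp add: Pt_def)

lemma Pt_le: assumes "sm u" "0 <= t" "!!p. p:M ==> u p <= c" shows "Pt t u x <= c"
proof -
 have "Pt t u x <= (LINT w|P. c)" unfolding Pt_def by (rule integral_mono) (use assms Y_M integrable_Y in auto)
 thus ?thesis by (simp add: prob_space)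
qed

lemma Pt_abs_diff:
 assumes "sm u" "sm v" "0 <= t" "!!p. p:M ==> |u p - v p| <= c" shows "|Pt t u x - Pt t v x| <= c"
proof -
 have d: "Pt t (%p. u p - v p) x = Pt t u x - Pt t v x" using assms(1-3) by (simp add: Pt_def integrable_Y)
 have "Pt t (%p. u p - v p) x <= c" "Pt t (%p. (-1)*(u p - v p)) x <= c"
  by (rule Pt_le; use assms in "auto intro!: sm_diff sm_mult sm_const simp: abs_le_iff")+
 thus ?thesis unfolding Pt_cmult d by (simp add: abs_le_iff)
qed

lemma Pt_continuous: "sm u ==> continuous_on {0..} (%t. Pt t u x)" unfolding Pt_def by (rule expectation_X_continuous[OF sol[OF x]])

lemma Pt_dynkin:
 assumes u: "sm u" and s: "0 <= s" "0 <= h"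
 shows "Pt (s + h) u x = Pt s u x + integral {s..s + h} (%r. Pt r (L u) x)"
proof -
 have d: "Pt t u x = u x + integral {0..t} (%r. Pt r (L u) x)" if "0 <= t" for t
 proof -
  have "integral {0..t} (%r. (LINT w|P. G u (Y x r w))) = integral {0..t} (%r. Pt r (L u) x)"
   unfolding Pt_def using Y_M G_L[OF u] by (intro Henstock_Kurzweil_Integration.integral_cong lint_cong) auto
  thus ?thesis using dynkin[OF sol[OF x] u that] by (simp add: Pt_def)
 qed
 have "integral {0..s} (%r. Pt r (L u) x) + integral {s..s + h} (%r. Pt r (L u) x) = integral {0..s + h} (%r. Pt r (L u) x)"
  using s by (intro Henstock_Kurzweil_Integration.integral_combine integrable_continuous_real continuous_on_subset[OF Pt_continuous[OF sm_L[OF u]]]) auto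
 thus ?thesis using d[of s] d[of "s + h"] s by simp
qed

lemma Pt_0: "sm u ==> Pt 0 u x = u x" using dynkin[OF sol[OF x], of u 0] by (simp add: Pt_def)

lemma Pt_increment:
 assumes u: "sm u" and s: "0 <= s" "0 <= h" and K: "!!p. p:M ==> |L u p| <= K"
 shows "|Pt (s + h) u x - Pt s u x| <= K*h"
proof -
 have Lb: "|Pt r (L u) x| <= K" if "0 <= r" for r using Pt_abs_diff[of "L u" "%_. 0" r K] u K that by (auto simp: Pt_def)
 have "norm (integral {s..s + h} (%r. Pt r (L u) x)) <= K*(s + h - s)"
  using s Lb by (intro integral_bound continuous_on_subset[OF Pt_continuous[OF sm_L[OF u]]]) auto
 thus ?thesis using Pt_dynkin[OF u s] by simp
qed

lemma Pt_step:
 assumes u: "sm u" and s: "0 <= s" "0 <= h" and K: "!!p. p:M ==> |L (L u) p| <= K"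
 shows "|Pt (s + h) u x - Pt s u x - h*Pt s (L u) x| <= K*h^2"
proof -
 let ?l = "%r. Pt r (L u) x"
 have K0: "0 <= K" using K[OF x] abs_ge_zero order_trans by blast
 have c: "continuous_on {s..s + h} ?l" using s by (intro continuous_on_subset[OF Pt_continuous[OF sm_L[OF u]]]) auto
 have b: "|?l r - ?l s| <= K*h" if "r:{s..s + h}" for r
 proof -
  have "|?l (s + (r - s)) - ?l s| <= K*(r - s)" by (rule Pt_increment[OF sm_L[OF u] s(1) _ K]) (use that in auto)
  also have "... <= K*h" using that K0 by (intro mult_left_mono) auto
  finally show ?thesis by simp
 qed
 have "norm (integral {s..s + h} (%r. ?l r - ?l s)) <= K*h*(s + h - s)"
  using s b c by (intro integral_bound continuous_on_diff continuous_on_const) auto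
 moreover have "integral {s..s + h} (%r. ?l r - ?l s) = integral {s..s + h} ?l - h*?l s"
  using s integrable_continuous_real[OF c] by (subst Henstock_Kurzweil_Integration.integral_diff) auto
 ultimately show ?thesis using Pt_dynkin[OF u s] by (simp add: power2_eq_square mult.assoc)
qed

end

text \<open>Dynkin's formula applied to \<open>u\<close> and again to \<open>L u\<close> leaves a
  remainder of at most \<open>t\<close> times the supremum of \<open>L (L u)\<close>, so the
  difference quotients converge uniformly in the starting point.\<close>

lemma generator: assumes u: "sm u" shows "generator_maps M P Y u (L u)" unfolding generator_maps_def uniform_limit_iff
proof (intro allI impI)
 fix e :: real assume e: "0 < e"
 obtain K where K: "0 <= K" "!!p. p:M ==> norm (L (L u) p) <= K" using sm_bounded[OF sm_L[OF sm_L[OF u]]] by metis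
 have "eventually (%t. t:{0<..<e/(K + 1)}) (at_right 0)" using e K by (intro eventually_at_right_real) auto
 thus "\<forall>\<^sub>F t in at_right 0. ALL x:M. dist (((LINT w|P. u (Y x t w)) - u x)/t) (L u x) < e"
 proof eventually_elim
  case (elim t)
  show ?case
  proof
   fix x assume x: "x:M"
   have "|Pt t u x - u x - t*L u x| <= K*t^2" using Pt_step[OF x u, of 0 t K] Pt_0[OF x u] Pt_0[OF x sm_L[OF u]] K elim by auto
   hence "|(Pt t u x - u x)/t - L u x| <= K*t" using elim by (simp add: abs_le_iff field_simps power2_eq_square)
   also have "... <= (K + 1)*t" using elim by (simp add: algebra_simps)
   also have "... < e" using elim K by (simp add: field_simps)
   finally show "dist (((LINT w|P. u (Y x t w)) - u x)/t) (L u x) < e" by (simp add: dist_real_def Pt_def)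
  qed
 qed
qed

definition "fh i = ext (f i)"
definition "Bh = ext B"
text \<open>The factor compensates the average over \<open>card R\<close> directions and the 1/2 of
  the second order term in \<open>Lop\<close>, so that \<open>a\<close> times the sum of squares
  results. In \<open>ch\<close> the first summand cancels the Ito correction and the second is the
  drift.\<close>

definition "sh i x = sqrt (2*a*card R) *R fh i x"
definition "ch i x = (1/2) *R fd (sh i) x (sh i x) + Bh x"

lemma smooth_fh: "i:R ==> smooth (fh i)" and smooth_Bh: "smooth Bh"
 and fh: "i:R ==> x:M ==> fh i x = f i x" and Bh: "x:M ==> Bh x = B x"
 using ext[OF svf(1)[OF svf_f]] ext[OF svf(1)[OF svf_B]] by (auto simp: fh_def Bh_def)

lemma smooth_sh: "i:R ==> smooth (sh i)" unfolding sh_def[abs_def] by (intro smooth_on_scaleR smooth_on_const smooth_fh open_UNIV)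

lemma bfield_ext: "sm V ==> bfield (ext V)" using ext[of V] bfield_compact_support[of "ext V"] by metis

sublocale S: scheme R sh ch
proof
 have sup: "EX r. ALL x. norm x > r --> ext V x = 0" if "sm V" for V :: "'a => 'a" using ext(3)[OF that] .
 show "finite R" "R ~= {}" by (rule finite_R, rule R_ne)
 show "bvec R sh"
 proof (rule bvec_of_bfields[OF finite_R])
  fix i assume i: "i:R"
  then obtain r where "ALL x. norm x > r --> fh i x = 0" using sup[OF svf(1)[OF svf_f]] unfolding fh_def by blast
  thus "bfield (sh i)" by (intro bfield_compact_support[where R=r] smooth_sh i) (simp add: sh_def)
 qed
 show "bvec R ch"
 proof (rule bvec_of_bfields[OF finite_R])
  fix i assume i: "i:R"
  obtain r where r: "ALL x. norm x > r --> fh i x = 0" using sup[OF svf(1)[OF svf_f[OF i]]] unfolding fh_def by blast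
  obtain r' where r': "ALL x. norm x > r' --> Bh x = 0" using sup[OF svf(1)[OF svf_B]] unfolding Bh_def by blast
  show "bfield (ch i)"
  proof (rule bfield_compact_support[where R="max r r'"])
   show "smooth (ch i)" unfolding ch_def[abs_def]
    by (intro smooth_on_add smooth_on_scaleR smooth_on_const smooth_on_fd_field smooth_sh smooth_Bh i open_UNIV)
   show "ch i x = 0" if "norm x > max r r'" for x using that r r' fd_zero[OF smooth_diff[OF smooth_sh[OF i]]] by (simp add: ch_def sh_def)
  qed
 qed
qed

definition Xh :: "'i => ('a => real) => 'a => real" where "Xh i u x = fd u x (fh i x)"
definition Lh :: "('a => real) => 'a => real" where "Lh u x = a*(\<Sum>i\<in>R. Xh i (Xh i u) x) + fd u x (Bh x)"

lemma smooth_Xh: "i:R ==> smooth u ==> smooth (Xh i u)" unfolding Xh_def[abs_def] by (intro smooth_on_fd_field smooth_fh open_UNIV)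

lemma smooth_sm: "smooth u ==> sm u" by (rule smI) simp_all

lemma Xh_X: "i:R ==> smooth u ==> p:M ==> X i u p = Xh i u p" using D_fd[OF _ f_T, of p i u u] by (simp add: Xh_def fh)

lemma smooth_Lh: "smooth u ==> smooth (Lh u)" unfolding Lh_def[abs_def]
 by (intro smooth_on_add smooth_on_mult smooth_on_const smooth_on_sum smooth_Xh smooth_on_fd_field smooth_Bh open_UNIV)

lemma Lh_L: assumes u: "smooth u" and p: "p:M" shows "L u p = Lh u p"
proof -
 have "X i (X i u) p = Xh i (Xh i u) p" if i: "i:R" for i
 proof -
  have "X i (X i u) p = X i (Xh i u) p" by (rule D_cong[OF p f_T[OF i p] sm_X[OF i smooth_sm[OF u]]]) (rule Xh_X[OF i u])
  thus ?thesis using Xh_X[OF i smooth_Xh[OF i u] p] by simp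
 qed
 moreover have "D u p (B p) = fd u p (Bh p)" using D_fd[OF p svf(2)[OF svf_B p] u] by (simp add: Bh p)
 ultimately show ?thesis by (simp add: L_def Lh_def)
qed

lemma bfam_Xh: "i:R ==> bfam A u ==> bfam A (%j. Xh i (u j))" unfolding Xh_def[abs_def] fh_def by (intro bfam_fd bfield_ext svf(1) svf_f)

lemma bfam_Lh: "bfam A u ==> bfam A (%j. Lh (u j))" unfolding Lh_def[abs_def] Bh_def
 by (intro bfam_add bfam_cmult bfam_sum finite_R bfam_Xh bfam_fd bfield_ext svf(1) svf_B)

lemma Lop_Lh: assumes u: "smooth u" shows "S.Lop u x = Lh u x"
proof -
 let ?r = "real (card R)"
 have r: "?r > 0" using finite_R R_ne by (simp add: card_gt_0_iff)
 have lu: "linear (%v. fd u x v)" for x by (rule fd_linear[OF smooth_diff[OF u]])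
 have sq: "sqrt (2*a*?r) * sqrt (2*a*?r) = 2*a*?r" using a r by simp
 have t: "fd (%y. fd u y (sh i y)) x (sh i x)/2 + fd u x (ch i x) - fd u x (fd (sh i) x (sh i x))/2 = ?r*(a*Xh i (Xh i u) x) + fd u x (Bh x)"
  if i: "i:R" for i
 proof -
  have "fd (%y. fd u y (sh i y)) x (sh i x) = sqrt (2*a*?r)*fd (Xh i u) x (sh i x)"
   unfolding sh_def linear_scale[OF lu] using fd_cmult[OF smooth_diff[OF smooth_Xh[OF i u]]] by (simp add: Xh_def[abs_def])
  also have "fd (Xh i u) x (sh i x) = sqrt (2*a*?r)*Xh i (Xh i u) x"
   unfolding sh_def linear_scale[OF fd_linear[OF smooth_diff[OF smooth_Xh[OF i u]]]] by (simp add: Xh_def)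
  finally have "fd (%y. fd u y (sh i y)) x (sh i x) = 2*a*?r*Xh i (Xh i u) x" using sq by (simp add: mult.assoc[symmetric])
  moreover have "fd u x (ch i x) = fd u x (fd (sh i) x (sh i x))/2 + fd u x (Bh x)" unfolding ch_def linear_add[OF lu] linear_scale[OF lu] by simp
  ultimately show ?thesis by simp
 qed
 have "S.Lop u x = (1/?r)*(\<Sum>i\<in>R. ?r*(a*Xh i (Xh i u) x) + fd u x (Bh x))"
  unfolding S.Lop_eq[OF u] using t by (intro arg_cong2[where f=times] sum.cong refl)
 also have "... = Lh u x" using r by (simp add: Lh_def sum.distrib sum_distrib_left[symmetric] distrib_left)
 finally show ?thesis .
qed

lemma L_cong: assumes p: "p:M" and u: "sm u" and uv: "!!q. q:M ==> u q = v q" shows "L u p = L v p"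
proof -
 have "X i (X i u) p = X i (X i v) p" if i: "i:R" for i by (rule D_cong[OF p f_T[OF i p] sm_X[OF i u]]) (rule D_cong[OF _ f_T[OF i] u uv])
 thus ?thesis using D_cong[OF p svf(2)[OF svf_B p] u uv] by (simp add: L_def)
qed

lemma LL_Lh: "smooth u ==> p:M ==> L (L u) p = Lh (Lh u) p" using L_cong[of p "L u" "Lh u"] Lh_L[of u] Lh_L[OF smooth_Lh] sm_L[OF smooth_sm] by simp

definition un :: "('a => real) => real => nat => 'a => real" where "un ps eps n = (S.Q eps ^^ n) (ext ps)"

lemma smooth_un: "sm ps ==> smooth (un ps eps n)" unfolding un_def by (intro S.smooth_Q_pow ext)

definition energy :: "real => ('a => real) => 'a => real" where "energy A u p = \<Gamma> u u p + A*(u p*u p)"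

lemma sm_energy: "sm u ==> sm (energy A u)" unfolding energy_def[abs_def] by (intro sm_add sm_carre sm_mult sm_const)

text \<open>The one-step estimates that the comparison with the process needs, on the horizon
  \<open>S\<close>. They concern points of \<open>M\<close> only, although the walk itself runs in
  the ambient space.\<close>

definition scheme_bound :: "('a => real) => real => real => real => bool" where
 "scheme_bound ps A S K <-> 0 <= A & 0 <= K & (ALL eps n p. 0 <= eps --> eps <= 1 --> real n*eps^2 <= S --> p:M -->
   |L (L (un ps eps n)) p| <= K & |L (L (energy A (un ps eps n))) p| <= K &
   |un ps eps (Suc n) p - un ps eps n p - eps^2*L (un ps eps n) p| <= K*eps^4 &
   energy A (un ps eps (Suc n)) p <= energy A (un ps eps n) p + eps^2*L (energy A (un ps eps n)) p + K*eps^4 &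
   (un ps eps (Suc n) p)^2 <= (un ps eps n p)^2 + eps^2*(2*un ps eps n p*L (un ps eps n) p) + K*eps^4)"

text \<open>\<open>A\<close> comes from Bernstein's estimate and serves every horizon;
  \<open>K\<close> comes from the derivative bounds for the iterates and depends on
  \<open>S\<close>. This order of quantifiers makes gradient bounds uniform in time
  possible.\<close>

lemma scheme_bounds:
 assumes ps: "sm ps" obtains A where "!!S. EX K. scheme_bound ps A S K"
proof -
 obtain A where A: "0 <= A" and bern: "!!u p. sm u ==> p:M ==> L (energy A u) p >= 2*\<Gamma> u (L u) p + 2*A*u p*L u p"
  using bernstein unfolding energy_def[abs_def] by blast
 have "EX K. scheme_bound ps A S K" for S
proof -
 define Z where "Z = {(j :: unit, eps, n). j:UNIV & 0 <= eps & eps <= 1 & real n*eps^2 <= S}"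
 define u where "u = (%(j :: unit, eps, n). un ps eps n)"
 have "bfam (UNIV :: unit set) (%j. ext ps)" using ext[OF ps] bfam_compact_support[of "ext ps"] by metis
 from S.bfam_Q_pow[OF this, of S] have bu: "bfam Z u" unfolding Z_def u_def un_def .
 note su = bfam_smooth[OF bu]
 define e where "e j x = S.Q (fst (snd j)) (u j) x - u j x - (fst (snd j))^2*S.Lop (u j) x" for j :: "unit \<times> real \<times> nat" and x
 \<comment> \<open>The ambient counterpart of the energy, equal to it on \<open>M\<close>. As a
   family with bounded derivatives it yields a bound for \<open>L\<close> applied twice to the
   energy.\<close>
 define w where "w j x = (\<Sum>i\<in>R. Xh i (u j) x*Xh i (u j) x) + A*(u j x*u j x)" for j x
 have bw: "bfam Z w" unfolding w_def[abs_def] by (intro bfam_add bfam_sum bfam_mult bfam_Xh bfam_const bu finite_R)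
 have unif: "EX K>=0. ALL i:R. ALL j:Z. ALL x. |v i j x| <= K" if v: "!!i. i:R ==> bfam Z (v i)" for v
 proof -
  have "ALL i:R. EX K>=0. ALL j:Z. ALL x. |v i j x| <= K" using bfam_bounded[OF v] by metis
  then obtain K where K: "!!i. i:R ==> 0 <= K i & (ALL j:Z. ALL x. |v i j x| <= K i)" by metis
  have "K i <= sum K R" if "i:R" for i using K finite_R that by (intro member_le_sum) auto
  thus ?thesis using K sum_nonneg[of R K] by (meson order_trans)
 qed
 obtain K1 where K1: "0 <= K1" "!!j x. j:Z ==> |Lh (Lh (u j)) x| <= K1" using bfam_bounded[OF bfam_Lh[OF bfam_Lh[OF bu]]] by metis
 obtain K2 where K2: "0 <= K2" "!!j x. j:Z ==> |Lh (Lh (w j)) x| <= K2" using bfam_bounded[OF bfam_Lh[OF bfam_Lh[OF bw]]] by metis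
 obtain K3 where K3: "0 <= K3" "!!j eps x. j:Z ==> |eps| <= 1 ==> |S.Q eps (u j) x - u j x - eps^2*S.Lop (u j) x| <= K3*eps^4"
  "!!j eps x b. j:Z ==> |eps| <= 1 ==> b:Basis ==> |fd (%x. S.Q eps (u j) x - u j x - eps^2*S.Lop (u j) x) x b| <= K3*eps^4"
  by (rule S.Q_taylor[OF bu]) blast
 obtain K4 where K4: "0 <= K4" "!!j x. j:Z ==> |u j x| <= K4" using bfam_bounded[OF bu] by metis
 obtain K5 where K5: "0 <= K5" "!!j x. j:Z ==> |Lh (u j) x| <= K5" using bfam_bounded[OF bfam_Lh[OF bu]] by metis
 obtain K6 where K6: "0 <= K6" "ALL i:R. ALL j:Z. ALL x. |Xh i (u j) x| <= K6" using unif[of "%i j. Xh i (u j)", OF bfam_Xh[OF _ bu]] by auto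
 obtain K7 where K7: "0 <= K7" "ALL i:R. ALL j:Z. ALL x. |Xh i (Lh (u j)) x| <= K7" using unif[of "%i j. Xh i (Lh (u j))", OF bfam_Xh[OF _ bfam_Lh[OF bu]]] by auto
 obtain K8 where K8: "0 <= K8" "!!i b p. i:R ==> b:Basis ==> p:M ==> |f i p \<bullet> b| <= K8"
  using sm_bounded_family[of "R \<times> Basis" "%(i, b) p. f i p \<bullet> b"] finite_R sm_inner[OF svf(1)[OF svf_f]] by (auto simp: Ball_def)
 define Km where "Km = K3 + K4 + K5 + K6 + K7 + DIM('a)*(K8*K3)"
 have Km: "K3 <= Km" "K4 <= Km" "K5 <= Km" "K6 <= Km" "K7 <= Km" "DIM('a)*(K8*K3) <= Km" "0 <= Km"
  using K3(1) K4(1) K5(1) K6(1) K7(1) K8(1) by (auto simp: Km_def)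
 define K where "K = K1 + K2 + K3 + (real (card R) + A + 1)*(6*Km^2)"
 have K: "0 <= K" "K1 <= K" "K2 <= K" "K3 <= K" "(real (card R) + A)*(6*Km^2) <= K" "6*Km^2 <= K"
  using K1(1) K2(1) K3(1) A mult_nonneg_nonneg[of "real (card R) + A" "6*Km^2"] by (auto simp: K_def distrib_right)
 show ?thesis unfolding scheme_bound_def
 proof (intro exI[of _ K] conjI[OF A] conjI[OF K(1)] allI impI)
  fix eps :: real and n p assume eps: "0 <= eps" "eps <= 1" "real n*eps^2 <= S" and p: "p:M"
  define j where "j = ((), eps, n)"
  have j: "j:Z" using eps by (simp add: j_def Z_def)
  have uj: "un ps eps n = u j" by (simp add: j_def u_def)
  let ?h = "eps^2" and ?v = "un ps eps (Suc n)"
  have h: "0 <= ?h" "?h <= 1" "?h^2 = eps^4" using eps by (simp_all add: power_le_one)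
  have vQ: "?v = S.Q eps (u j)" by (simp add: un_def uj[symmetric])
  have ve: "?v = (%x. u j x + ?h*Lh (u j) x + e j x)" by (rule HOL.ext) (simp only: vQ e_def Lop_Lh[OF su[OF j]], simp add: j_def)
  have se: "smooth (e j)" unfolding e_def[abs_def] by (intro smooth_on_diff smooth_cmult S.smooth_Q S.smooth_Lop su j open_UNIV)
  have eb: "|e j p| <= K3*eps^4" "!!b. b:Basis ==> |fd (e j) p b| <= K3*eps^4"
   using K3(2,3)[OF j, of eps] eps unfolding e_def[abs_def] by (simp_all add: j_def)
  have up: "K'*eps^4 <= Km*?h^2" if "K' <= Km" for K' unfolding h(3) by (rule mult_right_mono[OF that]) simp
  have Xe: "|Xh i (e j) p| <= Km*?h^2" if i: "i:R" for i
  proof -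
   have "|Xh i (e j) p| <= (\<Sum>b\<in>Basis. |f i p \<bullet> b|*|fd (e j) p b| )"
    unfolding Xh_def fh[OF i p] fd_expand_real[OF se, of p "f i p"] using sum_abs[of "%b. (f i p \<bullet> b)*fd (e j) p b" Basis]
    by (simp only: abs_mult)
   also have "... <= (\<Sum>b\<in>(Basis :: 'a set). K8*(K3*eps^4))" using K8 i p eb(2) by (intro sum_mono mult_mono) auto
   also have "... = DIM('a)*(K8*K3)*eps^4" by simp
   also have "... <= Km*?h^2" by (rule up[OF Km(6)])
   finally show ?thesis .
  qed
  have Xv: "Xh i ?v p = Xh i (u j) p + ?h*Xh i (Lh (u j)) p + Xh i (e j) p" if i: "i:R" for i
   unfolding ve Xh_def using su[OF j] se smooth_Lh[OF su[OF j]] by (simp add: fd_add fd_cmult smooth_diff smooth_cmult smooth_add)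
  have LL: "L (L (u j)) p = Lh (Lh (u j)) p" by (rule LL_Lh[OF su[OF j] p])
  have smv: "smooth ?v" unfolding vQ by (rule S.smooth_Q[OF su[OF j]])
  have En: "energy A v q = (\<Sum>i\<in>R. Xh i v q*Xh i v q) + A*(v q * v q)" if "smooth v" "q:M" for v q
   using Xh_X that by (simp add: energy_def carre_def)
  have Ew: "energy A (u j) q = w j q" if "q:M" for q using En[OF su[OF j] that] by (simp add: w_def)
  have LLw: "L (L (energy A (u j))) p = Lh (Lh (w j)) p"
  proof -
   have "L (L (energy A (u j))) p = L (L (w j)) p" using sm_energy[OF smooth_sm[OF su[OF j]]] Ew by (intro L_cong p sm_L) auto
   thus ?thesis using LL_Lh[OF bfam_smooth[OF bw j] p] by simp
  qed
  have sqb: "(?v p)^2 <= (u j p)^2 + ?h*(2*u j p*Lh (u j) p) + 6*Km^2*?h^2"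
   unfolding ve using K4(2)[OF j, of p] K5(2)[OF j, of p] Km eb(1) up[OF Km(1)] h by (intro square_step) auto
  have Xsq: "Xh i ?v p*Xh i ?v p <= Xh i (u j) p*Xh i (u j) p + ?h*(2*Xh i (u j) p*Xh i (Lh (u j)) p) + 6*Km^2*?h^2" if i: "i:R" for i
   unfolding Xv[OF i] using square_step[OF _ _ Xe[OF i] h(1,2), of "Xh i (u j) p" "Xh i (Lh (u j)) p"] K6(2) K7(2) i j Km order_trans
   by (fastforce simp: power2_eq_square)
  have XL: "X i (L (u j)) p = Xh i (Lh (u j)) p" if i: "i:R" for i
   using D_cong[OF p f_T[OF i p] sm_L[OF smooth_sm[OF su[OF j]]] Lh_L[OF su[OF j]]] Xh_X[OF i smooth_Lh[OF su[OF j]] p] by simp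
  \<comment> \<open>The square of each ingredient is expanded to first order in
    \<open>eps^2\<close>. The linear terms add up to the right-hand side of Bernstein's inequality,
    which replaces them by \<open>L\<close> of the energy.\<close>
  have "energy A ?v p <= (\<Sum>i\<in>R. Xh i (u j) p*Xh i (u j) p + ?h*(2*Xh i (u j) p*Xh i (Lh (u j)) p) + 6*Km^2*?h^2)
    + A*((u j p)^2 + ?h*(2*u j p*Lh (u j) p) + 6*Km^2*?h^2)"
   unfolding En[OF smv p] using sqb A by (intro add_mono sum_mono mult_left_mono Xsq) (auto simp: power2_eq_square)
  also have "... = energy A (u j) p + ?h*(2*\<Gamma> (u j) (L (u j)) p + 2*A*u j p*L (u j) p) + (real (card R) + A)*(6*Km^2)*?h^2"
   using Xh_X[OF _ su[OF j] p] XL by (simp add: En[OF su[OF j] p] carre_def sum.distrib Lh_L[OF su[OF j] p] sum_distrib_left square_simps)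
  also have "... <= energy A (u j) p + ?h*L (energy A (u j)) p + K*?h^2"
   using bern[OF smooth_sm[OF su[OF j]] p] K(5) h(1) by (intro add_mono mult_left_mono mult_right_mono order_refl) auto
  finally have 1: "energy A ?v p <= energy A (u j) p + ?h*L (energy A (u j)) p + K*eps^4" unfolding h(3) .
  have 2: "(?v p)^2 <= (u j p)^2 + ?h*(2*u j p*L (u j) p) + K*eps^4"
   using sqb mult_right_mono[OF K(6), of "eps^4"] eps(1) unfolding h(3) Lh_L[OF su[OF j] p] by simp
  have 3: "|?v p - u j p - ?h*L (u j) p| <= K*eps^4" using eb(1) mult_right_mono[OF K(4), of "eps^4"] eps(1) unfolding ve Lh_L[OF su[OF j] p] by simp
  show "|L (L (un ps eps n)) p| <= K & |L (L (energy A (un ps eps n))) p| <= K & |?v p - un ps eps n p - ?h*L (un ps eps n) p| <= K*eps^4 &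
   energy A ?v p <= energy A (un ps eps n) p + ?h*L (energy A (un ps eps n)) p + K*eps^4 &
   (?v p)^2 <= (un ps eps n p)^2 + ?h*(2*un ps eps n p*L (un ps eps n) p) + K*eps^4"
   unfolding uj using 1 2 3 order_trans[OF K1(2)[OF j] K(2)] order_trans[OF K2(2)[OF j] K(3)] unfolding LL LLw by blast
 qed
 qed
 thus ?thesis by (rule that)
qed

end

section \<open>Probability measures are determined by smooth functions\<close>

definition box_bump :: "'a::euclidean_space => 'a => 'a => real" where
 "box_bump l u x = (\<Prod>i\<in>Basis. bump ((x - l) \<bullet> i)*bump ((u - x) \<bullet> i))"

text \<open>Since \<open>box_bump\<close> is positive exactly on the open box, these smooth
  functions increase with \<open>k\<close> to its indicator.\<close>

definition box_approx :: "'a::euclidean_space => 'a => nat => 'a => real" where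
 "box_approx l u k x = 1 - exp (- real k*box_bump l u x)"

lemma smooth_box_approx: "smooth (box_approx l u k)" unfolding box_approx_def[abs_def] box_bump_def
 by (intro smooth_on_diff smooth_on_const smooth_on_exp smooth_on_mult smooth_on_prod smooth_on_bump smooth_on_inner smooth_on_ident open_UNIV)

lemma box_bump: "0 <= box_bump l u x" "box_bump l u x > 0 <-> x:box l u"
proof -
 show n: "0 <= box_bump l u x" unfolding box_bump_def by (intro prod_nonneg ballI mult_nonneg_nonneg bump_nonneg)
 have p: "bump t > 0 <-> t > 0" for t using bump_pos[of t] bump_zero[of t] by linarith
 have "bump s*bump t > 0 <-> s > 0 & t > 0" for s t
  using p[of s] p[of t] bump_nonneg[of s] bump_nonneg[of t] by (auto simp: zero_less_mult_iff)
 moreover have "box_bump l u x > 0 <-> (ALL i:Basis. bump ((x - l) \<bullet> i)*bump ((u - x) \<bullet> i) > 0)"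
 proof
  assume "box_bump l u x > 0"
  hence nz: "ALL i:Basis. bump ((x - l) \<bullet> i)*bump ((u - x) \<bullet> i) ~= 0" unfolding box_bump_def by (metis finite_Basis less_irrefl prod_zero)
  show "ALL i:Basis. bump ((x - l) \<bullet> i)*bump ((u - x) \<bullet> i) > 0"
   using nz by (intro ballI order_le_neq_trans mult_nonneg_nonneg bump_nonneg) auto
 qed (auto simp: box_bump_def intro: prod_pos)
 ultimately show "box_bump l u x > 0 <-> x:box l u" by (auto simp: mem_box inner_diff_left)
qed

lemma box_approx: "0 <= box_approx l u k x" "box_approx l u k x <= 1"
 "(%k. box_approx l u k x) ----> indicator (box l u) x"
proof -
 show "0 <= box_approx l u k x" "box_approx l u k x <= 1" using box_bump(1)[of l u x] by (simp_all add: box_approx_def)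
 show "(%k. box_approx l u k x) ----> indicator (box l u) x"
 proof (cases "x:box l u")
  case True
  have "filterlim (%k. real k*box_bump l u x) at_top sequentially"
   using filterlim_tendsto_pos_mult_at_top[OF tendsto_const _ filterlim_real_sequentially, of "box_bump l u x"] box_bump(2)[of l u x] True
   by (simp add: mult.commute)
  hence "(%k. exp (- (real k*box_bump l u x))) ----> 0"
   by (intro filterlim_compose[OF exp_at_bot]) (simp add: filterlim_uminus_at_top[symmetric] filterlim_uminus_at_bot)
  from tendsto_diff[OF tendsto_const[of 1] this] show ?thesis using True by (simp add: box_approx_def)
 next
  case False
  hence "box_bump l u x = 0" using box_bump[of l u x] by linarith
  thus ?thesis using False by (simp add: box_approx_def)
 qed
qed

lemma box_approx_measurable: "box_approx l u k:borel_measurable borel"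
 by (rule borel_measurable_continuous_onI[OF smooth_on_imp_continuous[OF smooth_box_approx]])

lemma measure_box_limit:
 assumes "prob_space p" "sets p = sets borel"
 shows "(%k. (LINT x|p. box_approx l u k x)) ----> measure p (box l u)"
proof -
 interpret prob_space p by fact
 note [measurable_cong] = assms(2)
 have "(%k. (LINT x|p. box_approx l u k x)) ----> (LINT x|p. indicator (box l u) x)"
 proof (rule integral_dominated_convergence[where w="%_. 1"])
  show "box_approx l u k:borel_measurable p" for k using box_approx_measurable by measurable
  show "(indicator (box l u) :: 'a => real):borel_measurable p" by measurable
  show "AE x in p. norm (box_approx l u k x) <= 1" for k by (intro AE_I2) (simp add: box_approx abs_of_nonneg)
  show "AE x in p. (%k. box_approx l u k x) ----> indicator (box l u) x" by (intro AE_I2 box_approx(3))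
 qed simp
 moreover have "(LINT x|p. indicator (box l u) x) = measure p (box l u)" using sets_eq_imp_space_eq[OF assms(2)] by simp
 ultimately show ?thesis by simp
qed

text \<open>Integrals of the smooth approximations determine the measures of open boxes, which form
  a generator stable under intersections.\<close>

lemma prob_eq_of_smooth:
 fixes p q :: "'a::euclidean_space measure"
 assumes p: "prob_space p" "sets p = sets borel" and q: "prob_space q" "sets q = sets borel"
  and eq: "!!u :: 'a => real. smooth u ==> (!!x. |u x| <= 1) ==> (LINT x|p. u x) = (LINT x|q. u x)"
 shows "p = q"
proof -
 interpret p: prob_space p by fact
 interpret q: prob_space q by fact
 let ?E = "range (%(a, b). box a b :: 'a set)"
 have s: "sets borel = sigma_sets UNIV ?E" using borel_eq_box[where 'a='a] by (metis sets_measure_of top_greatest Pow_UNIV)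
 show ?thesis
 proof (rule measure_eqI_generator_eq[where E="?E" and \<Omega>=UNIV and A="%n. box (- (real n *R One)) (real n *R One)"])
  show "Int_stable ?E" by (auto simp: Int_stable_def box_Int_box)
  show "emeasure p A = emeasure q A" if A: "A:?E" for A
  proof -
   obtain l u where A: "A = box l u" using A by auto
   have "(LINT x|p. box_approx l u k x) = (LINT x|q. box_approx l u k x)" for k
    using box_approx(1,2)[of l u k] by (intro eq smooth_box_approx) (simp add: abs_le_iff)
   hence "measure p A = measure q A" using measure_box_limit[OF p, of l u] measure_box_limit[OF q, of l u] LIMSEQ_unique unfolding A by simp
   thus ?thesis by (simp add: p.emeasure_eq_measure q.emeasure_eq_measure)
  qed
  show "(\<Union>n. box (- (real n *R One)) (real n *R One)) = (UNIV :: 'a set)" using UN_box_eq_UNIV by simp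
 qed (use p q s in auto)
qed

text \<open>With \<open>eps^2 = t/n\<close>, an error of order \<open>eps^4\<close> in each of
  \<open>n\<close> steps adds up to order \<open>t^2/n\<close>.\<close>

lemma step_size:
 fixes t C d :: real
 assumes t: "0 < t" and C: "0 <= C" and d: "0 < d"
 obtains n eps where "0 < n" "0 < eps" "eps <= 1" "real n*eps^2 = t" "real n*(C*eps^4) <= d"
proof -
 obtain n :: nat where n: "real n > max t (C*t^2/d)" using reals_Archimedean2 by blast
 have n0: "real n > 0" using n t by linarith
 let ?e = "sqrt (t/real n)"
 have e2: "?e^2 = t/real n" using t n0 by simp
 have "?e^4 = (?e^2)^2" by (simp only: power_mult[symmetric]) simp
 hence e4: "?e^4 = (t/real n)^2" by (simp only: e2)
 have "real n*(C*?e^4) = C*t^2/real n" unfolding e4 using n0 by (simp add: power2_eq_square field_simps)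
 also have "... <= d" using n n0 d by (simp add: field_simps)
 finally show ?thesis using that[of n ?e] n0 t n e2 by (auto simp: real_sqrt_le_1_iff)
qed

section \<open>Comparison of the process with the walk\<close>

context langevin
begin

sublocale mu: prob_space \<mu> by (rule \<mu>(1))

lemma space_\<mu>: "space \<mu> = M" using sets_eq_imp_space_eq[OF \<mu>(2)] by (simp add: space_restrict_space)

lemma rv_\<mu>: "continuous_on M u ==> u:borel_measurable nu" if "sets nu = sets (restrict_space borel M)" for u :: "'a => real" and nu
 using borel_measurable_continuous_on_restrict[of M u] measurable_cong_sets[OF that refl] by blast

lemma integrable_inv:
 assumes nu: "prob_space nu" "sets nu = sets (restrict_space borel M)" and u: "continuous_on M (u :: 'a => real)"
 shows "integrable nu u"
proof -
 interpret q: prob_space nu by fact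
 have "bounded (u ` M)" by (rule compact_imp_bounded[OF compact_continuous_image[OF u compact]])
 then obtain C where "ALL y:u ` M. norm y <= C" unfolding bounded_iff by blast
 thus ?thesis using sets_eq_imp_space_eq[OF nu(2)]
  by (intro q.integrable_const_bound[where B=C] rv_\<mu>[OF nu(2) u]) (auto simp: space_restrict_space)
qed

lemma integrable_\<mu>: "sm u ==> integrable \<mu> u" for u :: "'a => real" by (rule integrable_inv[OF \<mu> sm_cont])

context
 fixes ps :: "'a => real" and A K S eps :: real and n :: nat
 assumes ps: "sm ps" and eps: "0 <= eps" "eps <= 1" and nS: "real n*eps^2 <= S"
  and bd: "scheme_bound ps A S K"
begin

abbreviation "v m \<equiv> un ps eps m"

lemma v_sm: "sm (v m)" by (rule smooth_sm[OF smooth_un[OF ps]])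

lemma v_0: "p:M ==> v 0 p = ps p" by (simp add: un_def ext(2)[OF ps])

lemma bdm:
 assumes "m <= n" "p:M"
 shows "|L (L (v m)) p| <= K" "|L (L (energy A (v m))) p| <= K"
  "|v (Suc m) p - v m p - eps^2*L (v m) p| <= K*eps^4"
  "energy A (v (Suc m)) p <= energy A (v m) p + eps^2*L (energy A (v m)) p + K*eps^4"
  "(v (Suc m) p)^2 <= (v m p)^2 + eps^2*(2 * v m p*L (v m) p) + K*eps^4"
proof -
 have "real m*eps^2 <= real n*eps^2" using assms(1) by (intro mult_right_mono) auto
 thus "|L (L (v m)) p| <= K" "|L (L (energy A (v m))) p| <= K"
  "|v (Suc m) p - v m p - eps^2*L (v m) p| <= K*eps^4"
  "energy A (v (Suc m)) p <= energy A (v m) p + eps^2*L (energy A (v m)) p + K*eps^4"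
  "(v (Suc m) p)^2 <= (v m p)^2 + eps^2*(2 * v m p*L (v m) p) + K*eps^4"
  using bd[unfolded scheme_bound_def, THEN conjunct2, THEN conjunct2, rule_format, OF eps _ assms(2), of m] nS by auto
qed

lemma h4: "(eps^2)^2 = eps^4" by (simp add: power_mult[symmetric])

text \<open>A telescoping comparison: one walk step on \<open>v (n - Suc k)\<close> is exchanged for
  running the process a further time \<open>eps^2\<close>. The Taylor error of the walk and the
  Dynkin error of the process are at most \<open>K*eps^4\<close> each, and both concern smooth
  functions.\<close>

lemma Pt_v: assumes x: "x:M" and k: "k <= n" shows "|Pt (real k*eps^2) (v (n - k)) x - v n x| <= real k*(2*K*eps^4)" using k
proof (induction k)
 case 0
 thus ?case by (simp add: Pt_0[OF x v_sm])
next
 case (Suc k)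
 let ?h = "eps^2" and ?m = "n - Suc k" and ?s = "real k*eps^2"
 have m: "?m <= n" "n - k = Suc ?m" using Suc.prems by auto
 have s: "0 <= ?s" "0 <= ?h" by auto
 have 1: "|Pt (?s + ?h) (v ?m) x - Pt ?s (v ?m) x - ?h*Pt ?s (L (v ?m)) x| <= K*?h^2" by (rule Pt_step[OF x v_sm s bdm(1)[OF m(1)]])
 have "|v (Suc ?m) p - (v ?m p + ?h*L (v ?m) p)| <= K*eps^4" if "p:M" for p using bdm(3)[OF m(1) that] by (simp add: diff_diff_eq)
 hence 2: "|Pt ?s (v (Suc ?m)) x - Pt ?s (%p. v ?m p + ?h*L (v ?m) p) x| <= K*eps^4" by (intro Pt_abs_diff[OF x] v_sm sm_add sm_mult sm_const sm_L s)
 have 3: "Pt ?s (%p. v ?m p + ?h*L (v ?m) p) x = Pt ?s (v ?m) x + ?h*Pt ?s (L (v ?m)) x"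
  using Pt_add[OF x v_sm sm_mult[OF sm_const sm_L[OF v_sm]] s(1)] by (simp add: Pt_cmult[OF x])
 have 4: "|Pt ?s (v (Suc ?m)) x - v n x| <= real k*(2*K*eps^4)" using Suc m by simp
 have 5: "real (Suc k)*?h = ?s + ?h" "real (Suc k)*(2*K*eps^4) = real k*(2*K*eps^4) + 2*(K*eps^4)" by (simp_all add: algebra_simps)
 show ?case using 1 2 4 unfolding 3 5 h4 by linarith
qed

lemma Pt_approx: assumes x: "x:M" shows "|Pt (real n*eps^2) ps x - v n x| <= real n*(2*K*eps^4)"
proof -
 have "Pt (real n*eps^2) (v 0) x = Pt (real n*eps^2) ps x" unfolding Pt_def using Y_M[OF x] v_0 by (intro lint_cong) auto
 thus ?thesis using Pt_v[OF x order_refl] by simp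
qed

text \<open>The walk averages over points off \<open>M\<close> and so obeys no maximum principle on
  \<open>M\<close>. Instead \<open>E + eps^2*L E\<close> is compared with the expectation of the
  energy \<open>E\<close> after the time \<open>eps^2\<close>, which is at most its supremum on
  \<open>M\<close>.\<close>

lemma energy_v:
 assumes c: "!!p. p:M ==> energy A (v 0) p <= c" and k: "k <= n" and p: "p:M"
 shows "energy A (v k) p <= c + real k*(2*K*eps^4)" using k p
proof (induction k arbitrary: p)
 case 0
 thus ?case using c by simp
next
 case (Suc k)
 let ?E = "energy A (v k)" and ?c = "c + real k*(2*K*eps^4)"
 have k: "k <= n" using Suc by simp
 have "|Pt (0 + eps^2) ?E p - Pt 0 ?E p - eps^2*Pt 0 (L ?E) p| <= K*(eps^2)^2"
  by (rule Pt_step[OF Suc.prems(2) sm_energy[OF v_sm]]) (use bdm(2)[OF k] in auto)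
 moreover have "Pt (eps^2) ?E p <= ?c" using Suc k by (intro Pt_le[OF Suc.prems(2)] sm_energy v_sm) auto
 ultimately have "?E p + eps^2*L ?E p <= ?c + K*eps^4" unfolding h4 using Pt_0[OF Suc.prems(2)] sm_energy[OF v_sm] sm_L by (auto simp: abs_le_iff)
 hence "energy A (v (Suc k)) p <= ?c + 2*(K*eps^4)" using bdm(4)[OF k Suc.prems(2)] by linarith
 thus ?case by (simp add: algebra_simps)
qed

lemma mean_v: "k <= n ==> |(LINT x|\<mu>. v k x) - (LINT x|\<mu>. ps x)| <= real k*(K*eps^4)"
proof (induction k)
 case 0
 have "(LINT x|\<mu>. v 0 x) = (LINT x|\<mu>. ps x)" by (intro lint_cong) (auto simp: space_\<mu> v_0)
 thus ?case by simp
next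
 case (Suc k)
 hence k: "k <= n" by simp
 note i = integrable_\<mu>[OF v_sm] integrable_\<mu>[OF sm_L[OF v_sm[of k]]]
 have "|(LINT x|\<mu>. v (Suc k) x - v k x - eps^2*L (v k) x)| <= (LINT x|\<mu>. K*eps^4)"
  using i bdm(3)[OF k] by (intro order_trans[OF integral_abs_bound] integral_mono) (auto simp: space_\<mu>)
 hence "|(LINT x|\<mu>. v (Suc k) x) - (LINT x|\<mu>. v k x)| <= K*eps^4" using i integral_\<mu>_L[OF v_sm[of k]] by (simp add: mu.prob_space)
 thus ?case using Suc k by (simp add: distrib_right)
qed

text \<open>The integral of \<open>L\<close> applied to the square of \<open>v k\<close> vanishes,
  so the first order change of the squared norm in one step is \<open>- 2*a*eps^2\<close> times the
  Dirichlet energy of \<open>v k\<close>; summation over the steps gives the energy balance.\<close>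

lemma dirichlet_v: "k <= n ==> 2*a*(\<Sum>m<k. eps^2*(LINT x|\<mu>. \<Gamma> (v m) (v m) x)) + (LINT x|\<mu>. (v k x)^2) <= (LINT x|\<mu>. (ps x)^2) + real k*(K*eps^4)"
proof (induction k)
 case 0
 have "(LINT x|\<mu>. (v 0 x)^2) = (LINT x|\<mu>. (ps x)^2)" by (intro lint_cong) (auto simp: space_\<mu> v_0)
 thus ?case by simp
next
 case (Suc k)
 hence k: "k <= n" by simp
 let ?G = "(LINT x|\<mu>. \<Gamma> (v k) (v k) x)"
 have s2: "sm (%x. (v m x)^2)" for m unfolding power2_eq_square by (intro sm_mult v_sm)
 have sL: "sm (%x. 2 * v k x*L (v k) x)" by (intro sm_mult sm_const sm_L v_sm)
 have "0 = (LINT x|\<mu>. L (%q. v k q * v k q) x)" using integral_\<mu>_L[OF sm_mult[OF v_sm v_sm]] by simp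
 also have "... = (LINT x|\<mu>. 2 * v k x*L (v k) x + 2*a*\<Gamma> (v k) (v k) x)"
  by (intro lint_cong) (auto simp: space_\<mu> L_mult[OF _ v_sm v_sm])
 also have "... = (LINT x|\<mu>. 2 * v k x*L (v k) x) + 2*a*?G" using integrable_\<mu>[OF sL] integrable_\<mu>[OF sm_carre[OF v_sm v_sm]] by simp
 finally have z: "(LINT x|\<mu>. 2 * v k x*L (v k) x) = - 2*a*?G" by simp
 have "(LINT x|\<mu>. (v (Suc k) x)^2) <= (LINT x|\<mu>. (v k x)^2 + eps^2*(2 * v k x*L (v k) x) + K*eps^4)"
  by (rule integral_mono[OF integrable_\<mu>[OF s2]]) (use bdm(5)[OF k] integrable_\<mu>[OF s2] integrable_\<mu>[OF sL] in "auto simp: space_\<mu>")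
 also have "... = (LINT x|\<mu>. (v k x)^2) - eps^2*(2*a*?G) + K*eps^4"
  using integrable_\<mu>[OF s2] integrable_\<mu>[OF sL] z by (simp add: mu.prob_space)
 finally show ?case using Suc.IH k by (simp add: algebra_simps)
qed

end

lemma Pt_uniform_approx:
 assumes ps: "sm ps" and t: "0 < t" and d: "0 < d"
 obtains u where "sm u" "!!x. x:M ==> |Pt t ps x - u x| <= d" "|(LINT x|\<mu>. u x) - (LINT x|\<mu>. ps x)| <= d"
proof -
 obtain A where "!!S. EX K. scheme_bound ps A S K" using scheme_bounds[OF ps] by blast
 then obtain K where b: "scheme_bound ps A t K" by blast
 hence K: "0 <= K" by (simp add: scheme_bound_def)
 obtain n eps where n: "0 < n" "0 < eps" "eps <= 1" "real n*eps^2 = t" "real n*((2*K)*eps^4) <= d" using step_size[OF t _ d, of "2*K"] K by auto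
 note bd = ps less_imp_le[OF n(2)] n(3) eq_refl[OF n(4)] b
 show ?thesis
 proof (rule that[of "un ps eps n"])
  show "sm (un ps eps n)" by (rule smooth_sm[OF smooth_un[OF ps]])
  show "|Pt t ps x - un ps eps n x| <= d" if "x:M" for x using Pt_approx[OF bd that] n(4,5) by simp
  have "real n*(K*eps^4) <= real n*(2*K*eps^4)" using K n by (intro mult_left_mono mult_right_mono) auto
  thus "|(LINT x|\<mu>. un ps eps n x) - (LINT x|\<mu>. ps x)| <= d" using mean_v[OF bd order_refl] n(5) by simp
 qed
qed

end

section \<open>Transition kernels and invariance\<close>

context langevin
begin

text \<open>The walk iterates approximate the expectation uniformly in the starting point, so
  continuity is inherited from a uniform limit.\<close>

lemma Pt_continuous_on: assumes ps: "sm ps" and t: "0 <= t" shows "continuous_on M (Pt t ps)"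
proof (cases "t = 0")
 case True
 thus ?thesis using Pt_0[OF _ ps] continuous_on_eq[OF sm_cont[OF ps]] by metis
next
 case False
 hence t: "0 < t" using t by simp
 have "ALL k. EX u. sm u & (ALL x:M. |Pt t ps x - u x| <= inverse (real (Suc k)))"
  by (intro allI, rule Pt_uniform_approx[OF ps t, of "inverse (real (Suc _))"]) auto
 then obtain u where u: "!!k. sm (u k)" "!!k x. x:M ==> |Pt t ps x - u k x| <= inverse (real (Suc k))" by metis
 show ?thesis
 proof (rule uniform_limit_theorem[where F=sequentially and f=u])
  show "uniform_limit M u (Pt t ps) sequentially"
  proof (rule uniform_limitI)
   fix e :: real assume "0 < e"
   hence "eventually (%k. inverse (real (Suc k)) < e) sequentially" using LIMSEQ_inverse_real_of_nat order_tendstoD(2) by blast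
   thus "\<forall>\<^sub>F k in sequentially. ALL x:M. dist (u k x) (Pt t ps x) < e"
   proof eventually_elim
    case (elim k)
    thus ?case using u(2)[of _ k] by (auto simp: dist_real_def abs_minus_commute intro: le_less_trans)
   qed
  qed
 qed (use sm_cont[OF u(1)] in auto)
qed

lemma integral_\<mu>_Pt: assumes ps: "sm ps" and t: "0 <= t" shows "(LINT x|\<mu>. Pt t ps x) = (LINT x|\<mu>. ps x)"
proof (cases "t = 0")
 case True
 thus ?thesis using Pt_0[OF _ ps] by (intro lint_cong) (auto simp: space_\<mu>)
next
 case False
 hence t': "0 < t" using t by simp
 have "|(LINT x|\<mu>. Pt t ps x) - (LINT x|\<mu>. ps x)| <= 0 + e" if e: "0 < e" for e
 proof -
  obtain u where u: "sm u" "!!x. x:M ==> |Pt t ps x - u x| <= e/2" "|(LINT x|\<mu>. u x) - (LINT x|\<mu>. ps x)| <= e/2"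
   using Pt_uniform_approx[OF ps t', of "e/2"] e by auto
  note i = integrable_inv[OF \<mu> Pt_continuous_on[OF ps t]] integrable_\<mu>[OF u(1)]
  have "|(LINT x|\<mu>. Pt t ps x - u x)| <= (LINT x|\<mu>. e/2)"
   using i u(2) by (intro order_trans[OF integral_abs_bound] integral_mono) (auto simp: space_\<mu>)
  hence "|(LINT x|\<mu>. Pt t ps x) - (LINT x|\<mu>. u x)| <= e/2" using i by (simp add: mu.prob_space)
  thus ?thesis using u(3) by linarith
 qed
 hence "|(LINT x|\<mu>. Pt t ps x) - (LINT x|\<mu>. ps x)| <= 0" by (rule field_le_epsilon)
 thus ?thesis by simp
qed

definition Kn :: "real => 'a => 'a measure" where "Kn t x = distr P borel (Y x t)"

lemma Y_rv: "x:M ==> 0 <= t ==> Y x t:borel_measurable P" using X_adapted[OF sol] F_measurable_M unfolding cont_adapted_def by blast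

lemma Kn:
 assumes x: "x:M" and t: "0 <= t"
 shows "prob_space (Kn t x)" "sets (Kn t x) = sets borel" "smooth u ==> (LINT y|(Kn t x). u y) = Pt t u x"
  "Q:sets borel ==> emeasure (Kn t x) Q = emeasure P {w:space P. Y x t w:Q}"
proof -
 note [measurable] = Y_rv[OF x t]
 show "prob_space (Kn t x)" unfolding Kn_def by (rule prob_space_distr) measurable
 show "sets (Kn t x) = sets borel" by (simp add: Kn_def)
 show "(LINT y|(Kn t x). u y) = Pt t u x" if "smooth u" for u
  unfolding Kn_def Pt_def using borel_measurable_continuous_onI[OF smooth_on_imp_continuous[OF that]] by (intro integral_distr) measurable
 show "emeasure (Kn t x) Q = emeasure P {w:space P. Y x t w:Q}" if "Q:sets borel" for Q
  unfolding Kn_def using that by (subst emeasure_distr) (auto intro!: arg_cong[where f="emeasure P"])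
qed

context
 fixes nu :: "'a measure" and t :: real
 assumes nu: "prob_space nu" "sets nu = sets (restrict_space borel M)" and t: "0 <= t"
begin

interpretation q: prob_space nu by (rule nu(1))

lemma space_nu: "space nu = M" using sets_eq_imp_space_eq[OF nu(2)] by (simp add: space_restrict_space)

text \<open>The probability of an open box is a limit of expectations of smooth functions, which
  depend continuously on the starting point; boxes generate the Borel sets.\<close>

lemma Kn_measurable: "Kn t:measurable nu (prob_algebra borel)"
proof (rule measurable_prob_algebra_generated[where \<Omega>=UNIV and G="range (%(a, b). box a b :: 'a set)"])
 show "sets borel = sigma_sets UNIV (range (%(a, b). box a b :: 'a set))"
  using borel_eq_box[where 'a='a] by (metis sets_measure_of top_greatest Pow_UNIV)
 show "Int_stable (range (%(a, b). box a b :: 'a set))" by (auto simp: Int_stable_def box_Int_box)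
 show "(%x. emeasure (Kn t x) A):borel_measurable nu" if "A:range (%(a, b). box a b)" for A
 proof -
  obtain l u where A: "A = box l u" using `A:_` by auto
  have "(%x. measure (Kn t x) A):borel_measurable nu"
  proof (rule borel_measurable_LIMSEQ_real)
   show "(%k. Pt t (box_approx l u k) x) ----> measure (Kn t x) A" if "x:space nu" for x
    using measure_box_limit[OF Kn(1,2)[OF _ t]] Kn(3)[OF _ t smooth_box_approx] that unfolding A space_nu by simp
   show "Pt t (box_approx l u k):borel_measurable nu" for k by (rule rv_\<mu>[OF nu(2) Pt_continuous_on[OF smooth_sm[OF smooth_box_approx] t]])
  qed
  hence "(%x. ennreal (measure (Kn t x) A)):borel_measurable nu" by measurable
  moreover have "emeasure (Kn t x) A = ennreal (measure (Kn t x) A)" if "x:space nu" for x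
  proof -
   interpret k: prob_space "Kn t x" using Kn(1)[OF _ t] that by (simp add: space_nu)
   show ?thesis by (rule k.emeasure_eq_measure)
  qed
  ultimately show ?thesis by (simp cong: measurable_cong)
 qed
qed (use Kn(1,2)[OF _ t] space_nu in auto)

lemma bind_prob: "prob_space (bind nu (Kn t))" "sets (bind nu (Kn t)) = sets borel"
 using prob_space_bind'[of nu nu, OF _ Kn_measurable] sets_bind'[of nu nu, OF _ Kn_measurable] nu(1) by (auto simp: space_prob_algebra)

lemma emeasure_bind_Kn: "Q:sets borel ==> emeasure (bind nu (Kn t)) Q = (\<integral>\<^sup>+x. emeasure P {w:space P. Y x t w:Q} \<partial>nu)"
 using emeasure_bind_prob_algebra[of nu nu, OF _ Kn_measurable] nu(1)
 by (auto simp: space_prob_algebra space_nu Kn(4)[OF _ t] intro!: nn_integral_cong)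

lemma integral_bind_Kn:
 assumes u: "smooth u" and b: "!!x. |u x| <= 1" shows "(LINT x|(bind nu (Kn t)). u x) = (LINT x|nu. Pt t u x)"
proof -
 interpret r: prob_space "bind nu (Kn t)" by (rule bind_prob(1))
 have ub: "u:borel_measurable borel" by (rule borel_measurable_continuous_onI[OF smooth_on_imp_continuous[OF u]])
 \<comment> \<open>The kernel identity is used for non-negative integrals, so the test function is
   shifted by 1.\<close>
 have nn: "0 <= u x + 1" for x using b[of x] by (simp add: abs_le_iff)
 have int: "(\<integral>\<^sup>+x. ennreal (u x + 1) \<partial>p) = ennreal ((LINT x|p. u x) + 1)" "- 1 <= (LINT x|p. u x)" if p: "prob_space p" "sets p = sets borel" for p
 proof -
  interpret p: prob_space p by fact
  have i: "integrable p u" using b ub p(2) by (intro p.integrable_const_bound[where B=1]) (auto cong: measurable_cong_sets)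
  show "(\<integral>\<^sup>+x. ennreal (u x + 1) \<partial>p) = ennreal ((LINT x|p. u x) + 1)"
   using i nn by (subst nn_integral_eq_integral) (auto simp: p.prob_space)
  have "(LINT x|p. -1) <= (LINT x|p. u x)" using i b by (intro integral_mono) (auto simp: abs_le_iff minus_le_iff)
  thus "- 1 <= (LINT x|p. u x)" by (simp add: p.prob_space)
 qed
 have cP: "continuous_on M (Pt t u)" by (rule Pt_continuous_on[OF smooth_sm[OF u] t])
 have P1: "- 1 <= Pt t u x" "0 <= 1 + Pt t u x" if "x:M" for x using int(2)[OF Kn(1,2)[OF that t]] Kn(3)[OF that t u] by simp_all
 note q1 = q.prob_space[unfolded space_nu]
 have "ennreal ((LINT x|(bind nu (Kn t)). u x) + 1) = (\<integral>\<^sup>+x. ennreal (u x + 1) \<partial>(bind nu (Kn t)))" using int(1)[OF bind_prob] by simp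
 also have "... = (\<integral>\<^sup>+x. \<integral>\<^sup>+y. ennreal (u y + 1) \<partial>Kn t x \<partial>nu)"
  by (rule nn_integral_bind[OF _ measurable_prob_algebraD[OF Kn_measurable]]) (use ub in measurable)
 also have "... = (\<integral>\<^sup>+x. ennreal (Pt t u x + 1) \<partial>nu)"
  using int(1)[OF Kn(1,2)[OF _ t]] Kn(3)[OF _ t u] by (intro nn_integral_cong) (simp add: space_nu)
 also have "... = ennreal ((LINT x|nu. Pt t u x) + 1)"
  using integrable_inv[OF nu cP] P1 by (subst nn_integral_eq_integral) (auto simp: space_nu q1 add.commute intro!: AE_I2)
 finally have "(LINT x|(bind nu (Kn t)). u x) + 1 = (LINT x|nu. Pt t u x) + 1"
  using int(2)[OF bind_prob] integral_mono[of nu "%_. -1" "Pt t u"] integrable_inv[OF nu cP] P1 by (subst (asm) ennreal_inj) (auto simp: space_nu q1)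
 thus ?thesis by simp
qed

lemma borel_of_nu: "prob_space (distr nu borel (%x. x))" "sets (distr nu borel (%x. x)) = sets borel"
 "Q:sets borel ==> emeasure (distr nu borel (%x. x)) Q = emeasure nu (Q \<inter> M)" "smooth (u :: 'a => real) ==> (LINT x|(distr nu borel (%x. x)). u x) = (LINT x|nu. u x)"
proof -
 have m: "(%x. x):borel_measurable nu"
  using borel_measurable_continuous_on_restrict[OF continuous_on_id[of M]] measurable_cong_sets[OF nu(2) refl] by blast
 thus "prob_space (distr nu borel (%x. x))" by (rule q.prob_space_distr)
 show "emeasure (distr nu borel (%x. x)) Q = emeasure nu (Q \<inter> M)" if "Q:sets borel" for Q
  using emeasure_distr[OF m that] by (simp add: space_nu)
 show "(LINT x|(distr nu borel (%x. x)). u x) = (LINT x|nu. u x)" if "smooth u" for u :: "'a => real"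
  using borel_measurable_continuous_onI[OF smooth_on_imp_continuous[OF that]] m by (intro integral_distr) auto
 show "sets (distr nu borel (%x. x)) = sets borel" by simp
qed

lemma sets_nu: "A:sets nu <-> A:sets borel & A <= M" unfolding nu(2) using M_borel by (auto simp: sets_restrict_space_iff)

text \<open>Invariance becomes an equality of two measures on the ambient space, which smooth
  functions can decide. Intersecting an ambient Borel set with \<open>M\<close> changes neither
  side, because the process stays in \<open>M\<close>.\<close>

lemma invariance_iff:
 "(ALL A:sets nu. emeasure nu A = (\<integral>\<^sup>+x. emeasure P {w:space P. Y x t w:A} \<partial>nu)) <-> bind nu (Kn t) = distr nu borel (%x. x)"
proof
 assume L: "ALL A:sets nu. emeasure nu A = (\<integral>\<^sup>+x. emeasure P {w:space P. Y x t w:A} \<partial>nu)"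
 show "bind nu (Kn t) = distr nu borel (%x. x)"
 proof (rule measure_eqI)
  fix Q assume "Q:sets (bind nu (Kn t))"
  hence Q: "Q:sets borel" by (simp add: bind_prob)
  have "emeasure (bind nu (Kn t)) Q = (\<integral>\<^sup>+x. emeasure P {w:space P. Y x t w:Q \<inter> M} \<partial>nu)"
   unfolding emeasure_bind_Kn[OF Q] using Y_M[OF _ t] by (intro nn_integral_cong arg_cong[where f="emeasure P"]) (auto simp: space_nu)
  also have "... = emeasure nu (Q \<inter> M)" by (rule bspec[OF L, symmetric]) (use Q M_borel in "auto simp: sets_nu")
  finally show "emeasure (bind nu (Kn t)) Q = emeasure (distr nu borel (%x. x)) Q" by (simp add: borel_of_nu(3)[OF Q])
 qed (simp add: bind_prob)
next
 assume R: "bind nu (Kn t) = distr nu borel (%x. x)"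
 show "ALL A:sets nu. emeasure nu A = (\<integral>\<^sup>+x. emeasure P {w:space P. Y x t w:A} \<partial>nu)"
 proof
  fix A assume "A:sets nu"
  hence A: "A:sets borel" "A \<inter> M = A" using sets_nu by auto
  show "emeasure nu A = (\<integral>\<^sup>+x. emeasure P {w:space P. Y x t w:A} \<partial>nu)"
   using emeasure_bind_Kn[OF A(1)] borel_of_nu(3)[OF A(1)] R A(2) by simp
 qed
qed

end

lemma invariant_\<mu>: "invariant_prob M P Y \<mu>" unfolding invariant_prob_def
proof (intro conjI allI impI)
 fix t :: real assume t: "0 <= t"
 have "bind \<mu> (Kn t) = distr \<mu> borel (%x. x)" by (rule prob_eq_of_smooth[OF bind_prob[OF \<mu> t] borel_of_nu(1,2)[OF \<mu> t]])
   (simp add: integral_bind_Kn[OF \<mu> t] borel_of_nu(4)[OF \<mu> t] integral_\<mu>_Pt[OF smooth_sm t])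
 thus "ALL A:sets \<mu>. emeasure \<mu> A = (\<integral>\<^sup>+x. emeasure P {w:space P. Y x t w:A} \<partial>\<mu>)"
  using invariance_iff[OF \<mu> t] by blast
qed (rule \<mu>)+

lemma invariant_Pt:
 assumes nu: "invariant_prob M P Y nu" and t: "0 <= t" and u: "smooth u" "!!x. |u x| <= 1"
 shows "(LINT x|nu. Pt t u x) = (LINT x|nu. u x)"
proof -
 have nu': "prob_space nu" "sets nu = sets (restrict_space borel M)" using nu by (simp_all add: invariant_prob_def)
 have "bind nu (Kn t) = distr nu borel (%x. x)" using invariance_iff[OF nu' t] nu t unfolding invariant_prob_def by blast
 thus ?thesis using integral_bind_Kn[OF nu' t u] borel_of_nu(4)[OF nu' t u(1)] by simp
qed

lemma invariant_eq:
 assumes nu: "prob_space nu" "sets nu = sets (restrict_space borel M)"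
  and eq: "!!u :: 'a => real. smooth u ==> (!!x. |u x| <= 1) ==> (LINT x|nu. u x) = (LINT x|\<mu>. u x)"
 shows "nu = \<mu>"
proof (rule measure_eqI)
 show "sets nu = sets \<mu>" using nu(2) \<mu>(2) by simp
 have d: "distr nu borel (%x. x) = distr \<mu> borel (%x. x)"
  by (rule prob_eq_of_smooth[OF borel_of_nu(1,2)[OF nu order_refl] borel_of_nu(1,2)[OF \<mu> order_refl]])
   (simp add: borel_of_nu(4)[OF \<mu> order_refl] borel_of_nu(4)[OF nu order_refl] eq)
 fix A assume "A:sets nu"
 hence A: "A:sets borel" "A \<inter> M = A" using sets_nu[OF nu order_refl] by auto
 thus "emeasure nu A = emeasure \<mu> A" using borel_of_nu(3)[OF nu order_refl A(1)] borel_of_nu(3)[OF \<mu> order_refl A(1)] d by simp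
qed

end

section \<open>Convergence to a constant and uniqueness\<close>

text \<open>The increment is the integral of the derivative along the segment; after Fubini,
  translation invariance removes the segment parameter.\<close>

lemma translate_bound:
 fixes G :: "'a::euclidean_space => real"
 assumes G: "smooth G" and K: "K:sets borel" "K':sets borel" "!!x s. x:K' ==> 0 <= s ==> s <= 1 ==> x + s *R z:K"
 shows "(\<integral>\<^sup>+x\<in>K'. ennreal |G (x + z) - G x| \<partial>lborel) <= (\<integral>\<^sup>+x\<in>K. ennreal |fd G x z| \<partial>lborel)"
proof -
 let ?k = "%x. ennreal |fd G x z|*indicator K x"
 have cf: "continuous_on UNIV (%x. fd G x z)" by (rule smooth_on_imp_continuous[OF smooth_on_fd[OF G]])
 have [measurable]: "(%x. fd G x z):borel_measurable borel" by (rule borel_measurable_continuous_onI[OF cf])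
 note [measurable] = K
 have le: "ennreal |G (x + z) - G x|*indicator K' x <= (\<integral>\<^sup>+s. ?k (x + s *R z)*indicator {0..1::real} s \<partial>lborel)" for x
 proof (cases "x:K'")
  case True
  have d: "((%s. G (x + s *R z)) has_real_derivative fd G (x + s *R z) z) (at s)" for s
  proof -
   have "((%s. x + s *R z) has_derivative (%s. s *R z)) (at s)" by (auto intro!: derivative_eq_intros)
   from has_derivative_compose[OF this has_derivative_fd[OF smooth_diff[OF G]]]
   show ?thesis by (simp add: has_field_derivative_def linear_scale[OF fd_linear[OF smooth_diff[OF G]]] mult.commute[of _ "fd G _ _"])
  qed
  have c: "continuous_on UNIV (%s. fd G (x + s *R z) z)" by (rule continuous_on_compose2[OF cf]) (auto intro!: continuous_intros)
  have "has_bochner_integral lborel (%s. fd G (x + s *R z) z*indicator {0..1::real} s) (G (x + 1 *R z) - G (x + 0 *R z))"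
   by (rule has_bochner_integral_FTC_Icc_real) (use d c in "auto simp: continuous_on_eq_continuous_at")
  hence "ennreal (norm (G (x + z) - G x)) <= (\<integral>\<^sup>+s. ennreal (norm (fd G (x + s *R z) z*indicator {0..1::real} s)) \<partial>lborel)"
   using has_bochner_integral_norm_bound by fastforce
  also have "... <= (\<integral>\<^sup>+s. ?k (x + s *R z)*indicator {0..1::real} s \<partial>lborel)"
   using K(3)[OF True] by (intro nn_integral_mono) (auto split: split_indicator)
  finally show ?thesis using True by simp
 qed simp
 have "(\<integral>\<^sup>+x\<in>K'. ennreal |G (x + z) - G x| \<partial>lborel) <= (\<integral>\<^sup>+x. \<integral>\<^sup>+s. ?k (x + s *R z)*indicator {0..1::real} s \<partial>lborel \<partial>lborel)"
  by (rule nn_integral_mono[OF le])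
 also have "... = (\<integral>\<^sup>+s. \<integral>\<^sup>+x. ?k (x + s *R z)*indicator {0..1::real} s \<partial>lborel \<partial>lborel)"
  by (rule lborel_pair.Fubini'[symmetric]) measurable
 also have "... = (\<integral>\<^sup>+s. (\<integral>\<^sup>+x. ?k x \<partial>lborel)*indicator {0..1::real} s \<partial>lborel)"
 proof (rule nn_integral_cong)
  fix s :: real
  have "(\<integral>\<^sup>+x. ?k x \<partial>lborel) = (\<integral>\<^sup>+x. ?k x \<partial>distr lborel borel ((+) (s *R z)))" by (simp add: lborel_distr_plus)
  also have "... = (\<integral>\<^sup>+x. ?k (s *R z + x) \<partial>lborel)" by (rule nn_integral_distr) auto
  finally show "(\<integral>\<^sup>+x. ?k (x + s *R z)*indicator {0..1::real} s \<partial>lborel) = (\<integral>\<^sup>+x. ?k x \<partial>lborel)*indicator {0..1::real} s"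
   by (subst nn_integral_multc) (auto simp: add.commute)
 qed
 also have "... = (\<integral>\<^sup>+x. ?k x \<partial>lborel)" by (subst nn_integral_cmult_indicator) auto
 finally show ?thesis .
qed

context langevin
begin

text \<open>In a chart the L1 distance between \<open>V\<close> and its translates is bounded by the
  uniform error plus the L1 norm of the derivatives of \<open>v j\<close>, which vanishing energy
  makes small. So a small translation changes the continuous function \<open>V\<close> on a null set
  only, hence nowhere.\<close>

lemma locally_constant_limit:
 fixes v :: "nat => 'a => real"
 assumes v: "!!j. sm (v j)" and V: "continuous_on M V" and lim: "uniform_limit M v V sequentially"
  and energy: "(%j. (LINT x|\<mu>. \<Gamma> (v j) (v j) x)) ----> 0" and p: "p:M"
 shows "EX Q. openin (top_of_set M) Q & p:Q & (ALL q:Q. V q = V p)"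
proof -
 obtain U h u where c: "chart' U h" "u:U" "h u = p" and lp: "local_param M U h" using chart_at[OF p] .
 interpret c: chart M f R g nabla U h by (rule c(1))
 obtain e where e: "e > 0" "cball u e <= U" using c.U(1) c(2) open_contains_cball by blast
 define K where "K = cball u e"
 have K: "compact K" "K <= U" using e by (auto simp: K_def)
 obtain C where C: "C >= 0" "!!w z v. w:K ==> sm v ==> |fd (%w. v (h w)) w z| <= C*norm z * sqrt (\<Gamma> v v (h w))"
  using c.chart_gradient_bound[OF K] by blast
 obtain E where E': "ALL u :: 'a => real. sm u --> (ALL x:M. 0 <= u x) --> (LINT w|lborel. indicator K w*u (h w)) <= E*(LINT x|\<mu>. u x)"
  using chart_lower_bound[OF lp K] ..
 note E = E'[rule_format]
 have G0: "0 <= \<Gamma> (v j) (v j) x" for j x by (auto simp: carre_def intro: sum_nonneg)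
 define K' where "K' = cball u (e/2)"
 \<comment> \<open>\<open>translate_bound\<close> asks for functions that are smooth on the whole
   coordinate space, hence the extension from the closed ball.\<close>
 have "EX G. smooth G & (ALL x:K. G x = v j (h x))" for j
 proof -
  have "smooth_map K (%w. v j (h w))" unfolding smooth_map_def using c.smooth_comp_h[OF v[of j]] c.U(1) K(2) by blast
  thus ?thesis using smooth_map_extension[OF K(1)] by metis
 qed
 then obtain G where G: "!!j. smooth (G j)" "!!j x. x:K ==> G j x = v j (h x)" by metis
 have [measurable]: "G j:borel_measurable borel" "K:sets borel" "K':sets borel" for j
  using borel_measurable_continuous_onI[OF smooth_on_imp_continuous[OF G(1)]] by (auto simp: K_def K'_def)
 have Vc: "V (h (u + z)) = V (h u)" if z: "norm z < e/2" for z
 proof -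
  have seg: "x + s *R z:ball u e" if "x:K'" "0 <= s" "s <= 1" for x s
  proof -
   have "norm (s *R z) <= norm z" using that by (simp add: mult_left_le_one_le)
   moreover have "dist u (x + s *R z) <= dist u x + norm (s *R z)" using dist_triangle[of u "x + s *R z" x] by (simp add: dist_norm)
   ultimately show ?thesis using that z by (auto simp: K'_def)
  qed
  have KK: "x:K" "x + z:K" if "x:K'" for x using seg[OF that, of 0] seg[OF that, of 1] by (auto simp: K_def)
  let ?F = "%x. |V (h (x + z)) - V (h x)|"
  have cF: "continuous_on K' ?F"
  proof -
   have "continuous_on K (%x. V (h x))"
    by (rule continuous_on_compose2[OF V continuous_on_subset[OF smooth_on_imp_continuous[OF c.U(2)] K(2)]]) (use c.U(3) K(2) in auto)
   thus ?thesis using KK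
    by (intro continuous_intros continuous_on_subset[of K "%x. V (h x)" K'] continuous_on_compose2[of K "%x. V (h x)" K' "%x. x + z"]) auto
  qed
  have small: "(\<integral>\<^sup>+x\<in>K'. ennreal (?F x) \<partial>lborel) <= 0 + ennreal eta" if eta: "eta > 0" for eta
  proof -
   define m where "m = measure lborel K"
   have m: "0 <= m" "emeasure lborel K = ennreal m" "emeasure lborel K' <= ennreal m"
   proof -
    show "0 <= m" by (simp add: m_def)
    show mK: "emeasure lborel K = ennreal m"
     using emeasure_lborel_cball_finite[of u e] unfolding m_def K_def by (intro emeasure_eq_ennreal_measure) auto
    show "emeasure lborel K' <= ennreal m" unfolding mK[symmetric] K_def K'_def using e by (intro emeasure_mono) auto
   qed
   define C' where "C' = C*norm z"
   have C': "0 <= C'" using C by (simp add: C'_def)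
   \<comment> \<open>The three contributions \<open>C'*dl*m\<close>, the energy term and
     \<open>2*dl*m\<close> are then at most \<open>eta/4\<close>, \<open>eta/4\<close> and
     \<open>eta/2\<close>.\<close>
   define dl where "dl = eta/(4*(m*C' + m + 1))"
   have q: "m*C' + m + 1 > 0" using m C' by (simp add: add_nonneg_pos)
   have dl: "dl > 0" "dl*(m*C') <= eta/4" "dl*m <= eta/4" using q eta m C' by (auto simp: dl_def field_simps)
   have "eventually (%j. ALL x:M. dist (v j x) (V x) < dl) sequentially" using uniform_limitD[OF lim dl(1)] .
   moreover have "(%j. C'/dl*(E*(LINT x|\<mu>. \<Gamma> (v j) (v j) x))) ----> C'/dl*(E*0)" by (intro tendsto_mult tendsto_const energy)
   hence "eventually (%j. C'/dl*(E*(LINT x|\<mu>. \<Gamma> (v j) (v j) x)) < eta/4) sequentially" using eta by (intro order_tendstoD(2)) auto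
   ultimately obtain j where j: "!!x. x:M ==> |v j x - V x| < dl" "C'/dl*(E*(LINT x|\<mu>. \<Gamma> (v j) (v j) x)) < eta/4"
    using eventually_happens[OF eventually_conj] by (force simp: dist_real_def)
   let ?g = "%w. \<Gamma> (v j) (v j) (h w)"
   have ig: "integrable lborel (%w. indicator K w*?g w)"
    using borel_integrable_compact[OF K(1) continuous_on_subset[OF smooth_on_imp_continuous[OF c.smooth_comp_h[OF sm_carre[OF v v]]] K(2)]] by simp
   have "(\<integral>\<^sup>+x\<in>K'. ennreal (?F x) \<partial>lborel) <= (\<integral>\<^sup>+x. ennreal |G j (x + z) - G j x|*indicator K' x + ennreal (2*dl)*indicator K' x \<partial>lborel)"
   proof (rule nn_integral_mono)
    fix x
    show "ennreal (?F x)*indicator K' x <= ennreal |G j (x + z) - G j x|*indicator K' x + ennreal (2*dl)*indicator K' x"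
    proof (cases "x:K'")
     case True
     have "h x:M" "h (x + z):M" using KK[OF True] K(2) c.U(3) by auto
     hence "?F x <= |G j (x + z) - G j x| + 2*dl" using j(1)[of "h x"] j(1)[of "h (x + z)"] G(2) KK[OF True] by auto
     thus ?thesis using True dl(1) by (simp add: ennreal_plus[symmetric] ennreal_leI del: ennreal_plus)
    qed simp
   qed
   also have "... = (\<integral>\<^sup>+x\<in>K'. ennreal |G j (x + z) - G j x| \<partial>lborel) + ennreal (2*dl)*emeasure lborel K'"
    by (subst nn_integral_add, measurable) (simp add: nn_integral_cmult_indicator)
   also have "... <= (\<integral>\<^sup>+x\<in>ball u e. ennreal |fd (G j) x z| \<partial>lborel) + ennreal (2*dl)*ennreal m"
    using m by (intro add_mono translate_bound G(1) mult_left_mono seg) (auto simp: K'_def)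
   also have "(\<integral>\<^sup>+x\<in>ball u e. ennreal |fd (G j) x z| \<partial>lborel) <= (\<integral>\<^sup>+x. ennreal (C'*dl)*indicator K x + ennreal (C'/dl*(indicator K x*?g x)) \<partial>lborel)"
   proof (rule nn_integral_mono)
    fix x
    show "ennreal |fd (G j) x z|*indicator (ball u e) x <= ennreal (C'*dl)*indicator K x + ennreal (C'/dl*(indicator K x*?g x))"
    proof (cases "x:ball u e")
     case True
     hence xK: "x:K" by (simp add: K_def)
     have "fd (G j) x z = fd (%w. v j (h w)) x z" by (rule fd_cong_open[OF open_ball True]) (use G(2) in "auto simp: K_def")
     hence "|fd (G j) x z| <= C' * sqrt (?g x)" using C(2)[OF xK v] by (simp add: C'_def)
     \<comment> \<open>The root is split so that only the integral of \<Gamma> enters, with a factor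
       \<open>1/dl\<close> that is fixed before \<open>j\<close> is chosen.\<close>
     also have "... <= C'*(dl + ?g x/dl)"
     proof (rule mult_left_mono[OF _ C'])
      have "0 <= (dl - sqrt (?g x))^2 + dl * sqrt (?g x)" using dl G0 by simp
      also have "... = dl*dl + ?g x - dl * sqrt (?g x)" 
      proof -
       have "(dl - s)^2 + dl * s = dl*dl + s * s - dl * s" for s by (simp add: square_simps)
       from this[of "sqrt (?g x)"] show ?thesis using G0 by simp
      qed
      finally show "sqrt (?g x) <= dl + ?g x/dl" using dl(1) by (simp add: field_simps)
     qed
     finally show ?thesis using True xK dl(1) C' G0 by (simp add: ennreal_plus[symmetric] distrib_left ennreal_leI del: ennreal_plus)
    qed simp
   qed
   also have "... = ennreal (C'*dl)*ennreal m + ennreal (C'/dl*(LINT x|lborel. indicator K x*?g x))"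
   proof -
    have [measurable]: "(%x. indicator K x*?g x):borel_measurable lborel" using ig by (rule borel_measurable_integrable)
    have "(\<integral>\<^sup>+x. ennreal (C'/dl*(indicator K x*?g x)) \<partial>lborel) = ennreal (C'/dl*(LINT x|lborel. indicator K x*?g x))"
     using ig dl(1) C' G0 by (subst nn_integral_eq_integral) auto
    thus ?thesis using m(2) by (subst nn_integral_add, measurable) (simp add: nn_integral_cmult_indicator)
   qed
   also have "... <= ennreal (C'*dl)*ennreal m + ennreal (eta/4)"
   proof (intro add_left_mono ennreal_leI)
    have "C'/dl*(LINT x|lborel. indicator K x*?g x) <= C'/dl*(E*(LINT x|\<mu>. \<Gamma> (v j) (v j) x))"
     using E[OF sm_carre[OF v v]] G0 C' dl(1) by (intro mult_left_mono) auto
    thus "C'/dl*(LINT x|lborel. indicator K x*?g x) <= eta/4" using j(2) by linarith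
   qed
   finally have "(\<integral>\<^sup>+x\<in>K'. ennreal (?F x) \<partial>lborel) <= ennreal (C'*dl)*ennreal m + ennreal (eta/4) + ennreal (2*dl)*ennreal m" by (simp add: add_right_mono)
   also have "... = ennreal (C'*dl*m + eta/4 + 2*dl*m)"
    using C' dl(1) m(1) eta by (simp add: ennreal_mult[symmetric] ennreal_plus[symmetric] del: ennreal_plus)
   also have "... <= ennreal eta" using dl(2,3) by (intro ennreal_leI) (simp add: mult_ac)
   finally show ?thesis by simp
  qed
  have "(\<integral>\<^sup>+x\<in>K'. ennreal (?F x) \<partial>lborel) <= 0" by (rule ennreal_le_epsilon) (use small in auto)
  moreover have mF: "(%x. ennreal (?F x)*indicator K' x):borel_measurable lborel"
  proof -
   have "(%x. indicator K' x *R ?F x):borel_measurable borel" by (rule borel_measurable_continuous_on_indicator[OF _ cF]) (auto simp: K'_def)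
   hence "(%x. ennreal (indicator K' x *R ?F x)):borel_measurable lborel" by simp
   thus ?thesis by (rule measurable_cong[THEN iffD1, rotated]) (auto split: split_indicator)
  qed
  ultimately have "AE x in lborel. ennreal (?F x)*indicator K' x = 0" by (simp add: nn_integral_0_iff_AE)
  hence ae: "AE x in lborel. x \<notin> {x:ball u (e/2). ?F x ~= 0}" by eventually_elim (auto simp: K'_def split: split_indicator_asm)
  have o: "open {x:ball u (e/2). ?F x ~= 0}"
  proof -
   have "continuous_on (ball u (e/2)) ?F" by (rule continuous_on_subset[OF cF]) (auto simp: K'_def)
   from continuous_open_preimage[OF this open_ball, of "- {0::real}"] have "open (ball u (e/2) \<inter> ?F -` (- {0}))" by (simp add: open_Compl)
   moreover have "ball u (e/2) \<inter> ?F -` (- {0}) = {x:ball u (e/2). ?F x ~= 0}" by auto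
   ultimately show ?thesis by simp
  qed
  have "{x:ball u (e/2). ?F x ~= 0}:null_sets lborel" by (rule AE_iff_null_sets[THEN iffD2, OF _ ae]) (use borel_open[OF o] in simp)
  hence "negligible {x:ball u (e/2). ?F x ~= 0}" by (simp add: negligible_iff_null_sets null_sets_completionI)
  hence "{x:ball u (e/2). ?F x ~= 0} = {}" using open_not_negligible[OF o] by blast
  thus ?thesis using e(1) by (auto simp: set_eq_iff)
 qed
 have "openin (top_of_set U) (ball u (e/2))"
  using e(1) order_trans[OF order_trans[OF subset_ball[of "e/2" e u] ball_subset_cball] e(2)] by (simp add: openin_open_eq[OF c.U(1)])
 hence "openin (top_of_set M) (h ` ball u (e/2))" using lp homeomorphism_imp_open_map openin_trans unfolding local_param_def by blast
 moreover have "V (h x) = V p" if "x:ball u (e/2)" for x using Vc[of "x - u"] that c(3) by (simp add: dist_norm norm_minus_commute)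
 moreover have "p:h ` ball u (e/2)" using c(3) e(1) by (metis centre_in_ball half_gt_zero imageI)
 ultimately show ?thesis by (intro exI[of _ "h ` ball u (e/2)"]) auto
qed

text \<open>The bound on \<Gamma> is a Lipschitz bound in coordinates, and coordinate balls are
  relatively open in \<open>M\<close>.\<close>

lemma equicontinuous:
 fixes v :: "nat => 'a => real"
 assumes v: "!!j. sm (v j)" and c: "!!j x. x:M ==> \<Gamma> (v j) (v j) x <= c" and p: "p:M" and e: "0 < e"
 shows "EX d>0. ALL j. ALL y. y:M & norm (p - y) < d --> norm (v j p - v j y) < e"
proof -
 obtain U h u where ch: "chart' U h" "u:U" "h u = p" and lp: "local_param M U h" using chart_at[OF p] .
 interpret c: chart M f R g nabla U h by (rule ch(1))
 obtain r where r: "r > 0" "cball u r <= U" using c.U(1) ch(2) open_contains_cball by blast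
 obtain C where C: "C >= 0" "!!w z v. w:cball u r ==> sm v ==> |fd (%w. v (h w)) w z| <= C*norm z * sqrt (\<Gamma> v v (h w))"
  using c.chart_gradient_bound[OF compact_cball r(2)] by blast
 define B where "B = C * sqrt (max 0 c)"
 have B: "0 <= B" using C by (simp add: B_def)
 have lip: "|v j (h w) - v j (h u)| <= B*norm (w - u)" if w: "w:cball u r" for j w
 proof -
  have d: "(%w. v j (h w)) differentiable (at y)" if "y:cball u r" for y
   by (rule smooth_on_differentiable[OF c.smooth_comp_h[OF v]]) (use that r in auto)
  have "onorm (fd (%w. v j (h w)) y) <= B" if y: "y:cball u r" for y
  proof (rule onorm_bound[OF B])
   fix z :: "real^'n"
   have "\<Gamma> (v j) (v j) (h y) <= max 0 c" using c[OF c.U(3)] y r by (meson max.coboundedI2 subsetD)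
   hence "C*norm z * sqrt (\<Gamma> (v j) (v j) (h y)) <= C*norm z * sqrt (max 0 c)" using C(1) by (intro mult_left_mono real_sqrt_le_mono) auto
   thus "norm (fd (%w. v j (h w)) y z) <= B*norm z" using C(2)[OF y v, of j z] by (simp add: B_def mult_ac)
  qed
  hence "norm (v j (h w) - v j (h u)) <= B*norm (w - u)"
   using d w r by (intro differentiable_bound[of "cball u r" "%w. v j (h w)" "fd (%w. v j (h w))"])
    (auto intro!: has_derivative_at_withinI has_derivative_fd)
  thus ?thesis by simp
 qed
 define rho' where "rho' = min r (e/(B + 1))"
 have rho: "0 < rho'" "rho' <= r" "B*rho' < e"
 proof -
  show "0 < rho'" "rho' <= r" using r e B by (auto simp: rho'_def)
  have "B*rho' < (B + 1)*rho'" using `0 < rho'` by (simp add: distrib_right)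
  also have "... <= (B + 1)*(e/(B + 1))" using B by (intro mult_left_mono) (auto simp: rho'_def)
  finally show "B*rho' < e" using B by simp
 qed
 have "openin (top_of_set U) (ball u rho')" using order_trans[OF order_trans[OF subset_ball[OF rho(2)] ball_subset_cball] r(2)] by (simp add: openin_open_eq[OF c.U(1)])
 hence "openin (top_of_set M) (h ` ball u rho')" using lp homeomorphism_imp_open_map openin_trans unfolding local_param_def by blast
 then obtain Q where Q: "open Q" "h ` ball u rho' = M \<inter> Q" unfolding openin_open by blast
 have "p:Q" using Q(2) ch(3) rho(1) by (metis IntD2 centre_in_ball image_eqI)
 then obtain d where d: "d > 0" "ball p d <= Q" using Q(1) open_contains_ball by blast
 have "norm (v j p - v j y) < e" if y: "y:M" "norm (p - y) < d" for j y
 proof -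
  have "y:ball p d" using y(2) by (simp add: dist_norm)
  hence "y:h ` ball u rho'" using Q(2) d y by blast
  then obtain w where w: "w:ball u rho'" "y = h w" by blast
  have "|v j (h w) - v j (h u)| <= B*norm (w - u)" using lip[of w j] w rho by auto
  also have "... <= B*rho'" using w B by (intro mult_left_mono) (auto simp: dist_norm norm_minus_commute)
  finally show ?thesis using rho(3) w ch(3) by simp
 qed
 thus ?thesis using d(1) by blast
qed

text \<open>By the energy identity, some iterate before time \<open>T\<close> has Dirichlet energy of order \<open>1 / T\<close>.\<close>

lemma low_energy_iterates:
 assumes ps: "sm ps"
 shows "EX B. ALL j. EX t>=0. EX u. sm u & (ALL x:M. |Pt t ps x - u x| <= inverse (real (Suc j)) & |u x| <= B & \<Gamma> u u x <= B)
  & (LINT x|\<mu>. \<Gamma> u u x) <= B*inverse (real (Suc j))"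
proof -
 obtain A where A: "!!S. EX K. scheme_bound ps A S K" using scheme_bounds[OF ps] by blast
 hence A0: "0 <= A" by (auto simp: scheme_bound_def)
 obtain c where c: "!!x. x:M ==> norm (energy A (ext ps) x) <= c" using sm_bounded[OF sm_energy[OF smooth_sm[OF ext(1)[OF ps]]]] by metis
 obtain c' where c': "!!x. x:M ==> norm (ps x) <= c'" using sm_bounded[OF ps] by metis
 \<comment> \<open>\<open>2*a*E\<close> is the initial squared norm plus 1, the most that the energy
   balance allows; if every iterate had energy above \<open>E/T\<close>, the sum over the time
   \<open>T\<close> would exceed it.\<close>
 define E where "E = ((LINT x|\<mu>. (ps x)^2) + 1)/(2*a)"
 define B where "B = max (c + 1) (max (c' + 1) E)"
 have "EX t>=0. EX u. sm u & (ALL x:M. |Pt t ps x - u x| <= inverse (real (Suc j)) & |u x| <= B & \<Gamma> u u x <= B)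
  & (LINT x|\<mu>. \<Gamma> u u x) <= B*inverse (real (Suc j))" for j
 proof -
  let ?T = "real (Suc j)" and ?dl = "inverse (real (Suc j))"
  have dl: "0 < ?dl" "?dl <= 1" by (simp_all add: inverse_le_1_iff)
  obtain K where K: "scheme_bound ps A ?T K" using A by blast
  hence K0: "0 <= K" by (simp add: scheme_bound_def)
  obtain n eps where n: "0 < n" "0 < eps" "eps <= 1" "real n*eps^2 = ?T" "real n*((2*K)*eps^4) <= ?dl" using step_size[of ?T "2*K" ?dl] K0 dl by auto
  let ?v = "un ps eps" and ?g = "%m. (LINT x|\<mu>. \<Gamma> (un ps eps m) (un ps eps m) x)"
  have "EX m<n. ?g m <= E*?dl"
  proof (rule ccontr)
   assume "\<not> ?thesis"
   hence "E*?dl < ?g m" if "m < n" for m using that by force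
   hence "(\<Sum>m<n. eps^2*(E*?dl)) < (\<Sum>m<n. eps^2*?g m)" using n by (intro sum_strict_mono) auto
   moreover have "(\<Sum>m<n. eps^2*(E*?dl)) = E" using n(4) by (simp add: mult.assoc[symmetric] del: of_nat_Suc)
   ultimately have "E < (\<Sum>m<n. eps^2*?g m)" by (simp only:)
   hence 1: "2*a*E < 2*a*(\<Sum>m<n. eps^2*?g m)" using a by simp
   have "0 <= (LINT x|\<mu>. (?v n x)^2)" by (rule integral_nonneg_AE) simp
   moreover have "real n*(K*eps^4) <= real n*(2*K*eps^4)" using K0 n by (intro mult_left_mono mult_right_mono) auto
   ultimately have "2*a*(\<Sum>m<n. eps^2*?g m) <= (LINT x|\<mu>. (ps x)^2) + 1"
    using dirichlet_v[OF ps less_imp_le[OF n(2)] n(3) eq_refl[OF n(4)] K order_refl] n(5) dl(2) by linarith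
   thus False using 1 a by (simp add: E_def)
  qed
  then obtain m where m: "m < n" "?g m <= E*?dl" by blast
  have mT: "real m*eps^2 <= ?T" unfolding n(4)[symmetric] using m by (intro mult_right_mono) auto
  note bd = ps less_imp_le[OF n(2)] n(3) mT K
  have m2: "real m*(2*K*eps^4) <= ?dl" using order_trans[OF mult_right_mono[of "real m" "real n" "2*K*eps^4"] n(5)] m(1) K0 by simp
  have P: "|Pt (real m*eps^2) ps x - ?v m x| <= ?dl" if "x:M" for x using Pt_approx[OF bd that] m2 by linarith
  have u: "|?v m x| <= B" if "x:M" for x
  proof -
   have "|Pt (real m*eps^2) ps x - Pt (real m*eps^2) (%_. 0) x| <= c'" using c' by (intro Pt_abs_diff[OF that ps]) auto
   thus ?thesis using P[OF that] dl(2) by (simp add: Pt_def B_def)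
  qed
  have "\<Gamma> (?v m) (?v m) x <= B" if x: "x:M" for x
  proof -
   have "energy A (?v m) x <= c + real m*(2*K*eps^4)" by (rule energy_v[OF bd _ order_refl x]) (use c in "auto simp: un_def abs_le_iff")
   hence "energy A (?v m) x <= c + 1" using m2 dl(2) by linarith
   moreover have "0 <= A*(?v m x*?v m x)" using A0 by simp
   ultimately show ?thesis by (simp add: energy_def B_def)
  qed
  moreover have "?g m <= B*?dl" by (rule order_trans[OF m(2) mult_right_mono]) (simp_all add: B_def)
  ultimately show ?thesis using P u smooth_sm[OF smooth_un[OF ps]] by (intro exI[of _ "real m*eps^2"] conjI exI[of _ "?v m"]) auto
 qed
 thus ?thesis by blast
qed

text \<open>One suitable time for each tolerance is enough, because an invariant measure may be
  tested at any single time.\<close>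

lemma semigroup_converges:
 assumes ps: "sm ps" and conn: "connected M"
 shows "EX k. ALL e>0. EX t>=0. ALL x:M. |Pt t ps x - k| <= e"
proof -
 obtain B where "ALL j. EX t>=0. EX u. sm u & (ALL x:M. |Pt t ps x - u x| <= inverse (real (Suc j)) & |u x| <= B & \<Gamma> u u x <= B)
  & (LINT x|\<mu>. \<Gamma> u u x) <= B*inverse (real (Suc j))" using low_energy_iterates[OF ps] ..
 then obtain t u where t: "!!j. 0 <= t j" and u: "!!j. sm (u j)"
  "!!j x. x:M ==> |Pt (t j) ps x - u j x| <= inverse (real (Suc j)) & |u j x| <= B & \<Gamma> (u j) (u j) x <= B"
  "!!j. (LINT x|\<mu>. \<Gamma> (u j) (u j) x) <= B*inverse (real (Suc j))" by metis
 have eqc: "EX d>0. ALL n y. y:M & norm (x - y) < d --> norm (u n x - u n y) < e" if "x:M" "0 < e" for x e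
  by (rule equicontinuous[OF u(1) _ that]) (use u(2) in blast)
 have ub: "norm (u n x) <= B" if "x:M" for n x using u(2)[OF that, of n] by simp
 obtain V s where V: "continuous_on M V" "strict_mono (s :: nat => nat)"
  "!!e. 0 < e ==> EX N. ALL n x. n >= N & x:M --> norm (u (s n) x - V x) < e" using Arzela_Ascoli[OF compact ub eqc] by metis
 have lim: "uniform_limit M (%n. u (s n)) V sequentially"
  by (rule uniform_limitI) (use V(3) in "fastforce simp: eventually_sequentially dist_real_def")
 have inv0: "(%n. inverse (real (Suc (s n)))) ----> 0" using LIMSEQ_subseq_LIMSEQ[OF LIMSEQ_inverse_real_of_nat V(2)] by (simp add: o_def)
 have G: "(%n. (LINT x|\<mu>. \<Gamma> (u (s n)) (u (s n)) x)) ----> 0"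
 proof (rule tendsto_sandwich[OF always_eventually always_eventually tendsto_const])
  show "ALL n. 0 <= (LINT x|\<mu>. \<Gamma> (u (s n)) (u (s n)) x)" by (intro allI integral_nonneg_AE) (auto simp: carre_def intro!: sum_nonneg)
  show "ALL n. (LINT x|\<mu>. \<Gamma> (u (s n)) (u (s n)) x) <= B*inverse (real (Suc (s n)))" using u(3) by blast
  show "(%n. B*inverse (real (Suc (s n)))) ----> 0" using tendsto_mult[OF tendsto_const[of B] inv0] by simp
 qed
 have "V constant_on M" by (rule locally_constant_imp_constant[OF conn locally_constant_limit[OF u(1) V(1) lim G]])
 then obtain k where k: "!!x. x:M ==> V x = k" unfolding constant_on_def by blast
 have "EX t>=0. ALL x:M. |Pt t ps x - k| <= e" if e: "e > 0" for e
 proof -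
  obtain N where N: "ALL n x. n >= N & x:M --> norm (u (s n) x - V x) < e/2" using V(3)[of "e/2"] e by auto
  obtain N' where N': "ALL n>=N'. norm (inverse (real (Suc (s n))) - 0) < e/2" using LIMSEQ_D[OF inv0, of "e/2"] e by auto
  let ?n = "max N N'"
  have i: "inverse (real (Suc (s ?n))) < e/2" using N'[rule_format, of ?n] by simp
  have "|Pt (t (s ?n)) ps x - k| <= e" if x: "x:M" for x
  proof -
   have "|Pt (t (s ?n)) ps x - u (s ?n) x| <= inverse (real (Suc (s ?n)))" using u(2)[OF x] by blast
   moreover have "|u (s ?n) x - k| < e/2" using N[rule_format, of ?n x] x k by simp
   ultimately show ?thesis using i by linarith
  qed
  thus ?thesis using t by blast
 qed
 thus ?thesis by blast
qed

text \<open>For a smooth test function, invariance and uniform closeness to the constant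
  \<open>k\<close> at some time force its integral against any invariant probability to be
  \<open>k\<close>; both measures in question are of this kind.\<close>

lemma unique_invariant:
 assumes nu: "invariant_prob M P Y nu" and conn: "connected M" shows "nu = \<mu>"
proof (rule invariant_eq)
 show "prob_space nu" "sets nu = sets (restrict_space borel M)" using nu by (simp_all add: invariant_prob_def)
 fix u :: "'a => real" assume u: "smooth u" "!!x. |u x| <= 1"
 obtain k where k: "ALL e>0. EX t>=0. ALL x:M. |Pt t u x - k| <= e" using semigroup_converges[OF smooth_sm[OF u(1)] conn] ..
 have "(LINT x|xi. u x) = k" if l: "invariant_prob M P Y xi" for xi
 proof -
  have l': "prob_space xi" "sets xi = sets (restrict_space borel M)" using l by (simp_all add: invariant_prob_def)
  interpret q: prob_space xi by (rule l'(1))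
  have "|(LINT x|xi. u x) - k| <= 0 + e" if "e > 0" for e
  proof -
   obtain t where t: "0 <= t" "!!x. x:M ==> |Pt t u x - k| <= e" using k `e > 0` by blast
   note i = integrable_inv[OF l' Pt_continuous_on[OF smooth_sm[OF u(1)] t(1)]]
   have "|(LINT x|xi. Pt t u x - k)| <= (LINT x|xi. e)"
    using i t(2) by (intro order_trans[OF integral_abs_bound] integral_mono) (auto simp: space_nu[OF l' order_refl])
   thus ?thesis using i invariant_Pt[OF l t(1) u] by (simp add: q.prob_space[unfolded space_nu[OF l' order_refl]] space_nu[OF l' order_refl])
  qed
  hence "|(LINT x|xi. u x) - k| <= 0" by (rule field_le_epsilon)
  thus ?thesis by simp
 qed
 from this[OF nu] this[OF invariant_\<mu>] show "(LINT x|nu. u x) = (LINT x|\<mu>. u x)" by simp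
qed

end

section \<open>Identification of the given equation\<close>

context framed
begin

lemma svf_cong: "svf V ==> (!!q. q:M ==> V q = V' q) ==> svf V'" unfolding smooth_vector_field_def using sm_cong[of V V'] by auto

lemma D_scale: "p:M ==> v:T p ==> sm \<psi> ==> D \<psi> p (c *R v) = c *R D \<psi> p v"
 using D_linear_arg[of p \<psi> "{()}" "%_. v" "%_. c"] subspace_scale[OF subspace_T] by simp

text \<open>The derivatives of \<open>V\<close> along itself cancel, so only the derivatives of the
  two coefficients survive.\<close>

lemma bracket_scaleR:
 assumes p: "p:M" and V: "svf V" and \<alpha>: "sm \<alpha>" and \<beta>: "sm \<beta>"
 shows "lie_bracket M (%q. \<alpha> q *R V q) (%q. \<beta> q *R V q) p = (\<alpha> p*D \<beta> p (V p) - \<beta> p*D \<alpha> p (V p)) *R V p"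
proof -
 note v = svf(2)[OF V p]
 have s: "c *R V p:T p" for c by (rule subspace_scale[OF subspace_T[OF p] v])
 show ?thesis by (simp add: lie_bracket_D D_scaleR[OF p s _ svf(1)[OF V]] \<alpha> \<beta> D_scale[OF p v] svf(1)[OF V] algebra_simps)
qed

text \<open>The square of a rescaled field has a first order part with the coefficient
  \<open>gm\<close> times its own derivative; for the two coefficients cosine and minus sine these
  parts have opposite signs.\<close>

lemma D_scaled_twice:
 assumes p: "p:M" and V: "svf V" and gm: "sm gm" and \<psi>: "sm (\<psi> :: 'a => real)"
 shows "D (%q. D \<psi> q (s *R (gm q *R V q))) p (s *R (gm p *R V p))
  = s^2*((gm p)^2*D (%q. D \<psi> q (V q)) p (V p) + gm p*D gm p (V p)*D \<psi> p (V p))"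
proof -
 have v: "q:M ==> V q:T q" "q:M ==> c *R V q:T q" for q c using svf(2)[OF V] subspace_scale[OF subspace_T] by auto
 have e: "D \<psi> q (s *R (gm q *R V q)) = s *R (gm q*D \<psi> q (V q))" if "q:M" for q
  using D_scale[OF that v(1)[OF that] \<psi>, of "s*gm q"] by simp
 have sm: "sm (%q. gm q*D \<psi> q (V q))" "sm (%q. s *R (gm q*D \<psi> q (V q)))" by (intro sm_cmult sm_mult sm_D V gm \<psi>)+
 have "D (%q. D \<psi> q (s *R (gm q *R V q))) p ((s*gm p) *R V p) = D (%q. s *R (gm q*D \<psi> q (V q))) p ((s*gm p) *R V p)"
  by (rule D_cong[OF p v(2)[OF p] sm(2), symmetric]) (simp only: e)
 also have "... = (s*gm p)*(s*D (%q. gm q*D \<psi> q (V q)) p (V p))" using D_scale[OF p v(1)[OF p] sm(2)] D_cmult[OF p v(1)[OF p] sm(1)] by simp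
 also have "D (%q. gm q*D \<psi> q (V q)) p (V p) = gm p*D (%q. D \<psi> q (V q)) p (V p) + D gm p (V p)*D \<psi> p (V p)"
  by (rule D_mult[OF p v(1)[OF p] gm sm_D[OF V \<psi>]])
 finally show ?thesis by (simp add: square_simps)
qed

end

theorem theorem2:
  fixes M :: "(real^'m) set"
    and f :: "nat \<Rightarrow> real^'m \<Rightarrow> real^'m" and r :: nat
    and \<phi> :: "real^'m \<Rightarrow> real"
    and g :: "real^'m \<Rightarrow> real^'m \<Rightarrow> real^'m \<Rightarrow> real"
    and nabla :: "(real^'m \<Rightarrow> real^'m) \<Rightarrow> (real^'m \<Rightarrow> real^'m) \<Rightarrow> real^'m \<Rightarrow> real^'m"
    and vol :: "(real^'m) measure"
    and \<kappa> :: real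
    and F :: "nat \<Rightarrow> real \<Rightarrow> real"
    and f0 b :: "real^'m \<Rightarrow> real^'m"
    and \<sigma> :: "nat \<times> nat \<Rightarrow> real^'m \<Rightarrow> real^'m"
    and P :: "'w measure" and \<F> :: "real \<Rightarrow> 'w measure"
    and W :: "nat \<Rightarrow> real \<Rightarrow> 'w \<Rightarrow> real"
    and X :: "real^'m \<Rightarrow> real \<Rightarrow> 'w \<Rightarrow> real^'m"
    and c :: real and \<mu> :: "(real^'m) measure"
  assumes "embedded_submanifold TYPE('n::finite) M"
    and "orientable TYPE('n) M"
    and "compact M" "connected M" "M \<noteq> {}"
    and "smooth_map M \<phi>"
    and "\<And>i. i \<in> {1..r} \<Longrightarrow> smooth_vector_field M (f i)"
    and "\<And>x. x \<in> M \<Longrightarrow> span ((\<lambda>i. f i x) ` {1..r}) = tangent_space M x"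
    and "riemannian_metric M g"
    and "\<And>(\<psi> :: real^'m \<Rightarrow> real) x. smooth_map M \<psi> \<Longrightarrow> x \<in> M \<Longrightarrow>
           gradient M g \<psi> x = (\<Sum>i=1..r. lie_deriv M (f i) \<psi> x *\<^sub>R f i x)"
    and "levi_civita M g nabla"
    and "riemannian_density TYPE('n) M g vol"
    and "\<kappa> > 0"
    and "F 1 = cos" "F 2 = (\<lambda>s. - sin s)"
    and "f0 = (\<lambda>x. - (1 / (2 * \<kappa>)) *\<^sub>R (\<Sum>i=1..r. nabla (f i) (f i) x))"
    and "b = (\<lambda>x. f0 x + (\<Sum>i=1..r.
           lie_bracket M (\<lambda>y. F 1 (\<phi> y) *\<^sub>R f i y) (\<lambda>y. F 2 (\<phi> y) *\<^sub>R f i y) x))"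
    and "\<sigma> = (\<lambda>(i, j) x. (1 / sqrt \<kappa>) *\<^sub>R (F j (\<phi> x) *\<^sub>R f i x))"
    and "filtered_prob_space P \<F>"
    and "wiener_process P \<F> {1..2 * r} W"
    and "\<And>x. x \<in> M \<Longrightarrow>
           stratonovich_solution M P \<F> b ({1..r} \<times> {1..2}) \<sigma> (\<lambda>(i, j). W (2 * i + j - 2)) x (X x)"
    and "c = (\<integral>x. exp (- 2 * \<kappa> * \<phi> x) \<partial>vol)"
    and "\<mu> = density vol (\<lambda>x. ennreal (inverse c * exp (- 2 * \<kappa> * \<phi> x)))"
  shows "(\<forall>\<psi> :: real^'m \<Rightarrow> real. smooth_map M \<psi> \<longrightarrow>
            generator_maps M P X \<psi>
              (\<lambda>x. 1 / (2 * \<kappa>) * laplace_beltrami TYPE('n) M g \<psi> x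
                   - g x (gradient M g \<phi> x) (gradient M g \<psi> x))) \<and>
         (invariant_prob M P X \<mu> \<and> (\<forall>\<nu>. invariant_prob M P X \<nu> \<longrightarrow> \<nu> = \<mu>))"
proof -
 let ?R = "{1..r}" and ?a = "1/(2*\<kappa>)" and ?I = "{1..r} \<times> {1..2::nat}" and ?s = "1/sqrt \<kappa>"
 have c0: "compact_set M" using assms(3) by (rule compact_set.intro)
 have fr: "framed M f ?R g nabla" by (intro framed.intro framed_axioms.intro c0) (use assms(7-11) in auto)
 interpret w: weighted M f ?R g nabla "TYPE('n)" ?a \<phi> vol
  by (intro weighted.intro weighted_axioms.intro drift.intro drift_axioms.intro framed_manifold.intro framed_manifold_axioms.intro fr)
   (use assms(1,5,6,12,13) in auto)
 have smc: "w.sm (%q. cos (\<phi> q))" and sms: "w.sm (%q. - sin (\<phi> q))" by (intro w.sm_cos w.sm_minus w.sm_sin w.\<phi>)+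
 have smF: "w.sm (%q. F j (\<phi> q))" if "j:{1..2}" for j
 proof -
  have "j = 1 \<or> j = 2" using that by auto
  thus ?thesis using smc sms assms(14,15) by auto
 qed
 have DF: "w.D (%q. cos (\<phi> q)) p v = - sin (\<phi> p)*w.D \<phi> p v" "w.D (%q. - sin (\<phi> q)) p v = - cos (\<phi> p)*w.D \<phi> p v"
  if "p:M" "v:w.T p" for p v
 proof -
  note id = smooth_on_ident[OF open_UNIV]
  note w.D_comp[OF that w.\<phi> smooth_on_cos[OF open_UNIV id]]
   w.D_comp[OF that w.\<phi> smooth_on_uminus[OF open_UNIV smooth_on_sin[OF open_UNIV id]]]
  thus "w.D (%q. cos (\<phi> q)) p v = - sin (\<phi> p)*w.D \<phi> p v" "w.D (%q. - sin (\<phi> q)) p v = - cos (\<phi> p)*w.D \<phi> p v"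
   by (metis DERIV_cos, metis DERIV_minus DERIV_sin)
 qed
 \<comment> \<open>For cosine and minus sine of \<phi> the bracket coefficient is minus the
   derivative of \<phi> along the field, since the squares add up to 1; summed over the frame this
   is minus the gradient of \<phi>.\<close>
 have bB: "b p = w.B p" if p: "p:M" for p
 proof -
  have "lie_bracket M (%y. F 1 (\<phi> y) *R f i y) (%y. F 2 (\<phi> y) *R f i y) p = - (w.D \<phi> p (f i p) *R f i p)" if i: "i:?R" for i
  proof -
   have "cos x*(- cos x*d) - - sin x*(- sin x*d) = - d" for x d :: real
   proof -
    have "c*(- c*d) - - s*(- s*d) = - ((c^2 + s^2)*d)" for c s :: real by (simp add: square_simps)
    from this[of "cos x" "sin x"] show ?thesis by (simp only: sin_cos_squared_add2 mult_1)
   qed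
   thus ?thesis using w.bracket_scaleR[OF p w.svf_f[OF i] smc sms] DF[OF p w.f_T[OF i p]] assms(14,15) by simp
  qed
  hence "(\<Sum>i\<in>?R. lie_bracket M (%y. F 1 (\<phi> y) *R f i y) (%y. F 2 (\<phi> y) *R f i y) p) = (\<Sum>i\<in>?R. - (w.D \<phi> p (f i p) *R f i p))"
   by (rule sum.cong[OF refl])
  thus ?thesis unfolding assms(16,17) w.B_def w.accel_def w.grad_def by (simp only: sum_negf add_uminus_conv_diff)
 qed
 have svfb: "w.svf b" by (rule w.svf_cong[OF w.svf_B]) (simp add: bB)
 have svf\<sigma>: "w.svf (\<sigma> k)" if "k:?I" for k
 proof (cases k)
  case (Pair i j)
  hence ij: "i:?R" "j:{1..2}" using that by auto
  show ?thesis unfolding assms(18) Pair prod.case by (intro w.svf_cmult w.svf_scaleR smF[OF ij(2)] w.svf_f[OF ij(1)])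
 qed
 \<comment> \<open>For \<open>j\<close> equal to 1 or 2 the values are \<open>2*i - 1\<close> and
   \<open>2*i\<close>, so the pairs enumerate the components without repetition; as
   \<open>i >= 1\<close>, the subtraction is not truncated.\<close>
 have inj: "inj_on (%(i, j). 2*i + j - 2) ?I" by (rule inj_onI) (auto simp: numeral_2_eq_2 le_Suc_eq, presburger+)
 have "wiener_family P \<F> ?I (%k. W ((%(i, j). 2*i + j - 2) k))" by (rule wiener_process_family[OF assms(19,20) _ inj]) auto
 moreover have "(%k. W ((%(i, j). 2*i + j - 2) k)) = (%(i, j). W (2*i + j - 2))" by auto
 ultimately have "wiener_family P \<F> ?I (%(i, j). W (2*i + j - 2))" by simp
 hence sde: "sde P \<F> ?I (%(i, j). W (2*i + j - 2)) M b \<sigma>" using svfb svf\<sigma> by (intro sde.intro sde_axioms.intro c0)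
 \<comment> \<open>The second order parts add up by cos^2 + sin^2 = 1 and the first order parts
   cancel; half of the factor 1/\<kappa> is the coefficient \<open>?a\<close>.\<close>
 have GL: "sde.G ?I M b \<sigma> \<psi> p = w.L \<psi> p" if \<psi>: "w.sm \<psi>" and p: "p:M" for \<psi> p
 proof -
  have t: "w.D (%q. w.D \<psi> q (\<sigma> (i, 1) q)) p (\<sigma> (i, 1) p) + w.D (%q. w.D \<psi> q (\<sigma> (i, 2) q)) p (\<sigma> (i, 2) p)
   = w.X i (w.X i \<psi>) p/\<kappa>" if i: "i:?R" for i
  proof -
   have s: "?s^2 = 1/\<kappa>" using assms(13) by (simp add: power_divide)
   have "(cos x)^2*d + cos x*(- sin x*e)*e' + ((- sin x)^2*d + - sin x*(- cos x*e)*e') = d" for x d e e' :: real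
   proof -
    have "c^2*d + c*(- s*e)*e' + ((- s)^2*d + - s*(- c*e)*e') = (c^2 + s^2)*d" for c s :: real by (simp add: algebra_simps)
    from this[of "cos x" "sin x"] show ?thesis by (simp only: sin_cos_squared_add2 mult_1)
   qed
   note trig = this
   have "\<sigma> (i, 1) = (%x. ?s *R (cos (\<phi> x) *R f i x))" "\<sigma> (i, 2) = (%x. ?s *R (- sin (\<phi> x) *R f i x))"
    by (simp_all only: assms(14,15,18) prod.case)
   note this[THEN fun_cong] w.D_scaled_twice[OF p w.svf_f[OF i] smc \<psi>] w.D_scaled_twice[OF p w.svf_f[OF i] sms \<psi>] DF[OF p w.f_T[OF i p]] s
   thus ?thesis by (simp only: distrib_left[symmetric] trig) simp
  qed
  have "(\<Sum>k\<in>?I. w.D (%q. w.D \<psi> q (\<sigma> k q)) p (\<sigma> k p)) = (\<Sum>i\<in>?R. w.X i (w.X i \<psi>) p/\<kappa>)"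
   using t by (subst sum.cartesian_product') (simp add: numeral_2_eq_2)
  thus ?thesis unfolding sde.G_def[OF sde] w.L_def bB[OF p] by (simp add: sum_divide_distrib[symmetric])
 qed
 \<comment> \<open>An empty frame would have trace 0, but the trace is \<open>CARD('n)\<close>,
   which is positive.\<close>
 have R: "?R ~= {}"
 proof
  assume e: "?R = {}"
  obtain p where "p:M" using assms(5) by blast
  thus False using w.trace[of p] unfolding e by simp
 qed
 interpret langevin M f ?R g nabla "TYPE('n)" ?a \<phi> vol P \<F> ?I "%(i, j). W (2*i + j - 2)" b \<sigma> X
  by (intro langevin.intro langevin_axioms.intro w.weighted_axioms sde assms(21) GL R)
 \<comment> \<open>With \<open>?a\<close> equal to 1/(2 \<kappa>), the exponent -\<phi>/a is -2
   \<kappa> \<phi>.\<close>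
 have rho: "w.rho = (%x. exp (- 2*\<kappa>*\<phi> x))" unfolding w.rho_def[abs_def] by (simp add: mult_ac)
 have \<mu>: "\<mu> = w.\<mu>" unfolding w.\<mu>_def assms(22,23) rho ..
 have "generator_maps M P X \<psi> (%x. ?a*laplace_beltrami TYPE('n) M g \<psi> x - g x (gradient M g \<phi> x) (gradient M g \<psi> x))"
  if "w.sm \<psi>" for \<psi> :: "real^'m => real"
  using generator[OF that] w.L_laplace[OF _ that] unfolding generator_maps_def uniform_limit_iff by simp
 thus ?thesis using invariant_\<mu> unique_invariant[OF _ assms(4)] unfolding \<mu> by blast
qed

end
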